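(* Let $G$ be a connected reductive complex algebraic group with Lie algebra $\mathfrak g$ and let $\pi:G\to\mathrm{Aut}(V)$ be a locally faithful rational representation. Then $$\Phi_\pi|_K=\Phi_{\pi|K}$$ (as maps $K\to\mathrm{Lie}(K)\subset\mathfrak g$) in each of the following cases: (a) $K$ is a reductive subgroup of $G$ which is the connected centralizer $K=\big(\bigcap_{x\in A}G^x\big)_o$ of a subset $A\subset G$; (b) $G$ is semisimple and $K$ is the connected subgroup of $G$ corresponding to a simple ideal of $\mathfrak g$.
   Context: Locally (infinitesimally) faithful means that $\pi'=d\pi(e):\mathfrak g\to\mathrm{End}(V)$ is injective; $V$ is finite-dimensional. For a reductive complex algebraic group $G$ and such $\pi$, the form $\mathrm{tr}(\pi'(X)\pi'(Y))$ on $\mathfrak g$ is nondegenerate, and the generalized Cayley mapping $\Phi_\pi:G\to\mathfrak g$ is the map defined by $\mathrm{tr}(\pi'(\Phi_\pi(g))\pi'(X))=\mathrm{tr}(\pi(g)\pi'(X))$ for all $g\in G$, $X\in\mathfrak g$. For $K\subset G$ reductive, $\Phi_{\pi|K}:K\to\mathrm{Lie}(K)$ is the generalized Cayley mapping of the restricted representation $\pi|_K$. $G^x$ is the centralizer of $x$ in $G$ and $(\cdot)_o$ denotes the identity component. *)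

theory Defs
  imports
    "HOL-Analysis.Abstract_Topology_2"
    "HOL-Algebra.Solvable_Groups"
    "Jordan_Normal_Form.Determinant"
begin

text \<open>
  A complex (linear) algebraic group is a Zariski-closed subgroup \<open>G\<close> of \<open>GL n\<close>, for some \<open>n\<close>.
  Matrices are those of the Jordan normal form development, so the dimensions \<open>n\<close> (of the ambient
  general linear group) and \<open>m\<close> (of the representation space \<open>V = \<complex>\<^sup>m\<close>) are arbitrary natural numbers.
\<close>

definition GL :: "nat \<Rightarrow> complex mat monoid" where
  "GL n = units_of (ring_mat TYPE(complex) n ())"

abbreviation GL_sub :: "nat \<Rightarrow> complex mat set \<Rightarrow> complex mat monoid" where
  "GL_sub n H \<equiv> (GL n)\<lparr>carrier := H\<rparr>"

lemma carrier_GL: "carrier (GL n) = {g \<in> carrier_mat n n. invertible_mat g}"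
proof -
  have "invertible_mat g \<longleftrightarrow> (\<exists>x\<in>carrier_mat n n. x * g = 1\<^sub>m n \<and> g * x = 1\<^sub>m n)"
    if g: "g \<in> carrier_mat n n" for g :: "complex mat"
  proof
    assume "invertible_mat g"
    then obtain B where B: "g * B = 1\<^sub>m n" "B * g = 1\<^sub>m (dim_row B)"
      using g by (auto simp: invertible_mat_def inverts_mat_def)
    have "dim_col (g * B) = n" "dim_col (B * g) = dim_row B"
      using B by simp_all
    then have "B \<in> carrier_mat n n"
      using g by auto
    then show "\<exists>x\<in>carrier_mat n n. x * g = 1\<^sub>m n \<and> g * x = 1\<^sub>m n"
      using B by (intro bexI[of _ B]) auto
  next
    assume "\<exists>x\<in>carrier_mat n n. x * g = 1\<^sub>m n \<and> g * x = 1\<^sub>m n"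
    then show "invertible_mat g"
      using g by (auto simp: invertible_mat_def inverts_mat_def)
  qed
  then show ?thesis
    by (auto simp: GL_def units_of_def Units_def ring_mat_def)
qed

lemma mult_GL: "x \<otimes>\<^bsub>GL n\<^esub> y = x * y"
  by (simp add: GL_def units_of_def ring_mat_def)

lemma one_GL: "\<one>\<^bsub>GL n\<^esub> = 1\<^sub>m n"
  by (simp add: GL_def units_of_def ring_mat_def)

lemma group_GL: "group (GL n)"
proof -
  interpret ring "ring_mat TYPE(complex) n ()"
    by (rule ring_mat)
  show ?thesis
    unfolding GL_def by (rule units_group)
qed

text \<open>
  The coordinate ring of \<open>GL n\<close>: polynomials in the matrix entries and \<open>1 / det\<close>.
  Its elements are total functions; only their values on invertible matrices matter.
\<close>

inductive_set regular_funs :: "nat \<Rightarrow> (complex mat \<Rightarrow> complex) set" for n :: nat where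
  const: "(\<lambda>_. c) \<in> regular_funs n"
| entry: "i < n \<Longrightarrow> j < n \<Longrightarrow> (\<lambda>g. g $$ (i, j)) \<in> regular_funs n"
| inv_det: "(\<lambda>g. 1 / det g) \<in> regular_funs n"
| add: "f \<in> regular_funs n \<Longrightarrow> h \<in> regular_funs n \<Longrightarrow> (\<lambda>g. f g + h g) \<in> regular_funs n"
| mult: "f \<in> regular_funs n \<Longrightarrow> h \<in> regular_funs n \<Longrightarrow> (\<lambda>g. f g * h g) \<in> regular_funs n"

definition zariski :: "nat \<Rightarrow> complex mat topology" where
  "zariski n = topology (\<lambda>U. \<exists>S \<subseteq> regular_funs n. U = {g \<in> carrier (GL n). \<exists>f\<in>S. f g \<noteq> 0})"

lemma openin_zariski:
  "openin (zariski n) U \<longleftrightarrow> (\<exists>S \<subseteq> regular_funs n. U = {g \<in> carrier (GL n). \<exists>f\<in>S. f g \<noteq> 0})"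
proof -
  let ?P = "\<lambda>S. {g \<in> carrier (GL n). \<exists>f\<in>S. f g \<noteq> (0::complex)}"
  have "istopology (\<lambda>U. \<exists>S \<subseteq> regular_funs n. U = ?P S)"
    unfolding istopology_def
  proof (intro conjI allI impI)
    fix U V assume "\<exists>S \<subseteq> regular_funs n. U = ?P S" "\<exists>S \<subseteq> regular_funs n. V = ?P S"
    then obtain S T where ST: "S \<subseteq> regular_funs n" "T \<subseteq> regular_funs n" "U = ?P S" "V = ?P T"
      by (elim exE conjE) (rule that)
    let ?R = "(\<lambda>(f, h) g. f g * h g) ` (S \<times> T)"
    have "?R \<subseteq> regular_funs n"
      using ST by (auto intro: regular_funs.mult)
    moreover have "U \<inter> V = ?P ?R"
    proof (intro equalityI subsetI)
      fix g assume "g \<in> U \<inter> V"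
      then obtain f h where fh: "f \<in> S" "h \<in> T" "f g \<noteq> 0" "h g \<noteq> 0" "g \<in> carrier (GL n)"
        using ST by auto
      have "(\<lambda>g. f g * h g) \<in> ?R"
        using fh by (intro image_eqI[of _ _ "(f, h)"]) auto
      then have "\<exists>r\<in>?R. r g \<noteq> 0"
        by (rule bexI[rotated]) (use fh in simp)
      then show "g \<in> ?P ?R"
        using fh by simp
    qed (use ST in auto)
    ultimately show "\<exists>S \<subseteq> regular_funs n. U \<inter> V = ?P S"
      by (intro exI[of _ ?R] conjI)
  next
    fix \<U> assume "\<forall>U\<in>\<U>. \<exists>S \<subseteq> regular_funs n. U = ?P S"
    then obtain F where "\<forall>U\<in>\<U>. F U \<subseteq> regular_funs n \<and> U = ?P (F U)"
      unfolding bchoice_iff by (elim exE) (rule that)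
    then have F: "F U \<subseteq> regular_funs n" "U = ?P (F U)" if "U \<in> \<U>" for U
      using that by simp_all
    have "\<Union>\<U> = (\<Union>U\<in>\<U>. U)"
      by simp
    also have "\<dots> = (\<Union>U\<in>\<U>. ?P (F U))"
      by (rule SUP_cong[OF refl]) (rule F(2))
    also have "\<dots> = ?P (\<Union>(F ` \<U>))"
      by auto
    finally have "\<Union>\<U> = ?P (\<Union>(F ` \<U>))" .
    moreover have "\<Union>(F ` \<U>) \<subseteq> regular_funs n"
      using F(1) by (rule UN_least)
    ultimately show "\<exists>S \<subseteq> regular_funs n. \<Union>\<U> = ?P S"
      by (intro exI[of _ "\<Union>(F ` \<U>)"] conjI)
  qed
  then show ?thesis
    by (simp add: zariski_def)
qed

lemma topspace_zariski: "topspace (zariski n) = carrier (GL n)"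
proof (rule antisym)
  show "topspace (zariski n) \<subseteq> carrier (GL n)"
    by (auto simp: topspace_def openin_zariski)
  have "openin (zariski n) (carrier (GL n))"
    unfolding openin_zariski
    by (rule exI[of _ "{\<lambda>_. 1}"]) (auto intro: regular_funs.const)
  then show "carrier (GL n) \<subseteq> topspace (zariski n)"
    by (rule openin_subset)
qed

lemma closedin_zariski:
  "closedin (zariski n) Z \<longleftrightarrow> (\<exists>S \<subseteq> regular_funs n. Z = {g \<in> carrier (GL n). \<forall>f\<in>S. f g = 0})"
proof -
  have "Z \<subseteq> carrier (GL n) \<and> carrier (GL n) - Z = {g \<in> carrier (GL n). \<exists>f\<in>S. f g \<noteq> 0}
      \<longleftrightarrow> Z = {g \<in> carrier (GL n). \<forall>f\<in>S. f g = 0}" for S :: "(complex mat \<Rightarrow> complex) set"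
    by blast
  then show ?thesis
    unfolding closedin_def topspace_zariski openin_zariski
    by (simp only: ex_simps(2)[symmetric] conj_left_commute)
qed

definition algebraic_group :: "nat \<Rightarrow> complex mat set \<Rightarrow> bool" where
  "algebraic_group n G \<longleftrightarrow> subgroup G (GL n) \<and> closedin (zariski n) G"

definition identity_component :: "nat \<Rightarrow> complex mat set \<Rightarrow> complex mat set" where
  "identity_component n H = connected_component_of_set (subtopology (zariski n) H) (1\<^sub>m n)"

definition centralizer :: "complex mat set \<Rightarrow> complex mat \<Rightarrow> complex mat set" where
  "centralizer G x = {g \<in> G. g * x = x * g}"

definition unipotent :: "nat \<Rightarrow> complex mat \<Rightarrow> bool" where
  "unipotent n g \<longleftrightarrow> (\<exists>k. (g - 1\<^sub>m n) ^\<^sub>m k = 0\<^sub>m n n)"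

text \<open>Reductive: trivial unipotent radical. Semisimple: trivial (solvable) radical.\<close>

definition reductive :: "nat \<Rightarrow> complex mat set \<Rightarrow> bool" where
  "reductive n G \<longleftrightarrow> algebraic_group n G \<and>
    (\<forall>U. algebraic_group n U \<and> connectedin (zariski n) U \<and> U \<lhd> GL_sub n G \<and> (\<forall>u\<in>U. unipotent n u)
       \<longrightarrow> U = {1\<^sub>m n})"

definition semisimple :: "nat \<Rightarrow> complex mat set \<Rightarrow> bool" where
  "semisimple n G \<longleftrightarrow> algebraic_group n G \<and>
    (\<forall>R. algebraic_group n R \<and> connectedin (zariski n) R \<and> R \<lhd> GL_sub n G \<and> solvable (GL_sub n R)
       \<longrightarrow> R = {1\<^sub>m n})"

text \<open>
  The Lie algebra of \<open>G\<close> as the Zariski tangent space at the identity inside the \<open>n \<times> n\<close> matrices: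
  those \<open>X\<close> along which every regular function vanishing on \<open>G\<close> has zero derivative. Its bracket is
  the commutator of matrices.
\<close>

definition lie_algebra :: "nat \<Rightarrow> complex mat set \<Rightarrow> complex mat set" where
  "lie_algebra n G = {X \<in> carrier_mat n n. \<forall>f\<in>regular_funs n. (\<forall>g\<in>G. f g = 0) \<longrightarrow>
     ((\<lambda>t::complex. f (1\<^sub>m n + t \<cdot>\<^sub>m X)) has_field_derivative 0) (at 0)}"

definition bracket :: "complex mat \<Rightarrow> complex mat \<Rightarrow> complex mat" where
  "bracket X Y = X * Y - Y * X"

definition subspace_mat :: "nat \<Rightarrow> complex mat set \<Rightarrow> bool" where
  "subspace_mat n S \<longleftrightarrow> S \<subseteq> carrier_mat n n \<and> 0\<^sub>m n n \<in> S \<and>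
    (\<forall>X\<in>S. \<forall>Y\<in>S. X + Y \<in> S) \<and> (\<forall>c. \<forall>X\<in>S. c \<cdot>\<^sub>m X \<in> S)"

definition lie_ideal :: "nat \<Rightarrow> complex mat set \<Rightarrow> complex mat set \<Rightarrow> bool" where
  "lie_ideal n I L \<longleftrightarrow> I \<subseteq> L \<and> subspace_mat n I \<and> (\<forall>X\<in>L. \<forall>Y\<in>I. bracket X Y \<in> I)"

text \<open>A simple ideal is an ideal that is simple as a Lie algebra in its own right.\<close>

definition simple_ideal :: "nat \<Rightarrow> complex mat set \<Rightarrow> complex mat set \<Rightarrow> bool" where
  "simple_ideal n S L \<longleftrightarrow> lie_ideal n S L \<and> (\<exists>X\<in>S. \<exists>Y\<in>S. bracket X Y \<noteq> 0\<^sub>m n n) \<and>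
    (\<forall>I. lie_ideal n I S \<longrightarrow> I = {0\<^sub>m n n} \<or> I = S)"

definition rational_rep :: "nat \<Rightarrow> complex mat set \<Rightarrow> nat \<Rightarrow> (complex mat \<Rightarrow> complex mat) \<Rightarrow> bool" where
  "rational_rep n G m \<pi> \<longleftrightarrow> \<pi> \<in> hom (GL_sub n G) (GL m) \<and>
    (\<forall>i<m. \<forall>j<m. \<exists>F\<in>regular_funs n. \<forall>g\<in>G. F g = \<pi> g $$ (i, j))"

text \<open>
  The differential at the identity of a regular function \<open>\<phi>\<close> on \<open>G\<close>, which is the restriction of some
  \<open>F \<in> regular_funs n\<close>. On \<open>lie_algebra n G\<close> the derivative does not depend on the choice of \<open>F\<close>.
\<close>

definition differential :: "nat \<Rightarrow> complex mat set \<Rightarrow> (complex mat \<Rightarrow> complex) \<Rightarrow> complex mat \<Rightarrow> complex"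
  where "differential n G \<phi> X = (THE d. \<exists>F\<in>regular_funs n. (\<forall>g\<in>G. F g = \<phi> g) \<and>
     ((\<lambda>t::complex. F (1\<^sub>m n + t \<cdot>\<^sub>m X)) has_field_derivative d) (at 0))"

definition rep_differential ::
  "nat \<Rightarrow> complex mat set \<Rightarrow> nat \<Rightarrow> (complex mat \<Rightarrow> complex mat) \<Rightarrow> complex mat \<Rightarrow> complex mat" where
  "rep_differential n G m \<pi> X = mat m m (\<lambda>(i, j). differential n G (\<lambda>g. \<pi> g $$ (i, j)) X)"

definition locally_faithful ::
  "nat \<Rightarrow> complex mat set \<Rightarrow> nat \<Rightarrow> (complex mat \<Rightarrow> complex mat) \<Rightarrow> bool" where
  "locally_faithful n G m \<pi> \<longleftrightarrow> inj_on (rep_differential n G m \<pi>) (lie_algebra n G)"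

definition trace_mat :: "complex mat \<Rightarrow> complex" where
  "trace_mat A = (\<Sum>i<dim_row A. A $$ (i, i))"

text \<open>
  The generalized Cayley mapping. The description is unique when the trace form of \<open>\<pi>\<close> is
  nondegenerate on the Lie algebra, as it is for \<open>G\<close> reductive and \<open>\<pi>\<close> locally faithful.
  The restriction of \<open>\<pi>\<close> to a subgroup \<open>K\<close> is \<open>\<pi>\<close> itself with \<open>K\<close> in place of \<open>G\<close>, so the Cayley
  mapping of the restriction is \<open>cayley n K m \<pi>\<close>.
\<close>

definition cayley ::
  "nat \<Rightarrow> complex mat set \<Rightarrow> nat \<Rightarrow> (complex mat \<Rightarrow> complex mat) \<Rightarrow> complex mat \<Rightarrow> complex mat" where
  "cayley n G m \<pi> g = (THE Y. Y \<in> lie_algebra n G \<and> (\<forall>X\<in>lie_algebra n G.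
     trace_mat (rep_differential n G m \<pi> Y * rep_differential n G m \<pi> X) =
     trace_mat (\<pi> g * rep_differential n G m \<pi> X)))"

end

theory Submission
  imports
    "HOL-Complex_Analysis.Complex_Analysis"
    "HOL-Library.Function_Algebras"
    "Jordan_Normal_Form.Jordan_Normal_Form_Existence"
    Defs
begin

text \<open>
  Nondegeneracy of the trace form: the Lie algebra of an algebraic group contains, with \<open>X\<close>, the
  semisimple part of \<open>X\<close> with complex conjugate eigenvalues, so the radical of the form consists of nilpotent
  matrices. By Engel's theorem its one-parameter subgroups generate a normal unipotent subgroup.

  (a) If \<open>a\<close> commutes with \<open>k\<close>, then \<open>Ad a\<close> fixes the Cayley image \<open>Y\<close> of \<open>k\<close>. The
  one-parameter subgroup of \<open>Y\<close> thus lies in the connected centralizer \<open>K\<close>, and \<open>Y\<close> in its Lie algebra.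

  (b) The Lie algebra of \<open>K\<close> has an orthogonal complement \<open>P\<close> in that of \<open>G\<close>, and \<open>P\<close> commutes with it. As
  \<open>K\<close> is connected, \<open>\<pi> k\<close> commutes with \<open>d\<pi> P\<close>. Hence the Cayley image of \<open>k\<close> is
  orthogonal to \<open>[P, P]\<close>, its component in \<open>P\<close> is central, and the centre is zero since \<open>G\<close> is semisimple.
  The passage from the Lie algebra to \<open>K\<close> uses Krull's intersection theorem in the coordinate ring: the matrix
  entries of the commutator are functions on \<open>K\<close> that vanish to infinite order at the identity, hence near it.
\<close>

section \<open>Noetherian rings and Krull's intersection theorem\<close>

text \<open>\<open>lie_algebra\<close> sees only the first order of a group at the identity, while
  connectedness is meant in the Zariski topology; the proof is shaped by the gap between the two.
  Where a group may be built, one-parameter subgroups fill it and stand in for dimension theory and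
  quotients. In (b) the group \<open>K\<close> is given and not generated; there flatness yields an
  identity near the identity element, and connectedness spreads it over \<open>K\<close>.

  Conjugate eigenvalues turn a vanishing complex trace into a vanishing sum of squared moduli. They
  are available because a regular function along exp(tX) is an exponential polynomial whose
  exponents are integer combinations of the eigenvalues of X. If it vanishes identically, it still
  does after an additive map is applied to the exponents, and complex conjugation is such a map.

  \<open>cayley\<close> is a definite description, so it has a meaning only where the form is
  nondegenerate, on \<open>G\<close> and on \<open>K\<close> as well. In (a) the latter comes from
  reductivity of \<open>K\<close>, in (b) from simplicity of its Lie algebra.\<close>

definition is_subring :: "'a::comm_ring_1 set \<Rightarrow> bool" where
  "is_subring R \<longleftrightarrow> 0 \<in> R \<and> 1 \<in> R \<and> (\<forall>x\<in>R. \<forall>y\<in>R. x - y \<in> R \<and> x * y \<in> R)"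

definition is_ideal :: "'a::comm_ring_1 set \<Rightarrow> 'a set \<Rightarrow> bool" where
  "is_ideal R I \<longleftrightarrow> I \<subseteq> R \<and> 0 \<in> I \<and> (\<forall>x\<in>I. \<forall>y\<in>I. x + y \<in> I) \<and> (\<forall>r\<in>R. \<forall>x\<in>I. r * x \<in> I)"

text \<open>Ideals are subsets of a ring type, so that the notion applies to
  \<open>regular_funs n\<close> inside the ring of all functions on matrices with pointwise
  operations.\<close>

definition noetherian :: "'a::comm_ring_1 set \<Rightarrow> bool" where
  "noetherian R \<longleftrightarrow> (\<forall>f. (\<forall>i::nat. is_ideal R (f i) \<and> f i \<subseteq> f (Suc i)) \<longrightarrow> (\<exists>N. \<forall>i\<ge>N. f i = f N))"

definition adjoin :: "'a::comm_ring_1 set \<Rightarrow> 'a \<Rightarrow> 'a set" where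
  "adjoin R x = {poly p x | p. \<forall>i. coeff p i \<in> R}"

lemma subring_uminus: "is_subring R \<Longrightarrow> x \<in> R \<Longrightarrow> - x \<in> R"
  unfolding is_subring_def by (metis diff_0)

lemma subring_add: "is_subring R \<Longrightarrow> x \<in> R \<Longrightarrow> y \<in> R \<Longrightarrow> x + y \<in> R"
  using subring_uminus[of R y] unfolding is_subring_def by (metis diff_minus_eq_add)

lemma subring_sum: "is_subring R \<Longrightarrow> (\<And>i. i \<in> A \<Longrightarrow> f i \<in> R) \<Longrightarrow> sum f A \<in> R"
  by (induction A rule: infinite_finite_induct) (auto simp: subring_add, auto simp: is_subring_def)

lemma ideal_diff:
  assumes "is_subring R" "is_ideal R I" "x \<in> I" "y \<in> I" shows "x - y \<in> I"
proof -
  have "(-1) * y \<in> I"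
    using assms subring_uminus[of R 1] unfolding is_ideal_def is_subring_def by blast
  then show ?thesis
    using assms(2,3) unfolding is_ideal_def by fastforce
qed

section \<open>Adjoining one element and Hilbert's basis theorem\<close>

lemma subring_adjoin:
  assumes R: "is_subring R" shows "is_subring (adjoin R x)"
  unfolding is_subring_def
proof (intro conjI ballI)
  have R01: "0 \<in> R" "1 \<in> R" using R by (auto simp: is_subring_def)
  show "0 \<in> adjoin R x" unfolding adjoin_def using R01 by (auto intro!: exI[of _ 0])
  show "1 \<in> adjoin R x" unfolding adjoin_def using R01
    by (auto intro!: exI[of _ 1] simp: coeff_1)
  fix a b assume "a \<in> adjoin R x" "b \<in> adjoin R x"
  then obtain p q where pq: "\<And>i. coeff p i \<in> R" "\<And>i. coeff q i \<in> R" "a = poly p x" "b = poly q x"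
    unfolding adjoin_def by auto
  show "a - b \<in> adjoin R x"
    unfolding adjoin_def using pq R by (auto intro!: exI[of _ "p - q"] simp: is_subring_def)
  have "coeff (p * q) i \<in> R" for i
    unfolding coeff_mult using pq R by (intro subring_sum[OF R]) (auto simp: is_subring_def)
  then show "a * b \<in> adjoin R x"
    unfolding adjoin_def using pq by (auto intro!: exI[of _ "p * q"])
qed

lemma adjoin_superset:
  assumes R: "is_subring R" shows "R \<subseteq> adjoin R x" "x \<in> adjoin R x"
proof -
  have R01: "0 \<in> R" "1 \<in> R" using R by (auto simp: is_subring_def)
  show "R \<subseteq> adjoin R x"
  proof
    fix r assume "r \<in> R"
    then show "r \<in> adjoin R x" unfolding adjoin_def using R01
      by (auto intro!: exI[of _ "[:r:]"] simp: coeff_pCons split: nat.splits)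
  qed
  show "x \<in> adjoin R x" unfolding adjoin_def using R01
    by (auto intro!: exI[of _ "[:0,1:]"] simp: coeff_pCons split: nat.splits)
qed

lemma adjoin_least:
  assumes "is_subring S" "R \<subseteq> S" "x \<in> S" shows "adjoin R x \<subseteq> S"
proof
  fix a assume "a \<in> adjoin R x"
  then obtain p where p: "\<And>i. coeff p i \<in> R" "a = poly p x" unfolding adjoin_def by auto
  have "poly p x = (\<Sum>i\<le>degree p. coeff p i * x ^ i)" by (rule poly_altdef)
  also have "\<dots> \<in> S"
  proof (rule subring_sum[OF assms(1)])
    fix i
    have "x ^ i \<in> S" using assms(1,3) by (induction i) (auto simp: is_subring_def)
    then show "coeff p i * x ^ i \<in> S" using p assms by (auto simp: is_subring_def)
  qed
  finally show "a \<in> S" using p by simp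
qed

text \<open>\<open>x\<close> may be algebraic over \<open>R\<close>, so an element of
  \<open>adjoin R x\<close> has no degree; the polynomials run over all representatives of elements
  of \<open>J\<close>. Admitting degrees below \<open>d\<close>, hence the coefficient 0, is what
  makes the set an ideal.\<close>

definition lead_ideal :: "'a::comm_ring_1 set \<Rightarrow> 'a \<Rightarrow> 'a set \<Rightarrow> nat \<Rightarrow> 'a set" where
  "lead_ideal R x J d = {coeff p d | p. (\<forall>i. coeff p i \<in> R) \<and> degree p \<le> d \<and> poly p x \<in> J}"

lemma ideal_lead_ideal:
  assumes R: "is_subring R" and J: "is_ideal (adjoin R x) J"
  shows "is_ideal R (lead_ideal R x J d)"
  unfolding is_ideal_def
proof (intro conjI ballI)
  have R01: "0 \<in> R" using R by (auto simp: is_subring_def)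
  show "lead_ideal R x J d \<subseteq> R" by (auto simp: lead_ideal_def)
  show "0 \<in> lead_ideal R x J d"
    unfolding lead_ideal_def using J R01 by (auto intro!: exI[of _ 0] simp: is_ideal_def)
next
  fix a b assume "a \<in> lead_ideal R x J d" "b \<in> lead_ideal R x J d"
  then obtain p q where pq: "\<forall>i. coeff p i \<in> R" "degree p \<le> d" "poly p x \<in> J" "a = coeff p d"
     "\<forall>i. coeff q i \<in> R" "degree q \<le> d" "poly q x \<in> J" "b = coeff q d"
    unfolding lead_ideal_def by blast
  then show "a + b \<in> lead_ideal R x J d"
    unfolding lead_ideal_def using J R
    by (auto intro!: exI[of _ "p + q"] degree_add_le simp: subring_add is_ideal_def)
next
  fix r b assume r: "r \<in> R" and "b \<in> lead_ideal R x J d"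
  then obtain q where q: "\<forall>i. coeff q i \<in> R" "degree q \<le> d" "poly q x \<in> J" "b = coeff q d"
    unfolding lead_ideal_def by blast
  have "r \<in> adjoin R x" using adjoin_superset[OF R] r by auto
  then have "r * poly q x \<in> J" using J q by (auto simp: is_ideal_def)
  then show "r * b \<in> lead_ideal R x J d"
    unfolding lead_ideal_def using q R r
    by (auto intro!: exI[of _ "Polynomial.smult r q"] le_trans[OF degree_smult_le] simp: is_subring_def)
qed

lemma lead_ideal_mono_ideal: "J \<subseteq> J' \<Longrightarrow> lead_ideal R x J d \<subseteq> lead_ideal R x J' d"
  unfolding lead_ideal_def by blast

lemma lead_ideal_Suc:
  assumes R: "is_subring R" and J: "is_ideal (adjoin R x) J"
  shows "lead_ideal R x J d \<subseteq> lead_ideal R x J (Suc d)"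
proof
  fix b assume "b \<in> lead_ideal R x J d"
  then obtain q where q: "\<forall>i. coeff q i \<in> R" "degree q \<le> d" "poly q x \<in> J" "b = coeff q d"
    unfolding lead_ideal_def by blast
  have "x * poly q x \<in> J" using adjoin_superset(2)[OF R] J q by (auto simp: is_ideal_def)
  moreover have "\<forall>i. coeff (pCons 0 q) i \<in> R"
    using q R by (auto simp: coeff_pCons is_subring_def split: nat.splits)
  ultimately show "b \<in> lead_ideal R x J (Suc d)"
    unfolding lead_ideal_def using q by (auto intro!: exI[of _ "pCons 0 q"] le_trans[OF degree_pCons_le])
qed

lemma lead_ideal_mono_deg:
  assumes R: "is_subring R" and J: "is_ideal (adjoin R x) J" and "d \<le> e"
  shows "lead_ideal R x J d \<subseteq> lead_ideal R x J e"
  using lift_Suc_mono_le[of "lead_ideal R x J", OF lead_ideal_Suc[OF R J] \<open>d \<le> e\<close>] .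

text \<open>An element of \<open>J'\<close> is lowered in degree by subtracting an element of
  \<open>J\<close> with the same top coefficient, until nothing is left.\<close>

lemma ideal_eq_if_lead_ideals_eq:
  assumes R: "is_subring R" and J: "is_ideal (adjoin R x) J" and J': "is_ideal (adjoin R x) J'"
    and sub: "J \<subseteq> J'" and eq: "\<And>d. lead_ideal R x J' d \<subseteq> lead_ideal R x J d"
  shows "J = J'"
proof
  \<comment> \<open>The alternative \<open>p = 0\<close> is there because the zero polynomial has
    degree 0; for \<open>d = 0\<close> it is the only case.\<close>
  have *: "\<forall>i. coeff p i \<in> R \<Longrightarrow> poly p x \<in> J' \<Longrightarrow> degree p < d \<or> p = 0 \<Longrightarrow> poly p x \<in> J" for p d
  proof (induction d arbitrary: p)
    case 0
    then show ?case using J by (auto simp: is_ideal_def)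
  next
    case (Suc d)
    then have "degree p \<le> d" by auto
    then have "coeff p d \<in> lead_ideal R x J' d" using Suc unfolding lead_ideal_def by blast
    then have "coeff p d \<in> lead_ideal R x J d" using eq by blast
    then obtain q where q: "\<forall>i. coeff q i \<in> R" "degree q \<le> d" "poly q x \<in> J" "coeff q d = coeff p d"
      unfolding lead_ideal_def by force
    have "poly q x \<in> J'" using q sub by auto
    then have "poly p x - poly q x \<in> J'"
      using Suc.prems(2) ideal_diff[OF subring_adjoin[OF R] J'] by blast
    moreover have "degree (p - q) < d \<or> p - q = 0"
    proof -
      have "degree (p - q) \<le> d" using \<open>degree p \<le> d\<close> q by (simp add: degree_diff_le)
      moreover have "degree (p - q) \<noteq> d \<or> p - q = 0"
        using q(4) by (metis coeff_diff eq_iff_diff_eq_0 leading_coeff_0_iff)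
      ultimately show ?thesis by auto
    qed
    moreover have "\<forall>i. coeff (p - q) i \<in> R"
      using Suc.prems(1) q R by (auto simp: is_subring_def)
    ultimately have "poly (p - q) x \<in> J" using Suc.IH[of "p - q"] by auto
    then have "poly (p - q) x + poly q x \<in> J" using q J unfolding is_ideal_def by blast
    then show ?case by simp
  qed
  show "J' \<subseteq> J"
  proof
    fix a assume a: "a \<in> J'"
    then have "a \<in> adjoin R x" using J' by (auto simp: is_ideal_def)
    then obtain p where "\<forall>i. coeff p i \<in> R" "a = poly p x" unfolding adjoin_def by auto
    then show "a \<in> J" using *[of p "Suc (degree p)"] a by auto
  qed
qed (rule sub)

text \<open>Hilbert's basis theorem. The ideals \<open>lead_ideal R x (f i) d\<close> increase in
  \<open>i\<close> and in \<open>d\<close>. The diagonal is constant from some \<open>M\<close> on,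
  which settles all \<open>d > M\<close>; the finitely many rows \<open>d \<le> M\<close> stabilize
  one by one, and \<open>K\<close> bounds all these indices.\<close>

theorem noetherian_adjoin:
  assumes R: "is_subring R" and N: "noetherian R"
  shows "noetherian (adjoin R x)"
  unfolding noetherian_def
proof (intro allI impI)
  fix f :: "nat \<Rightarrow> 'a set" assume f: "\<forall>i. is_ideal (adjoin R x) (f i) \<and> f i \<subseteq> f (Suc i)"
  let ?L = "\<lambda>i d. lead_ideal R x (f i) d"
  have mono: "f i \<subseteq> f j" if "i \<le> j" for i j
    using lift_Suc_mono_le[of f, OF _ that] f by blast
  have Lmono: "?L i d \<subseteq> ?L j e" if "i \<le> j" "d \<le> e" for i j d e
    using lead_ideal_mono_ideal[OF mono[OF that(1)]] lead_ideal_mono_deg[OF R _ that(2)] f by blast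
  have stab: "\<exists>N. \<forall>k\<ge>N. g k = g N" if "\<And>k. g k = ?L (a k) (b k)" "mono a" "mono b" for g and a b :: "nat \<Rightarrow> nat"
  proof -
    have "is_ideal R (g k) \<and> g k \<subseteq> g (Suc k)" for k
      using that(1) ideal_lead_ideal[OF R] f Lmono[of "a k" "a (Suc k)" "b k" "b (Suc k)"]
        monoD[OF that(2), of k "Suc k"] monoD[OF that(3), of k "Suc k"] by simp
    then show ?thesis using N unfolding noetherian_def by blast
  qed
  obtain M where M: "\<And>k. k \<ge> M \<Longrightarrow> ?L k k = ?L M M"
    using stab[of "\<lambda>k. ?L k k" id id] by (auto simp: mono_def)
  have "\<exists>N. \<forall>i\<ge>N. ?L i d = ?L N d" for d
    using stab[of "\<lambda>k. ?L k d" id "\<lambda>_. d"] by (auto simp: mono_def)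
  then obtain n where n: "\<And>d i. i \<ge> n d \<Longrightarrow> ?L i d = ?L (n d) d" by metis
  define K where "K = Max (insert M (n ` {..M}))"
  have K: "M \<le> K" "\<And>d. d \<le> M \<Longrightarrow> n d \<le> K" unfolding K_def by (rule Max_ge; simp)+
  have "f K = f i" if i: "i \<ge> K" for i
  proof (rule ideal_eq_if_lead_ideals_eq[OF R])
    show "is_ideal (adjoin R x) (f K)" "is_ideal (adjoin R x) (f i)" using f by auto
    show "f K \<subseteq> f i" using mono i by auto
    fix d
    show "?L i d \<subseteq> ?L K d"
    proof (cases "d \<le> M")
      case True
      then show ?thesis using n[of d i] n[of d K] K i by (metis le_trans order_refl)
    next
      case False
      have "?L i d \<subseteq> ?L (max i d) (max i d)" by (rule Lmono) auto
      also have "\<dots> = ?L M M" using M[of "max i d"] False by auto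
      also have "\<dots> \<subseteq> ?L K d" using False K by (intro Lmono) auto
      finally show ?thesis .
    qed
  qed
  then show "\<exists>N. \<forall>i\<ge>N. f i = f N" by (intro exI[of _ K]) auto
qed

lemma noetherian_maximal:
  assumes N: "noetherian R" and P0: "is_ideal R J0" "P J0"
  shows "\<exists>J. is_ideal R J \<and> P J \<and> (\<forall>J'. is_ideal R J' \<and> P J' \<and> J \<subseteq> J' \<longrightarrow> J' = J)"
proof (rule ccontr)
  assume "\<not> ?thesis"
  then have "\<exists>J'. is_ideal R J' \<and> P J' \<and> J \<subset> J'" if "is_ideal R J \<and> P J" for J
    using that by blast
  note ex = this
  define s where "s = (\<lambda>J. SOME J'. is_ideal R J' \<and> P J' \<and> J \<subset> J')"
  have s: "is_ideal R (s J) \<and> P (s J) \<and> J \<subset> s J" if "is_ideal R J \<and> P J" for J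
    unfolding s_def by (rule someI_ex[OF ex[OF that]])
  define f where "f i = (s ^^ i) J0" for i
  have f: "is_ideal R (f i) \<and> P (f i)" for i
  proof (induction i)
    case (Suc i)
    then show ?case using s[of "f i"] by (simp add: f_def)
  qed (use P0 in \<open>simp add: f_def\<close>)
  have "f i \<subset> f (Suc i)" for i using s[OF f[of i]] by (simp add: f_def)
  moreover from this obtain n where "\<forall>i\<ge>n. f i = f n"
    using N f unfolding noetherian_def by blast
  then have "f (Suc n) = f n" by (rule allE[of _ "Suc n"]) simp
  ultimately show False by blast
qed

lemma noetherian_field_like:
  assumes "\<And>x. x \<in> R \<Longrightarrow> x \<noteq> 0 \<Longrightarrow> \<exists>y\<in>R. y * x = 1"
  shows "noetherian R"
  unfolding noetherian_def
proof (intro allI impI)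
  fix f :: "nat \<Rightarrow> 'a set" assume f: "\<forall>i. is_ideal R (f i) \<and> f i \<subseteq> f (Suc i)"
  have mono: "f i \<subseteq> f j" if "i \<le> j" for i j
    using lift_Suc_mono_le[of f, OF _ that] f by blast
  have all: "f i = R" if x: "x \<in> f i" "x \<noteq> 0" for i x
  proof -
    have I: "is_ideal R (f i)" using f by auto
    then have "x \<in> R" using x(1) I unfolding is_ideal_def by blast
    then obtain y where "y \<in> R" "y * x = 1" using assms[of x] x(2) by blast
    have "y * x \<in> f i" using I x(1) \<open>y \<in> R\<close> unfolding is_ideal_def by blast
    then have one: "1 \<in> f i" using \<open>y * x = 1\<close> by simp
    have "r * 1 \<in> f i" if "r \<in> R" for r using I one that unfolding is_ideal_def by blast
    then have "R \<subseteq> f i" unfolding mult_1_right by blast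
    then show ?thesis using I unfolding is_ideal_def by blast
  qed
  show "\<exists>N. \<forall>i\<ge>N. f i = f N"
  proof (cases "\<forall>i. f i = {0}")
    case False
    then obtain i x where "x \<in> f i" "x \<noteq> 0" using f unfolding is_ideal_def by blast
    then have "\<forall>j\<ge>i. f j = f i" using all mono by blast
    then show ?thesis by blast
  qed auto
qed


lemma subring_zero: "is_subring R \<Longrightarrow> 0 \<in> R"
  and subring_one: "is_subring R \<Longrightarrow> 1 \<in> R"
  and subring_mult: "is_subring R \<Longrightarrow> x \<in> R \<Longrightarrow> y \<in> R \<Longrightarrow> x * y \<in> R"
  by (auto simp: is_subring_def)

lemma subring_prod_list: "is_subring R \<Longrightarrow> (\<And>x. x \<in> set w \<Longrightarrow> f x \<in> R) \<Longrightarrow> prod_list (map f w) \<in> R"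
  by (induction w) (auto simp: subring_one subring_mult)

lemma subring_power: "is_subring R \<Longrightarrow> x \<in> R \<Longrightarrow> x ^ k \<in> R"
  by (induction k) (auto simp: subring_one subring_mult)

lemma ideal_zero: "is_ideal R I \<Longrightarrow> 0 \<in> I"
  and ideal_add: "is_ideal R I \<Longrightarrow> x \<in> I \<Longrightarrow> y \<in> I \<Longrightarrow> x + y \<in> I"
  and ideal_mult: "is_ideal R I \<Longrightarrow> r \<in> R \<Longrightarrow> x \<in> I \<Longrightarrow> r * x \<in> I"
  and ideal_sub: "is_ideal R I \<Longrightarrow> x \<in> I \<Longrightarrow> x \<in> R"
  by (auto simp: is_ideal_def)

text \<open>This is the \<open>k\<close>-th power of the ideal of \<open>R\<close> generated by the \<open>y l\<close>.\<close>

inductive_set words_span :: "'a::comm_ring_1 set \<Rightarrow> ('l \<Rightarrow> 'a) \<Rightarrow> 'l set \<Rightarrow> nat \<Rightarrow> 'a set"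
  for R y L k where
  zero: "0 \<in> words_span R y L k"
| word: "set w \<subseteq> L \<Longrightarrow> length w = k \<Longrightarrow> r \<in> R \<Longrightarrow> prod_list (map y w) * r \<in> words_span R y L k"
| add: "a \<in> words_span R y L k \<Longrightarrow> b \<in> words_span R y L k \<Longrightarrow> a + b \<in> words_span R y L k"

section \<open>The adic filtration modulo an ideal\<close>

locale adic =
  fixes R I :: "'a::comm_ring_1 set" and y :: "'l \<Rightarrow> 'a" and L :: "'l set"
  assumes R: "is_subring R" and I: "is_ideal R I" and y: "\<And>l. l \<in> L \<Longrightarrow> y l \<in> R" and L: "finite L"
begin

abbreviation "W \<equiv> words_span R y L"

lemma W_sub: "a \<in> W k \<Longrightarrow> a \<in> R"
  by (induction rule: words_span.induct)
    (auto intro!: subring_zero[OF R] subring_mult[OF R] subring_add[OF R] subring_prod_list[OF R] y)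

lemma W_mult: "a \<in> W j \<Longrightarrow> b \<in> W k \<Longrightarrow> a * b \<in> W (j + k)"
proof (induction rule: words_span.induct)
  case (word w r)
  from word(4) show ?case
  proof (induction rule: words_span.induct)
    case (word w' r')
    have "prod_list (map y w) * r * (prod_list (map y w') * r') = prod_list (map y (w @ w')) * (r * r')"
      by (simp add: mult_ac)
    moreover have "prod_list (map y (w @ w')) * (r * r') \<in> W (j + k)"
      by (rule words_span.word) (use word \<open>set w \<subseteq> L\<close> \<open>length w = j\<close> \<open>r \<in> R\<close> subring_mult[OF R] in auto)
    ultimately show ?case by (simp only:)
  qed (auto simp: distrib_left intro: words_span.zero words_span.add)
qed (auto simp: distrib_right intro: words_span.zero words_span.add)

lemma W_0: "r \<in> R \<Longrightarrow> r \<in> W 0"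
  using words_span.word[of "[]" L 0 r R y] by simp

lemma W_1: "l \<in> L \<Longrightarrow> y l \<in> W 1"
  using words_span.word[of "[l]" L 1 1 R y] subring_one[OF R] by simp

lemma W_ideal: "is_ideal R (W k)"
  unfolding is_ideal_def
proof (intro conjI ballI subsetI)
  fix r x assume "r \<in> R" "x \<in> W k"
  then show "r * x \<in> W k" using W_mult[OF W_0, of r x k] by simp
qed (auto intro: words_span.zero words_span.add W_sub)

lemma W_Suc: "a \<in> W (Suc k) \<Longrightarrow> a \<in> W k"
proof (induction rule: words_span.induct)
  case (word w r)
  then obtain l w' where w: "w = l # w'" by (cases w) auto
  have "prod_list (map y w') * (y l * r) \<in> W k"
    by (rule words_span.word) (use word w y subring_mult[OF R] in auto)
  then show ?case by (simp add: w mult_ac)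
qed (auto intro: words_span.zero words_span.add)

text \<open>The preimage in \<open>R\<close> of the \<open>k\<close>-th power of the ideal of
  \<open>R / I\<close> generated by the \<open>y l\<close>; this form avoids quotient rings.\<close>

definition "Q k = {x \<in> R. \<exists>p\<in>W k. x - p \<in> I}"

lemma Q_W: "x \<in> W k \<Longrightarrow> x \<in> Q k"
  unfolding Q_def using W_sub[of x k] ideal_zero[OF I] by (auto intro!: bexI[of _ x])

lemma Q_I: "x \<in> I \<Longrightarrow> x \<in> Q k"
  unfolding Q_def using ideal_sub[OF I] words_span.zero by (auto intro!: bexI[of _ 0])

lemma Q_Suc: "x \<in> Q (Suc k) \<Longrightarrow> x \<in> Q k"
  unfolding Q_def using W_Suc by auto

lemma Q_mult: assumes "a \<in> Q j" "b \<in> Q k" shows "a * b \<in> Q (j + k)"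
proof -
  obtain p q where p: "a \<in> R" "p \<in> W j" "a - p \<in> I" and q: "b \<in> R" "q \<in> W k" "b - q \<in> I"
    using assms unfolding Q_def by auto
  have "b * (a - p) + p * (b - q) \<in> I"
    using p q W_sub by (intro ideal_add[OF I] ideal_mult[OF I]) auto
  also have "b * (a - p) + p * (b - q) = a * b - p * q" by (simp add: algebra_simps)
  finally show ?thesis unfolding Q_def using p q W_mult subring_mult[OF R] by blast
qed

lemma Q_0: "r \<in> R \<Longrightarrow> r \<in> Q 0" by (intro Q_W W_0)

lemma Q_ideal: "is_ideal R (Q k)"
  unfolding is_ideal_def
proof (intro conjI ballI subsetI)
  fix a b assume "a \<in> Q k" "b \<in> Q k"
  then obtain p q where p: "a \<in> R" "p \<in> W k" "a - p \<in> I" and q: "b \<in> R" "q \<in> W k" "b - q \<in> I"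
    unfolding Q_def by auto
  have "(a - p) + (b - q) \<in> I" by (intro ideal_add[OF I]) (use p q in auto)
  also have "(a - p) + (b - q) = (a + b) - (p + q)" by simp
  finally show "a + b \<in> Q k" unfolding Q_def using p q words_span.add subring_add[OF R] by blast
next
  fix r x assume "r \<in> R" "x \<in> Q k"
  then show "r * x \<in> Q k" using Q_mult[OF Q_0, of r x k] by simp
next
  show "0 \<in> Q k" by (rule Q_I[OF ideal_zero[OF I]])
qed (simp add: Q_def)

lemmas Q_add = ideal_add[OF Q_ideal] and Q_diff = ideal_diff[OF R Q_ideal]

text \<open>Pigeonhole: a word longer than the sum of the \<open>e l\<close> contains some letter
  \<open>l\<close> at least \<open>e l\<close> times. The successor also takes care of an empty
  \<open>L\<close>, where the power 0 would be the whole ring.\<close>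

lemma W_subset_ideal_if_powers:
  assumes J: "is_ideal R J" and pow: "\<And>l. l \<in> L \<Longrightarrow> y l ^ e l \<in> J"
  shows "W (Suc (\<Sum>l\<in>L. e l)) \<subseteq> J"
proof
  fix a assume "a \<in> W (Suc (\<Sum>l\<in>L. e l))"
  then show "a \<in> J"
  proof (induction rule: words_span.induct)
    case (word w r)
    have "\<exists>l\<in>L. e l \<le> count_list w l"
    proof (rule ccontr)
      assume "\<not> ?thesis"
      then have "(\<Sum>l\<in>L. count_list w l) \<le> (\<Sum>l\<in>L. e l)" by (intro sum_mono) force
      then show False using word sum_count_set[OF word(1) L] by simp
    qed
    then obtain l where l: "l \<in> L" "e l \<le> count_list w l" by blast
    have "\<exists>s\<in>R. prod_list (map y w) = s * y l ^ count_list w l"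
      using word(1)
    proof (induction w)
      case (Cons a w)
      then obtain s where "s \<in> R" "prod_list (map y w) = s * y l ^ count_list w l" by auto
      then have "prod_list (map y (a # w)) = (if a = l then s else y a * s) * y l ^ count_list (a # w) l"
        by (simp add: mult_ac)
      moreover have "(if a = l then s else y a * s) \<in> R"
        using \<open>s \<in> R\<close> y[of a] Cons.prems subring_mult[OF R] by simp
      ultimately show ?case by blast
    qed (use subring_one[OF R] in auto)
    then obtain s where s: "s \<in> R" "prod_list (map y w) = s * y l ^ count_list w l" by blast
    have "prod_list (map y w) * r = (s * r * y l ^ (count_list w l - e l)) * y l ^ e l"
      using l(2) by (simp add: s mult_ac flip: power_add)
    also have "\<dots> \<in> J"
      using s word l y pow by (intro ideal_mult[OF J] subring_mult[OF R] subring_power[OF R]) auto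
    finally show ?case .
  qed (auto intro: ideal_zero[OF J] ideal_add[OF J])
qed

text \<open>In place of the Artin-Rees lemma, take an ideal \<open>J\<close> that is maximal with
  \<open>P\<close>: it contains \<open>I\<close> and all multiples of \<open>h\<close> by
  \<open>W 1\<close>, and modulo \<open>I\<close> it contains no further multiples of
  \<open>h\<close>. Maximality forces a power of every \<open>y l\<close> into \<open>J\<close>,
  hence some \<open>W k\<close>, hence \<open>h\<close> itself; the last condition with
  \<open>r = 1\<close> then gives \<open>a\<close>.\<close>

theorem krull_intersection:
  assumes N: "noetherian R" and h: "\<And>k. h \<in> Q k"
  shows "\<exists>a\<in>W 1. h - a * h \<in> I"
proof -
  have hR: "h \<in> R" using h[of 0] unfolding Q_def by auto
  define P where "P J \<longleftrightarrow> I \<subseteq> J \<and> (\<forall>a\<in>W 1. a * h \<in> J) \<and>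
     (\<forall>r\<in>R. r * h \<in> J \<longrightarrow> (\<exists>a\<in>W 1. r * h - a * h \<in> I))" for J
  define J0 where "J0 = {a * h + i | a i. a \<in> W 1 \<and> i \<in> I}"
  have J0: "is_ideal R J0"
    unfolding is_ideal_def
  proof (intro conjI ballI subsetI)
    show "0 \<in> J0" unfolding J0_def using words_span.zero ideal_zero[OF I] by force
  next
    fix u v assume "u \<in> J0" "v \<in> J0"
    then obtain a i b j where *: "a \<in> W 1" "i \<in> I" "u = a * h + i" "b \<in> W 1" "j \<in> I" "v = b * h + j"
      unfolding J0_def by blast
    then have "u + v = (a + b) * h + (i + j)" by (simp add: algebra_simps)
    then show "u + v \<in> J0" unfolding J0_def using * words_span.add ideal_add[OF I] by blast
  next
    fix r u assume r: "r \<in> R" and "u \<in> J0"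
    then obtain a i where *: "a \<in> W 1" "i \<in> I" "u = a * h + i" unfolding J0_def by blast
    then have "r * u = (r * a) * h + r * i" by (simp add: algebra_simps)
    then show "r * u \<in> J0" unfolding J0_def using * r ideal_mult[OF W_ideal] ideal_mult[OF I] by blast
  next
    fix u assume "u \<in> J0"
    then show "u \<in> R" unfolding J0_def
      using W_sub ideal_sub[OF I] hR by (auto intro!: subring_add[OF R] subring_mult[OF R])
  qed
  have "P J0"
    unfolding P_def
  proof (intro conjI ballI impI subsetI)
    fix i assume "i \<in> I" then show "i \<in> J0" unfolding J0_def using words_span.zero by force
  next
    fix a assume "a \<in> W 1" then show "a * h \<in> J0" unfolding J0_def using ideal_zero[OF I] by force
  next
    fix r assume "r \<in> R" "r * h \<in> J0"
    then show "\<exists>a\<in>W 1. r * h - a * h \<in> I" unfolding J0_def by force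
  qed
  then obtain J where J: "is_ideal R J" "P J"
    and max: "\<And>J'. is_ideal R J' \<Longrightarrow> P J' \<Longrightarrow> J \<subseteq> J' \<Longrightarrow> J' = J"
    using noetherian_maximal[of R J0 P, OF N J0 \<open>P J0\<close>] by metis
  have "\<exists>k. y l ^ k \<in> J" if l: "l \<in> L" for l
  proof -
    let ?x = "y l"
    have xR: "?x ^ k \<in> R" for k using y[OF l] by (rule subring_power[OF R])
    define f where "f k = {s \<in> R. ?x ^ k * s \<in> J}" for k
    have "is_ideal R (f k) \<and> f k \<subseteq> f (Suc k)" for k
    proof (intro conjI subsetI)
      show "is_ideal R (f k)"
        unfolding is_ideal_def f_def
        using subring_zero[OF R] ideal_zero[OF J(1)] subring_add[OF R] ideal_add[OF J(1)] subring_mult[OF R] ideal_mult[OF J(1)]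
        by (auto simp: distrib_left mult.left_commute)
      fix s assume "s \<in> f k"
      then show "s \<in> f (Suc k)" unfolding f_def using ideal_mult[OF J(1) y[OF l]] by (auto simp: mult.assoc)
    qed
    \<comment> \<open>The colon ideals of \<open>J\<close> by the powers of \<open>?x\<close>
      increase. At their stable index, adding \<open>?x ^ k\<close> to \<open>J\<close> introduces
      no new multiple of \<open>h\<close>.\<close>
    then obtain k where k: "\<And>i. i \<ge> k \<Longrightarrow> f i = f k" using N unfolding noetherian_def by blast
    define J' where "J' = {j + ?x ^ k * s | j s. j \<in> J \<and> s \<in> R}"
    have J': "is_ideal R J'"
      unfolding is_ideal_def
    proof (intro conjI ballI subsetI)
      show "0 \<in> J'" unfolding J'_def using subring_zero[OF R] ideal_zero[OF J(1)] by force
    next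
      fix u v assume "u \<in> J'" "v \<in> J'"
      then obtain a i b j where *: "a \<in> J" "i \<in> R" "u = a + ?x ^ k * i" "b \<in> J" "j \<in> R" "v = b + ?x ^ k * j"
        unfolding J'_def by blast
      then have "u + v = (a + b) + ?x ^ k * (i + j)" by (simp add: algebra_simps)
      then show "u + v \<in> J'" unfolding J'_def using * subring_add[OF R] ideal_add[OF J(1)] by blast
    next
      fix r u assume r: "r \<in> R" and "u \<in> J'"
      then obtain a i where *: "a \<in> J" "i \<in> R" "u = a + ?x ^ k * i" unfolding J'_def by blast
      then have "r * u = (r * a) + ?x ^ k * (r * i)" by (simp add: algebra_simps)
      then show "r * u \<in> J'" unfolding J'_def using * r ideal_mult[OF J(1)] subring_mult[OF R] by blast
    next
      fix u assume "u \<in> J'"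
      then show "u \<in> R" unfolding J'_def
        using ideal_sub[OF J(1)] xR by (auto intro!: subring_add[OF R] subring_mult[OF R])
    qed
    have JJ': "J \<subseteq> J'"
    proof
      fix j assume "j \<in> J"
      then have "j = j + ?x ^ k * 0 \<and> j \<in> J \<and> 0 \<in> R" using subring_zero[OF R] by simp
      then show "j \<in> J'" unfolding J'_def by blast
    qed
    have "P J'"
      unfolding P_def
    proof (intro conjI ballI impI)
      show "I \<subseteq> J'" using J JJ' unfolding P_def by blast
      show "a * h \<in> J'" if "a \<in> W 1" for a using J JJ' that unfolding P_def by blast
      fix r assume r: "r \<in> R" "r * h \<in> J'"
      then obtain j s where js: "j \<in> J" "s \<in> R" "r * h = j + ?x ^ k * s" unfolding J'_def by blast
      \<comment> \<open>Multiples of \<open>h\<close> by \<open>?x\<close> are in \<open>J\<close>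
        already. This puts \<open>?x ^ Suc k * s\<close> into \<open>J\<close>, and stability of the
        colon ideals takes the extra factor away.\<close>
      have "r * ?x * h \<in> J"
        using J(2) r(1) ideal_mult[OF W_ideal r(1) W_1[OF l]] unfolding P_def by blast
      then have "(?x * r) * h \<in> J" by (simp only: mult.commute[of r])
      then have "(?x * r) * h - ?x * j \<in> J" using ideal_diff[OF R J(1)] ideal_mult[OF J(1) y[OF l]] js by blast
      also have "(?x * r) * h - ?x * j = ?x ^ Suc k * s"
        unfolding mult.assoc[of ?x r h] js(3) by (simp add: algebra_simps)
      finally have "s \<in> f (Suc k)" unfolding f_def using js by blast
      then have "s \<in> f k" using k[of "Suc k"] by simp
      then have "r * h \<in> J" unfolding f_def using js ideal_add[OF J(1)] by simp
      then show "\<exists>a\<in>W 1. r * h - a * h \<in> I" using J(2) r unfolding P_def by blast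
    qed
    then have "J' = J" using max J' JJ' by blast
    moreover have "?x ^ k \<in> J'"
    proof -
      have "?x ^ k = 0 + ?x ^ k * 1 \<and> 0 \<in> J \<and> 1 \<in> R" using ideal_zero[OF J(1)] subring_one[OF R] by simp
      then show ?thesis unfolding J'_def by blast
    qed
    ultimately show ?thesis by blast
  qed
  then obtain e where "\<And>l. l \<in> L \<Longrightarrow> y l ^ e l \<in> J" by metis
  from W_subset_ideal_if_powers[OF J(1) this] have "W (Suc (\<Sum>l\<in>L. e l)) \<subseteq> J" by blast
  moreover obtain p where p: "p \<in> W (Suc (\<Sum>l\<in>L. e l))" "h - p \<in> I"
    using h[of "Suc (\<Sum>l\<in>L. e l)"] unfolding Q_def by blast
  ultimately have "(h - p) + p \<in> J" using J unfolding P_def by (intro ideal_add[OF J(1)]) blast+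
  then have "1 * h \<in> J" by simp
  then obtain a where "a \<in> W 1" "1 * h - a * h \<in> I" using J(2) subring_one[OF R] unfolding P_def by blast
  then show ?thesis by auto
qed

text \<open>\<open>E\<close> is a derivation modulo \<open>I\<close> that fixes each
  \<open>y l\<close> to first order, so it acts as multiplication by \<open>k\<close> on
  \<open>Q k\<close> modulo \<open>Q (Suc k)\<close>. As \<open>E\<close> also raises the order of
  the family \<open>H\<close>, the element \<open>k * h\<close> lies in \<open>Q (Suc k)\<close>,
  and \<open>k\<close> is invertible. The induction starts at \<open>H1\<close> because
  multiplication by 0 would say nothing.\<close>

theorem euler_infinitely_flat:
  assumes E_add: "\<And>a b. a \<in> R \<Longrightarrow> b \<in> R \<Longrightarrow> E (a + b) - (E a + E b) \<in> I"
    and E_mult: "\<And>a b. a \<in> R \<Longrightarrow> b \<in> R \<Longrightarrow> E (a * b) - (a * E b + b * E a) \<in> I"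
    and E_I: "\<And>a. a \<in> I \<Longrightarrow> E a \<in> I"
    and E_R: "\<And>a. a \<in> R \<Longrightarrow> E a \<in> Q 1"
    and E_y: "\<And>l. l \<in> L \<Longrightarrow> E (y l) - y l \<in> Q 2"
    and inv: "\<And>k. k > 0 \<Longrightarrow> \<exists>c\<in>R. c * of_nat k = 1"
    and H1: "\<And>h. h \<in> H \<Longrightarrow> h \<in> Q 1"
    and H: "\<And>k h. (\<And>g. g \<in> H \<Longrightarrow> g \<in> Q k) \<Longrightarrow> h \<in> H \<Longrightarrow> E h \<in> Q (Suc k)"
    and h: "h \<in> H"
  shows "h \<in> Q k"
proof -
  have E_word: "E (prod_list (map y w) * r) - of_nat (length w) * (prod_list (map y w) * r) \<in> Q (Suc (length w))"
    if "set w \<subseteq> L" "r \<in> R" for w r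
    using that(1)
  proof (induction w)
    case Nil then show ?case using E_R[OF that(2)] by simp
  next
    case (Cons l w)
    let ?b = "prod_list (map y w) * r" and ?n = "of_nat (length w) :: 'a"
    have bR: "?b \<in> R" using Cons.prems y that(2) by (auto intro!: subring_mult[OF R] subring_prod_list[OF R])
    have bW: "?b \<in> Q (length w)" using Cons.prems that(2) by (intro Q_W words_span.word) auto
    have l: "l \<in> L" using Cons.prems by auto
    have "y l * (E ?b - ?n * ?b) \<in> Q (1 + Suc (length w))"
      by (rule Q_mult[OF Q_W[OF W_1[OF l]]]) (use Cons in auto)
    moreover have "(E (y l) - y l) * ?b \<in> Q (2 + length w)"
      by (intro Q_mult E_y l bW)
    moreover have "E (y l * ?b) - (y l * E ?b + ?b * E (y l)) \<in> Q (Suc (length (l # w)))"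
      by (intro Q_I E_mult y l bR)
    ultimately have "E (y l * ?b) - (y l * E ?b + ?b * E (y l)) + (y l * (E ?b - ?n * ?b) + (E (y l) - y l) * ?b)
       \<in> Q (Suc (length (l # w)))"
      by (intro Q_add) auto
    also have "E (y l * ?b) - (y l * E ?b + ?b * E (y l)) + (y l * (E ?b - ?n * ?b) + (E (y l) - y l) * ?b)
       = E (y l * ?b) - (1 + ?n) * (y l * ?b)" by (simp add: algebra_simps)
    finally show ?case by (simp add: mult.assoc)
  qed
  have E0: "E 0 \<in> I" using E_I ideal_zero[OF I] by blast
  have W: "E x - of_nat k * x \<in> Q (Suc k)" if "x \<in> W k" for x k
    using that
  proof (induction rule: words_span.induct)
    case zero then show ?case using Q_I[OF E0] by simp
  next
    case (word w r)
    then show ?case using E_word[of w r] by auto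
  next
    case (add a b)
    have "E (a + b) - (E a + E b) + ((E a - of_nat k * a) + (E b - of_nat k * b)) \<in> Q (Suc k)"
      by (intro Q_add add Q_I E_add W_sub[of _ k])
    then show ?case by (simp add: algebra_simps)
  qed
  have E_Q: "E x - of_nat k * x \<in> Q (Suc k)" if "x \<in> Q k" for x k
  proof -
    from \<open>x \<in> Q k\<close> obtain p where p: "x \<in> R" "p \<in> W k" "x - p \<in> I" unfolding Q_def by blast
    have kR: "of_nat k \<in> R" by (induction k) (auto intro: subring_zero[OF R] subring_add[OF R] subring_one[OF R])
    have "E (p + (x - p)) - (E p + E (x - p)) \<in> Q (Suc k)"
      using p W_sub ideal_sub[OF I] by (intro Q_I E_add) auto
    moreover have "E (x - p) \<in> Q (Suc k)" "of_nat k * (x - p) \<in> Q (Suc k)"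
      using p ideal_mult[OF I kR] by (auto intro: Q_I E_I)
    moreover have "E p - of_nat k * p \<in> Q (Suc k)" using W p by blast
    ultimately have "(E (p + (x - p)) - (E p + E (x - p))) + E (x - p) - of_nat k * (x - p) + (E p - of_nat k * p) \<in> Q (Suc k)"
      by (rule Q_add[OF Q_diff[OF Q_add]])
    then show ?thesis by (simp add: algebra_simps)
  qed
  have "\<forall>h\<in>H. h \<in> Q (Suc k)" for k
  proof (induction k)
    case (Suc k)
    show ?case
    proof
      fix h assume h: "h \<in> H"
      have E1: "E h - of_nat (Suc k) * h \<in> Q (Suc (Suc k))" and E2: "E h \<in> Q (Suc (Suc k))"
        using E_Q[of h "Suc k"] H[of "Suc k" h] Suc h by blast+
      have "E h - (E h - of_nat (Suc k) * h) \<in> Q (Suc (Suc k))" by (rule Q_diff[OF E2 E1])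
      then have *: "of_nat (Suc k) * h \<in> Q (Suc (Suc k))"
        by (simp only: diff_diff_eq2 add_diff_cancel_left')
      obtain c where c: "c \<in> R" "c * of_nat (Suc k) = 1" using inv[of "Suc k"] by blast
      have "c * (of_nat (Suc k) * h) \<in> Q (Suc (Suc k))" using ideal_mult[OF Q_ideal c(1) *] .
      then show "h \<in> Q (Suc (Suc k))" using c by (simp only: mult.assoc[symmetric]) simp
    qed
  qed (use H1 in auto)
  then show ?thesis using h Q_Suc by blast
qed

end

section \<open>Regular functions on the general linear group\<close>

lemma mat_mult_entry:
  fixes A B :: "'a::comm_ring_1 mat"
  assumes "A \<in> carrier_mat n n" "B \<in> carrier_mat n n" "i < n" "j < n"
  shows "(A * B) $$ (i, j) = (\<Sum>k<n. A $$ (i, k) * B $$ (k, j))"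
  using assms by (auto simp: scalar_prod_def lessThan_atLeast0)

lemma sum_indicator_pair:
  fixes x :: "nat \<Rightarrow> nat \<Rightarrow> 'a::comm_semiring_1"
  assumes "i < n" "j < n"
  shows "(\<Sum>k<n. \<Sum>l<n. (if k = i \<and> l = j then 1 else 0) * x k l) = x i j"
    and "(\<Sum>k<n. \<Sum>l<n. x k l * (if k = i \<and> l = j then 1 else 0)) = x i j"
proof -
  have "(\<Sum>l<n. (if k = i \<and> l = j then 1 else 0) * x k l) = (if k = i then x k j else 0)" for k
    using assms by (cases "k = i") (auto simp: if_distrib[of "\<lambda>u. u * _"] cong: if_cong)
  then show *: "(\<Sum>k<n. \<Sum>l<n. (if k = i \<and> l = j then 1 else 0) * x k l) = x i j"
    using assms by simp
  then show "(\<Sum>k<n. \<Sum>l<n. x k l * (if k = i \<and> l = j then 1 else 0)) = x i j"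
    by (simp add: mult.commute)
qed

section \<open>Invertible matrices and their inverses\<close>

lemma GL_iff_det: "g \<in> carrier (GL n) \<longleftrightarrow> g \<in> carrier_mat n n \<and> det g \<noteq> 0"
proof
  assume g: "g \<in> carrier (GL n)"
  then obtain h where h: "h \<in> carrier (GL n)" "h * g = 1\<^sub>m n"
    using group.l_inv_ex[OF group_GL g] by (auto simp: mult_GL one_GL)
  have "det h * det g = 1"
    using g h det_mult[of h n g] by (simp add: carrier_GL)
  then show "g \<in> carrier_mat n n \<and> det g \<noteq> 0" using g by (auto simp: carrier_GL)
next
  assume g: "g \<in> carrier_mat n n \<and> det g \<noteq> 0"
  let ?h = "(1 / det g) \<cdot>\<^sub>m adj_mat g"
  have "g * ?h = 1\<^sub>m n" "?h * g = 1\<^sub>m n" "?h \<in> carrier_mat n n"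
    using g adj_mat[of g n] by (auto simp: mult_smult_distrib[of _ n n _ n] mult_smult_assoc_mat[of _ n n _ n])
  then show "g \<in> carrier (GL n)"
    using g by (auto simp: carrier_GL invertible_mat_def inverts_mat_def intro!: exI[of _ ?h])
qed

lemma GL_carrier: "g \<in> carrier (GL n) \<Longrightarrow> g \<in> carrier_mat n n"
  by (simp add: GL_iff_det)

lemma one_in_GL: "1\<^sub>m n \<in> carrier (GL n)"
  by (simp add: GL_iff_det)

lemma mult_in_GL: "g \<in> carrier (GL n) \<Longrightarrow> h \<in> carrier (GL n) \<Longrightarrow> g * h \<in> carrier (GL n)"
  by (auto simp: GL_iff_det det_mult)

text \<open>The adjugate formula makes the entries of the inverse visibly regular; on
  \<open>GL n\<close> it is the group inverse by \<open>inv_GL\<close>.\<close>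

definition minv :: "complex mat \<Rightarrow> complex mat" where
  "minv g = (1 / det g) \<cdot>\<^sub>m adj_mat g"

lemma minv:
  assumes "g \<in> carrier (GL n)"
  shows "minv g \<in> carrier (GL n)" "g * minv g = 1\<^sub>m n" "minv g * g = 1\<^sub>m n"
proof -
  have g: "g \<in> carrier_mat n n" "det g \<noteq> 0" using assms by (auto simp: GL_iff_det)
  show *: "g * minv g = 1\<^sub>m n" "minv g * g = 1\<^sub>m n"
    using g adj_mat[of g n] by (auto simp: minv_def mult_smult_distrib[of _ n n _ n] mult_smult_assoc_mat[of _ n n _ n])
  have c: "minv g \<in> carrier_mat n n" using g adj_mat[of g n] by (simp add: minv_def)
  have "det g * det (minv g) = 1" using * det_mult[OF g(1) c] by simp
  then show "minv g \<in> carrier (GL n)" using c by (auto simp: GL_iff_det)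
qed

lemma minv_eq:
  assumes "g \<in> carrier (GL n)" "h \<in> carrier_mat n n" "g * h = 1\<^sub>m n"
  shows "h = minv g"
proof -
  have "h = (minv g * g) * h" using minv[OF assms(1)] assms(2) by simp
  also have "\<dots> = minv g * (g * h)"
    using minv[OF assms(1)] assms by (intro assoc_mult_mat) (auto simp: GL_iff_det)
  also have "\<dots> = minv g" using minv(1)[OF assms(1), THEN GL_carrier] assms(3) by simp
  finally show ?thesis .
qed

lemma inv_GL:
  assumes "g \<in> carrier (GL n)" shows "inv\<^bsub>GL n\<^esub> g = minv g"
proof -
  interpret group "GL n" by (rule group_GL)
  show ?thesis using minv_eq[OF assms, of "inv\<^bsub>GL n\<^esub> g"] r_inv[OF assms] inv_closed[OF assms] GL_carrier
    by (simp add: mult_GL one_GL)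
qed

lemma minv_minv: "g \<in> carrier (GL n) \<Longrightarrow> minv (minv g) = g"
  by (rule minv_eq[OF minv(1) GL_carrier minv(3), symmetric])

lemma minv_mult:
  assumes "g \<in> carrier (GL n)" "h \<in> carrier (GL n)" shows "minv (g * h) = minv h * minv g"
  using group.inv_mult_group[OF group_GL assms]
  by (simp add: inv_GL[OF assms(1)] inv_GL[OF assms(2)] inv_GL[OF mult_in_GL[OF assms]] mult_GL)

text \<open>Members of \<open>regular_funs n\<close> are total functions built by fixed rules, and
  identities such as multiplicativity of the determinant hold only for matrices of the right size.
  Agreement on \<open>GL n\<close> with such a member is stable under substitution and
  rewriting.\<close>

definition reg :: "nat \<Rightarrow> (complex mat \<Rightarrow> complex) \<Rightarrow> bool" where
  "reg n F \<longleftrightarrow> (\<exists>F'\<in>regular_funs n. \<forall>g\<in>carrier (GL n). F g = F' g)"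

lemma reg_regular: "F \<in> regular_funs n \<Longrightarrow> reg n F"
  unfolding reg_def by blast

lemma reg_const: "reg n (\<lambda>_. c)"
  by (rule reg_regular) (rule regular_funs.const)

lemma reg_entry: "i < n \<Longrightarrow> j < n \<Longrightarrow> reg n (\<lambda>g. g $$ (i, j))"
  by (rule reg_regular) (rule regular_funs.entry)

lemma reg_inv_det: "reg n (\<lambda>g. 1 / det g)"
  by (rule reg_regular) (rule regular_funs.inv_det)

lemma reg_add: "reg n F \<Longrightarrow> reg n H \<Longrightarrow> reg n (\<lambda>g. F g + H g)"
  unfolding reg_def by (elim bexE) (rule bexI[OF _ regular_funs.add]; simp)

lemma reg_mult: "reg n F \<Longrightarrow> reg n H \<Longrightarrow> reg n (\<lambda>g. F g * H g)"
  unfolding reg_def by (elim bexE) (rule bexI[OF _ regular_funs.mult]; simp)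

lemma reg_cong: "(\<And>g. g \<in> carrier (GL n) \<Longrightarrow> F g = H g) \<Longrightarrow> reg n F \<longleftrightarrow> reg n H"
  unfolding reg_def by simp

lemma reg_uminus: "reg n F \<Longrightarrow> reg n (\<lambda>g. - F g)"
  using reg_mult[OF reg_const[of n "-1"], of F] by simp

lemma reg_diff: "reg n F \<Longrightarrow> reg n H \<Longrightarrow> reg n (\<lambda>g. F g - H g)"
  using reg_add[OF _ reg_uminus, of n F H] by simp

lemma reg_sum: "(\<And>i. i \<in> A \<Longrightarrow> reg n (F i)) \<Longrightarrow> reg n (\<lambda>g. \<Sum>i\<in>A. F i g)"
  by (induction A rule: infinite_finite_induct) (simp_all add: reg_const reg_add)

lemma reg_prod: "(\<And>i. i \<in> A \<Longrightarrow> reg n (F i)) \<Longrightarrow> reg n (\<lambda>g. \<Prod>i\<in>A. F i g)"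
  by (induction A rule: infinite_finite_induct) (simp_all add: reg_const reg_mult)

lemma reg_det:
  assumes "\<And>g. g \<in> carrier (GL n) \<Longrightarrow> T g \<in> carrier_mat k k"
    and "\<And>i j. i < k \<Longrightarrow> j < k \<Longrightarrow> reg n (\<lambda>g. T g $$ (i, j))"
  shows "reg n (\<lambda>g. det (T g))"
proof -
  have "reg n (\<lambda>g. \<Sum>p | p permutes {0..<k}. signof p * (\<Prod>i = 0..<k. T g $$ (i, p i)))"
    using assms(2) permutes_in_image by (intro reg_sum reg_mult reg_prod reg_const) fastforce
  then show ?thesis
    by (subst reg_cong[of n _ "\<lambda>g. \<Sum>p | p permutes {0..<k}. signof p * (\<Prod>i = 0..<k. T g $$ (i, p i))"])
      (auto simp: det_def'[OF assms(1)])
qed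

lemma reg_det_self: "reg n det"
  using reg_det[of n "\<lambda>g. g" n] reg_entry GL_carrier by simp

lemma reg_minv:
  assumes ij: "i < n" "j < n" shows "reg n (\<lambda>g. minv g $$ (i, j))"
proof -
  have "reg n (\<lambda>g. det (mat_delete g j i))"
  proof (rule reg_det)
    fix g assume "g \<in> carrier (GL n)"
    then show "mat_delete g j i \<in> carrier_mat (n - 1) (n - 1)"
      by (rule mat_delete_carrier[OF GL_carrier])
  next
    fix k l assume kl: "k < n - 1" "l < n - 1"
    have "reg n (\<lambda>g. g $$ (if k < j then k else Suc k, if l < i then l else Suc l))"
      using kl by (intro reg_entry) auto
    then show "reg n (\<lambda>g. mat_delete g j i $$ (k, l))"
    proof (rule reg_cong[THEN iffD1, rotated])
      fix g assume "g \<in> carrier (GL n)"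
      then have "dim_row g = n" "dim_col g = n" by (auto simp: GL_iff_det)
      then show "g $$ (if k < j then k else Suc k, if l < i then l else Suc l) = mat_delete g j i $$ (k, l)"
        using kl unfolding mat_delete_def by (subst index_mat) auto
    qed
  qed
  then have "reg n (\<lambda>g. 1 / det g * ((-1) ^ (j + i) * det (mat_delete g j i)))"
    by (intro reg_mult reg_inv_det reg_const)
  then show ?thesis
    by (rule reg_cong[THEN iffD1, rotated])
      (use ij in \<open>auto simp: minv_def adj_mat_def GL_iff_det Determinant.cofactor_def\<close>)
qed

text \<open>The reciprocal determinant is a generator of the ring, so substitution asks for it
  beside the entries of \<open>T\<close>.\<close>

lemma reg_subst:
  assumes F: "reg n F"
    and T: "\<And>g. g \<in> carrier (GL n) \<Longrightarrow> T g \<in> carrier (GL n)"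
    and e: "\<And>i j. i < n \<Longrightarrow> j < n \<Longrightarrow> reg n (\<lambda>g. T g $$ (i, j))"
    and d: "reg n (\<lambda>g. 1 / det (T g))"
  shows "reg n (\<lambda>g. F (T g))"
proof -
  have *: "reg n (\<lambda>g. F (T g))" if "F \<in> regular_funs n" for F
    using that by induction (simp_all add: e d reg_const reg_add reg_mult)
  obtain F' where F': "F' \<in> regular_funs n" "\<And>g. g \<in> carrier (GL n) \<Longrightarrow> F g = F' g"
    using F unfolding reg_def by blast
  show ?thesis
    by (rule reg_cong[THEN iffD1, rotated, OF *[OF F'(1)]]) (simp add: F'(2) T)
qed

lemma reg_mult_left:
  assumes h: "h \<in> carrier (GL n)" and F: "reg n F" shows "reg n (\<lambda>g. F (h * g))"
proof (rule reg_subst[OF F])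
  show "h * g \<in> carrier (GL n)" if "g \<in> carrier (GL n)" for g using h that by (rule mult_in_GL)
  show "reg n (\<lambda>g. (h * g) $$ (i, j))" if ij: "i < n" "j < n" for i j
  proof -
    have "reg n (\<lambda>g. \<Sum>k<n. h $$ (i, k) * g $$ (k, j))"
      using ij by (intro reg_sum reg_mult reg_const reg_entry) auto
    then show ?thesis
      by (rule reg_cong[THEN iffD1, rotated]) (simp add: mat_mult_entry[of _ n] GL_carrier h ij del: index_mult_mat)
  qed
  have "reg n (\<lambda>g. 1 / det h * (1 / det g))" by (intro reg_mult reg_const reg_inv_det)
  then show "reg n (\<lambda>g. 1 / det (h * g))"
    by (rule reg_cong[THEN iffD1, rotated]) (use h GL_carrier in \<open>simp add: Determinant.det_mult[of _ n]\<close>)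
qed

lemma reg_mult_right:
  assumes h: "h \<in> carrier (GL n)" and F: "reg n F" shows "reg n (\<lambda>g. F (g * h))"
proof (rule reg_subst[OF F])
  show "g * h \<in> carrier (GL n)" if "g \<in> carrier (GL n)" for g using that h by (rule mult_in_GL)
  show "reg n (\<lambda>g. (g * h) $$ (i, j))" if ij: "i < n" "j < n" for i j
  proof -
    have "reg n (\<lambda>g. \<Sum>k<n. g $$ (i, k) * h $$ (k, j))"
      using ij by (intro reg_sum reg_mult reg_const reg_entry) auto
    then show ?thesis
      by (rule reg_cong[THEN iffD1, rotated]) (simp add: mat_mult_entry[of _ n] GL_carrier h ij del: index_mult_mat)
  qed
  have "reg n (\<lambda>g. 1 / det g * (1 / det h))" by (intro reg_mult reg_const reg_inv_det)
  then show "reg n (\<lambda>g. 1 / det (g * h))"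
    by (rule reg_cong[THEN iffD1, rotated]) (use h GL_carrier in \<open>simp add: Determinant.det_mult[of _ n]\<close>)
qed

lemma reg_comp_minv:
  assumes F: "reg n F" shows "reg n (\<lambda>g. F (minv g))"
proof (rule reg_subst[OF F])
  have "1 / det (minv g) = det g" if "g \<in> carrier (GL n)" for g
  proof -
    have "det g * det (minv g) = 1"
      using minv[OF that] det_mult[of g n "minv g"] that GL_carrier by simp
    then show ?thesis by (metis div_by_0 mult_zero_right nonzero_eq_divide_eq zero_neq_one)
  qed
  then show "reg n (\<lambda>g. 1 / det (minv g))"
    by (subst reg_cong[of n _ det]) (auto simp: reg_det_self)
qed (simp_all add: minv reg_minv)

section \<open>Zariski closed sets and continuous maps\<close>

lemma closedin_zariski_reg:
  assumes "\<And>i. i \<in> A \<Longrightarrow> reg n (F i)"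
  shows "closedin (zariski n) {g \<in> carrier (GL n). \<forall>i\<in>A. F i g = 0}"
proof -
  obtain F' where F': "\<And>i. i \<in> A \<Longrightarrow> F' i \<in> regular_funs n"
      "\<And>i g. i \<in> A \<Longrightarrow> g \<in> carrier (GL n) \<Longrightarrow> F i g = F' i g"
    using assms unfolding reg_def by metis
  show ?thesis
    unfolding closedin_zariski by (rule exI[of _ "F' ` A"]) (use F' in auto)
qed

lemma continuous_map_zariski:
  assumes T: "\<And>g. g \<in> carrier (GL n) \<Longrightarrow> T g \<in> carrier (GL n)"
    and reg: "\<And>F. reg n F \<Longrightarrow> reg n (\<lambda>g. F (T g))"
  shows "continuous_map (zariski n) (zariski n) T"
  unfolding continuous_map_closedin
proof (intro conjI allI impI)
  fix C assume "closedin (zariski n) C"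
  then obtain S where S: "S \<subseteq> regular_funs n" "C = {g \<in> carrier (GL n). \<forall>f\<in>S. f g = 0}"
    unfolding closedin_zariski by blast
  have "{x \<in> topspace (zariski n). T x \<in> C} = {g \<in> carrier (GL n). \<forall>f\<in>S. f (T g) = 0}"
    using S T by (auto simp: topspace_zariski)
  then show "closedin (zariski n) {x \<in> topspace (zariski n). T x \<in> C}"
    using S closedin_zariski_reg[of S n "\<lambda>f g. f (T g)"] reg reg_regular by (metis (no_types, lifting) subsetD)
qed (use T in \<open>auto simp: topspace_zariski\<close>)

section \<open>Gradients of regular functions\<close>

definition mderiv :: "nat \<Rightarrow> (complex \<Rightarrow> complex mat) \<Rightarrow> complex mat \<Rightarrow> complex \<Rightarrow> bool" where
  "mderiv n c c' t \<longleftrightarrow> (\<forall>i<n. \<forall>j<n. ((\<lambda>s. c s $$ (i, j)) has_field_derivative c' $$ (i, j)) (at t))"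

text \<open>The chain rule along all matrix curves is taken as the definition of a gradient, so that
  no calculus of several variables enters later. The partial derivatives have to be regular again;
  this lets vector fields act on the ring.\<close>

definition has_grad :: "nat \<Rightarrow> (complex mat \<Rightarrow> complex) \<Rightarrow> (nat \<Rightarrow> nat \<Rightarrow> complex mat \<Rightarrow> complex) \<Rightarrow> bool" where
  "has_grad n F Gr \<longleftrightarrow> (\<forall>i<n. \<forall>j<n. Gr i j \<in> regular_funs n) \<and>
    (\<forall>c c' t. (\<forall>s. c s \<in> carrier_mat n n) \<longrightarrow> c t \<in> carrier (GL n) \<longrightarrow> mderiv n c c' t \<longrightarrow>
      ((\<lambda>s. F (c s)) has_field_derivative (\<Sum>i<n. \<Sum>j<n. Gr i j (c t) * c' $$ (i, j))) (at t))"

lemma has_gradI: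
  assumes "\<And>i j. i < n \<Longrightarrow> j < n \<Longrightarrow> Gr i j \<in> regular_funs n"
    and "\<And>c c' t. (\<And>s. c s \<in> carrier_mat n n) \<Longrightarrow> c t \<in> carrier (GL n) \<Longrightarrow> mderiv n c c' t \<Longrightarrow>
      ((\<lambda>s. F (c s)) has_field_derivative (\<Sum>i<n. \<Sum>j<n. Gr i j (c t) * c' $$ (i, j))) (at t)"
  shows "has_grad n F Gr"
  using assms unfolding has_grad_def by blast

lemma has_gradD:
  assumes "has_grad n F Gr"
  shows "\<And>i j. i < n \<Longrightarrow> j < n \<Longrightarrow> Gr i j \<in> regular_funs n"
    and "\<And>c c' t. (\<And>s. c s \<in> carrier_mat n n) \<Longrightarrow> c t \<in> carrier (GL n) \<Longrightarrow> mderiv n c c' t \<Longrightarrow>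
      ((\<lambda>s. F (c s)) has_field_derivative (\<Sum>i<n. \<Sum>j<n. Gr i j (c t) * c' $$ (i, j))) (at t)"
  using assms unfolding has_grad_def by blast+

lemma has_grad_const: "has_grad n (\<lambda>_. a) (\<lambda>_ _ _. 0)"
  by (rule has_gradI) (simp_all add: regular_funs.const)

lemma has_grad_entry:
  assumes "i < n" "j < n"
  shows "has_grad n (\<lambda>g. g $$ (i, j)) (\<lambda>k l _. if k = i \<and> l = j then 1 else 0)"
proof (rule has_gradI)
  fix c c' t assume "mderiv n c c' t"
  then show "((\<lambda>s. c s $$ (i, j)) has_field_derivative
      (\<Sum>k<n. \<Sum>l<n. (if k = i \<and> l = j then 1 else 0) * c' $$ (k, l))) (at t)"
    using assms unfolding mderiv_def by (simp add: sum_indicator_pair)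
qed (rule regular_funs.const)

lemma has_grad_add:
  assumes F: "has_grad n F A" and H: "has_grad n H B"
  shows "has_grad n (\<lambda>g. F g + H g) (\<lambda>i j g. A i j g + B i j g)"
proof (rule has_gradI)
  fix c c' t assume c: "\<And>s. c s \<in> carrier_mat n n" "c t \<in> carrier (GL n)" "mderiv n c c' t"
  show "((\<lambda>s. F (c s) + H (c s)) has_field_derivative
      (\<Sum>i<n. \<Sum>j<n. (A i j (c t) + B i j (c t)) * c' $$ (i, j))) (at t)"
    using DERIV_add[OF has_gradD(2)[OF F c] has_gradD(2)[OF H c]]
    by (simp add: distrib_right sum.distrib)
qed (intro regular_funs.add has_gradD(1)[OF F] has_gradD(1)[OF H]; assumption)

lemma has_grad_mult:
  assumes F: "has_grad n F A" and H: "has_grad n H B"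
    and reg: "F \<in> regular_funs n" "H \<in> regular_funs n"
  shows "has_grad n (\<lambda>g. F g * H g) (\<lambda>i j g. A i j g * H g + B i j g * F g)"
proof (rule has_gradI)
  fix c c' t assume c: "\<And>s. c s \<in> carrier_mat n n" "c t \<in> carrier (GL n)" "mderiv n c c' t"
  show "((\<lambda>s. F (c s) * H (c s)) has_field_derivative
      (\<Sum>i<n. \<Sum>j<n. (A i j (c t) * H (c t) + B i j (c t) * F (c t)) * c' $$ (i, j))) (at t)"
    using DERIV_mult[OF has_gradD(2)[OF F c] has_gradD(2)[OF H c]]
    by (simp add: algebra_simps sum.distrib sum_distrib_left)
next
  fix i j assume "i < n" "j < n"
  then show "(\<lambda>g. A i j g * H g + B i j g * F g) \<in> regular_funs n"
    by (intro regular_funs.add regular_funs.mult reg has_gradD(1)[OF F] has_gradD(1)[OF H])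
qed

lemma regular_sum: "(\<And>i. i \<in> A \<Longrightarrow> F i \<in> regular_funs n) \<Longrightarrow> (\<lambda>g. \<Sum>i\<in>A. F i g) \<in> regular_funs n"
  by (induction A rule: infinite_finite_induct) (simp_all add: regular_funs.const regular_funs.add)

lemma regular_prod: "(\<And>i. i \<in> A \<Longrightarrow> F i \<in> regular_funs n) \<Longrightarrow> (\<lambda>g. \<Prod>i\<in>A. F i g) \<in> regular_funs n"
  by (induction A rule: infinite_finite_induct) (simp_all add: regular_funs.const regular_funs.mult)

lemma has_grad_sum:
  "(\<And>i. i \<in> A \<Longrightarrow> \<exists>Gr. has_grad n (F i) Gr) \<Longrightarrow> \<exists>Gr. has_grad n (\<lambda>g. \<Sum>i\<in>A. F i g) Gr"
proof (induction A rule: infinite_finite_induct)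
  case (insert a A)
  then obtain B C where "has_grad n (F a) B" "has_grad n (\<lambda>g. \<Sum>i\<in>A. F i g) C" by blast
  from has_grad_add[OF this] show ?case using insert by auto
qed (use has_grad_const[of n 0] has_grad_const[of n 1] in auto)

lemma has_grad_prod:
  "(\<And>i. i \<in> A \<Longrightarrow> F i \<in> regular_funs n \<and> (\<exists>Gr. has_grad n (F i) Gr)) \<Longrightarrow> \<exists>Gr. has_grad n (\<lambda>g. \<Prod>i\<in>A. F i g) Gr"
proof (induction A rule: infinite_finite_induct)
  case (insert a A)
  then obtain B C where "has_grad n (F a) B" "has_grad n (\<lambda>g. \<Prod>i\<in>A. F i g) C" by blast
  from has_grad_mult[OF this] show ?case using insert by (auto intro: regular_prod)
qed (use has_grad_const[of n 0] has_grad_const[of n 1] in auto)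

lemma has_grad_det: "\<exists>Gr. has_grad n det Gr"
proof -
  have "\<exists>Gr. has_grad n (\<lambda>g. \<Sum>p | p permutes {0..<n}. signof p * (\<Prod>i = 0..<n. g $$ (i, p i))) Gr"
  proof (rule has_grad_sum)
    fix p assume "p \<in> {p. p permutes {0..<n}}"
    then have p: "p i < n" if "i < n" for i using that permutes_in_image[of p "{0..<n}" i] by simp
    have reg: "(\<lambda>g. \<Prod>i = 0..<n. g $$ (i, p i)) \<in> regular_funs n"
      using p by (intro regular_prod regular_funs.entry) auto
    obtain Gr where "has_grad n (\<lambda>g. \<Prod>i = 0..<n. g $$ (i, p i)) Gr"
      using has_grad_prod[of "{0..<n}" "\<lambda>i g. g $$ (i, p i)" n] has_grad_entry p regular_funs.entry by fastforce
    from has_grad_mult[OF has_grad_const this regular_funs.const reg]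
    show "\<exists>Gr. has_grad n (\<lambda>g. signof p * (\<Prod>i = 0..<n. g $$ (i, p i))) Gr" by blast
  qed
  then obtain Gr where Gr: "has_grad n (\<lambda>g. \<Sum>p | p permutes {0..<n}. signof p * (\<Prod>i = 0..<n. g $$ (i, p i))) Gr" by blast
  have "has_grad n det Gr"
  proof (rule has_gradI)
    fix c c' t assume c: "\<And>s. c s \<in> carrier_mat n n" "c t \<in> carrier (GL n)" "mderiv n c c' t"
    show "((\<lambda>s. det (c s)) has_field_derivative (\<Sum>i<n. \<Sum>j<n. Gr i j (c t) * c' $$ (i, j))) (at t)"
      using has_gradD(2)[OF Gr c] by (simp only: det_def'[OF c(1)])
  qed (rule has_gradD(1)[OF Gr])
  then show ?thesis by blast
qed

theorem regular_has_grad: "F \<in> regular_funs n \<Longrightarrow> \<exists>Gr. has_grad n F Gr"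
proof (induction rule: regular_funs.induct)
  case inv_det
  obtain Gr where Gr: "has_grad n det Gr" using has_grad_det by blast
  have "has_grad n (\<lambda>g. 1 / det g) (\<lambda>i j g. - Gr i j g * (1 / det g) * (1 / det g))"
  proof (rule has_gradI)
    fix i j assume "i < n" "j < n"
    then have "(\<lambda>g. (-1) * Gr i j g * (1 / det g) * (1 / det g)) \<in> regular_funs n"
      using has_gradD(1)[OF Gr] by (intro regular_funs.mult regular_funs.const regular_funs.inv_det) auto
    then show "(\<lambda>g. - Gr i j g * (1 / det g) * (1 / det g)) \<in> regular_funs n" by simp
  next
    fix c c' t assume c: "\<And>s. c s \<in> carrier_mat n n" "c t \<in> carrier (GL n)" "mderiv n c c' t"
    have "det (c t) \<noteq> 0" using c by (simp add: GL_iff_det)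
    from DERIV_divide[OF DERIV_const[of 1 "at t"] has_gradD(2)[OF Gr c] this]
    have "((\<lambda>s. 1 / det (c s)) has_field_derivative
      - (\<Sum>i<n. \<Sum>j<n. Gr i j (c t) * c' $$ (i, j)) / (det (c t) * det (c t))) (at t)" by simp
    also have "- (\<Sum>i<n. \<Sum>j<n. Gr i j (c t) * c' $$ (i, j)) / (det (c t) * det (c t)) =
      (\<Sum>i<n. \<Sum>j<n. - Gr i j (c t) * (1 / det (c t)) * (1 / det (c t)) * c' $$ (i, j))"
      by (simp add: sum_divide_distrib flip: sum_negf)
    finally show "((\<lambda>s. 1 / det (c s)) has_field_derivative
      (\<Sum>i<n. \<Sum>j<n. - Gr i j (c t) * (1 / det (c t)) * (1 / det (c t)) * c' $$ (i, j))) (at t)" .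
  qed
  then show ?case by blast
next
  case (const c) show ?case by (rule exI, rule has_grad_const)
next
  case (entry i j) then show ?case by (intro exI, rule has_grad_entry)
next
  case (add f h) then show ?case by (elim exE) (rule exI, rule has_grad_add)
next
  case (mult f h) then show ?case by (elim exE) (rule exI, rule has_grad_mult)
qed

section \<open>First-order expansion at the identity\<close>

abbreviation ycoord :: "nat \<times> nat \<Rightarrow> complex mat \<Rightarrow> complex" where
  "ycoord p g \<equiv> g $$ p - (if fst p = snd p then 1 else 0)"

abbreviation idx :: "nat \<Rightarrow> (nat \<times> nat) set" where
  "idx n \<equiv> {..<n} \<times> {..<n}"

text \<open>Hadamard's lemma in algebraic form: \<open>F\<close> minus its value at the identity
  lies in the ideal generated by the entries \<open>ycoord p\<close> of \<open>g - 1\<close>, with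
  regular coefficients. That every regular function has such an expansion means that these entries
  generate the maximal ideal of the identity.\<close>

definition first_order :: "nat \<Rightarrow> (complex mat \<Rightarrow> complex) \<Rightarrow> (nat \<times> nat \<Rightarrow> complex mat \<Rightarrow> complex) \<Rightarrow> bool" where
  "first_order n F f \<longleftrightarrow> reg n F \<and> (\<forall>p\<in>idx n. reg n (f p)) \<and>
    (\<forall>g\<in>carrier (GL n). F g = F (1\<^sub>m n) + (\<Sum>p\<in>idx n. ycoord p g * f p g))"

lemma first_orderI:
  assumes "reg n F" "\<And>p. p \<in> idx n \<Longrightarrow> reg n (f p)"
    "\<And>g. g \<in> carrier (GL n) \<Longrightarrow> F g = F (1\<^sub>m n) + (\<Sum>p\<in>idx n. ycoord p g * f p g)"
  shows "first_order n F f"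
  using assms unfolding first_order_def by blast

lemma first_orderD:
  assumes "first_order n F f"
  shows "reg n F" "\<And>p. p \<in> idx n \<Longrightarrow> reg n (f p)"
    "\<And>g. g \<in> carrier (GL n) \<Longrightarrow> F g = F (1\<^sub>m n) + (\<Sum>p\<in>idx n. ycoord p g * f p g)"
  using assms unfolding first_order_def by blast+

lemma first_order_const: "first_order n (\<lambda>_. c) (\<lambda>_ _. 0)"
  by (rule first_orderI) (simp_all add: reg_const)

lemma first_order_entry:
  assumes "i < n" "j < n"
  shows "first_order n (\<lambda>g. g $$ (i, j)) (\<lambda>p _. if p = (i, j) then 1 else 0)"
proof (rule first_orderI)
  fix g :: "complex mat" assume "g \<in> carrier (GL n)"
  have "(\<Sum>p\<in>idx n. ycoord p g * (if p = (i, j) then 1 else 0)) = (\<Sum>p\<in>idx n. if p = (i, j) then ycoord p g else 0)"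
    by (rule sum.cong) auto
  also have "\<dots> = ycoord (i, j) g" using assms by (subst sum.delta) auto
  finally show "g $$ (i, j) = 1\<^sub>m n $$ (i, j) + (\<Sum>p\<in>idx n. ycoord p g * (if p = (i, j) then 1 else 0))"
    using assms by simp
qed (use assms in \<open>auto intro: reg_const reg_entry\<close>)

lemma first_order_add:
  assumes F: "first_order n F f" and H: "first_order n H h"
  shows "first_order n (\<lambda>g. F g + H g) (\<lambda>p g. f p g + h p g)"
proof (rule first_orderI)
  fix g :: "complex mat" assume g: "g \<in> carrier (GL n)"
  have "(\<Sum>p\<in>idx n. ycoord p g * (f p g + h p g)) = (\<Sum>p\<in>idx n. ycoord p g * f p g) + (\<Sum>p\<in>idx n. ycoord p g * h p g)"
    by (simp only: distrib_left sum.distrib)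
  then show "F g + H g = F (1\<^sub>m n) + H (1\<^sub>m n) + (\<Sum>p\<in>idx n. ycoord p g * (f p g + h p g))"
    using first_orderD(3)[OF F g] first_orderD(3)[OF H g] by simp
qed (intro reg_add first_orderD[OF F] first_orderD[OF H]; assumption)+

lemma first_order_mult:
  assumes F: "first_order n F f" and H: "first_order n H h"
  shows "first_order n (\<lambda>g. F g * H g) (\<lambda>p g. f p g * H g + F (1\<^sub>m n) * h p g)"
proof (rule first_orderI)
  fix g :: "complex mat" assume g: "g \<in> carrier (GL n)"
  have "F g * H g = F (1\<^sub>m n) * H (1\<^sub>m n) + ((F g - F (1\<^sub>m n)) * H g + F (1\<^sub>m n) * (H g - H (1\<^sub>m n)))"
    by (simp add: algebra_simps)
  also have "F g - F (1\<^sub>m n) = (\<Sum>p\<in>idx n. ycoord p g * f p g)"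
    using first_orderD(3)[OF F g] by simp
  also have "H g - H (1\<^sub>m n) = (\<Sum>p\<in>idx n. ycoord p g * h p g)"
    using first_orderD(3)[OF H g] by simp
  also have "(\<Sum>p\<in>idx n. ycoord p g * f p g) * H g + F (1\<^sub>m n) * (\<Sum>p\<in>idx n. ycoord p g * h p g)
     = (\<Sum>p\<in>idx n. ycoord p g * (f p g * H g + F (1\<^sub>m n) * h p g))"
    unfolding sum_distrib_left sum_distrib_right sum.distrib[symmetric]
    by (rule sum.cong) (auto simp: algebra_simps)
  finally show "F g * H g = F (1\<^sub>m n) * H (1\<^sub>m n) + (\<Sum>p\<in>idx n. ycoord p g * (f p g * H g + F (1\<^sub>m n) * h p g))" .
qed (intro reg_add reg_mult reg_const first_orderD[OF F] first_orderD[OF H]; assumption)+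

lemma first_order_sum:
  "(\<And>i. i \<in> A \<Longrightarrow> \<exists>f. first_order n (F i) f) \<Longrightarrow> \<exists>f. first_order n (\<lambda>g. \<Sum>i\<in>A. F i g) f"
proof (induction A rule: infinite_finite_induct)
  case (insert a A)
  then obtain B C where "first_order n (F a) B" "first_order n (\<lambda>g. \<Sum>i\<in>A. F i g) C" by blast
  from first_order_add[OF this] show ?case using insert(1,2) by auto
qed (use first_order_const[of n 0] first_order_const[of n 1] in auto)

lemma first_order_prod:
  "(\<And>i. i \<in> A \<Longrightarrow> \<exists>f. first_order n (F i) f) \<Longrightarrow> \<exists>f. first_order n (\<lambda>g. \<Prod>i\<in>A. F i g) f"
proof (induction A rule: infinite_finite_induct)
  case (insert a A)
  then obtain B C where "first_order n (F a) B" "first_order n (\<lambda>g. \<Prod>i\<in>A. F i g) C" by blast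
  from first_order_mult[OF this] show ?case using insert(1,2) by auto
qed (use first_order_const[of n 0] first_order_const[of n 1] in auto)

lemma first_order_cong:
  assumes "first_order n F f" "\<And>g. g \<in> carrier (GL n) \<Longrightarrow> F g = H g"
  shows "first_order n H f"
proof (rule first_orderI)
  show "reg n H" using reg_cong[of n F H] assms(2) first_orderD(1)[OF assms(1)] by blast
  show "H g = H (1\<^sub>m n) + (\<Sum>p\<in>idx n. ycoord p g * f p g)" if "g \<in> carrier (GL n)" for g
    using first_orderD(3)[OF assms(1) that] by (simp only: assms(2)[OF that] assms(2)[OF one_in_GL])
qed (rule first_orderD(2)[OF assms(1)])

lemma first_order_det: "\<exists>f. first_order n det f"
proof -
  have "\<exists>f. first_order n (\<lambda>g. \<Sum>p | p permutes {0..<n}. signof p * (\<Prod>i = 0..<n. g $$ (i, p i))) f"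
  proof (rule first_order_sum)
    fix p assume "p \<in> {p. p permutes {0..<n}}"
    then have p: "p i < n" if "i < n" for i using that permutes_in_image[of p "{0..<n}" i] by simp
    obtain f where "first_order n (\<lambda>g. \<Prod>i = 0..<n. g $$ (i, p i)) f"
      using first_order_prod[of "{0..<n}" n "\<lambda>i g. g $$ (i, p i)"] first_order_entry p by fastforce
    from first_order_mult[OF first_order_const this]
    show "\<exists>f. first_order n (\<lambda>g. signof p * (\<Prod>i = 0..<n. g $$ (i, p i))) f" by blast
  qed
  then obtain f where "first_order n (\<lambda>g. \<Sum>p | p permutes {0..<n}. signof p * (\<Prod>i = 0..<n. g $$ (i, p i))) f" ..
  then have "first_order n det f"
    by (rule first_order_cong) (simp add: det_def'[OF GL_carrier])
  then show ?thesis by blast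
qed

lemma regular_first_order: "F \<in> regular_funs n \<Longrightarrow> \<exists>f. first_order n F f"
proof (induction rule: regular_funs.induct)
  case inv_det
  obtain f where f: "first_order n det f" using first_order_det by blast
  have "first_order n (\<lambda>g. 1 / det g) (\<lambda>p g. - f p g * (1 / det g))"
  proof (rule first_orderI)
    fix g :: "complex mat" assume g: "g \<in> carrier (GL n)"
    then have "1 / det g = 1 + (det g - det (1\<^sub>m n)) * (- 1 / det g)" by (simp add: GL_iff_det field_simps)
    also have "det g - det (1\<^sub>m n) = (\<Sum>p\<in>idx n. ycoord p g * f p g)"
      using first_orderD(3)[OF f g] by simp
    also have "(\<Sum>p\<in>idx n. ycoord p g * f p g) * (- 1 / det g) = (\<Sum>p\<in>idx n. ycoord p g * (- f p g * (1 / det g)))"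
      unfolding sum_distrib_right by (rule sum.cong) auto
    finally show "1 / det g = 1 / det (1\<^sub>m n) + (\<Sum>p\<in>idx n. ycoord p g * (- f p g * (1 / det g)))"
      by (simp only: Determinant.det_one div_by_1)
  qed (intro reg_mult reg_uminus reg_inv_det first_orderD[OF f]; assumption)+
  then show ?case by blast
next
  case (const c) show ?case by (rule exI, rule first_order_const)
next
  case (entry i j) then show ?case by (intro exI, rule first_order_entry)
next
  case (add f h) then show ?case by (elim exE) (rule exI, rule first_order_add)
next
  case (mult f h) then show ?case by (elim exE) (rule exI, rule first_order_mult)
qed

section \<open>Curves and one-parameter subgroups\<close>

lemma sq_mult_closed: "A \<in> carrier_mat n n \<Longrightarrow> B \<in> carrier_mat n n \<Longrightarrow> A * B \<in> carrier_mat n n"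
  by (rule mult_carrier_mat)

lemma sq_assoc:
  fixes A B C :: "complex mat"
  shows "A \<in> carrier_mat n n \<Longrightarrow> B \<in> carrier_mat n n \<Longrightarrow> C \<in> carrier_mat n n \<Longrightarrow> A * B * C = A * (B * C)"
  by (rule assoc_mult_mat)

lemma sq_eqI:
  fixes A B :: "complex mat"
  assumes "A \<in> carrier_mat n n" "B \<in> carrier_mat n n" "\<And>i j. i < n \<Longrightarrow> j < n \<Longrightarrow> A $$ (i, j) = B $$ (i, j)"
  shows "A = B"
  using assms by (intro eq_matI) auto

lemma one_smult: "(1::'a::semiring_1) \<cdot>\<^sub>m A = A"
  by (rule eq_matI) auto

lemma zero_smult_mat: "A \<in> carrier_mat r c \<Longrightarrow> (0::'a::semiring_1) \<cdot>\<^sub>m A = 0\<^sub>m r c"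
  by (rule eq_matI) auto

lemma neg_one_smult_mat: "(- 1::'a::ring_1) \<cdot>\<^sub>m A = - A"
  by (rule eq_matI) auto

section \<open>Matrix curves and linear differential equations\<close>

lemma mderivD: "mderiv n c c' t \<Longrightarrow> i < n \<Longrightarrow> j < n \<Longrightarrow> ((\<lambda>s. c s $$ (i, j)) has_field_derivative c' $$ (i, j)) (at t)"
  unfolding mderiv_def by blast

lemma mderivI: "(\<And>i j. i < n \<Longrightarrow> j < n \<Longrightarrow> ((\<lambda>s. c s $$ (i, j)) has_field_derivative c' $$ (i, j)) (at t)) \<Longrightarrow> mderiv n c c' t"
  unfolding mderiv_def by blast

lemma mderiv_const: "mderiv n (\<lambda>_. A) (0\<^sub>m n n) t"
  by (rule mderivI) simp

lemma mderiv_mult: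
  assumes "\<And>s. c s \<in> carrier_mat n n" "\<And>s. d s \<in> carrier_mat n n"
    and "c' \<in> carrier_mat n n" "d' \<in> carrier_mat n n"
    and "mderiv n c c' t" "mderiv n d d' t"
  shows "mderiv n (\<lambda>s. c s * d s) (c' * d t + c t * d') t"
proof (rule mderivI)
  fix i j assume ij: "i < n" "j < n"
  have "((\<lambda>s. \<Sum>k<n. c s $$ (i, k) * d s $$ (k, j)) has_field_derivative
     (\<Sum>k<n. c t $$ (i, k) * d' $$ (k, j) + c' $$ (i, k) * d t $$ (k, j))) (at t)"
    using ij assms by (intro DERIV_sum DERIV_mult' mderivD[of n]) auto
  moreover have "(\<lambda>s. (c s * d s) $$ (i, j)) = (\<lambda>s. \<Sum>k<n. c s $$ (i, k) * d s $$ (k, j))"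
    using assms ij by (intro ext mat_mult_entry)
  moreover have "(c' * d t + c t * d') $$ (i, j) = (\<Sum>k<n. c t $$ (i, k) * d' $$ (k, j) + c' $$ (i, k) * d t $$ (k, j))"
  proof -
    have "(c' * d t + c t * d') $$ (i, j) = (c' * d t) $$ (i, j) + (c t * d') $$ (i, j)"
      using assms(1-4) ij by (intro index_add_mat) (auto simp: carrier_matD[OF assms(1)] carrier_matD[OF assms(4)])
    then show ?thesis
      using mat_mult_entry[OF assms(3) assms(2) ij, of t] mat_mult_entry[OF assms(1) assms(4) ij, of t]
      by (simp add: sum.distrib)
  qed
  ultimately show "((\<lambda>s. (c s * d s) $$ (i, j)) has_field_derivative (c' * d t + c t * d') $$ (i, j)) (at t)"
    by simp
qed

lemma mderiv_mult_right:
  assumes "\<And>s. c s \<in> carrier_mat n n" "B \<in> carrier_mat n n" "c' \<in> carrier_mat n n" "mderiv n c c' t"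
  shows "mderiv n (\<lambda>s. c s * B) (c' * B) t"
  using mderiv_mult[OF assms(1) _ assms(3) _ assms(4) mderiv_const, of B] assms
  by (simp add: right_mult_zero_mat[OF assms(1)] right_add_zero_mat[OF sq_mult_closed])

lemma mderiv_mult_left:
  assumes "\<And>s. c s \<in> carrier_mat n n" "B \<in> carrier_mat n n" "c' \<in> carrier_mat n n" "mderiv n c c' t"
  shows "mderiv n (\<lambda>s. B * c s) (B * c') t"
  using mderiv_mult[of "\<lambda>_. B" n c "0\<^sub>m n n" c' t] mderiv_const assms
  by (simp add: left_mult_zero_mat[OF assms(1)] left_add_zero_mat[OF sq_mult_closed])

lemma mderiv_diff:
  assumes "\<And>s. c s \<in> carrier_mat n n" "\<And>s. d s \<in> carrier_mat n n"
    and "c' \<in> carrier_mat n n" "d' \<in> carrier_mat n n"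
    and "mderiv n c c' t" "mderiv n d d' t"
  shows "mderiv n (\<lambda>s. c s - d s) (c' - d') t"
proof (rule mderivI)
  fix i j assume ij: "i < n" "j < n"
  have "((\<lambda>s. c s $$ (i, j) - d s $$ (i, j)) has_field_derivative c' $$ (i, j) - d' $$ (i, j)) (at t)"
    using ij assms by (intro DERIV_diff mderivD[of n])
  then show "((\<lambda>s. (c s - d s) $$ (i, j)) has_field_derivative (c' - d') $$ (i, j)) (at t)"
    using ij assms(4) carrier_matD[OF assms(2)] by simp
qed

lemma mderiv_comp:
  assumes "mderiv n c c' (f t)" "(f has_field_derivative a) (at t)" "c' \<in> carrier_mat n n"
  shows "mderiv n (\<lambda>s. c (f s)) (a \<cdot>\<^sub>m c') t"
proof (rule mderivI)
  fix i j assume ij: "i < n" "j < n"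
  have "((\<lambda>s. c (f s) $$ (i, j)) has_field_derivative c' $$ (i, j) * a) (at t)"
    using DERIV_chain2[OF mderivD[OF assms(1) ij] assms(2)] .
  then show "((\<lambda>s. c (f s) $$ (i, j)) has_field_derivative (a \<cdot>\<^sub>m c') $$ (i, j)) (at t)"
    using ij assms(3) by (simp add: mult.commute)
qed

lemma mderiv_unique:
  assumes "mderiv n c A t" "mderiv n c B t" "A \<in> carrier_mat n n" "B \<in> carrier_mat n n" shows "A = B"
  using assms(3,4) by (rule sq_eqI) (use DERIV_unique[OF mderivD[OF assms(1)] mderivD[OF assms(2)]] in auto)

lemma mderiv_line:
  assumes "X \<in> carrier_mat n n" "A \<in> carrier_mat n n"
  shows "mderiv n (\<lambda>s. A + s \<cdot>\<^sub>m X) X t"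
proof (rule mderivI)
  fix i j assume ij: "i < n" "j < n"
  have "((\<lambda>s. A $$ (i, j) + s * X $$ (i, j)) has_field_derivative X $$ (i, j)) (at t)"
    by (auto intro!: derivative_eq_intros)
  then show "((\<lambda>s. (A + s \<cdot>\<^sub>m X) $$ (i, j)) has_field_derivative X $$ (i, j)) (at t)"
    using ij assms by simp
qed

text \<open>All derivatives of the entire function \<open>f 0\<close> vanish at 0, so it is zero by
  the identity theorem. The derivatives are supplied as a sequence, which in the applications arises
  by iterating an operator.\<close>

lemma flat_entire_zero:
  fixes f :: "nat \<Rightarrow> complex \<Rightarrow> complex"
  assumes d: "\<And>k t. (f k has_field_derivative f (Suc k) t) (at t)" and z: "\<And>k. f k 0 = 0"
  shows "f 0 t = 0"
proof -
  have "(deriv ^^ k) (f 0) = f k" for k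
  proof (induction k)
    case (Suc k)
    have "deriv (f k) = f (Suc k)" using DERIV_imp_deriv[OF d] by auto
    then show ?case by (simp add: Suc)
  qed simp
  moreover have "f 0 holomorphic_on UNIV"
    using d[of 0] by (auto simp: holomorphic_on_def field_differentiable_def)
  ultimately show ?thesis
    using holomorphic_fun_eq_0_on_connected[OF _ open_UNIV connected_UNIV, of "f 0" 0 t] z by simp
qed

text \<open>The successive derivatives of an entry of \<open>u\<close> are entries of
  \<open>u t\<close> times the powers of \<open>X\<close>, all zero at \<open>t = 0\<close>; norms
  and estimates are avoided.\<close>

lemma linear_ode_zero:
  assumes u: "\<And>t. u t \<in> carrier_mat n n" and X: "X \<in> carrier_mat n n"
    and d: "\<And>t. mderiv n u (u t * X) t" and z: "u 0 = 0\<^sub>m n n"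
  shows "u t = 0\<^sub>m n n"
proof (rule sq_eqI[OF u])
  fix i j assume ij: "i < n" "j < n"
  define P where "P k = ((\<lambda>B. X * B) ^^ k) (1\<^sub>m n)" for k
  have P: "P k \<in> carrier_mat n n" for k by (induction k) (use X in \<open>auto simp: P_def\<close>)
  have PS: "P (Suc k) = X * P k" for k by (simp add: P_def)
  have "((\<lambda>t. (u t * P k) $$ (i, j)) has_field_derivative (u t * P (Suc k)) $$ (i, j)) (at t)" for k t
    using mderivD[OF mderiv_mult_right[OF u P sq_mult_closed[OF u X] d] ij, of k t]
    unfolding PS sq_assoc[OF u X P] .
  then have "(u t * P 0) $$ (i, j) = 0"
    by (rule flat_entire_zero) (use ij P z in \<open>simp add: left_mult_zero_mat[OF P]\<close>)
  then show "u t $$ (i, j) = 0\<^sub>m n n $$ (i, j)" using u ij by (simp add: P_def right_mult_one_mat[OF u])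
qed simp

text \<open>The curve exp(tX), characterized by its differential equation and initial value.
  Existence comes later, in \<open>one_param_exists\<close>, from an explicit formula based on the
  Jordan form.\<close>

definition one_param :: "nat \<Rightarrow> complex mat \<Rightarrow> (complex \<Rightarrow> complex mat) \<Rightarrow> bool" where
  "one_param n X c \<longleftrightarrow> (\<forall>t. c t \<in> carrier_mat n n) \<and> c 0 = 1\<^sub>m n \<and> (\<forall>t. mderiv n c (c t * X) t)"

lemma one_paramD:
  assumes "one_param n X c"
  shows "c t \<in> carrier_mat n n" "c 0 = 1\<^sub>m n" "mderiv n c (c t * X) t"
  using assms unfolding one_param_def by blast+

lemma linear_ode_unique:
  assumes "\<And>t. u t \<in> carrier_mat n n" "\<And>t. v t \<in> carrier_mat n n" and X: "X \<in> carrier_mat n n"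
    and "\<And>t. mderiv n u (u t * X) t" "\<And>t. mderiv n v (v t * X) t" and z: "u 0 = v 0"
  shows "u t = v t"
proof -
  have zero: "(\<lambda>t. u t - v t) t = 0\<^sub>m n n" for t
  proof (rule linear_ode_zero[OF _ X])
    show "mderiv n (\<lambda>t. u t - v t) ((u t - v t) * X) t" for t
      using mderiv_diff[OF assms(1,2) sq_mult_closed[OF assms(1) X] sq_mult_closed[OF assms(2) X] assms(4,5), of t]
      by (simp add: minus_mult_distrib_mat[OF assms(1,2) X])
    show "u t - v t \<in> carrier_mat n n" for t by (rule minus_carrier_mat[OF assms(2)])
    show "u 0 - v 0 = 0\<^sub>m n n" using z assms(2)[of 0] by simp
  qed
  show ?thesis
  proof (rule sq_eqI[OF assms(1) assms(2)])
    fix i j assume ij: "i < n" "j < n"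
    have "(u t - v t) $$ (i, j) = u t $$ (i, j) - v t $$ (i, j)"
      using ij assms(2)[of t] by simp
    then show "u t $$ (i, j) = v t $$ (i, j)" using zero[of t] ij by simp
  qed
qed

lemma one_param_unique:
  assumes "X \<in> carrier_mat n n" "one_param n X c" "one_param n X d" shows "c t = d t"
  by (rule linear_ode_unique[where u = c and v = d, OF _ _ assms(1)])
    (simp_all add: one_paramD[OF assms(2)] one_paramD[OF assms(3)])

text \<open>Both sides solve the equation u' = u X with the value \<open>B\<close> at 0.\<close>

lemma one_param_commute:
  assumes X: "X \<in> carrier_mat n n" and c: "one_param n X c"
    and B: "B \<in> carrier_mat n n" "X * B = B * X"
  shows "c t * B = B * c t"
proof (rule linear_ode_unique[where u = "\<lambda>t. c t * B" and v = "\<lambda>t. B * c t", OF _ _ X])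
  note cc = one_paramD(1)[OF c]
  show "mderiv n (\<lambda>t. c t * B) (c t * B * X) t" for t
    using mderiv_mult_right[OF cc B(1) sq_mult_closed[OF cc X] one_paramD(3)[OF c], of t]
    by (simp only: sq_assoc[OF cc B(1) X] sq_assoc[OF cc X B(1)] B(2))
  show "mderiv n (\<lambda>t. B * c t) (B * c t * X) t" for t
    using mderiv_mult_left[OF cc B(1) sq_mult_closed[OF cc X] one_paramD(3)[OF c], of t]
    by (simp only: sq_assoc[OF B(1) cc X])
  show "c t * B \<in> carrier_mat n n" "B * c t \<in> carrier_mat n n" for t using cc[of t] B by auto
  show "c 0 * B = B * c 0" using B by (simp add: one_paramD(2)[OF c])
qed

lemma one_param_add:
  assumes X: "X \<in> carrier_mat n n" and c: "one_param n X c"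
  shows "c (s + t) = c s * c t"
proof (rule linear_ode_unique[where u = "\<lambda>t. c (s + t)" and v = "\<lambda>t. c s * c t", OF _ _ X])
  note cc = one_paramD(1)[OF c]
  show "mderiv n (\<lambda>t. c (s + t)) (c (s + t) * X) t" for t
  proof -
    have "((+) s has_field_derivative 1) (at t)" by (auto intro!: derivative_eq_intros)
    from mderiv_comp[OF one_paramD(3)[OF c] this sq_mult_closed[OF cc X]] show ?thesis by (simp add: one_smult)
  qed
  show "mderiv n (\<lambda>t. c s * c t) (c s * c t * X) t" for t
    using mderiv_mult_left[OF cc cc sq_mult_closed[OF cc X] one_paramD(3)[OF c], of s t]
    by (simp only: sq_assoc[OF cc cc X])
  show "c (s + t) \<in> carrier_mat n n" "c s * c t \<in> carrier_mat n n" for t using cc[of s] cc[of "s + t"] cc[of t] by auto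
  show "c (s + 0) = c s * c 0" by (simp add: one_paramD(2)[OF c] right_mult_one_mat[OF cc])
qed

lemma one_param_inverse:
  assumes X: "X \<in> carrier_mat n n" and c: "one_param n X c"
  shows "c t \<in> carrier (GL n)" "minv (c t) = c (- t)"
proof -
  have 1: "c t * c (- t) = 1\<^sub>m n" using one_param_add[OF assms, of t "- t"] one_paramD(2)[OF c] by simp
  then have "det (c t) * det (c (- t)) = 1"
    using det_mult[OF one_paramD(1)[OF c] one_paramD(1)[OF c], of t "- t"] by simp
  then show g: "c t \<in> carrier (GL n)" using one_paramD(1)[OF c] by (auto simp: GL_iff_det)
  show "minv (c t) = c (- t)" using minv_eq[OF g one_paramD(1)[OF c] 1] by simp
qed

lemma one_param_conj:
  assumes X: "X \<in> carrier_mat n n" and c: "one_param n X c" and g: "g \<in> carrier (GL n)"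
  shows "one_param n (g * X * minv g) (\<lambda>t. g * c t * minv g)"
  unfolding one_param_def
proof (intro conjI allI)
  note cc = one_paramD(1)[OF c]
  have gc: "g \<in> carrier_mat n n" and ic: "minv g \<in> carrier_mat n n"
    using g minv(1)[OF g] by (auto simp: GL_iff_det)
  show "g * c t * minv g \<in> carrier_mat n n" for t using cc gc ic by (intro sq_mult_closed)
  show "g * c 0 * minv g = 1\<^sub>m n" using gc minv(2)[OF g] by (simp add: one_paramD(2)[OF c])
  fix t
  have "mderiv n (\<lambda>t. g * c t * minv g) (g * (c t * X) * minv g) t"
    using cc gc ic X by (intro mderiv_mult_right mderiv_mult_left one_paramD(3)[OF c] sq_mult_closed)
  moreover have "g * c t * minv g * (g * X * minv g) = g * (c t * X) * minv g"
  proof -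
    have "g * c t * minv g * (g * X * minv g) = g * c t * (minv g * g) * X * minv g"
      using cc[of t] gc ic X by (simp only: sq_assoc[of _ n] sq_mult_closed)
    also have "\<dots> = g * (c t * X) * minv g"
      using cc[of t] gc ic X by (simp add: minv(3)[OF g] sq_assoc[of _ n])
    finally show ?thesis .
  qed
  ultimately show "mderiv n (\<lambda>t. g * c t * minv g) (g * c t * minv g * (g * X * minv g)) t" by simp
qed

section \<open>Differentials and left-invariant derivatives of regular functions\<close>

definition Gradient :: "nat \<Rightarrow> (complex mat \<Rightarrow> complex) \<Rightarrow> nat \<Rightarrow> nat \<Rightarrow> complex mat \<Rightarrow> complex" where
  "Gradient n F = (SOME Gr. (\<forall>i<n. \<forall>j<n. Gr i j \<in> regular_funs n) \<and>
    (\<forall>c c' t. (\<forall>s. c s \<in> carrier_mat n n) \<longrightarrow> c t \<in> carrier (GL n) \<longrightarrow> mderiv n c c' t \<longrightarrow>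
      ((\<lambda>s. F (c s)) has_field_derivative (\<Sum>i<n. \<Sum>j<n. Gr i j (c t) * c' $$ (i, j))) (at t)))"

text \<open>Functions that are known to agree only on \<open>GL n\<close> can be exchanged under a
  derivative at \<open>t\<close>, since a curve through an invertible matrix stays invertible near
  \<open>t\<close>.\<close>

lemma eventually_GL:
  assumes "\<And>s. c s \<in> carrier_mat n n" "c t \<in> carrier (GL n)" "mderiv n c c' t"
  shows "eventually (\<lambda>s. c s \<in> carrier (GL n)) (nhds t)"
proof -
  obtain Gr where "has_grad n det Gr" using has_grad_det by blast
  from has_gradD(2)[OF this assms] have "isCont (\<lambda>s. det (c s)) t" by (rule DERIV_isCont)
  then have "((\<lambda>s. det (c s)) \<longlongrightarrow> det (c t)) (nhds t)"
    unfolding isCont_def tendsto_at_iff_tendsto_nhds[of "\<lambda>s. det (c s)"] .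
  moreover have "det (c t) \<noteq> 0" using assms(2) by (simp add: GL_iff_det)
  ultimately have "eventually (\<lambda>s. det (c s) \<noteq> 0) (nhds t)" by (rule tendsto_imp_eventually_ne)
  then show ?thesis using assms(1) by (simp add: GL_iff_det)
qed

lemma Gradient_ex:
  assumes "reg n F"
  shows "\<exists>Gr. (\<forall>i<n. \<forall>j<n. Gr i j \<in> regular_funs n) \<and>
    (\<forall>c c' t. (\<forall>s. c s \<in> carrier_mat n n) \<longrightarrow> c t \<in> carrier (GL n) \<longrightarrow> mderiv n c c' t \<longrightarrow>
      ((\<lambda>s. F (c s)) has_field_derivative (\<Sum>i<n. \<Sum>j<n. Gr i j (c t) * c' $$ (i, j))) (at t))"
proof -
  obtain F' where F': "F' \<in> regular_funs n" "\<And>g. g \<in> carrier (GL n) \<Longrightarrow> F g = F' g"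
    using assms unfolding reg_def by blast
  obtain Gr where Gr: "has_grad n F' Gr" using regular_has_grad[OF F'(1)] by blast
  show ?thesis
  proof (intro exI[of _ Gr] conjI allI impI)
    show "Gr i j \<in> regular_funs n" if "i < n" "j < n" for i j using has_gradD(1)[OF Gr that] .
  next
    fix c c' t assume c: "\<forall>s. c s \<in> carrier_mat n n" "c t \<in> carrier (GL n)" "mderiv n c c' t"
    have "eventually (\<lambda>s. c s \<in> carrier (GL n)) (nhds t)" by (rule eventually_GL) (use c in auto)
    then have "eventually (\<lambda>s. F' (c s) = F (c s)) (nhds t)"
      by eventually_elim (simp add: F'(2))
    from DERIV_cong_ev[OF refl this refl]
    show "((\<lambda>s. F (c s)) has_field_derivative (\<Sum>i<n. \<Sum>j<n. Gr i j (c t) * c' $$ (i, j))) (at t)"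
      using has_gradD(2)[OF Gr, of c t c'] c by blast
  qed
qed

lemma Gradient:
  assumes "reg n F"
  shows "\<And>i j. i < n \<Longrightarrow> j < n \<Longrightarrow> reg n (Gradient n F i j)"
    and "\<And>c c' t. (\<And>s. c s \<in> carrier_mat n n) \<Longrightarrow> c t \<in> carrier (GL n) \<Longrightarrow> mderiv n c c' t \<Longrightarrow>
      ((\<lambda>s. F (c s)) has_field_derivative (\<Sum>i<n. \<Sum>j<n. Gradient n F i j (c t) * c' $$ (i, j))) (at t)"
  using someI_ex[OF Gradient_ex[OF assms]] unfolding Gradient_def[symmetric] by (blast intro: reg_regular)+

text \<open>The differential of \<open>F\<close> at the identity, linear in \<open>X\<close> by its
  form. \<open>Gradient\<close> is a choice, but its values at invertible matrices are determined by
  \<open>F\<close>.\<close>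

definition dlin :: "nat \<Rightarrow> (complex mat \<Rightarrow> complex) \<Rightarrow> complex mat \<Rightarrow> complex" where
  "dlin n F X = (\<Sum>i<n. \<Sum>j<n. Gradient n F i j (1\<^sub>m n) * X $$ (i, j))"

text \<open>The left-invariant vector field of \<open>X\<close> applied to \<open>F\<close>: at
  \<open>g\<close> it has the direction \<open>g * X\<close>.\<close>

definition lder :: "nat \<Rightarrow> complex mat \<Rightarrow> (complex mat \<Rightarrow> complex) \<Rightarrow> complex mat \<Rightarrow> complex" where
  "lder n X F g = (\<Sum>i<n. \<Sum>j<n. Gradient n F i j g * (g * X) $$ (i, j))"

lemma dlin_curve:
  assumes "reg n F" "\<And>s. c s \<in> carrier_mat n n" "c t = 1\<^sub>m n" "mderiv n c X t"
  shows "((\<lambda>s. F (c s)) has_field_derivative dlin n F X) (at t)"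
  using Gradient(2)[OF assms(1), of c t X] assms unfolding dlin_def by (simp add: one_in_GL)

lemma lder_curve:
  assumes "reg n F" "\<And>s. c s \<in> carrier_mat n n" "c t \<in> carrier (GL n)" "mderiv n c (c t * X) t"
  shows "((\<lambda>s. F (c s)) has_field_derivative lder n X F (c t)) (at t)"
  using Gradient(2)[OF assms(1), of c t "c t * X"] assms unfolding lder_def by simp

lemma reg_lder:
  assumes F: "reg n F" and X: "X \<in> carrier_mat n n" shows "reg n (lder n X F)"
proof -
  have "reg n (\<lambda>g. \<Sum>i<n. \<Sum>j<n. Gradient n F i j g * (\<Sum>k<n. g $$ (i, k) * X $$ (k, j)))"
    by (intro reg_sum reg_mult Gradient(1)[OF F] reg_entry reg_const) auto
  then show ?thesis
  proof (rule reg_cong[THEN iffD1, rotated])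
    fix g assume g: "g \<in> carrier (GL n)"
    show "(\<Sum>i<n. \<Sum>j<n. Gradient n F i j g * (\<Sum>k<n. g $$ (i, k) * X $$ (k, j))) = lder n X F g"
      unfolding lder_def using mat_mult_entry[OF GL_carrier[OF g] X] by simp
  qed
qed

lemma dlin_line:
  assumes F: "reg n F" and X: "X \<in> carrier_mat n n"
  shows "((\<lambda>t. F (1\<^sub>m n + t \<cdot>\<^sub>m X)) has_field_derivative dlin n F X) (at 0)"
  by (rule dlin_curve[OF F]) (use X mderiv_line[OF X] in auto)

lemma lder_one:
  assumes X: "X \<in> carrier_mat n n" shows "lder n X F (1\<^sub>m n) = dlin n F X"
  unfolding lder_def dlin_def using X by simp

lemma dlin_add:
  "X \<in> carrier_mat n n \<Longrightarrow> Y \<in> carrier_mat n n \<Longrightarrow> dlin n F (X + Y) = dlin n F X + dlin n F Y"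
  unfolding dlin_def by (simp add: distrib_left sum.distrib)

lemma dlin_smult:
  "X \<in> carrier_mat n n \<Longrightarrow> dlin n F (a \<cdot>\<^sub>m X) = a * dlin n F X"
  unfolding dlin_def by (simp add: sum_distrib_left mult_ac)

text \<open>If two closed sets separated the curve, equations \<open>f1\<close> and
  \<open>f2\<close> of them would become entire functions of \<open>t\<close> with product zero,
  neither of them identically zero. The first is nonzero near \<open>t2\<close>, so the second
  vanishes there, and then everywhere by the identity theorem.\<close>

lemma connectedin_curve:
  assumes c: "\<And>t. c t \<in> carrier (GL n)"
    and hol: "\<And>F. F \<in> regular_funs n \<Longrightarrow> (\<lambda>t. F (c t)) holomorphic_on UNIV"
  shows "connectedin (zariski n) (range c)"
  unfolding connectedin_closedin
proof (intro conjI notI)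
  show "range c \<subseteq> topspace (zariski n)" using c by (auto simp: topspace_zariski)
  assume "\<exists>E1 E2. closedin (zariski n) E1 \<and> closedin (zariski n) E2 \<and> range c \<subseteq> E1 \<union> E2 \<and>
    E1 \<inter> E2 \<inter> range c = {} \<and> E1 \<inter> range c \<noteq> {} \<and> E2 \<inter> range c \<noteq> {}"
  then obtain E1 E2 where E: "closedin (zariski n) E1" "closedin (zariski n) E2" "range c \<subseteq> E1 \<union> E2"
    "E1 \<inter> E2 \<inter> range c = {}" "E1 \<inter> range c \<noteq> {}" "E2 \<inter> range c \<noteq> {}" by blast
  obtain S1 where S1: "S1 \<subseteq> regular_funs n" "E1 = {g \<in> carrier (GL n). \<forall>f\<in>S1. f g = 0}"
    using E(1) unfolding closedin_zariski by blast
  obtain S2 where S2: "S2 \<subseteq> regular_funs n" "E2 = {g \<in> carrier (GL n). \<forall>f\<in>S2. f g = 0}"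
    using E(2) unfolding closedin_zariski by blast
  note S = S1 S2
  obtain t1 where t1: "c t1 \<in> E1" using E(5) by blast
  obtain t2 where t2: "c t2 \<in> E2" using E(6) by blast
  have t: "c t1 \<in> E1" "c t2 \<in> E2" "c t1 \<notin> E2" "c t2 \<notin> E1" using t1 t2 E(4) by auto
  obtain f2 where f2: "f2 \<in> S2" "f2 (c t1) \<noteq> 0" using t(3) c[of t1] unfolding S2(2) by auto
  obtain f1 where f1: "f1 \<in> S1" "f1 (c t2) \<noteq> 0" using t(4) c[of t2] unfolding S1(2) by auto
  have zero: "f1 (c t) * f2 (c t) = 0" for t
  proof -
    have "c t \<in> E1 \<or> c t \<in> E2" using E(3) by blast
    then show ?thesis
    proof
      assume "c t \<in> E1" then have "f1 (c t) = 0" unfolding S(2) using f1(1) by blast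
      then show ?thesis by simp
    next
      assume "c t \<in> E2" then have "f2 (c t) = 0" unfolding S(4) using f2(1) by blast
      then show ?thesis by simp
    qed
  qed
  have h1: "(\<lambda>t. f1 (c t)) holomorphic_on UNIV" and h2: "(\<lambda>t. f2 (c t)) holomorphic_on UNIV"
    using hol[of f1] hol[of f2] f1(1) f2(1) S1(1) S2(1) by blast+
  have "isCont (\<lambda>t. f1 (c t)) t2"
    using holomorphic_on_imp_continuous_on[OF h1] by (simp add: continuous_on_eq_continuous_at)
  then have "((\<lambda>t. f1 (c t)) \<longlongrightarrow> f1 (c t2)) (at t2)" by (simp add: isCont_def)
  then have "eventually (\<lambda>t. f1 (c t) \<noteq> 0) (at t2)" by (rule tendsto_imp_eventually_ne) (rule f1(2))
  then have "eventually (\<lambda>t. f2 (c t) = 0) (at t2)"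
  proof eventually_elim
    case (elim t)
    then show ?case using zero[of t] by simp
  qed
  then have "frequently (\<lambda>t. f2 (c t) = 0) (at t2)" by (rule eventually_frequently[rotated]) simp
  then have "t2 islimpt {t. f2 (c t) = 0}" by (simp add: islimpt_conv_frequently_at)
  then have "f2 (c t1) = 0"
    by (rule analytic_continuation[OF h2 open_UNIV connected_UNIV subset_UNIV UNIV_I]) auto
  then show False using f2 by simp
qed

text \<open>The factor \<open>g\<close> allows chains of such orbits, which join the elements of a
  generated group to the identity.\<close>

lemma one_param_connected:
  assumes X: "X \<in> carrier_mat n n" and c: "one_param n X c" and g: "g \<in> carrier (GL n)"
  shows "connectedin (zariski n) (range (\<lambda>t. c t * g))"
proof (rule connectedin_curve)
  have gc: "g \<in> carrier_mat n n" using g by (rule GL_carrier)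
  show G: "c t * g \<in> carrier (GL n)" for t using mult_in_GL[OF one_param_inverse(1)[OF X c] g] .
  fix F assume "F \<in> regular_funs n"
  then have F: "reg n F" by (rule reg_regular)
  have "((\<lambda>t. F (c t * g)) has_field_derivative
      (\<Sum>i<n. \<Sum>j<n. Gradient n F i j (c t * g) * ((c t * X) * g) $$ (i, j))) (at t)" for t
    by (rule Gradient(2)[OF F _ G])
      (use gc one_paramD(1)[OF c] X in \<open>auto intro!: mderiv_mult_right one_paramD(3)[OF c] sq_mult_closed\<close>)
  then show "(\<lambda>t. F (c t * g)) holomorphic_on UNIV"
    by (auto simp: holomorphic_on_def field_differentiable_def intro: has_field_derivative_at_within)
qed

section \<open>Jordan decomposition\<close>

definition diagm :: "nat \<Rightarrow> (nat \<Rightarrow> complex) \<Rightarrow> complex mat" where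
  "diagm n f = mat n n (\<lambda>(i, j). if i = j then f i else 0)"

lemma diagm_carrier [simp]: "diagm n f \<in> carrier_mat n n" "dim_row (diagm n f) = n" "dim_col (diagm n f) = n"
  by (auto simp: diagm_def)

lemma diagm_entry: "i < n \<Longrightarrow> j < n \<Longrightarrow> diagm n f $$ (i, j) = (if i = j then f i else 0)"
  by (simp add: diagm_def)

lemma diagm_mult_entry:
  assumes "A \<in> carrier_mat n n" "i < n" "j < n" shows "(diagm n f * A) $$ (i, j) = f i * A $$ (i, j)"
proof -
  have "(diagm n f * A) $$ (i, j) = (\<Sum>k<n. if k = i then f i * A $$ (k, j) else 0)"
    unfolding mat_mult_entry[OF diagm_carrier(1) assms] using assms
    by (intro sum.cong refl) (auto simp: diagm_entry)
  then show ?thesis using assms by simp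
qed

lemma mult_diagm_entry:
  assumes "A \<in> carrier_mat n n" "i < n" "j < n" shows "(A * diagm n f) $$ (i, j) = A $$ (i, j) * f j"
proof -
  have "(A * diagm n f) $$ (i, j) = (\<Sum>k<n. if k = j then A $$ (i, k) * f j else 0)"
    unfolding mat_mult_entry[OF assms(1) diagm_carrier(1) assms(2,3)] using assms
    by (intro sum.cong refl) (auto simp: diagm_entry)
  then show ?thesis using assms by simp
qed

text \<open>Encodes the decomposition \<open>X = P * (diagm n l + N) * Q\<close>; the last condition makes \<open>N\<close> commute with \<open>diagm n l\<close>.\<close>

definition jdec :: "nat \<Rightarrow> complex mat \<Rightarrow> complex mat \<Rightarrow> (nat \<Rightarrow> complex) \<Rightarrow> complex mat \<Rightarrow> bool" where
  "jdec n P Q l N \<longleftrightarrow> P \<in> carrier_mat n n \<and> Q \<in> carrier_mat n n \<and> N \<in> carrier_mat n n \<and>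
     P * Q = 1\<^sub>m n \<and> Q * P = 1\<^sub>m n \<and> (\<forall>i<n. \<forall>j<n. j \<le> i \<longrightarrow> N $$ (i, j) = 0) \<and>
     (\<forall>i<n. \<forall>j<n. N $$ (i, j) \<noteq> 0 \<longrightarrow> l i = l j)"

lemma jdecD:
  assumes "jdec n P Q l N"
  shows "P \<in> carrier_mat n n" "Q \<in> carrier_mat n n" "N \<in> carrier_mat n n" "P * Q = 1\<^sub>m n" "Q * P = 1\<^sub>m n"
    "\<And>i j. i < n \<Longrightarrow> j < n \<Longrightarrow> j \<le> i \<Longrightarrow> N $$ (i, j) = 0"
    "\<And>i j. i < n \<Longrightarrow> j < n \<Longrightarrow> N $$ (i, j) \<noteq> 0 \<Longrightarrow> l i = l j"
  using assms unfolding jdec_def by blast+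

text \<open>A nonzero entry above the diagonal lies inside one Jordan block, whose eigenvalue stands
  at both diagonal places.\<close>

lemma jordan_matrix_entries:
  assumes "i < sum_list (map fst as)" "j < sum_list (map fst as)"
  shows "(j < i \<longrightarrow> jordan_matrix as $$ (i, j) = (0::complex)) \<and>
    (i < j \<and> jordan_matrix as $$ (i, j) \<noteq> 0 \<longrightarrow> jordan_matrix as $$ (i, i) = jordan_matrix as $$ (j, j))"
  using assms
proof (induction as arbitrary: i j)
  case (Cons a as)
  obtain k x where a: "a = (k, x)" by force
  have B: "jordan_matrix as \<in> carrier_mat (sum_list (map fst as)) (sum_list (map fst as))" by simp
  show ?case
    using Cons.prems Cons.IH[of "i - k" "j - k"]
    by (auto simp: a jordan_matrix_Cons Let_def)
qed simp

lemma jdec_exists: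
  assumes X: "X \<in> carrier_mat n n"
  shows "\<exists>P Q l N. jdec n P Q l N \<and> X = P * (diagm n l + N) * Q"
proof -
  obtain as where "char_poly X = (\<Prod>a\<leftarrow>as. [:- a, 1:])"
    using char_poly_factorized[OF X] by blast
  then obtain ns where "jordan_nf X ns" using jordan_nf_exists[OF X] by blast
  then obtain P Q where PQ: "similar_mat_wit X (jordan_matrix ns) P Q"
    unfolding jordan_nf_def similar_mat_def by blast
  let ?J = "jordan_matrix ns :: complex mat"
  have d: "P \<in> carrier_mat n n" "Q \<in> carrier_mat n n" "?J \<in> carrier_mat n n" "P * Q = 1\<^sub>m n" "Q * P = 1\<^sub>m n"
    "X = P * ?J * Q"
    using PQ X unfolding similar_mat_wit_def Let_def by auto
  have sl: "sum_list (map fst ns) = n" using d(3) by auto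
  define l where "l i = ?J $$ (i, i)" for i
  define N where "N = ?J - diagm n l"
  have N: "N \<in> carrier_mat n n" unfolding N_def using d(3) by auto
  have Nij: "N $$ (i, j) = ?J $$ (i, j) - (if i = j then l i else 0)" if "i < n" "j < n" for i j
    using that d(3) by (simp add: N_def diagm_entry)
  have "?J = diagm n l + N"
    by (rule sq_eqI[OF d(3)]) (use N in \<open>auto simp: Nij diagm_entry\<close>)
  moreover have "jdec n P Q l N"
    unfolding jdec_def using d N
  proof (intro conjI allI impI)
    fix i j assume ij: "i < n" "j < n"
    note J = jordan_matrix_entries[of i ns j, unfolded sl, OF ij]
    show "N $$ (i, j) = 0" if "j \<le> i" using that J ij by (auto simp: Nij l_def)
    show "l i = l j" if "N $$ (i, j) \<noteq> 0" using that J ij by (cases i j rule: linorder_cases) (auto simp: Nij l_def)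
  qed auto
  moreover from this have "X = P * (diagm n l + N) * Q" using d(6) \<open>?J = diagm n l + N\<close> by simp
  ultimately show ?thesis by blast
qed

text \<open>The exponential series of \<open>t\<close> times \<open>N\<close>, cut off at
  \<open>n\<close>; this is exact for matrices whose \<open>n\<close>-th power is zero.\<close>

definition nilexp :: "nat \<Rightarrow> complex mat \<Rightarrow> complex \<Rightarrow> complex mat" where
  "nilexp n N t = mat n n (\<lambda>(i, j). \<Sum>k<n. t ^ k / fact k * (N ^\<^sub>m k) $$ (i, j))"

lemma nilexp_carrier [simp]: "nilexp n N t \<in> carrier_mat n n"
  by (simp add: nilexp_def)

text \<open>The explicit exponential of \<open>t\<close> times
  \<open>P * (diagm n l + N) * Q\<close>. Its entries are visibly sums of polynomials in
  \<open>t\<close> times exponentials, which the comparison with conjugate exponents relies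
  on.\<close>

definition jcurve :: "nat \<Rightarrow> complex mat \<Rightarrow> complex mat \<Rightarrow> (nat \<Rightarrow> complex) \<Rightarrow> complex mat \<Rightarrow> complex \<Rightarrow> complex mat" where
  "jcurve n P Q l N t = P * (diagm n (\<lambda>i. exp (l i * t)) * nilexp n N t) * Q"

text \<open>Each factor of a strictly upper triangular matrix moves the support one diagonal further
  up.\<close>

lemma nilpotent_pow_entry:
  assumes N: "N \<in> carrier_mat n n" and up: "\<And>i j. i < n \<Longrightarrow> j < n \<Longrightarrow> j \<le> i \<Longrightarrow> N $$ (i, j) = (0::complex)"
  shows "i < n \<Longrightarrow> j < n \<Longrightarrow> j < i + k \<Longrightarrow> (N ^\<^sub>m k) $$ (i, j) = 0"
proof (induction k arbitrary: i j)
  case 0 then show ?case using N by simp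
next
  case (Suc k)
  have "(N ^\<^sub>m Suc k) $$ (i, j) = (\<Sum>l<n. (N ^\<^sub>m k) $$ (i, l) * N $$ (l, j))"
    using mat_mult_entry[OF pow_carrier_mat[OF N] N Suc.prems(1,2)] by simp
  also have "\<dots> = 0"
  proof (rule sum.neutral, safe)
    fix l assume "l < n"
    show "(N ^\<^sub>m k) $$ (i, l) * N $$ (l, j) = 0"
    proof (cases "l < i + k")
      case True then show ?thesis using Suc.IH[of i l] Suc.prems \<open>l < n\<close> by simp
    next
      case False then show ?thesis using up[of l j] Suc.prems \<open>l < n\<close> by simp
    qed
  qed
  finally show ?case .
qed

lemma jdec_pow_zero: "jdec n P Q l N \<Longrightarrow> N ^\<^sub>m n = 0\<^sub>m n n"
  using jdecD nilpotent_pow_entry[of N n _ _ n]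
  by (intro sq_eqI[of _ n]) (auto simp: trans_less_add2)

text \<open>A nonzero entry of \<open>N\<close> joins indices with equal \<open>l\<close>, hence
  with equal values of any function of \<open>l\<close>.\<close>

lemma jdec_diag_commute:
  assumes j: "jdec n P Q l N"
  shows "N * diagm n (\<lambda>i. f (l i)) = diagm n (\<lambda>i. f (l i)) * N"
proof (rule sq_eqI[of _ n])
  note N = jdecD(3)[OF j]
  fix i k assume ik: "i < n" "k < n"
  show "(N * diagm n (\<lambda>i. f (l i))) $$ (i, k) = (diagm n (\<lambda>i. f (l i)) * N) $$ (i, k)"
    unfolding diagm_mult_entry[OF N ik] mult_diagm_entry[OF N ik]
    using jdecD(7)[OF j ik] by (cases "N $$ (i, k) = 0") auto
qed (use jdecD(3)[OF j] in auto)

lemma pow_commute_mat: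
  assumes "A \<in> carrier_mat n n" "B \<in> carrier_mat n n" "A * B = B * (A::complex mat)"
  shows "A ^\<^sub>m k * B = B * A ^\<^sub>m k"
proof (induction k)
  case (Suc k)
  have Ak: "A ^\<^sub>m k \<in> carrier_mat n n" by (rule pow_carrier_mat[OF assms(1)])
  have "A ^\<^sub>m Suc k * B = A ^\<^sub>m k * (A * B)" using sq_assoc[OF Ak assms(1,2)] by simp
  also have "\<dots> = A ^\<^sub>m k * B * A" using sq_assoc[OF Ak assms(2,1)] assms(3) by simp
  also have "\<dots> = B * A ^\<^sub>m Suc k" using sq_assoc[OF assms(2) Ak assms(1)] Suc by simp
  finally show ?case .
qed (use assms in simp)

lemma nilexp_commute:
  assumes j: "jdec n P Q l N"
  shows "nilexp n N t * diagm n (\<lambda>i. f (l i)) = diagm n (\<lambda>i. f (l i)) * nilexp n N t"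
proof (rule sq_eqI[of _ n])
  note N = jdecD(3)[OF j]
  fix i k assume ik: "i < n" "k < n"
  have *: "(N ^\<^sub>m m) $$ (i, k) * f (l k) = f (l i) * (N ^\<^sub>m m) $$ (i, k)" for m
    using pow_commute_mat[OF N diagm_carrier(1) jdec_diag_commute[OF j], of m f]
      diagm_mult_entry[OF pow_carrier_mat[OF N] ik, of "\<lambda>i. f (l i)" m] mult_diagm_entry[OF pow_carrier_mat[OF N] ik, of m "\<lambda>i. f (l i)"]
    by metis
  show "(nilexp n N t * diagm n (\<lambda>i. f (l i))) $$ (i, k) = (diagm n (\<lambda>i. f (l i)) * nilexp n N t) $$ (i, k)"
    unfolding diagm_mult_entry[OF nilexp_carrier ik] mult_diagm_entry[OF nilexp_carrier ik]
    using ik unfolding nilexp_def index_mat(1)[OF ik] split sum_distrib_left sum_distrib_right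
    by (intro sum.cong refl) (simp only: mult.assoc *, simp only: mult.left_commute)
qed (auto intro: sq_mult_closed)

lemma mderiv_nilexp:
  assumes N: "N \<in> carrier_mat n n" and nil: "N ^\<^sub>m n = 0\<^sub>m n n"
  shows "mderiv n (nilexp n N) (nilexp n N t * N) t"
proof (rule mderivI)
  fix i k assume ik: "i < n" "k < n"
  define a where "a m = (N ^\<^sub>m m) $$ (i, k)" for m
  obtain n' where n': "n = Suc n'" using ik by (cases n) auto
  have "((\<lambda>t. \<Sum>m<n. t ^ m / fact m * a m) has_field_derivative (\<Sum>m<n. t ^ m / fact m * a (Suc m))) (at t)"
  proof -
    have "((\<lambda>t. \<Sum>m<n. t ^ m / fact m * a m) has_field_derivative (\<Sum>m<n. of_nat m * t ^ (m - 1) / fact m * a m)) (at t)"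
      by (intro DERIV_sum) (auto intro!: derivative_eq_intros)
    also have "(\<Sum>m<n. of_nat m * t ^ (m - 1) / fact m * a m) = (\<Sum>m<n'. t ^ m / fact m * a (Suc m))"
      unfolding n' by (subst sum.lessThan_Suc_shift) (simp add: fact_Suc field_simps del: of_nat_Suc)
    also have "\<dots> = (\<Sum>m<n. t ^ m / fact m * a (Suc m))"
      using nil ik by (simp add: n' a_def)
    finally show ?thesis .
  qed
  moreover have "(nilexp n N t * N) $$ (i, k) = (\<Sum>m<n. t ^ m / fact m * a (Suc m))"
  proof -
    have "(nilexp n N t * N) $$ (i, k) = (\<Sum>r<n. (\<Sum>m<n. t ^ m / fact m * (N ^\<^sub>m m) $$ (i, r)) * N $$ (r, k))"
      unfolding mat_mult_entry[OF nilexp_carrier N ik] using ik by (simp add: nilexp_def)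
    also have "\<dots> = (\<Sum>m<n. t ^ m / fact m * (\<Sum>r<n. (N ^\<^sub>m m) $$ (i, r) * N $$ (r, k)))"
      unfolding sum_distrib_left sum_distrib_right by (subst sum.swap) (simp add: mult.assoc)
    also have "\<dots> = (\<Sum>m<n. t ^ m / fact m * a (Suc m))"
      using mat_mult_entry[OF pow_carrier_mat[OF N] N ik] by (simp add: a_def)
    finally show ?thesis .
  qed
  moreover have "(\<lambda>t. nilexp n N t $$ (i, k)) = (\<lambda>t. \<Sum>m<n. t ^ m / fact m * a m)"
    using ik by (simp add: nilexp_def a_def)
  ultimately show "((\<lambda>t. nilexp n N t $$ (i, k)) has_field_derivative (nilexp n N t * N) $$ (i, k)) (at t)" by simp
qed

lemma mderiv_diag_exp:
  "mderiv n (\<lambda>t. diagm n (\<lambda>i. exp (l i * t))) (diagm n (\<lambda>i. exp (l i * t)) * diagm n l) t"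
proof (rule mderivI)
  fix i k assume ik: "i < n" "k < n"
  show "((\<lambda>t. diagm n (\<lambda>i. exp (l i * t)) $$ (i, k)) has_field_derivative
      (diagm n (\<lambda>i. exp (l i * t)) * diagm n l) $$ (i, k)) (at t)"
    unfolding mult_diagm_entry[OF diagm_carrier(1) ik] using ik
    by (auto simp: diagm_entry intro!: derivative_eq_intros)
qed

lemma jcurve_carrier: "jdec n P Q l N \<Longrightarrow> jcurve n P Q l N t \<in> carrier_mat n n"
  unfolding jcurve_def by (intro sq_mult_closed jdecD nilexp_carrier diagm_carrier)

text \<open>The diagonal part and \<open>N\<close> commute, so the product rule collects both
  derivatives into the factor \<open>?D + N\<close> on the right.\<close>

theorem one_param_jcurve:
  assumes j: "jdec n P Q l N"
  shows "one_param n (P * (diagm n l + N) * Q) (jcurve n P Q l N)"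
  unfolding one_param_def
proof (intro conjI allI)
  note P = jdecD(1)[OF j] and Q = jdecD(2)[OF j] and N = jdecD(3)[OF j]
  let ?E = "\<lambda>t. diagm n (\<lambda>i. exp (l i * t))" and ?S = "nilexp n N" and ?D = "diagm n l"
  show "jcurve n P Q l N t \<in> carrier_mat n n" for t by (rule jcurve_carrier[OF j])
  show "jcurve n P Q l N 0 = 1\<^sub>m n"
  proof -
    have "?E 0 = 1\<^sub>m n" by (rule sq_eqI[of _ n]) (auto simp: diagm_entry)
    moreover have "?S 0 = 1\<^sub>m n"
    proof (rule sq_eqI[of _ n])
      fix i k assume ik: "i < n" "k < n"
      obtain n' where n': "n = Suc n'" using ik by (cases n) auto
      have "?S 0 $$ (i, k) = (\<Sum>m<n. 0 ^ m / fact m * (N ^\<^sub>m m) $$ (i, k))"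
        unfolding nilexp_def using ik by simp
      also have "\<dots> = 1\<^sub>m n $$ (i, k)"
        unfolding n' sum.lessThan_Suc_shift using carrier_matD(1)[OF N] n' by simp
      finally show "?S 0 $$ (i, k) = 1\<^sub>m n $$ (i, k)" .
    qed auto
    ultimately show ?thesis using P jdecD(4)[OF j] by (simp add: jcurve_def)
  qed
  fix t
  have ES: "?E t * ?S t \<in> carrier_mat n n" by (intro sq_mult_closed nilexp_carrier diagm_carrier)
  have "mderiv n (\<lambda>t. ?E t * ?S t) (?E t * ?D * ?S t + ?E t * (?S t * N)) t"
    by (intro mderiv_mult mderiv_diag_exp mderiv_nilexp[OF N jdec_pow_zero[OF j]] sq_mult_closed nilexp_carrier diagm_carrier N)
  also have "?E t * ?D * ?S t + ?E t * (?S t * N) = ?E t * ?S t * (?D + N)"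
  proof -
    have "?E t * ?D * ?S t = ?E t * ?S t * ?D"
      using nilexp_commute[OF j, of t "\<lambda>x. x"]
      by (simp add: sq_assoc[OF diagm_carrier(1) diagm_carrier(1) nilexp_carrier] sq_assoc[OF diagm_carrier(1) nilexp_carrier diagm_carrier(1)])
    moreover have "?E t * (?S t * N) = ?E t * ?S t * N"
      by (simp add: sq_assoc[OF diagm_carrier(1) nilexp_carrier N])
    ultimately show ?thesis by (simp add: mult_add_distrib_mat[OF ES diagm_carrier(1) N])
  qed
  finally have "mderiv n (\<lambda>t. ?E t * ?S t) (?E t * ?S t * (?D + N)) t" .
  then have "mderiv n (\<lambda>t. P * (?E t * ?S t) * Q) (P * (?E t * ?S t * (?D + N)) * Q) t"
    using P Q N by (intro mderiv_mult_left mderiv_mult_right sq_mult_closed nilexp_carrier diagm_carrier add_carrier_mat)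
  moreover have "P * (?E t * ?S t * (?D + N)) * Q = P * (?E t * ?S t) * Q * (P * (?D + N) * Q)"
  proof -
    have DN: "?D + N \<in> carrier_mat n n" using N by simp
    have "P * (?E t * ?S t) * Q * (P * (?D + N) * Q) = P * (?E t * ?S t) * (Q * P) * (?D + N) * Q"
      using P Q ES DN by (simp only: sq_assoc[of _ n] sq_mult_closed)
    also have "\<dots> = P * (?E t * ?S t * (?D + N)) * Q"
      unfolding jdecD(5)[OF j] right_mult_one_mat[OF sq_mult_closed[OF P ES]]
      using P Q ES DN by (simp only: sq_assoc[of _ n] sq_mult_closed)
    finally show ?thesis by simp
  qed
  ultimately show "mderiv n (jcurve n P Q l N) (jcurve n P Q l N t * (P * (diagm n l + N) * Q)) t"
    unfolding jcurve_def[abs_def] by simp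
qed

corollary one_param_exists:
  assumes "X \<in> carrier_mat n n" shows "\<exists>c. one_param n X c"
  using jdec_exists[OF assms] one_param_jcurve by blast

section \<open>Exponential polynomials\<close>

text \<open>The polynomial factor of the derivative of p(t) exp(a t).\<close>

definition twist :: "complex poly \<Rightarrow> complex \<Rightarrow> complex poly" where
  "twist p a = pderiv p + Polynomial.smult a p"

lemma twist_deriv: "((\<lambda>t. poly p t * exp (a * t)) has_field_derivative poly (twist p a) t * exp (a * t)) (at t)"
  unfolding twist_def by (auto intro!: derivative_eq_intros simp: algebra_simps poly_DERIV)

lemma twist_nonzero:
  assumes "p \<noteq> 0" "a \<noteq> 0" shows "twist p a \<noteq> 0"
proof
  assume "twist p a = 0"
  then have "coeff (pderiv p) (degree p) + a * coeff p (degree p) = 0"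
    unfolding twist_def by (metis Polynomial.coeff_0 Polynomial.coeff_add Polynomial.coeff_smult)
  moreover have "coeff (pderiv p) (degree p) = 0"
    by (simp add: coeff_pderiv coeff_eq_0)
  ultimately show False using assms by simp
qed

lemma twist_pow_nonzero: "p \<noteq> 0 \<Longrightarrow> a \<noteq> 0 \<Longrightarrow> ((\<lambda>p. twist p a) ^^ k) p \<noteq> 0"
  by (induction k) (auto simp: twist_nonzero)

lemma pderiv_pow_zero: "degree p < k \<Longrightarrow> (pderiv ^^ k) p = (0 :: complex poly)"
proof (induction k arbitrary: p)
  case (Suc k)
  show ?case
  proof (cases "degree p = 0")
    case True
    then have "pderiv p = 0" by (simp add: pderiv_eq_0_iff)
    moreover have "(pderiv ^^ k) 0 = (0 :: complex poly)" by (induction k) auto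
    ultimately show ?thesis by (simp add: funpow_swap1)
  next
    case False
    then have "degree (pderiv p) < k" using Suc.prems by (simp add: degree_pderiv)
    then show ?thesis using Suc.IH[of "pderiv p"] by (simp add: funpow_swap1)
  qed
qed simp

text \<open>Divide by exp(v t) for one exponent \<open>v\<close> and differentiate until its
  polynomial is gone. The other exponents \<open>m - v\<close> are nonzero, so differentiation does
  not kill their polynomials unless these were zero, and the induction hypothesis applies to what is
  left.\<close>

lemma exp_poly_independent:
  assumes "finite S" "\<And>t. (\<Sum>m\<in>S. poly (p m) t * exp (m * t)) = 0" "m \<in> S"
  shows "p m = (0 :: complex poly)"
  using assms
proof (induction S arbitrary: p m rule: finite_induct)
  case (insert v S)
  define q where "q m k = ((\<lambda>p. twist p (m - v)) ^^ k) (p m)" for m k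
  define h where "h k t = poly ((pderiv ^^ k) (p v)) t + (\<Sum>m\<in>S. poly (q m k) t * exp ((m - v) * t))" for k t
  have hd: "(h k has_field_derivative h (Suc k) t) (at t)" for k t
    unfolding h_def q_def funpow.simps o_def by (intro DERIV_add DERIV_sum twist_deriv poly_DERIV)
  have h0: "h 0 t = 0" for t
  proof -
    have "h 0 t = exp (- v * t) * (poly (p v) t * exp (v * t) + (\<Sum>m\<in>S. poly (p m) t * exp (m * t)))"
      unfolding h_def q_def by (simp add: algebra_simps sum_distrib_left exp_diff exp_minus field_simps)
    also have "\<dots> = 0" using insert.prems(1)[of t] insert.hyps by simp
    finally show ?thesis .
  qed
  have hk: "h k t = 0" for k t
  proof (induction k arbitrary: t)
    case (Suc k)
    then have "h k = (\<lambda>_. 0)" by auto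
    then show ?case using DERIV_unique[OF hd[of k t]] by simp
  qed (rule h0)
  define K where "K = Suc (degree (p v))"
  have "(pderiv ^^ K) (p v) = 0" unfolding K_def by (rule pderiv_pow_zero) simp
  then have "(\<Sum>m\<in>S. poly (q m K) t * exp ((m - v) * t)) = 0" for t
    using hk[of K t] unfolding h_def by simp
  moreover have "(\<Sum>m\<in>S. poly (q m K) t * exp (m * t)) = exp (v * t) * (\<Sum>m\<in>S. poly (q m K) t * exp ((m - v) * t))" for t
    unfolding sum_distrib_left by (rule sum.cong) (auto simp: left_diff_distrib exp_diff)
  ultimately have "q m K = 0" if "m \<in> S" for m using insert.IH[of "\<lambda>m. q m K" m] that by simp
  then have pS: "p m = 0" if "m \<in> S" for m
    using that twist_pow_nonzero[of "p m" "m - v" K] insert.hyps unfolding q_def by auto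
  have "poly (p v) t = 0" for t
    using insert.prems(1)[of t] insert.hyps pS by simp
  then have "p v = 0" using poly_all_0_iff_0 by blast
  then show ?case using pS insert.prems(2) by auto
qed simp

text \<open>
  A pair of exponential polynomials whose second member arises from the first by conjugating all
  exponents and setting the polynomial parts to their constant terms. By linear independence the first
  member determines the second one.
\<close>

inductive ep :: "(complex \<Rightarrow> complex) \<Rightarrow> (complex \<Rightarrow> complex) \<Rightarrow> bool" where
  ep_const: "ep (\<lambda>_. a) (\<lambda>_. a)"
| ep_exp: "ep (\<lambda>t. exp (m * t)) (\<lambda>t. exp (cnj m * t))"
| ep_lin: "ep (\<lambda>t. t) (\<lambda>_. 0)"
| ep_add: "ep u v \<Longrightarrow> ep u' v' \<Longrightarrow> ep (\<lambda>t. u t + u' t) (\<lambda>t. v t + v' t)"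
| ep_mult: "ep u v \<Longrightarrow> ep u' v' \<Longrightarrow> ep (\<lambda>t. u t * u' t) (\<lambda>t. v t * v' t)"

lemma sum_list_mult_product:
  fixes f :: "'b \<Rightarrow> complex"
  assumes "\<And>x y. f (h x y) = f x * f y"
  shows "(\<Sum>x\<leftarrow>xs. f x) * (\<Sum>y\<leftarrow>ys. f y) = (\<Sum>z\<leftarrow>concat (map (\<lambda>x. map (h x) ys) xs). f z)"
proof (induction xs)
  case (Cons a xs)
  have "(\<Sum>y\<leftarrow>ys. f (h a y)) = f a * (\<Sum>y\<leftarrow>ys. f y)"
    by (simp add: assms sum_list_const_mult)
  then show ?case using Cons by (simp add: distrib_right o_def)
qed simp

text \<open>Exponents may repeat in the list, so that sums are concatenations and products are lists
  of all pairs; equal exponents are collected only in \<open>sum_list_group\<close>.\<close>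

definition ep_rep :: "(complex \<times> complex poly) list \<Rightarrow> (complex \<Rightarrow> complex) \<Rightarrow> (complex \<Rightarrow> complex) \<Rightarrow> bool" where
  "ep_rep xs u v \<longleftrightarrow> u = (\<lambda>t. \<Sum>x\<leftarrow>xs. poly (snd x) t * exp (fst x * t)) \<and>
     v = (\<lambda>t. \<Sum>x\<leftarrow>xs. poly (snd x) 0 * exp (cnj (fst x) * t))"

lemma ep_rep_mult:
  assumes "ep_rep xs u v" "ep_rep ys u' v'"
  shows "ep_rep (concat (map (\<lambda>x. map (\<lambda>y. (fst x + fst y, snd x * snd y)) ys) xs)) (\<lambda>t. u t * u' t) (\<lambda>t. v t * v' t)"
proof -
  let ?zs = "concat (map (\<lambda>x. map (\<lambda>y. (fst x + fst y, snd x * snd y)) ys) xs)"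
  have "(\<Sum>x\<leftarrow>xs. poly (snd x) t * exp (fst x * t)) * (\<Sum>x\<leftarrow>ys. poly (snd x) t * exp (fst x * t))
     = (\<Sum>x\<leftarrow>?zs. poly (snd x) t * exp (fst x * t))" for t
    by (rule sum_list_mult_product) (simp add: distrib_right exp_add)
  moreover have "(\<Sum>x\<leftarrow>xs. poly (snd x) 0 * exp (cnj (fst x) * t)) * (\<Sum>x\<leftarrow>ys. poly (snd x) 0 * exp (cnj (fst x) * t))
     = (\<Sum>x\<leftarrow>?zs. poly (snd x) 0 * exp (cnj (fst x) * t))" for t
    by (rule sum_list_mult_product) (simp add: distrib_right exp_add)
  ultimately show ?thesis using assms unfolding ep_rep_def by simp
qed

lemma ep_normal: "ep u v \<Longrightarrow> \<exists>xs. ep_rep xs u v"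
proof (induction rule: ep.induct)
  case (ep_const a)
  show ?case by (rule exI[of _ "[(0, [:a:])]"]) (simp add: ep_rep_def)
next
  case (ep_exp m)
  show ?case by (rule exI[of _ "[(m, 1)]"]) (simp add: ep_rep_def)
next
  case ep_lin
  show ?case by (rule exI[of _ "[(0, [:0, 1:])]"]) (simp add: ep_rep_def)
next
  case (ep_add u v u' v')
  then obtain xs ys where "ep_rep xs u v" "ep_rep ys u' v'" by blast
  then have "ep_rep (xs @ ys) (\<lambda>t. u t + u' t) (\<lambda>t. v t + v' t)" by (simp add: ep_rep_def)
  then show ?case ..
next
  case (ep_mult u v u' v')
  then obtain xs ys where "ep_rep xs u v" "ep_rep ys u' v'" by blast
  from ep_rep_mult[OF this] show ?case ..
qed

lemma sum_list_group:
  fixes f :: "'b \<Rightarrow> complex"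
  assumes "finite S" "fst ` set xs \<subseteq> S"
  shows "(\<Sum>x\<leftarrow>xs. poly (snd x) t * f (fst x)) = (\<Sum>m\<in>S. poly (\<Sum>x\<leftarrow>xs. if fst x = m then snd x else 0) t * f m)"
  using assms(2)
proof (induction xs)
  case (Cons x xs)
  have "(\<Sum>m\<in>S. poly (if fst x = m then snd x else 0) t * f m) = (\<Sum>m\<in>S. if m = fst x then poly (snd x) t * f m else 0)"
    by (intro sum.cong) auto
  also have "\<dots> = poly (snd x) t * f (fst x)" using Cons.prems assms(1) by simp
  finally show ?case using Cons by (simp add: distrib_right sum.distrib)
qed simp

text \<open>After equal exponents are collected, linear independence makes each polynomial of
  \<open>u\<close> zero. The function \<open>v\<close> is formed from the values at 0 of the same
  collected polynomials.\<close>

theorem ep_zero: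
  assumes "ep u v" and u: "\<And>t. u t = 0" shows "v t = 0"
proof -
  obtain xs where xs: "\<And>t. u t = (\<Sum>x\<leftarrow>xs. poly (snd x) t * exp (fst x * t))"
    "\<And>t. v t = (\<Sum>x\<leftarrow>xs. poly (snd x) 0 * exp (cnj (fst x) * t))"
    using ep_normal[OF assms(1)] unfolding ep_rep_def by auto
  let ?S = "fst ` set xs" and ?p = "\<lambda>m. \<Sum>x\<leftarrow>xs. if fst x = m then snd x else 0"
  have "(\<Sum>m\<in>?S. poly (?p m) t * exp (m * t)) = 0" for t
    using sum_list_group[of ?S xs t "\<lambda>m. exp (m * t)"] xs(1)[of t] u by simp
  then have "?p m = 0" if "m \<in> ?S" for m
    using exp_poly_independent[of ?S ?p m] that by blast
  then show ?thesis
    using sum_list_group[of ?S xs 0 "\<lambda>m. exp (cnj m * t)"] xs(2)[of t] by simp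
qed

text \<open>Along a one-parameter subgroup \<open>1 / det\<close> at \<open>t\<close> equals
  \<open>det\<close> at \<open>- t\<close>. Reflection thus replaces division, under which
  exponential polynomials are not closed.\<close>

lemma ep_reflect: "ep u v \<Longrightarrow> ep (\<lambda>t. u (- t)) (\<lambda>t. v (- t))"
proof (induction rule: ep.induct)
  case (ep_const a)
  show ?case by (rule ep.ep_const)
next
  case (ep_exp m)
  show ?case using ep.ep_exp[of "- m"] by simp
next
  case ep_lin
  show ?case using ep.ep_mult[OF ep.ep_const[of "-1"] ep.ep_lin] by simp
next
  case (ep_add u v u' v')
  show ?case by (rule ep.ep_add[OF ep_add.IH])
next
  case (ep_mult u v u' v')
  show ?case by (rule ep.ep_mult[OF ep_mult.IH])
qed

lemma ep_sum: "(\<And>i. i \<in> A \<Longrightarrow> ep (u i) (v i)) \<Longrightarrow> ep (\<lambda>t. \<Sum>i\<in>A. u i t) (\<lambda>t. \<Sum>i\<in>A. v i t)"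
proof (induction A rule: infinite_finite_induct)
  case (insert a A)
  have "ep (\<lambda>t. u a t + (\<Sum>i\<in>A. u i t)) (\<lambda>t. v a t + (\<Sum>i\<in>A. v i t))"
    by (rule ep_add[of "u a" "v a"]) (use insert in blast)+
  then show ?case using insert(1,2) by simp
qed (simp_all add: ep_const)

lemma ep_prod: "(\<And>i. i \<in> A \<Longrightarrow> ep (u i) (v i)) \<Longrightarrow> ep (\<lambda>t. \<Prod>i\<in>A. u i t) (\<lambda>t. \<Prod>i\<in>A. v i t)"
proof (induction A rule: infinite_finite_induct)
  case (insert a A)
  have "ep (\<lambda>t. u a t * (\<Prod>i\<in>A. u i t)) (\<lambda>t. v a t * (\<Prod>i\<in>A. v i t))"
    by (rule ep_mult[of "u a" "v a"]) (use insert in blast)+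
  then show ?case using insert(1,2) by simp
qed (simp_all add: ep_const)

lemma ep_power: "ep (\<lambda>t. t ^ k) (\<lambda>t. 0 ^ k)"
proof (induction k)
  case 0 show ?case unfolding power_0 by (rule ep_const)
next
  case (Suc k)
  have "ep (\<lambda>t. t * t ^ k) (\<lambda>t. 0 * 0 ^ k)" by (rule ep_mult[OF ep_lin Suc])
  then show ?case by simp
qed

lemma ep_diff:
  assumes "ep u v" "ep u' v'" shows "ep (\<lambda>t. u t - u' t) (\<lambda>t. v t - v' t)"
proof -
  have "ep (\<lambda>t. u t + (-1) * u' t) (\<lambda>t. v t + (-1) * v' t)"
    by (rule ep_add[OF assms(1) ep_mult[OF ep_const assms(2)]])
  then show ?thesis by simp
qed

lemma ep_eq:
  assumes "ep u v" "ep u' v'" "\<And>t. u t = u' t" shows "v t = v' t"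
proof -
  have "v t - v' t = 0" by (rule ep_zero[OF ep_diff[OF assms(1,2)]]) (simp add: assms(3))
  then show ?thesis by simp
qed

section \<open>One-parameter subgroups with conjugate eigenvalues\<close>

definition sscurve :: "nat \<Rightarrow> complex mat \<Rightarrow> complex mat \<Rightarrow> (nat \<Rightarrow> complex) \<Rightarrow> complex \<Rightarrow> complex mat" where
  "sscurve n P Q l = jcurve n P Q (\<lambda>i. cnj (l i)) (0\<^sub>m n n)"

lemma jdec_conj: "jdec n P Q l N \<Longrightarrow> jdec n P Q (\<lambda>i. cnj (l i)) (0\<^sub>m n n)"
  unfolding jdec_def[of n P Q "\<lambda>i. cnj (l i)"] using jdecD(1,2,4,5) by simp

lemma nilexp_at_0: "N \<in> carrier_mat n n \<Longrightarrow> nilexp n N 0 = 1\<^sub>m n"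
proof (rule sq_eqI[of _ n])
  fix i k assume N: "N \<in> carrier_mat n n" and ik: "i < n" "k < n"
  obtain n' where n': "n = Suc n'" using ik by (cases n) auto
  have "nilexp n N 0 $$ (i, k) = (\<Sum>m<n. 0 ^ m / fact m * (N ^\<^sub>m m) $$ (i, k))"
    unfolding nilexp_def using ik by simp
  also have "\<dots> = 1\<^sub>m n $$ (i, k)"
    unfolding n' sum.lessThan_Suc_shift using carrier_matD(1)[OF N] n' by simp
  finally show "nilexp n N 0 $$ (i, k) = 1\<^sub>m n $$ (i, k)" .
qed auto

lemma nilexp_zero: "nilexp n (0\<^sub>m n n) t = 1\<^sub>m n"
proof (rule sq_eqI[of _ n])
  fix i k assume ik: "i < n" "k < n"
  obtain n' where n': "n = Suc n'" using ik by (cases n) auto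
  have "(0\<^sub>m n n ^\<^sub>m Suc m :: complex mat) = 0\<^sub>m n n" for m
    by (simp add: right_mult_zero_mat[OF pow_carrier_mat])
  then show "nilexp n (0\<^sub>m n n) t $$ (i, k) = 1\<^sub>m n $$ (i, k)"
    using ik unfolding nilexp_def n' by (simp add: sum.lessThan_Suc_shift del: pow_mat.simps(2) sum.lessThan_Suc)
qed auto

text \<open>In the explicit formula the exponentials of the eigenvalues turn into those of their
  conjugates, and the polynomial entries of \<open>nilexp\<close> into their values at 0, that is,
  into the identity matrix.\<close>

lemma ep_jcurve_entry:
  assumes j: "jdec n P Q l N" and ik: "i < n" "k < n"
  shows "ep (\<lambda>t. jcurve n P Q l N t $$ (i, k)) (\<lambda>t. sscurve n P Q l t $$ (i, k))"
proof -
  note P = jdecD(1)[OF j] and Q = jdecD(2)[OF j] and N = jdecD(3)[OF j]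
  have ent: "jcurve n P Q l N t $$ (i, k) = (\<Sum>b<n. (\<Sum>a<n. P $$ (i, a) * (exp (l a * t) * nilexp n N t $$ (a, b))) * Q $$ (b, k))"
    if N: "N \<in> carrier_mat n n" for l N t
  proof -
    let ?M = "diagm n (\<lambda>i. exp (l i * t)) * nilexp n N t"
    have M: "?M \<in> carrier_mat n n" by (intro sq_mult_closed diagm_carrier nilexp_carrier)
    show ?thesis
      unfolding jcurve_def mat_mult_entry[OF sq_mult_closed[OF P M] Q ik]
      using ik by (auto intro!: sum.cong simp: mat_mult_entry[OF P M] diagm_mult_entry[OF nilexp_carrier] simp del: index_mult_mat(1))
  qed
  have N0: "0\<^sub>m n n \<in> carrier_mat n n" by simp
  have nil: "ep (\<lambda>t. nilexp n N t $$ (a, b)) (\<lambda>t. nilexp n (0\<^sub>m n n) t $$ (a, b))" if "a < n" "b < n" for a b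
  proof -
    have "ep (\<lambda>t. \<Sum>m<n. t ^ m * (1 / fact m * (N ^\<^sub>m m) $$ (a, b))) (\<lambda>t. \<Sum>m<n. 0 ^ m * (1 / fact m * (N ^\<^sub>m m) $$ (a, b)))"
      by (rule ep_sum, rule ep_mult[OF ep_power ep_const])
    moreover have "(\<Sum>m<n. 0 ^ m * (1 / fact m * (N ^\<^sub>m m) $$ (a, b))) = nilexp n N 0 $$ (a, b)"
      "(\<lambda>t. \<Sum>m<n. t ^ m * (1 / fact m * (N ^\<^sub>m m) $$ (a, b))) = (\<lambda>t. nilexp n N t $$ (a, b))"
      using that by (simp_all add: nilexp_def)
    ultimately show ?thesis by (simp add: nilexp_at_0[OF N] nilexp_zero)
  qed
  show ?thesis
    unfolding sscurve_def ent[OF N] ent[OF N0]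
    by (rule ep_sum, rule ep_mult[OF _ ep_const], rule ep_sum, rule ep_mult[OF ep_const], rule ep_mult[OF ep_exp nil]) auto
qed

lemma ep_det:
  assumes "\<And>t. A t \<in> carrier_mat n n" "\<And>t. B t \<in> carrier_mat n n"
    and "\<And>i k. i < n \<Longrightarrow> k < n \<Longrightarrow> ep (\<lambda>t. A t $$ (i, k)) (\<lambda>t. B t $$ (i, k))"
  shows "ep (\<lambda>t. det (A t)) (\<lambda>t. det (B t))"
  unfolding det_def'[OF assms(1)] det_def'[OF assms(2)]
proof (rule ep_sum, rule ep_mult[OF ep_const], rule ep_prod)
  fix p i assume "p \<in> {p. p permutes {0..<n}}" "i \<in> {0..<n}"
  then have "i < n" "p i < n" using permutes_in_image[of p "{0..<n}" i] by auto
  then show "ep (\<lambda>t. A t $$ (i, p i)) (\<lambda>t. B t $$ (i, p i))" by (rule assms(3))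
qed

theorem ep_regular:
  assumes j: "jdec n P Q l N" and F: "F \<in> regular_funs n"
  shows "ep (\<lambda>t. F (jcurve n P Q l N t)) (\<lambda>t. F (sscurve n P Q l t))"
  using F
proof induction
  case (const c) show ?case by (rule ep_const)
next
  case (entry i k) then show ?case by (rule ep_jcurve_entry[OF j])
next
  case (add f h) show ?case by (rule ep_add[OF add.IH])
next
  case (mult f h) show ?case by (rule ep_mult[OF mult.IH])
next
  case inv_det
  have inv: "1 / det (c t) = det (c (- t))" if X: "X \<in> carrier_mat n n" and c: "one_param n X c" for X c t
  proof -
    have "c t * c (- t) = 1\<^sub>m n" using one_param_add[OF X c, of t "- t"] one_paramD(2)[OF c] by simp
    then have "det (c t) * det (c (- t)) = 1"
      using det_mult[OF one_paramD(1)[OF c] one_paramD(1)[OF c], of t "- t"] by simp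
    moreover from this have "det (c t) \<noteq> 0" by auto
    ultimately show ?thesis by (simp add: divide_eq_eq mult.commute)
  qed
  note j' = jdec_conj[OF j]
  have X: "P * (diagm n l + N) * Q \<in> carrier_mat n n" if "jdec n P Q l N" for l N
    using jdecD[OF that] by (intro sq_mult_closed add_carrier_mat) auto
  have "ep (\<lambda>t. det (jcurve n P Q l N (- t))) (\<lambda>t. det (sscurve n P Q l (- t)))"
  proof (rule ep_reflect[where u = "\<lambda>t. det (jcurve n P Q l N t)" and v = "\<lambda>t. det (sscurve n P Q l t)"], rule ep_det)
    show "jcurve n P Q l N t \<in> carrier_mat n n" for t by (rule jcurve_carrier[OF j])
    show "sscurve n P Q l t \<in> carrier_mat n n" for t unfolding sscurve_def by (rule jcurve_carrier[OF j'])
  qed (rule ep_jcurve_entry[OF j])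
  then show ?case
    unfolding inv[OF X[OF j] one_param_jcurve[OF j]] sscurve_def inv[OF X[OF j'] one_param_jcurve[OF j']] .
qed

text \<open>
  Together with \<open>P * (diagm n l + N) * Q\<close> the Lie algebra of an algebraic group contains this matrix, and the
  trace of their product is the sum of the \<open>\<bar>l i\<bar>\<^sup>2\<close>. A trace form therefore detects nilpotency.
\<close>

definition ssconj :: "nat \<Rightarrow> complex mat \<Rightarrow> complex mat \<Rightarrow> (nat \<Rightarrow> complex) \<Rightarrow> complex mat" where
  "ssconj n P Q l = P * diagm n (\<lambda>i. cnj (l i)) * Q"

lemma one_param_sscurve:
  assumes "jdec n P Q l N" shows "one_param n (ssconj n P Q l) (sscurve n P Q l)"
proof -
  have "diagm n (\<lambda>i. cnj (l i)) + 0\<^sub>m n n = diagm n (\<lambda>i. cnj (l i))" by (rule right_add_zero_mat) simp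
  then show ?thesis
    using one_param_jcurve[OF jdec_conj[OF assms]] by (simp add: ssconj_def sscurve_def)
qed

lemma ssconj_carrier: "jdec n P Q l N \<Longrightarrow> ssconj n P Q l \<in> carrier_mat n n"
  unfolding ssconj_def by (intro sq_mult_closed jdecD diagm_carrier)

lemma jdec_sandwich:
  assumes j: "jdec n P Q l N" and A: "A \<in> carrier_mat n n"
  shows "Q * (P * A * Q) * P = A"
proof -
  note P = jdecD(1)[OF j] and Q = jdecD(2)[OF j]
  have "Q * (P * A * Q) * P = (Q * P) * A * (Q * P)"
    using P Q A by (simp only: sq_assoc[of _ n] sq_mult_closed)
  then show ?thesis using A by (simp add: jdecD(5)[OF j])
qed

lemma ssconj_zero:
  assumes j: "jdec n P Q l N" and z: "ssconj n P Q l = 0\<^sub>m n n" and i: "i < n" shows "l i = 0"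
proof -
  have "diagm n (\<lambda>i. cnj (l i)) = Q * 0\<^sub>m n n * P"
    using jdec_sandwich[OF j diagm_carrier(1), of "\<lambda>i. cnj (l i)"] z unfolding ssconj_def by simp
  also have "\<dots> = 0\<^sub>m n n"
    using jdecD(1,2)[OF j] by (simp add: right_mult_zero_mat[OF jdecD(2)[OF j]])
  finally show ?thesis using diagm_entry[OF i i, of "\<lambda>i. cnj (l i)"] i by simp
qed

lemma trace_mat_mult_comm:
  assumes "A \<in> carrier_mat n n" "B \<in> carrier_mat n n"
  shows "trace_mat (A * B) = trace_mat (B * A)"
proof -
  have "trace_mat (A * B) = (\<Sum>i<n. \<Sum>k<n. A $$ (i, k) * B $$ (k, i))"
    unfolding trace_mat_def using assms by (auto simp: mat_mult_entry[OF assms] simp del: index_mult_mat(1) intro!: sum.cong)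
  also have "\<dots> = (\<Sum>k<n. \<Sum>i<n. B $$ (k, i) * A $$ (i, k))"
    by (subst sum.swap) (simp add: mult.commute)
  also have "\<dots> = trace_mat (B * A)"
    unfolding trace_mat_def using assms by (auto simp: mat_mult_entry[OF assms(2,1)] simp del: index_mult_mat(1) intro!: sum.cong)
  finally show ?thesis .
qed

text \<open>By cyclicity the trace is that of \<open>diagm n l + N\<close> times the conjugate
  diagonal, and the strictly upper triangular \<open>N\<close> adds nothing to the diagonal.\<close>

lemma trace_ssconj:
  assumes j: "jdec n P Q l N"
  shows "trace_mat (P * (diagm n l + N) * Q * ssconj n P Q l) = (\<Sum>i<n. l i * cnj (l i))"
proof -
  note P = jdecD(1)[OF j] and Q = jdecD(2)[OF j] and N = jdecD(3)[OF j]
  let ?D = "diagm n (\<lambda>i. cnj (l i))"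
  have DN: "diagm n l + N \<in> carrier_mat n n" using N by simp
  have "P * (diagm n l + N) * Q * ssconj n P Q l = P * (diagm n l + N) * (Q * P) * ?D * Q"
    unfolding ssconj_def using P Q DN by (simp only: sq_assoc[of _ n] sq_mult_closed diagm_carrier)
  also have "\<dots> = P * ((diagm n l + N) * ?D * Q)"
    unfolding jdecD(5)[OF j] right_mult_one_mat[OF sq_mult_closed[OF P DN]]
    using P Q DN by (simp only: sq_assoc[of _ n] sq_mult_closed diagm_carrier)
  finally have "trace_mat (P * (diagm n l + N) * Q * ssconj n P Q l) = trace_mat ((diagm n l + N) * ?D * Q * P)"
    using trace_mat_mult_comm[OF P sq_mult_closed[OF sq_mult_closed[OF DN diagm_carrier(1)] Q]] by simp
  also have "(diagm n l + N) * ?D * Q * P = (diagm n l + N) * ?D"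
    using sq_assoc[OF sq_mult_closed[OF DN diagm_carrier(1)] Q P]
    by (simp add: jdecD(5)[OF j] right_mult_one_mat[OF sq_mult_closed[OF DN diagm_carrier(1)]])
  also have "trace_mat ((diagm n l + N) * ?D) = (\<Sum>i<n. l i * cnj (l i))"
    unfolding trace_mat_def using N
    by (auto intro!: sum.cong simp: mult_diagm_entry[OF DN] diagm_entry jdecD(6)[OF j] simp del: index_mult_mat(1))
  finally show ?thesis .
qed

lemma jdec_nilpotent:
  assumes j: "jdec n P Q l N" and z: "\<And>i. i < n \<Longrightarrow> l i = 0"
  shows "(P * (diagm n l + N) * Q) ^\<^sub>m n = 0\<^sub>m n n"
proof -
  note P = jdecD(1)[OF j] and Q = jdecD(2)[OF j] and N = jdecD(3)[OF j]
  have "diagm n l + N = N"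
    by (rule sq_eqI[of _ n]) (use N z in \<open>auto simp: diagm_entry\<close>)
  moreover have "(P * N * Q) ^\<^sub>m k = P * N ^\<^sub>m k * Q" for k
  proof (induction k)
    case 0
    then show ?case using P Q jdecD(4)[OF j] carrier_matD[OF P] carrier_matD[OF N] by simp
  next
    case (Suc k)
    have Nk: "N ^\<^sub>m k \<in> carrier_mat n n" by (rule pow_carrier_mat[OF N])
    have "(P * N * Q) ^\<^sub>m Suc k = P * N ^\<^sub>m k * (Q * P) * N * Q"
      using Suc P Q N Nk by (simp only: pow_mat.simps sq_assoc[of _ n] sq_mult_closed)
    also have "\<dots> = P * N ^\<^sub>m Suc k * Q"
      unfolding jdecD(5)[OF j] right_mult_one_mat[OF sq_mult_closed[OF P Nk]]
      using P Q N Nk by (simp only: pow_mat.simps sq_assoc[of _ n] sq_mult_closed)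
    finally show ?case .
  qed
  ultimately show ?thesis using jdec_pow_zero[OF j] P Q
    by (simp add: right_mult_zero_mat[OF P] left_mult_zero_mat[OF Q])
qed

section \<open>Lie algebras and differentials of representations\<close>

lemma algebraic_groupD:
  assumes "algebraic_group n G"
  shows "G \<subseteq> carrier (GL n)" "1\<^sub>m n \<in> G" "\<And>g h. g \<in> G \<Longrightarrow> h \<in> G \<Longrightarrow> g * h \<in> G" "\<And>g. g \<in> G \<Longrightarrow> minv g \<in> G"
    "closedin (zariski n) G"
proof -
  have s: "subgroup G (GL n)" and c: "closedin (zariski n) G" using assms unfolding algebraic_group_def by auto
  show G: "G \<subseteq> carrier (GL n)" by (rule subgroup.subset[OF s])
  show "1\<^sub>m n \<in> G" using subgroup.one_closed[OF s] by (simp add: one_GL)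
  show "g * h \<in> G" if "g \<in> G" "h \<in> G" for g h using subgroup.m_closed[OF s that] by (simp add: mult_GL)
  show "minv g \<in> G" if "g \<in> G" for g using subgroup.m_inv_closed[OF s that] inv_GL[of g n] that G by auto
  show "closedin (zariski n) G" by (rule c)
qed

lemma dlin_cong:
  assumes F: "reg n F" and eq: "\<And>g. g \<in> carrier (GL n) \<Longrightarrow> F g = H g" and X: "X \<in> carrier_mat n n"
  shows "dlin n F X = dlin n H X"
proof -
  have H: "reg n H" using F eq reg_cong by blast
  let ?c = "\<lambda>s. 1\<^sub>m n + s \<cdot>\<^sub>m X"
  have "eventually (\<lambda>s. ?c s \<in> carrier (GL n)) (nhds 0)"
    by (rule eventually_GL[where c' = X])
      (use X mderiv_line[OF X] in \<open>auto simp: one_in_GL zero_smult_mat[OF X]\<close>)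
  then have "eventually (\<lambda>s. F (?c s) = H (?c s)) (nhds 0)" by eventually_elim (rule eq)
  from DERIV_cong_ev[OF refl this refl] show ?thesis
    using DERIV_unique[OF dlin_line[OF H X]] dlin_line[OF F X] by simp
qed

text \<open>Rewrites the condition on derivatives as a system of linear equations in
  \<open>X\<close>, from which the closure properties of the Lie algebra are read off.\<close>

lemma lie_algebra_iff:
  assumes G: "G \<subseteq> carrier (GL n)"
  shows "X \<in> lie_algebra n G \<longleftrightarrow> X \<in> carrier_mat n n \<and> (\<forall>F. reg n F \<and> (\<forall>g\<in>G. F g = 0) \<longrightarrow> dlin n F X = 0)"
proof
  assume X: "X \<in> lie_algebra n G"
  then have Xc: "X \<in> carrier_mat n n" by (simp add: lie_algebra_def)
  moreover have "dlin n F X = 0" if F: "reg n F" "\<forall>g\<in>G. F g = 0" for F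
  proof -
    obtain F' where F': "F' \<in> regular_funs n" "\<And>g. g \<in> carrier (GL n) \<Longrightarrow> F g = F' g"
      using F(1) unfolding reg_def by blast
    have "\<forall>g\<in>G. F' g = 0" using F(2) F'(2) G by (metis subsetD)
    then have "((\<lambda>t. F' (1\<^sub>m n + t \<cdot>\<^sub>m X)) has_field_derivative 0) (at 0)"
      using X F'(1) by (auto simp: lie_algebra_def)
    then have "dlin n F' X = 0" using DERIV_unique[OF dlin_line[OF reg_regular[OF F'(1)] Xc]] by simp
    then show ?thesis using dlin_cong[OF F(1) F'(2) Xc] by simp
  qed
  ultimately show "X \<in> carrier_mat n n \<and> (\<forall>F. reg n F \<and> (\<forall>g\<in>G. F g = 0) \<longrightarrow> dlin n F X = 0)" by blast
next
  assume X: "X \<in> carrier_mat n n \<and> (\<forall>F. reg n F \<and> (\<forall>g\<in>G. F g = 0) \<longrightarrow> dlin n F X = 0)"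
  then show "X \<in> lie_algebra n G"
    unfolding lie_algebra_def using dlin_line[OF reg_regular, of _ n X] reg_regular by force
qed

lemma lie_algebra_mono: "K \<subseteq> G \<Longrightarrow> lie_algebra n K \<subseteq> lie_algebra n G"
  unfolding lie_algebra_def by blast

lemma lie_carrier: "X \<in> lie_algebra n G \<Longrightarrow> X \<in> carrier_mat n n"
  by (simp add: lie_algebra_def)

lemma lie_subspace:
  assumes G: "G \<subseteq> carrier (GL n)"
  shows "subspace_mat n (lie_algebra n G)"
  unfolding subspace_mat_def
proof (intro conjI ballI allI)
  show "lie_algebra n G \<subseteq> carrier_mat n n" using lie_carrier by blast
  show "0\<^sub>m n n \<in> lie_algebra n G" by (simp add: lie_algebra_iff[OF G] dlin_def)
  show "X + Y \<in> lie_algebra n G" if "X \<in> lie_algebra n G" "Y \<in> lie_algebra n G" for X Y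
    using that by (simp add: lie_algebra_iff[OF G] dlin_add)
  show "c \<cdot>\<^sub>m X \<in> lie_algebra n G" if "X \<in> lie_algebra n G" for c X
    using that by (simp add: lie_algebra_iff[OF G] dlin_smult)
qed

text \<open>Left translation carries the derivative at \<open>g\<close> along \<open>g * X\<close>
  to the derivative at the identity along \<open>X\<close>. Hence elements of the Lie algebra
  preserve the functions that vanish on the group.\<close>

lemma lder_translate:
  assumes g: "g \<in> carrier (GL n)" and F: "reg n F" and X: "X \<in> carrier_mat n n"
  shows "lder n X F g = dlin n (\<lambda>h. F (g * h)) X"
proof -
  let ?c = "\<lambda>s. 1\<^sub>m n + s \<cdot>\<^sub>m X"
  have gc: "g \<in> carrier_mat n n" using g by (rule GL_carrier)
  have c: "?c s \<in> carrier_mat n n" for s using X by simp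
  have c0: "?c 0 = 1\<^sub>m n" using X by (simp add: zero_smult_mat[OF X])
  have "((\<lambda>s. F (g * ?c s)) has_field_derivative lder n X F (g * ?c 0)) (at 0)"
    by (rule lder_curve[OF F])
      (use g gc c c0 X mderiv_mult_left[OF c gc X mderiv_line[OF X]] in \<open>auto simp: one_in_GL\<close>)
  moreover have "((\<lambda>s. F (g * ?c s)) has_field_derivative dlin n (\<lambda>h. F (g * h)) X) (at 0)"
    by (rule dlin_curve[where c = ?c, OF reg_mult_left[OF g F] c c0]) (rule mderiv_line, use X in auto)
  ultimately show ?thesis using DERIV_unique gc c0 by fastforce
qed

lemma lder_vanishes:
  assumes G: "algebraic_group n G" and X: "X \<in> lie_algebra n G"
    and F: "reg n F" "\<And>g. g \<in> G \<Longrightarrow> F g = 0" and g: "g \<in> G"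
  shows "lder n X F g = 0"
proof -
  note G' = algebraic_groupD[OF G]
  have gG: "g \<in> carrier (GL n)" using g G'(1) by auto
  have "\<forall>h\<in>G. F (g * h) = 0" using F(2) G'(3)[OF g] by blast
  then show ?thesis
    using lder_translate[OF gG F(1) lie_carrier[OF X]] X reg_mult_left[OF gG F(1)]
    by (simp add: lie_algebra_iff[OF G'(1)])
qed

text \<open>Along the curve the derivatives of an equation \<open>f\<close> of \<open>G\<close> are
  its iterates under \<open>lder n X\<close>. These vanish on \<open>G\<close>, in particular at the
  identity, so \<open>f\<close> is flat at \<open>t = 0\<close> and vanishes along the whole
  curve.\<close>

theorem one_param_in_group:
  assumes G: "algebraic_group n G" and X: "X \<in> lie_algebra n G" and c: "one_param n X c"
  shows "c t \<in> G"
proof -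
  note G' = algebraic_groupD[OF G] and Xc = lie_carrier[OF X]
  obtain S where S: "S \<subseteq> regular_funs n" "G = {g \<in> carrier (GL n). \<forall>f\<in>S. f g = 0}"
    using G'(5) unfolding closedin_zariski by blast
  have "f (c t) = 0" if f: "f \<in> S" for f
  proof -
    define h where "h k = (lder n X ^^ k) f" for k
    have h: "reg n (h k) \<and> (\<forall>g\<in>G. h k g = 0)" for k
    proof (induction k)
      case 0 then show ?case using f S reg_regular by (auto simp: h_def)
    next
      case (Suc k)
      have "h (Suc k) = lder n X (h k)" by (simp add: h_def)
      then show ?case using Suc reg_lder[OF _ Xc] lder_vanishes[OF G X] by auto
    qed
    have "((\<lambda>t. h k (c t)) has_field_derivative h (Suc k) (c t)) (at t)" for k t
    proof -
      have "h (Suc k) = lder n X (h k)" by (simp add: h_def)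
      then show ?thesis
        using lder_curve[of n "h k" c t X] h one_paramD[OF c] one_param_inverse(1)[OF Xc c] by simp
    qed
    then have "h 0 (c t) = 0"
      by (rule flat_entire_zero[where f = "\<lambda>k t. h k (c t)"]) (use h G'(2) one_paramD(2)[OF c] in auto)
    then show ?thesis by (simp add: h_def)
  qed
  then show ?thesis using S one_param_inverse(1)[OF Xc c] by auto
qed

lemma lieI_one_param:
  assumes G: "G \<subseteq> carrier (GL n)" and X: "X \<in> carrier_mat n n" and c: "one_param n X c" and cG: "\<And>t. c t \<in> G"
  shows "X \<in> lie_algebra n G"
  unfolding lie_algebra_iff[OF G]
proof (intro conjI allI impI X)
  fix F assume F: "reg n F \<and> (\<forall>g\<in>G. F g = 0)"
  have "((\<lambda>t. F (c t)) has_field_derivative dlin n F X) (at 0)"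
    using dlin_curve[of n F c 0 X] F one_paramD[OF c] one_paramD(3)[OF c, of 0] X by simp
  moreover have "(\<lambda>t. F (c t)) = (\<lambda>_. 0)" using F cG by auto
  ultimately show "dlin n F X = 0" using DERIV_unique[of "\<lambda>_. 0" _ 0 0] by simp
qed

lemma one_param_generator_unique:
  assumes "one_param n X c" "one_param n Y c" "X \<in> carrier_mat n n" "Y \<in> carrier_mat n n" shows "X = Y"
  using mderiv_unique[of n c X 0 Y] one_paramD(3)[OF assms(1), of 0] one_paramD(3)[OF assms(2), of 0] assms(3,4)
  by (simp add: one_paramD(2)[OF assms(1)])

lemma lie_Ad:
  assumes G: "algebraic_group n G" and X: "X \<in> lie_algebra n G" and g: "g \<in> G"
  shows "g * X * minv g \<in> lie_algebra n G"
proof -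
  note G' = algebraic_groupD[OF G] and Xc = lie_carrier[OF X]
  have gG: "g \<in> carrier (GL n)" using g G'(1) by auto
  obtain c where c: "one_param n X c" using one_param_exists[OF Xc] by blast
  show ?thesis
    by (rule lieI_one_param[OF G'(1) _ one_param_conj[OF Xc c gG]])
      (use G' g one_param_in_group[OF G X c] Xc gG minv(1)[OF gG] GL_carrier in \<open>auto intro!: sq_mult_closed\<close>)
qed

lemma mderiv_Ad:
  assumes X: "X \<in> carrier_mat n n" and Y: "Y \<in> carrier_mat n n" and c: "one_param n X c"
  shows "mderiv n (\<lambda>t. c t * Y * c (- t)) (bracket X Y) 0"
proof -
  note cc = one_paramD(1)[OF c]
  have "((\<lambda>t. - t) has_field_derivative - 1) (at (0::complex))" by (auto intro!: derivative_eq_intros)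
  from mderiv_comp[OF one_paramD(3)[OF c] this sq_mult_closed[OF cc X]]
  have 1: "mderiv n (\<lambda>t. c (- t)) (- 1 \<cdot>\<^sub>m X) 0" using X by (simp add: one_paramD(2)[OF c])
  have 2: "mderiv n (\<lambda>t. c t * Y) (X * Y) 0"
    using mderiv_mult_right[OF cc Y sq_mult_closed[OF cc X] one_paramD(3)[OF c], of 0] X by (simp add: one_paramD(2)[OF c])
  have "mderiv n (\<lambda>t. c t * Y * c (- t)) (X * Y * c (- 0) + c 0 * Y * (- 1 \<cdot>\<^sub>m X)) 0"
    by (rule mderiv_mult[OF _ _ _ _ 2 1]) (use X Y cc in \<open>auto intro!: sq_mult_closed\<close>)
  moreover have "X * Y * c (- 0) + c 0 * Y * (- 1 \<cdot>\<^sub>m X) = bracket X Y"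
    unfolding bracket_def minus_add_uminus_mat[OF sq_mult_closed[OF X Y] sq_mult_closed[OF Y X]]
    using X Y by (simp add: one_paramD(2)[OF c] right_mult_one_mat[OF sq_mult_closed[OF X Y]] mult_smult_distrib[OF Y X] neg_one_smult_mat)
  ultimately show ?thesis by simp
qed

lemma dlin_mderiv:
  assumes "mderiv n c c' t"
  shows "((\<lambda>s. dlin n F (c s)) has_field_derivative dlin n F c') (at t)"
  unfolding dlin_def by (intro DERIV_sum DERIV_cmult mderivD[OF assms]) auto

lemma bracket_carrier: "X \<in> carrier_mat n n \<Longrightarrow> Y \<in> carrier_mat n n \<Longrightarrow> bracket X Y \<in> carrier_mat n n"
  unfolding bracket_def by (intro minus_carrier_mat sq_mult_closed)

text \<open>The curve \<open>c t * Y * c (- t)\<close> runs in a space cut out by linear equations,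
  which therefore also hold for its derivative at 0, the bracket.\<close>

lemma lie_bracket:
  assumes G: "algebraic_group n G" and X: "X \<in> lie_algebra n G" and Y: "Y \<in> lie_algebra n G"
  shows "bracket X Y \<in> lie_algebra n G"
proof -
  note G' = algebraic_groupD[OF G] and Xc = lie_carrier[OF X] and Yc = lie_carrier[OF Y]
  obtain c where c: "one_param n X c" using one_param_exists[OF Xc] by blast
  have Ad: "c t * Y * c (- t) \<in> lie_algebra n G" for t
    using lie_Ad[OF G Y one_param_in_group[OF G X c], of t] one_param_inverse(2)[OF Xc c] by simp
  show ?thesis
    unfolding lie_algebra_iff[OF G'(1)]
  proof (intro conjI allI impI bracket_carrier Xc Yc)
    fix F assume F: "reg n F \<and> (\<forall>g\<in>G. F g = 0)"
    have "(\<lambda>t. dlin n F (c t * Y * c (- t))) = (\<lambda>_. 0)"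
      using Ad F by (simp add: lie_algebra_iff[OF G'(1)])
    then show "dlin n F (bracket X Y) = 0"
      using dlin_mderiv[OF mderiv_Ad[OF Xc Yc c], of F] DERIV_unique[of "\<lambda>_. 0" _ 0 0] by simp
  qed
qed

section \<open>Differentials of rational representations\<close>

locale rational_representation =
  fixes n m :: nat and G :: "complex mat set" and \<pi> :: "complex mat \<Rightarrow> complex mat"
  assumes G: "algebraic_group n G" and rat: "rational_rep n G m \<pi>"
begin

lemmas G' = algebraic_groupD[OF G]

abbreviation "\<gg> \<equiv> lie_algebra n G"
abbreviation "d\<pi> \<equiv> rep_differential n G m \<pi>"

lemma pi_GL: "g \<in> G \<Longrightarrow> \<pi> g \<in> carrier (GL m)"
  and pi_mult: "g \<in> G \<Longrightarrow> h \<in> G \<Longrightarrow> \<pi> (g * h) = \<pi> g * \<pi> h"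
  using rat unfolding rational_rep_def hom_def by (auto simp: mult_GL)

lemma pi_carrier: "g \<in> G \<Longrightarrow> \<pi> g \<in> carrier_mat m m"
  by (rule GL_carrier[OF pi_GL])

lemma pi_one: "\<pi> (1\<^sub>m n) = 1\<^sub>m m"
proof -
  let ?p = "\<pi> (1\<^sub>m n)"
  have p: "?p \<in> carrier (GL m)" "?p \<in> carrier_mat m m" using pi_GL pi_carrier G' by auto
  have "?p * ?p = ?p" using pi_mult[OF G'(2) G'(2)] by simp
  then have "minv ?p * (?p * ?p) = 1\<^sub>m m" using minv[OF p(1)] by simp
  then show ?thesis
    using sq_assoc[OF GL_carrier[OF minv(1)[OF p(1)]] p(2) p(2)] minv(3)[OF p(1)] p by simp
qed

lemma pi_minv: assumes "g \<in> G" shows "\<pi> (minv g) = minv (\<pi> g)"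
proof (rule minv_eq[OF pi_GL[OF assms]])
  have g: "g \<in> carrier (GL n)" using G' assms by auto
  show "\<pi> (minv g) \<in> carrier_mat m m" using pi_carrier G' assms by auto
  show "\<pi> g * \<pi> (minv g) = 1\<^sub>m m"
    using pi_mult[OF assms G'(4)[OF assms]] minv(2)[OF g] pi_one by simp
qed

definition "coef i j = (SOME F. F \<in> regular_funs n \<and> (\<forall>g\<in>G. F g = \<pi> g $$ (i, j)))"

lemma coef:
  assumes "i < m" "j < m"
  shows "coef i j \<in> regular_funs n" "reg n (coef i j)" "\<And>g. g \<in> G \<Longrightarrow> coef i j g = \<pi> g $$ (i, j)"
proof -
  have "\<exists>F. F \<in> regular_funs n \<and> (\<forall>g\<in>G. F g = \<pi> g $$ (i, j))"
    using rat assms unfolding rational_rep_def by blast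
  from someI_ex[OF this]
  show "coef i j \<in> regular_funs n" "reg n (coef i j)" "\<And>g. g \<in> G \<Longrightarrow> coef i j g = \<pi> g $$ (i, j)"
    unfolding coef_def[symmetric] using reg_regular by auto
qed

text \<open>Two regular extensions of \<open>f\<close> differ by a function vanishing on
  \<open>G\<close>, whose differential is zero on the Lie algebra; so exactly one value meets the
  definite description.\<close>

lemma differential_eq:
  assumes F: "F \<in> regular_funs n" "\<And>g. g \<in> G \<Longrightarrow> F g = f g" and X: "X \<in> \<gg>"
  shows "differential n G f X = dlin n F X"
  unfolding differential_def
proof (rule the_equality)
  note Xc = lie_carrier[OF X]
  show "\<exists>H\<in>regular_funs n. (\<forall>g\<in>G. H g = f g) \<and>
      ((\<lambda>t. H (1\<^sub>m n + t \<cdot>\<^sub>m X)) has_field_derivative dlin n F X) (at 0)"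
    using F by (auto intro!: bexI[of _ F] dlin_line reg_regular Xc)
  fix d assume "\<exists>H\<in>regular_funs n. (\<forall>g\<in>G. H g = f g) \<and>
      ((\<lambda>t. H (1\<^sub>m n + t \<cdot>\<^sub>m X)) has_field_derivative d) (at 0)"
  then obtain H where H: "H \<in> regular_funs n" "\<And>g. g \<in> G \<Longrightarrow> H g = f g"
    "((\<lambda>t. H (1\<^sub>m n + t \<cdot>\<^sub>m X)) has_field_derivative d) (at 0)" by blast
  have r: "reg n (\<lambda>g. H g - F g)" using H F by (intro reg_diff reg_regular)
  have "dlin n (\<lambda>g. H g - F g) X = 0"
    using X r H(2) F(2) unfolding lie_algebra_iff[OF G'(1)] by simp
  moreover have "((\<lambda>t. H (1\<^sub>m n + t \<cdot>\<^sub>m X) - F (1\<^sub>m n + t \<cdot>\<^sub>m X)) has_field_derivative d - dlin n F X) (at 0)"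
    by (intro DERIV_diff H(3) dlin_line[OF reg_regular[OF F(1)] Xc])
  ultimately show "d = dlin n F X" using DERIV_unique[OF dlin_line[OF r Xc]] by fastforce
qed

lemma dpi_entry: "X \<in> \<gg> \<Longrightarrow> i < m \<Longrightarrow> j < m \<Longrightarrow> d\<pi> X $$ (i, j) = dlin n (coef i j) X"
  unfolding rep_differential_def using differential_eq[OF coef(1) coef(3)] by simp

lemma dpi_carrier [simp]: "d\<pi> X \<in> carrier_mat m m"
  by (simp add: rep_differential_def)

lemma lie_closed:
  "0\<^sub>m n n \<in> \<gg>" "X \<in> \<gg> \<Longrightarrow> Y \<in> \<gg> \<Longrightarrow> X + Y \<in> \<gg>" "X \<in> \<gg> \<Longrightarrow> a \<cdot>\<^sub>m X \<in> \<gg>"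
  using lie_subspace[OF G'(1)] unfolding subspace_mat_def by auto

lemma dpi_add: "X \<in> \<gg> \<Longrightarrow> Y \<in> \<gg> \<Longrightarrow> d\<pi> (X + Y) = d\<pi> X + d\<pi> Y"
  by (rule sq_eqI[of _ m])
    (auto simp: dpi_entry lie_closed dlin_add lie_carrier carrier_matD[OF dpi_carrier])

lemma dpi_smult: "X \<in> \<gg> \<Longrightarrow> d\<pi> (a \<cdot>\<^sub>m X) = a \<cdot>\<^sub>m d\<pi> X"
  by (rule sq_eqI[of _ m])
    (auto simp: dpi_entry lie_closed dlin_smult lie_carrier carrier_matD[OF dpi_carrier])

lemma dpi_zero: "d\<pi> (0\<^sub>m n n) = 0\<^sub>m m m"
  by (rule sq_eqI[of _ m]) (auto simp: dpi_entry lie_closed dlin_def)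

lemma mderiv_pi:
  assumes c: "\<And>s. c s \<in> G" "c t = 1\<^sub>m n" "mderiv n c X t" and X: "X \<in> \<gg>"
  shows "mderiv m (\<lambda>s. \<pi> (c s)) (d\<pi> X) t"
proof (rule mderivI)
  fix i j assume ij: "i < m" "j < m"
  have "c s \<in> carrier_mat n n" for s using c(1) G'(1) GL_carrier by blast
  from dlin_curve[OF coef(2)[OF ij] this c(2,3)]
  show "((\<lambda>s. \<pi> (c s) $$ (i, j)) has_field_derivative d\<pi> X $$ (i, j)) (at t)"
    by (simp add: coef(3)[OF ij c(1)] dpi_entry[OF X ij])
qed

text \<open>The derivative at 0 is moved to \<open>t\<close> by writing \<open>c s\<close> as
  \<open>c t * c (s - t)\<close>.\<close>

lemma one_param_pi:
  assumes X: "X \<in> \<gg>" and c: "one_param n X c"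
  shows "one_param m (d\<pi> X) (\<lambda>t. \<pi> (c t))"
  unfolding one_param_def
proof (intro conjI allI)
  note cG = one_param_in_group[OF G X c] and Xc = lie_carrier[OF X]
  show "\<pi> (c t) \<in> carrier_mat m m" for t using cG pi_carrier by blast
  show "\<pi> (c 0) = 1\<^sub>m m" using pi_one one_paramD(2)[OF c] by simp
  fix t
  have 0: "mderiv n c X 0" using one_paramD(3)[OF c, of 0] one_paramD(2)[OF c] Xc by simp
  have 1: "mderiv m (\<lambda>s. \<pi> (c s)) (d\<pi> X) 0" by (rule mderiv_pi) (use cG X one_paramD(2)[OF c] 0 in auto)
  have "((\<lambda>s::complex. s - t) has_field_derivative 1) (at t)" by (auto intro!: derivative_eq_intros)
  from mderiv_comp[of m "\<lambda>s. \<pi> (c s)" _ "\<lambda>s. s - t", OF _ this dpi_carrier, of X] 1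
  have 2: "mderiv m (\<lambda>s. \<pi> (c (s - t))) (d\<pi> X) t" by (simp add: one_smult)
  have "mderiv m (\<lambda>s. \<pi> (c t) * \<pi> (c (s - t))) (\<pi> (c t) * d\<pi> X) t"
    by (rule mderiv_mult_left[OF _ _ dpi_carrier 2]) (use cG pi_carrier in auto)
  moreover have "\<pi> (c t) * \<pi> (c (s - t)) = \<pi> (c s)" for s
    using pi_mult[OF cG cG, of t "s - t"] one_param_add[OF Xc c, of t "s - t"] by simp
  ultimately show "mderiv m (\<lambda>s. \<pi> (c s)) (\<pi> (c t) * d\<pi> X) t" by simp
qed

lemma dpi_Ad:
  assumes X: "X \<in> \<gg>" and g: "g \<in> G"
  shows "d\<pi> (g * X * minv g) = \<pi> g * d\<pi> X * minv (\<pi> g)"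
proof -
  note Xc = lie_carrier[OF X]
  have gG: "g \<in> carrier (GL n)" using g G'(1) by auto
  obtain c where c: "one_param n X c" using one_param_exists[OF Xc] by blast
  note cG = one_param_in_group[OF G X c]
  have "one_param m (d\<pi> (g * X * minv g)) (\<lambda>t. \<pi> (g * c t * minv g))"
    by (rule one_param_pi[OF lie_Ad[OF G X g] one_param_conj[OF Xc c gG]])
  moreover have "\<pi> (g * c t * minv g) = \<pi> g * \<pi> (c t) * minv (\<pi> g)" for t
    using pi_mult G' g cG pi_minv by simp
  ultimately have "one_param m (d\<pi> (g * X * minv g)) (\<lambda>t. \<pi> g * \<pi> (c t) * minv (\<pi> g))" by simp
  moreover have "one_param m (\<pi> g * d\<pi> X * minv (\<pi> g)) (\<lambda>t. \<pi> g * \<pi> (c t) * minv (\<pi> g))"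
    by (rule one_param_conj[OF dpi_carrier one_param_pi[OF X c] pi_GL[OF g]])
  ultimately show ?thesis
    by (rule one_param_generator_unique)
      (use pi_carrier[OF g] GL_carrier[OF minv(1)[OF pi_GL[OF g]]] in \<open>auto intro!: sq_mult_closed\<close>)
qed

text \<open>Both sides are the derivative at 0 of
  \<open>\<pi> (c t) * d\<pi> Y * \<pi> (c (- t))\<close>, read once as the image of the adjoint
  action in \<open>G\<close> and once as the adjoint action in the general linear group.\<close>

lemma dpi_bracket:
  assumes X: "X \<in> \<gg>" and Y: "Y \<in> \<gg>"
  shows "d\<pi> (bracket X Y) = bracket (d\<pi> X) (d\<pi> Y)"
proof -
  note Xc = lie_carrier[OF X] and Yc = lie_carrier[OF Y]
  obtain c where c: "one_param n X c" using one_param_exists[OF Xc] by blast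
  note cG = one_param_in_group[OF G X c]
  have Ad: "c t * Y * c (- t) \<in> \<gg>" "d\<pi> (c t * Y * c (- t)) = \<pi> (c t) * d\<pi> Y * \<pi> (c (- t))" for t
    using lie_Ad[OF G Y cG, of t] dpi_Ad[OF Y cG, of t] one_param_inverse(2)[OF Xc c] pi_minv[OF cG, of t] by auto
  have 1: "mderiv m (\<lambda>t. \<pi> (c t) * d\<pi> Y * \<pi> (c (- t))) (d\<pi> (bracket X Y)) 0"
  proof (rule mderivI)
    fix i j assume ij: "i < m" "j < m"
    have "((\<lambda>t. dlin n (coef i j) (c t * Y * c (- t))) has_field_derivative dlin n (coef i j) (bracket X Y)) (at 0)"
      by (rule dlin_mderiv[OF mderiv_Ad[OF Xc Yc c]])
    then show "((\<lambda>t. (\<pi> (c t) * d\<pi> Y * \<pi> (c (- t))) $$ (i, j)) has_field_derivative d\<pi> (bracket X Y) $$ (i, j)) (at 0)"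
      unfolding dpi_entry[OF Ad(1) ij, symmetric] dpi_entry[OF lie_bracket[OF G X Y] ij, symmetric] Ad(2) .
  qed
  have 2: "mderiv m (\<lambda>t. \<pi> (c t) * d\<pi> Y * \<pi> (c (- t))) (bracket (d\<pi> X) (d\<pi> Y)) 0"
    using mderiv_Ad[OF dpi_carrier dpi_carrier one_param_pi[OF X c]] .
  show ?thesis by (rule mderiv_unique[OF 1 2]) (simp_all add: bracket_carrier)
qed

section \<open>The radical of the trace form\<close>

definition "trace_radical = {X \<in> \<gg>. \<forall>Y\<in>\<gg>. trace_mat (d\<pi> X * d\<pi> Y) = 0}"

text \<open>\<open>\<pi>\<close> carries the Jordan curve of \<open>X\<close> to that of
  \<open>d\<pi> X\<close>, and by linear independence also the conjugate curve to the conjugate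
  curve. So \<open>d\<pi> ?Y\<close> is the conjugate semisimple part of \<open>d\<pi> X\<close>,
  and the vanishing trace is the sum of the squared moduli of the eigenvalues of
  \<open>d\<pi> X\<close>. Faithfulness then makes \<open>?Y\<close> zero, so that \<open>X\<close>
  has no nonzero eigenvalue.\<close>

theorem trace_radical_nilpotent:
  assumes faithful: "locally_faithful n G m \<pi>" and X: "X \<in> trace_radical"
  shows "X ^\<^sub>m n = 0\<^sub>m n n"
proof -
  have Xg: "X \<in> \<gg>" and rad: "\<And>Y. Y \<in> \<gg> \<Longrightarrow> trace_mat (d\<pi> X * d\<pi> Y) = 0" using X by (auto simp: trace_radical_def)
  note Xc = lie_carrier[OF Xg]
  obtain P Q l N where j: "jdec n P Q l N" and Xj: "X = P * (diagm n l + N) * Q"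
    using jdec_exists[OF Xc] by blast
  obtain P' Q' l' N' where j': "jdec m P' Q' l' N'" and Xj': "d\<pi> X = P' * (diagm m l' + N') * Q'"
    using jdec_exists[OF dpi_carrier] by blast
  let ?c = "jcurve n P Q l N" and ?c' = "jcurve m P' Q' l' N'"
  let ?s = "sscurve n P Q l" and ?s' = "sscurve m P' Q' l'"
  have c: "one_param n X ?c" using one_param_jcurve[OF j] Xj by simp
  have c': "one_param m (d\<pi> X) ?c'" using one_param_jcurve[OF j'] Xj' by simp
  have pc: "\<pi> (?c t) = ?c' t" for t
    by (rule one_param_unique[OF dpi_carrier one_param_pi[OF Xg c] c'])
  note cG = one_param_in_group[OF G Xg c]
  let ?Y = "ssconj n P Q l"
  note s = one_param_sscurve[OF j] and Yc = ssconj_carrier[OF j]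
  obtain S where S: "S \<subseteq> regular_funs n" "G = {g \<in> carrier (GL n). \<forall>f\<in>S. f g = 0}"
    using G'(5) unfolding closedin_zariski by blast
  \<comment> \<open>An equation of \<open>G\<close> vanishes along the curve of \<open>X\<close>,
    hence also along its conjugate partner.\<close>
  have sG: "?s t \<in> G" for t
  proof -
    have "f (?s t) = 0" if "f \<in> S" for f
      by (rule ep_zero[OF ep_regular[OF j]]) (use that S cG in auto)
    then show ?thesis using one_param_inverse(1)[OF Yc s] S by auto
  qed
  have Y: "?Y \<in> \<gg>" by (rule lieI_one_param[OF G'(1) Yc s sG])
  \<comment> \<open>A coefficient of \<open>\<pi>\<close> along the curve of \<open>X\<close> is the
    first member of two pairs, one from \<open>n\<close> by \<open>n\<close> and one from
    \<open>m\<close> by \<open>m\<close> matrices; their second members must agree.\<close>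
  have ps: "\<pi> (?s t) = ?s' t" for t
  proof (rule sq_eqI[of _ m])
    fix i k assume ik: "i < m" "k < m"
    have "coef i k (?s t) = ?s' t $$ (i, k)"
      by (rule ep_eq[OF ep_regular[OF j coef(1)[OF ik]] ep_jcurve_entry[OF j' ik]]) (simp add: coef(3)[OF ik cG] pc)
    then show "\<pi> (?s t) $$ (i, k) = ?s' t $$ (i, k)" by (simp add: coef(3)[OF ik sG])
  qed (use pi_carrier[OF sG] one_paramD(1)[OF one_param_sscurve[OF j']] in auto)
  have dY: "d\<pi> ?Y = ssconj m P' Q' l'"
    using one_param_generator_unique[OF _ one_param_sscurve[OF j'] dpi_carrier ssconj_carrier[OF j']] one_param_pi[OF Y s]
    by (simp add: ps)
  have "(\<Sum>i<m. l' i * cnj (l' i)) = 0"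
    using rad[OF Y] trace_ssconj[OF j'] unfolding dY Xj'[symmetric] by simp
  then have "complex_of_real (\<Sum>i<m. (cmod (l' i))\<^sup>2) = 0"
    unfolding of_real_sum complex_norm_square .
  then have "(\<Sum>i<m. (cmod (l' i))\<^sup>2) = 0" by (simp only: of_real_eq_0_iff)
  then have l': "l' i = 0" if "i < m" for i using that by (simp add: sum_nonneg_eq_0_iff)
  have "ssconj m P' Q' l' = 0\<^sub>m m m"
  proof -
    have "diagm m (\<lambda>i. cnj (l' i)) = 0\<^sub>m m m" by (rule sq_eqI[of _ m]) (auto simp: diagm_entry l')
    then show ?thesis unfolding ssconj_def using jdecD(1,2)[OF j']
      by (simp add: right_mult_zero_mat[OF jdecD(1)[OF j']] left_mult_zero_mat[OF jdecD(2)[OF j']])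
  qed
  then have "d\<pi> ?Y = d\<pi> (0\<^sub>m n n)" using dY dpi_zero by simp
  then have "?Y = 0\<^sub>m n n"
    using faithful Y lie_closed(1) unfolding locally_faithful_def inj_on_def by blast
  then have "l i = 0" if "i < n" for i using ssconj_zero[OF j _ that] by blast
  then show ?thesis using jdec_nilpotent[OF j] Xj by simp
qed

end

section \<open>Duality for subspaces of matrices\<close>

text \<open>Matrices of size \<open>n\<close> are only a subset of their type, whereas functions on
  index pairs form a vector space as a whole. Linear algebra is done there and carried back along
  \<open>emb\<close> and \<open>unemb\<close>.\<close>

definition fscale :: "complex \<Rightarrow> (nat \<times> nat \<Rightarrow> complex) \<Rightarrow> nat \<times> nat \<Rightarrow> complex" where
  "fscale c f = (\<lambda>p. c * f p)"

interpretation fs: vector_space fscale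
  by unfold_locales (auto simp: fscale_def fun_eq_iff algebra_simps)

lemma vector_space_complex: "vector_space ((*) :: complex \<Rightarrow> complex \<Rightarrow> complex)"
  by unfold_locales (auto simp: algebra_simps)

interpretation cs: vector_space "(*) :: complex \<Rightarrow> complex \<Rightarrow> complex"
  by (rule vector_space_complex)

interpretation fc: vector_space_pair fscale "(*) :: complex \<Rightarrow> complex \<Rightarrow> complex"
  by unfold_locales

interpretation ff: vector_space_pair fscale fscale
  by unfold_locales

definition emb :: "nat \<Rightarrow> complex mat \<Rightarrow> nat \<times> nat \<Rightarrow> complex" where
  "emb n X = (\<lambda>p. if p \<in> idx n then X $$ p else 0)"

definition unemb :: "nat \<Rightarrow> (nat \<times> nat \<Rightarrow> complex) \<Rightarrow> complex mat" where
  "unemb n f = mat n n f"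

definition delta :: "nat \<times> nat \<Rightarrow> nat \<times> nat \<Rightarrow> complex" where
  "delta p = (\<lambda>q. if q = p then 1 else 0)"

text \<open>The trace of the transpose of \<open>A\<close> times \<open>X\<close>; it lets matrices
  serve as covectors, such as gradients.\<close>

definition pairing :: "nat \<Rightarrow> complex mat \<Rightarrow> complex mat \<Rightarrow> complex" where
  "pairing n A X = (\<Sum>p\<in>idx n. A $$ p * X $$ p)"

lemma unemb_carrier [simp]: "unemb n f \<in> carrier_mat n n"
  by (simp add: unemb_def)

lemma unemb_emb: "X \<in> carrier_mat n n \<Longrightarrow> unemb n (emb n X) = X"
  by (rule eq_matI) (auto simp: unemb_def emb_def)

lemma unemb_entry: "p \<in> idx n \<Longrightarrow> unemb n f $$ p = f p"
  by (auto simp: unemb_def)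

lemma emb_add: "X \<in> carrier_mat n n \<Longrightarrow> Y \<in> carrier_mat n n \<Longrightarrow> emb n (X + Y) = emb n X + emb n Y"
  by (auto simp: emb_def fun_eq_iff)

lemma emb_smult: "X \<in> carrier_mat n n \<Longrightarrow> emb n (a \<cdot>\<^sub>m X) = fscale a (emb n X)"
  by (auto simp: emb_def fscale_def fun_eq_iff)

lemma emb_inj: "X \<in> carrier_mat n n \<Longrightarrow> Y \<in> carrier_mat n n \<Longrightarrow> emb n X = emb n Y \<Longrightarrow> X = Y"
  by (metis unemb_emb)

lemma unemb_add: "unemb n (f + g) = unemb n f + unemb n g"
  by (rule eq_matI) (auto simp: unemb_def)

lemma unemb_smult: "unemb n (fscale a f) = a \<cdot>\<^sub>m unemb n f"
  by (rule eq_matI) (auto simp: unemb_def fscale_def)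

lemma sum_fun_apply: "(\<Sum>i\<in>A. f i) x = (\<Sum>i\<in>A. f i x)" for f :: "'b \<Rightarrow> 'c \<Rightarrow> complex"
  by (induction A rule: infinite_finite_induct) auto

lemma emb_expand: "emb n X = (\<Sum>p\<in>idx n. fscale (X $$ p) (delta p))"
proof
  fix q
  have "(\<Sum>p\<in>idx n. fscale (X $$ p) (delta p)) q = (\<Sum>p\<in>idx n. if p = q then X $$ p else 0)"
    unfolding sum_fun_apply by (intro sum.cong) (auto simp: fscale_def delta_def)
  also have "\<dots> = emb n X q" by (subst sum.delta) (auto simp: emb_def)
  finally show "emb n X q = (\<Sum>p\<in>idx n. fscale (X $$ p) (delta p)) q" ..
qed

lemma subspace_emb:
  assumes S: "subspace_mat n S" shows "fs.subspace (emb n ` S)"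
proof (rule fs.subspaceI)
  have c: "S \<subseteq> carrier_mat n n" "0\<^sub>m n n \<in> S" using S by (auto simp: subspace_mat_def)
  have "emb n (0\<^sub>m n n) = 0" by (auto simp: emb_def fun_eq_iff)
  then show "0 \<in> emb n ` S" using c by force
  fix f g assume "f \<in> emb n ` S" "g \<in> emb n ` S"
  then obtain X Y where XY: "X \<in> S" "Y \<in> S" "f = emb n X" "g = emb n Y" by blast
  then show "f + g \<in> emb n ` S"
    using S emb_add[OF subsetD[OF c(1)] subsetD[OF c(1)], of X Y]
    by (intro image_eqI[of _ _ "X + Y"]) (auto simp: subspace_mat_def)
next
  fix a f assume "f \<in> emb n ` S"
  then obtain X where "X \<in> S" "f = emb n X" by blast
  then show "fscale a f \<in> emb n ` S"
    using S emb_smult[of X n a] by (intro image_eqI[of _ _ "a \<cdot>\<^sub>m X"]) (auto simp: subspace_mat_def)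
qed

lemma fc_linear_expand:
  assumes "Vector_Spaces.linear fscale (*) g"
  shows "g (emb n X) = (\<Sum>p\<in>idx n. X $$ p * g (delta p))"
  unfolding emb_expand fc.linear_sum[OF assms] fc.linear_scale[OF assms] ..

text \<open>A basis of \<open>S\<close> extended by \<open>v\<close> admits a linear form that is 0
  on \<open>S\<close> and 1 at \<open>v\<close>; the matrix \<open>A\<close> lists its values on the
  unit matrices.\<close>

lemma double_annihilator:
  assumes S: "subspace_mat n S" and v: "v \<in> carrier_mat n n" "v \<notin> S"
  shows "\<exists>A\<in>carrier_mat n n. (\<forall>X\<in>S. pairing n A X = 0) \<and> pairing n A v \<noteq> 0"
proof -
  note sub = subspace_emb[OF S]
  have Sc: "S \<subseteq> carrier_mat n n" using S by (auto simp: subspace_mat_def)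
  obtain B where B: "B \<subseteq> emb n ` S" "fs.independent B" "emb n ` S \<subseteq> fs.span B"
    using fs.maximal_independent_subset[of "emb n ` S"] by blast
  have "fs.span B \<subseteq> emb n ` S" using fs.span_minimal[OF B(1) sub] .
  moreover have "emb n v \<notin> emb n ` S" using emb_inj v Sc by blast
  ultimately have "emb n v \<notin> fs.span B" by blast
  then have ind: "fs.independent (insert (emb n v) B)" using B(2) by (rule fs.independent_insertI)
  obtain g where g: "Vector_Spaces.linear fscale (*) g" "\<forall>x\<in>insert (emb n v) B. g x = (if x = emb n v then 1 else 0)"
    using fc.linear_independent_extend[OF ind, of "\<lambda>x. if x = emb n v then 1 else 0"] by blast
  have gB: "g b = 0" if "b \<in> B" for b using g(2) that \<open>emb n v \<notin> fs.span B\<close> fs.span_base by auto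
  have gS: "g x = 0" if "x \<in> emb n ` S" for x
    using fc.linear_eq_0_on_span[OF g(1) gB] B(3) that by blast
  define A where "A = unemb n (\<lambda>p. g (delta p))"
  have pA: "pairing n A X = g (emb n X)" for X
    unfolding pairing_def fc_linear_expand[OF g(1)] A_def
    by (intro sum.cong refl) (simp add: unemb_entry mult.commute)
  show ?thesis
  proof (intro bexI[of _ A] conjI ballI)
    show "A \<in> carrier_mat n n" by (simp add: A_def)
    show "pairing n A v \<noteq> 0" using g(2) by (simp add: pA)
    show "pairing n A X = 0" if "X \<in> S" for X using gS that by (simp add: pA)
  qed
qed

text \<open>Serves to extend linear forms from \<open>S\<close> to all matrices in
  \<open>riesz\<close>, and to build the vector field in \<open>vanishing_near_one\<close>.\<close>

lemma subspace_projection: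
  assumes S: "subspace_mat n S"
  shows "\<exists>p. Vector_Spaces.linear fscale fscale p \<and> (\<forall>f. unemb n (p f) \<in> S) \<and> (\<forall>X\<in>S. unemb n (p (emb n X)) = X)"
proof -
  note sub = subspace_emb[OF S]
  have Sc: "S \<subseteq> carrier_mat n n" using S by (auto simp: subspace_mat_def)
  obtain B where B: "B \<subseteq> emb n ` S" "fs.independent B" "emb n ` S \<subseteq> fs.span B"
    using fs.maximal_independent_subset[of "emb n ` S"] by blast
  have BS: "fs.span B \<subseteq> emb n ` S" using fs.span_minimal[OF B(1) sub] .
  let ?p = "ff.construct B id"
  have lin: "Vector_Spaces.linear fscale fscale ?p" by (rule ff.linear_construct[OF B(2)])
  have "?p f \<in> fs.span (id ` B)" for f by (rule ff.construct_in_span[OF B(2)])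
  then have r: "?p f \<in> emb n ` S" for f using BS by auto
  have "?p x = x" if "x \<in> fs.span B" for x
    using ff.linear_eq_on[OF lin fs.linear_id that] ff.construct_basis[OF B(2)] by auto
  then have id: "?p x = x" if "x \<in> emb n ` S" for x using B(3) that by blast
  show ?thesis
  proof (intro exI[of _ ?p] conjI allI ballI lin)
    show "unemb n (?p f) \<in> S" for f using r[of f] unemb_emb Sc by force
    show "unemb n (?p (emb n X)) = X" if "X \<in> S" for X using id unemb_emb Sc that by force
  qed
qed

text \<open>The forms \<open>b X\<close> make up a subspace \<open>T\<close> of the covectors. A
  form outside \<open>T\<close> would be separated from it by some \<open>C\<close>, whose
  projection to \<open>S\<close> lies in the radical of \<open>b\<close> and hence is zero. This
  replaces a count of dimensions.\<close>

lemma riesz: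
  assumes S: "subspace_mat n S"
    and badd1: "\<And>X Y Z. X \<in> S \<Longrightarrow> Y \<in> S \<Longrightarrow> Z \<in> S \<Longrightarrow> b (X + Y) Z = b X Z + b Y Z"
    and bscale1: "\<And>a X Y. X \<in> S \<Longrightarrow> Y \<in> S \<Longrightarrow> b (a \<cdot>\<^sub>m X) Y = a * b X Y"
    and badd2: "\<And>X Y Z. X \<in> S \<Longrightarrow> Y \<in> S \<Longrightarrow> Z \<in> S \<Longrightarrow> b X (Y + Z) = b X Y + b X Z"
    and bscale2: "\<And>a X Y. X \<in> S \<Longrightarrow> Y \<in> S \<Longrightarrow> b X (a \<cdot>\<^sub>m Y) = a * b X Y"
    and nondeg: "\<And>Y. Y \<in> S \<Longrightarrow> (\<And>X. X \<in> S \<Longrightarrow> b X Y = 0) \<Longrightarrow> Y = 0\<^sub>m n n"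
    and padd: "\<And>X Y. X \<in> S \<Longrightarrow> Y \<in> S \<Longrightarrow> \<phi> (X + Y) = \<phi> X + \<phi> Y"
    and pscale: "\<And>a X. X \<in> S \<Longrightarrow> \<phi> (a \<cdot>\<^sub>m X) = a * \<phi> X"
  shows "\<exists>X\<in>S. \<forall>Y\<in>S. b X Y = (\<phi> Y :: complex)"
proof -
  have Sc: "S \<subseteq> carrier_mat n n" and S0: "0\<^sub>m n n \<in> S"
    and Sadd: "\<And>X Y. X \<in> S \<Longrightarrow> Y \<in> S \<Longrightarrow> X + Y \<in> S" and Ssc: "\<And>a X. X \<in> S \<Longrightarrow> a \<cdot>\<^sub>m X \<in> S"
    using S by (auto simp: subspace_mat_def)
  obtain p where p: "Vector_Spaces.linear fscale fscale p" "\<And>f. unemb n (p f) \<in> S"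
    "\<And>X. X \<in> S \<Longrightarrow> unemb n (p (emb n X)) = X"
    using subspace_projection[OF S] by blast
  define q where "q f = unemb n (p f)" for f
  have qS: "q f \<in> S" for f unfolding q_def by (rule p(2))
  have qadd: "q (f + g) = q f + q g" for f g
    unfolding q_def ff.linear_add[OF p(1)] by (rule unemb_add)
  have qsc: "q (fscale a f) = a \<cdot>\<^sub>m q f" for a f
    unfolding q_def ff.linear_scale[OF p(1)] by (rule unemb_smult)
  have linear: "Vector_Spaces.linear fscale (*) (\<lambda>f. L (q f))"
    if "\<And>X Y. X \<in> S \<Longrightarrow> Y \<in> S \<Longrightarrow> L (X + Y) = L X + L Y" "\<And>a X. X \<in> S \<Longrightarrow> L (a \<cdot>\<^sub>m X) = a * L X"
    for L :: "complex mat \<Rightarrow> complex"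
    unfolding Vector_Spaces.linear_iff
    by (simp add: qadd qsc that qS fs.vector_space_axioms vector_space_complex)
  \<comment> \<open>Encodes a linear form on \<open>S\<close>, extended through the projection
    \<open>q\<close>, as the matrix of its values on the unit matrices.\<close>
  define M where "M L = unemb n (\<lambda>r. L (q (delta r)))" for L :: "complex mat \<Rightarrow> complex"
  have pM: "pairing n C (M L) = L (q (emb n C))"
    if "\<And>X Y. X \<in> S \<Longrightarrow> Y \<in> S \<Longrightarrow> L (X + Y) = L X + L Y" "\<And>a X. X \<in> S \<Longrightarrow> L (a \<cdot>\<^sub>m X) = a * L X" for L C
  proof -
    have "(\<lambda>f. L (q f)) (emb n C) = (\<Sum>r\<in>idx n. C $$ r * L (q (delta r)))"
      by (rule fc_linear_expand[OF linear]) (use that in auto)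
    then show ?thesis unfolding pairing_def M_def by (simp add: unemb_entry)
  qed
  define T where "T = (\<lambda>X. M (b X)) ` S"
  have Mb_add: "M (b (X + Y)) = M (b X) + M (b Y)" if "X \<in> S" "Y \<in> S" for X Y
    unfolding M_def unemb_add[symmetric] by (rule arg_cong[of _ _ "unemb n"]) (use that badd1 qS in auto)
  have Mb_sc: "M (b (a \<cdot>\<^sub>m X)) = a \<cdot>\<^sub>m M (b X)" if "X \<in> S" for a X
    unfolding M_def unemb_smult[symmetric] by (rule arg_cong[of _ _ "unemb n"]) (use that bscale1 qS in \<open>auto simp: fscale_def\<close>)
  have T: "subspace_mat n T"
    unfolding subspace_mat_def
  proof (intro conjI ballI allI)
    show "T \<subseteq> carrier_mat n n" by (auto simp: T_def M_def)
    have "0\<^sub>m n n = 0 \<cdot>\<^sub>m (0\<^sub>m n n :: complex mat)" by simp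
    then have "b (0\<^sub>m n n) Y = 0" if "Y \<in> S" for Y using bscale1[OF S0 that, of 0] by simp
    then have "M (b (0\<^sub>m n n)) = 0\<^sub>m n n" using qS by (intro eq_matI) (auto simp: M_def unemb_def)
    then show "0\<^sub>m n n \<in> T" using S0 unfolding T_def by force
    fix A B assume "A \<in> T" "B \<in> T"
    then obtain X Y where "X \<in> S" "Y \<in> S" "A = M (b X)" "B = M (b Y)" unfolding T_def by blast
    then show "A + B \<in> T" using Mb_add Sadd[of X Y] unfolding T_def by (intro image_eqI[of _ _ "X + Y"]) auto
  next
    fix a A assume "A \<in> T"
    then obtain X where "X \<in> S" "A = M (b X)" unfolding T_def by blast
    then show "a \<cdot>\<^sub>m A \<in> T" using Mb_sc Ssc[of X a] unfolding T_def by (intro image_eqI[of _ _ "a \<cdot>\<^sub>m X"]) auto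
  qed
  have "M \<phi> \<in> T"
  proof (rule ccontr)
    assume "M \<phi> \<notin> T"
    then obtain C where C: "C \<in> carrier_mat n n" "\<And>A. A \<in> T \<Longrightarrow> pairing n C A = 0" "pairing n C (M \<phi>) \<noteq> 0"
      using double_annihilator[OF T, of "M \<phi>"] by (auto simp: M_def)
    have "b X (q (emb n C)) = 0" if "X \<in> S" for X
      using pM[of "b X" C] badd2 bscale2 that C(2)[of "M (b X)"] by (auto simp: T_def)
    then have "q (emb n C) = 0\<^sub>m n n" using nondeg[OF qS] by blast
    moreover have "\<phi> (0\<^sub>m n n) = 0" using pscale[OF S0, of 0] by simp
    ultimately show False using C(3) pM[of \<phi> C] padd pscale by simp
  qed
  then obtain X where X: "X \<in> S" "M \<phi> = M (b X)" unfolding T_def by blast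
  show ?thesis
  proof (intro bexI[of _ X] ballI X(1))
    fix Y assume Y: "Y \<in> S"
    have "q (emb n Y) = Y" unfolding q_def by (rule p(3)[OF Y])
    then show "b X Y = \<phi> Y"
      using pM[of \<phi> Y] padd pscale pM[of "b X" Y] badd2 bscale2 X by simp
  qed
qed

text \<open>Dimension is measured by a basis \<open>B\<close> of the embedded subspace and bounded
  by the number of unit matrices, so some subspace with \<open>P\<close> has greatest dimension.
  This stands in for an induction on dimension in Engel's theorem.\<close>

lemma maximal_extension:
  assumes P0: "P {0\<^sub>m n n}" and sub: "\<And>M. P M \<Longrightarrow> subspace_mat n M"
  shows "\<exists>M. P M \<and> (\<forall>x\<in>carrier_mat n n. x \<notin> M \<longrightarrow> \<not> P {m + a \<cdot>\<^sub>m x | m a. m \<in> M})"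
proof -
  define D where "D = delta ` idx n"
  have fD: "finite D" unfolding D_def by simp
  have embD: "emb n X \<in> fs.span D" for X
    unfolding emb_expand D_def by (intro fs.span_sum fs.span_scale fs.span_base imageI)
  define ok where "ok B M \<longleftrightarrow> P M \<and> finite B \<and> fs.independent B \<and> fs.span B = emb n ` M" for B M
  have bound: "card B \<le> card D" if "ok B M" for B M
  proof -
    have "fs.span B \<subseteq> fs.span D" using that embD unfolding ok_def by auto
    then have "B \<subseteq> fs.span D" using fs.span_superset[of B] by blast
    then show ?thesis using fs.independent_span_bound[OF fD] that unfolding ok_def by blast
  qed
  have ok0: "ok {} {0\<^sub>m n n}"
    unfolding ok_def using P0 by (auto simp: emb_def fun_eq_iff fs.independent_empty)
  define Q where "Q k \<longleftrightarrow> (\<exists>B M. ok B M \<and> card B = k)" for k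
  have "Q 0" unfolding Q_def by (intro exI[of _ "{}"] exI[of _ "{0\<^sub>m n n}"] conjI ok0) simp
  moreover have "\<forall>k. Q k \<longrightarrow> k \<le> card D" unfolding Q_def using bound by blast
  ultimately have "\<exists>k. Q k \<and> (\<forall>j. Q j \<longrightarrow> j \<le> k)"
    by (rule Nat.ex_has_greatest_nat)
  then obtain B M where BM: "ok B M" and max: "\<And>B' M'. ok B' M' \<Longrightarrow> card B' \<le> card B"
    unfolding Q_def by blast
  have M: "P M" "finite B" "fs.independent B" "fs.span B = emb n ` M" using BM by (auto simp: ok_def)
  have Mc: "M \<subseteq> carrier_mat n n" using sub[OF M(1)] by (auto simp: subspace_mat_def)
  show ?thesis
  proof (intro exI[of _ M] conjI ballI impI notI M(1))
    fix x assume x: "x \<in> carrier_mat n n" "x \<notin> M" and P: "P {m + a \<cdot>\<^sub>m x | m a. m \<in> M}"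
    let ?M = "{m + a \<cdot>\<^sub>m x | m a. m \<in> M}"
    have nx: "emb n x \<notin> fs.span B" unfolding M(4) using emb_inj x Mc by blast
    have ind: "fs.independent (insert (emb n x) B)" by (rule fs.independent_insertI[OF nx M(3)])
    have "fs.span (insert (emb n x) B) = emb n ` ?M"
    proof (intro equalityI subsetI)
      fix f assume "f \<in> fs.span (insert (emb n x) B)"
      then obtain a where "f - fscale a (emb n x) \<in> fs.span B" using fs.span_breakdown_eq by blast
      then obtain m where m: "m \<in> M" "f - fscale a (emb n x) = emb n m" unfolding M(4) by blast
      have "f = (f - fscale a (emb n x)) + fscale a (emb n x)" by simp
      also have "\<dots> = emb n (m + a \<cdot>\<^sub>m x)" using m Mc x by (subst emb_add) (auto simp: emb_smult)
      finally show "f \<in> emb n ` ?M" using m(1) by blast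
    next
      fix f assume "f \<in> emb n ` ?M"
      then obtain m a where m: "m \<in> M" "f = emb n (m + a \<cdot>\<^sub>m x)" by blast
      have f: "f = emb n m + fscale a (emb n x)" unfolding m(2) using m(1) Mc x
        by (subst emb_add) (auto simp: emb_smult)
      have "emb n m \<in> fs.span B" using m(1) M(4) by blast
      then have "emb n m \<in> fs.span (insert (emb n x) B)" using fs.span_mono[of B "insert (emb n x) B"] by blast
      then show "f \<in> fs.span (insert (emb n x) B)"
        unfolding f by (rule fs.span_add[OF _ fs.span_scale[OF fs.span_base]]) simp
    qed
    then have "ok (insert (emb n x) B) ?M" using P M ind by (simp add: ok_def)
    then have "card (insert (emb n x) B) \<le> card B" by (rule max)
    moreover have "emb n x \<notin> B" using nx fs.span_base by blast
    ultimately show False using M(2) by simp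
  qed
qed

section \<open>Engel's theorem\<close>

definition mprod :: "nat \<Rightarrow> complex mat list \<Rightarrow> complex mat" where
  "mprod n w = foldr (\<lambda>a b. a * b) w (1\<^sub>m n)"

lemma mprod_simps [simp]: "mprod n [] = 1\<^sub>m n" "mprod n (a # w) = a * mprod n w"
  by (auto simp: mprod_def)

lemma mprod_carrier: "set w \<subseteq> carrier_mat n n \<Longrightarrow> mprod n w \<in> carrier_mat n n"
  by (induction w) (auto intro: sq_mult_closed)

lemma mprod_append:
  "set u \<subseteq> carrier_mat n n \<Longrightarrow> set v \<subseteq> carrier_mat n n \<Longrightarrow> mprod n (u @ v) = mprod n u * mprod n v"
  by (induction u) (auto simp: left_mult_one_mat[OF mprod_carrier] sq_assoc[OF _ mprod_carrier mprod_carrier])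

definition lie_subalgebra :: "nat \<Rightarrow> complex mat set \<Rightarrow> bool" where
  "lie_subalgebra n L \<longleftrightarrow> subspace_mat n L \<and> (\<forall>X\<in>L. \<forall>Y\<in>L. bracket X Y \<in> L)"

text \<open>The associative form of the conclusion of Engel's theorem, in place of a common kernel
  vector; it applies directly to products of exponentials.\<close>

definition nil_of_index :: "nat \<Rightarrow> nat \<Rightarrow> complex mat set \<Rightarrow> bool" where
  "nil_of_index n k L \<longleftrightarrow> (\<forall>w. set w \<subseteq> L \<and> length w = k \<longrightarrow> mprod n w = 0\<^sub>m n n)"

lemma nil_of_indexD:
  assumes k: "nil_of_index n k L" and L: "L \<subseteq> carrier_mat n n" and w: "set w \<subseteq> L" "k \<le> length w"
  shows "mprod n w = 0\<^sub>m n n"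
proof -
  have s: "set (take k w) \<subseteq> L" "set (drop k w) \<subseteq> L" using w set_take_subset set_drop_subset by fast+
  have "mprod n w = mprod n (take k w) * mprod n (drop k w)"
    using mprod_append[of "take k w" n "drop k w"] s L by auto
  also have "mprod n (take k w) = 0\<^sub>m n n" using k s w unfolding nil_of_index_def by auto
  finally show ?thesis using mprod_carrier[of "drop k w" n] s L by (simp add: left_mult_zero_mat)
qed

lemma subspaceD:
  assumes "subspace_mat n M"
  shows "M \<subseteq> carrier_mat n n" "0\<^sub>m n n \<in> M" "\<And>X Y. X \<in> M \<Longrightarrow> Y \<in> M \<Longrightarrow> X + Y \<in> M" "\<And>a X. X \<in> M \<Longrightarrow> a \<cdot>\<^sub>m X \<in> M"
  using assms by (auto simp: subspace_mat_def)

lemma bracket_add_left: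
  assumes "A \<in> carrier_mat n n" "B \<in> carrier_mat n n" "C \<in> carrier_mat n n"
  shows "bracket (A + B) C = bracket A C + bracket B C"
  unfolding bracket_def add_mult_distrib_mat[OF assms] mult_add_distrib_mat[OF assms(3,1,2)]
  using assms by (intro eq_matI) (auto simp del: index_mult_mat(1))

lemma bracket_add_right:
  assumes "A \<in> carrier_mat n n" "B \<in> carrier_mat n n" "C \<in> carrier_mat n n"
  shows "bracket C (A + B) = bracket C A + bracket C B"
  unfolding bracket_def add_mult_distrib_mat[OF assms] mult_add_distrib_mat[OF assms(3,1,2)]
  using assms by (intro eq_matI) (auto simp del: index_mult_mat(1))

lemma bracket_smult_right:
  assumes "A \<in> carrier_mat n n" "B \<in> carrier_mat n n"
  shows "bracket A (b \<cdot>\<^sub>m B) = b \<cdot>\<^sub>m bracket A B"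
  unfolding bracket_def mult_smult_distrib[OF assms] mult_smult_assoc_mat[OF assms(2,1)]
  using assms by (intro eq_matI) (auto simp: algebra_simps simp del: index_mult_mat(1))

lemma bracket_smult_swap:
  assumes "A \<in> carrier_mat n n" "B \<in> carrier_mat n n"
  shows "bracket (a \<cdot>\<^sub>m A) B = (- a) \<cdot>\<^sub>m bracket B A"
  unfolding bracket_def mult_smult_distrib[OF assms(2,1)] mult_smult_assoc_mat[OF assms]
  using assms by (intro eq_matI) (auto simp: algebra_simps simp del: index_mult_mat(1))

lemma bracket_multiples:
  assumes "A \<in> carrier_mat n n" shows "bracket (a \<cdot>\<^sub>m A) (b \<cdot>\<^sub>m A) = 0\<^sub>m n n"
  unfolding bracket_def mult_smult_distrib[OF smult_carrier_mat[OF assms] assms] mult_smult_assoc_mat[OF assms assms]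
  using assms by (intro eq_matI) (auto simp: algebra_simps simp del: index_mult_mat(1))

text \<open>A home for the \<open>r\<close>-fold iterated brackets with \<open>x\<close>. Closure
  under differences is all that \<open>m * a - a * m\<close> requires.\<close>

inductive_set conj_span :: "nat \<Rightarrow> complex mat set \<Rightarrow> complex mat \<Rightarrow> nat \<Rightarrow> complex mat set"
  for n M x r where
  gen: "set u \<subseteq> M \<Longrightarrow> set v \<subseteq> M \<Longrightarrow> length u + length v = r \<Longrightarrow> mprod n u * x * mprod n v \<in> conj_span n M x r"
| diff: "a \<in> conj_span n M x r \<Longrightarrow> b \<in> conj_span n M x r \<Longrightarrow> a - b \<in> conj_span n M x r"

lemma conj_span_carrier:
  assumes M: "M \<subseteq> carrier_mat n n" and x: "x \<in> carrier_mat n n"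
  shows "a \<in> conj_span n M x r \<Longrightarrow> a \<in> carrier_mat n n"
proof (induction rule: conj_span.induct)
  case (gen u v)
  then show ?case using mprod_carrier[of u n] mprod_carrier[of v n] M x by (auto intro!: sq_mult_closed)
next
  case (diff a b) then show ?case by auto
qed

lemma conj_span_mult:
  assumes M: "M \<subseteq> carrier_mat n n" and x: "x \<in> carrier_mat n n" and m: "m \<in> M"
  shows "a \<in> conj_span n M x r \<Longrightarrow> m * a \<in> conj_span n M x (Suc r) \<and> a * m \<in> conj_span n M x (Suc r)"
proof (induction rule: conj_span.induct)
  case (gen u v)
  have c: "mprod n u \<in> carrier_mat n n" "mprod n v \<in> carrier_mat n n" "m \<in> carrier_mat n n"
    using gen M m mprod_carrier by blast+
  have "m * (mprod n u * x * mprod n v) = mprod n (m # u) * x * mprod n v"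
    using c x by (simp only: mprod_simps sq_assoc[of _ n] sq_mult_closed)
  moreover have "mprod n u * x * mprod n v * m = mprod n u * x * mprod n (v @ [m])"
    using c x mprod_append[of v n "[m]"] gen M by (simp add: sq_assoc[of _ n] sq_mult_closed right_mult_one_mat[OF c(3)])
  moreover have "mprod n (m # u) * x * mprod n v \<in> conj_span n M x (Suc r)"
    by (rule conj_span.gen) (use gen m in auto)
  moreover have "mprod n u * x * mprod n (v @ [m]) \<in> conj_span n M x (Suc r)"
    by (rule conj_span.gen) (use gen m in auto)
  ultimately show ?case by simp
next
  case (diff a b)
  note ac = conj_span_carrier[OF M x diff(1)] and bc = conj_span_carrier[OF M x diff(2)]
  have mc: "m \<in> carrier_mat n n" using m M by blast
  show ?case
    using diff.IH conj_span.diff unfolding mult_minus_distrib_mat[OF mc ac bc] minus_mult_distrib_mat[OF ac bc mc] by blast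
qed

text \<open>A product with \<open>2 * k\<close> letters around \<open>x\<close> has at least
  \<open>k\<close> of them on one side.\<close>

lemma iterated_bracket_zero:
  assumes M: "M \<subseteq> carrier_mat n n" and x: "x \<in> carrier_mat n n" and k: "nil_of_index n k M"
    and w: "set w \<subseteq> M" "length w = 2 * k"
  shows "foldr bracket w x = 0\<^sub>m n n"
proof -
  have *: "set w \<subseteq> M \<Longrightarrow> foldr bracket w x \<in> conj_span n M x (length w)" for w
  proof (induction w)
    case Nil
    show ?case using conj_span.gen[of "[]" M "[]" 0 n x] x by (simp add: right_mult_one_mat[OF x])
  next
    case (Cons m w)
    then show ?case using conj_span_mult[OF M x, of m] conj_span.diff by (simp add: bracket_def)
  qed
  have "a = 0\<^sub>m n n" if "a \<in> conj_span n M x (2 * k)" for a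
    using that
  proof (induction rule: conj_span.induct)
    case (gen u v)
    have c: "mprod n u \<in> carrier_mat n n" "mprod n v \<in> carrier_mat n n"
      using gen M mprod_carrier by blast+
    have "mprod n u = 0\<^sub>m n n \<or> mprod n v = 0\<^sub>m n n"
      using nil_of_indexD[OF k M gen(1)] nil_of_indexD[OF k M gen(2)] gen(3) by linarith
    then show ?case
      using c x by (auto simp: left_mult_zero_mat[OF x] left_mult_zero_mat[OF c(2)] right_mult_zero_mat[OF sq_mult_closed[OF c(1) x]])
  qed auto
  then show ?thesis using *[OF w(1)] w(2) by simp
qed

text \<open>Iterated brackets of \<open>x\<close> with elements of \<open>M\<close> end at 0, hence
  in \<open>M\<close>. There is a length \<open>j\<close> at which some iterated bracket is still
  outside \<open>M\<close> while all those of length \<open>Suc j\<close> are inside; that bracket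
  is the element sought.\<close>

lemma normalizing_element:
  assumes M: "subspace_mat n M" and k: "nil_of_index n k M" and x: "x \<in> L" "x \<notin> M" "L \<subseteq> carrier_mat n n"
    and sub: "\<And>m y. m \<in> M \<Longrightarrow> y \<in> L \<Longrightarrow> bracket m y \<in> L"
  shows "\<exists>y\<in>L. y \<notin> M \<and> (\<forall>m\<in>M. bracket m y \<in> M)"
proof -
  define Q where "Q j \<longleftrightarrow> (\<forall>w. set w \<subseteq> M \<and> length w = j \<longrightarrow> foldr bracket w x \<in> M)" for j
  have "Q (2 * k)" unfolding Q_def
    using iterated_bracket_zero[OF subspaceD(1)[OF M] _ k] x subspaceD(2)[OF M] by auto
  moreover have "\<not> Q 0" unfolding Q_def using x by auto
  ultimately obtain j where j: "\<not> Q j" "Q (Suc j)"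
    using dec_induct[of 0 "2 * k" "\<lambda>j. \<not> Q j"] by blast
  then obtain w where w: "set w \<subseteq> M" "length w = j" "foldr bracket w x \<notin> M" unfolding Q_def by blast
  have "foldr bracket w x \<in> L" using w(1) by (induction w) (use x(1) sub in auto)
  moreover have "bracket m (foldr bracket w x) \<in> M" if "m \<in> M" for m
    using j(2) w that unfolding Q_def by (auto dest!: spec[of _ "m # w"])
  ultimately show ?thesis using w(3) by blast
qed

text \<open>The powers of \<open>x\<close> may be collected on the left since \<open>x\<close> normalizes \<open>M\<close>; hence this filtration is multiplicative.\<close>

inductive_set filt :: "nat \<Rightarrow> complex mat set \<Rightarrow> complex mat \<Rightarrow> nat \<Rightarrow> complex mat set"
  for n M x c where
  gen: "set v \<subseteq> M \<Longrightarrow> c \<le> length v \<Longrightarrow> x ^\<^sub>m i * mprod n v \<in> filt n M x c"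
| zero: "0\<^sub>m n n \<in> filt n M x c"
| add: "a \<in> filt n M x c \<Longrightarrow> b \<in> filt n M x c \<Longrightarrow> a + b \<in> filt n M x c"
| smult: "a \<in> filt n M x c \<Longrightarrow> s \<cdot>\<^sub>m a \<in> filt n M x c"

context
  fixes n :: nat and M :: "complex mat set" and x :: "complex mat"
  assumes M: "M \<subseteq> carrier_mat n n" and x: "x \<in> carrier_mat n n"
    and norm: "\<forall>m\<in>M. bracket m x \<in> M"
begin

lemma filt_carrier: "a \<in> filt n M x c \<Longrightarrow> a \<in> carrier_mat n n"
proof (induction rule: filt.induct)
  case (gen v i)
  then show ?case using mprod_carrier[of v n] M pow_carrier_mat[OF x] by (auto intro!: sq_mult_closed)
qed auto

lemma filt_weaken: "a \<in> filt n M x c \<Longrightarrow> d \<le> c \<Longrightarrow> a \<in> filt n M x d"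
proof (induction rule: filt.induct)
  case (gen v i) then show ?case by (intro filt.gen) auto
qed (auto intro: filt.zero filt.add filt.smult)

lemma filt_mult_M: "a \<in> filt n M x c \<Longrightarrow> m \<in> M \<Longrightarrow> a * m \<in> filt n M x (Suc c)"
proof (induction rule: filt.induct)
  case (gen v i)
  have mc: "m \<in> carrier_mat n n" "mprod n v \<in> carrier_mat n n" "x ^\<^sub>m i \<in> carrier_mat n n"
    using gen M mprod_carrier pow_carrier_mat[OF x] by blast+
  have "x ^\<^sub>m i * mprod n v * m = x ^\<^sub>m i * mprod n (v @ [m])"
    using mprod_append[of v n "[m]"] gen M mc by (simp add: sq_assoc[of _ n] right_mult_one_mat[OF mc(1)])
  also have "\<dots> \<in> filt n M x (Suc c)" by (rule filt.gen) (use gen in auto)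
  finally show ?case .
next
  case zero
  then have "m \<in> carrier_mat n n" using M by blast
  then show ?case by (simp add: left_mult_zero_mat filt.zero)
next
  case (add a b)
  have "m \<in> carrier_mat n n" using M add by blast
  from add_mult_distrib_mat[OF filt_carrier[OF add(1)] filt_carrier[OF add(2)] this]
  show ?case using add filt.add by simp
next
  case (smult a s)
  have "m \<in> carrier_mat n n" using M smult by blast
  from mult_smult_assoc_mat[OF filt_carrier[OF smult(1)] this, of s]
  show ?case using smult filt.smult by simp
qed

lemma filt_x_left: "a \<in> filt n M x c \<Longrightarrow> x * a \<in> filt n M x c"
proof (induction rule: filt.induct)
  case (gen v i)
  have mc: "mprod n v \<in> carrier_mat n n" "x ^\<^sub>m i \<in> carrier_mat n n"
    using gen M mprod_carrier pow_carrier_mat[OF x] by blast+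
  have "x * x ^\<^sub>m i = x ^\<^sub>m Suc i" using pow_commute_mat[OF x x refl, of i] by simp
  then have "x * (x ^\<^sub>m i * mprod n v) = x ^\<^sub>m Suc i * mprod n v"
    using sq_assoc[OF x mc(2,1)] by simp
  also have "\<dots> \<in> filt n M x c" by (rule filt.gen) (use gen in auto)
  finally show ?case .
next
  case zero
  then show ?case by (simp add: right_mult_zero_mat[OF x] filt.zero)
next
  case (add a b)
  from mult_add_distrib_mat[OF x filt_carrier[OF add(1)] filt_carrier[OF add(2)]]
  show ?case using add filt.add by simp
next
  case (smult a s)
  from mult_smult_distrib[OF x filt_carrier[OF smult(1)], of s]
  show ?case using smult filt.smult by simp
qed

lemma filt_xpow_left: "a \<in> filt n M x c \<Longrightarrow> x ^\<^sub>m i * a \<in> filt n M x c"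
proof (induction i)
  case 0
  then show ?case using x by (simp add: left_mult_one_mat[OF filt_carrier[OF 0]])
next
  case (Suc i)
  have "x ^\<^sub>m Suc i * a = x * (x ^\<^sub>m i * a)"
    using pow_commute_mat[OF x x refl, of i] sq_assoc[OF x pow_carrier_mat[OF x] filt_carrier[OF Suc(2)], of i] by simp
  then show ?case using filt_x_left Suc by simp
qed

lemma filt_mprod: "set v \<subseteq> M \<Longrightarrow> mprod n v \<in> filt n M x (length v)"
  using filt.gen[of v M "length v" x 0 n] x left_mult_one_mat[OF mprod_carrier[of v n]] M by auto

text \<open>Moving \<open>x\<close> to the left across \<open>m\<close> costs
  \<open>bracket m x\<close>, which is again a letter from \<open>M\<close>; the number of letters
  from \<open>M\<close> never drops.\<close>

lemma filt_mprod_x: "set v \<subseteq> M \<Longrightarrow> mprod n v * x \<in> filt n M x (length v)"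
proof (induction v rule: rev_induct)
  case Nil
  show ?case using filt.gen[of "[]" M 0 x 1 n] x by (simp add: right_mult_one_mat[OF x])
next
  case (snoc m v)
  have m: "m \<in> M" "m \<in> carrier_mat n n" and v: "set v \<subseteq> M" "mprod n v \<in> carrier_mat n n"
    using snoc.prems M mprod_carrier[of v n] by auto
  have b: "bracket m x \<in> M" "bracket m x \<in> carrier_mat n n" using norm m(1) M by auto
  have "m * x = x * m + bracket m x"
    unfolding bracket_def using m x by (intro eq_matI) auto
  then have "mprod n (v @ [m]) * x = mprod n v * x * m + mprod n v * bracket m x"
    using mprod_append[of v n "[m]"] m v M x b
    by (simp add: sq_assoc[of _ n] right_mult_one_mat[OF m(2)] mult_add_distrib_mat[OF v(2) sq_mult_closed[OF x m(2)] b(2)])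
  moreover have "mprod n v * x * m \<in> filt n M x (Suc (length v))" using filt_mult_M[OF snoc.IH[OF v(1)] m(1)] .
  moreover have "mprod n v * bracket m x \<in> filt n M x (Suc (length v))" using filt_mult_M[OF filt_mprod[OF v(1)] b(1)] .
  ultimately show ?case using filt.add by simp
qed

lemma filt_mult_x: "a \<in> filt n M x c \<Longrightarrow> a * x \<in> filt n M x c"
proof (induction rule: filt.induct)
  case (gen v i)
  have mc: "mprod n v \<in> carrier_mat n n" "x ^\<^sub>m i \<in> carrier_mat n n"
    using gen M mprod_carrier pow_carrier_mat[OF x] by blast+
  have "x ^\<^sub>m i * mprod n v * x = x ^\<^sub>m i * (mprod n v * x)" by (rule sq_assoc[OF mc(2,1) x])
  also have "\<dots> \<in> filt n M x c"
    by (rule filt_xpow_left[OF filt_weaken[OF filt_mprod_x[OF gen(1)] gen(2)]])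
  finally show ?case .
next
  case zero
  then show ?case by (simp add: left_mult_zero_mat[OF x] filt.zero)
next
  case (add a b)
  from add_mult_distrib_mat[OF filt_carrier[OF add(1)] filt_carrier[OF add(2)] x]
  show ?case using add filt.add by simp
next
  case (smult a s)
  from mult_smult_assoc_mat[OF filt_carrier[OF smult(1)] x, of s]
  show ?case using smult filt.smult by simp
qed

text \<open>Multiplied to \<open>a\<close> from the right, powers of \<open>x\<close> keep the
  filtration degree and each letter of \<open>v\<close> raises it by one.\<close>

lemma filt_mult:
  assumes a: "a \<in> filt n M x c" shows "b \<in> filt n M x d \<Longrightarrow> a * b \<in> filt n M x (c + d)"
proof (induction rule: filt.induct)
  case (gen v i)
  note ac = filt_carrier[OF a]
  have mc: "mprod n v \<in> carrier_mat n n" "x ^\<^sub>m i \<in> carrier_mat n n"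
    using gen M mprod_carrier pow_carrier_mat[OF x] by blast+
  have "a * x ^\<^sub>m i \<in> filt n M x c"
  proof (induction i)
    case 0 then show ?case using a ac x by simp
  next
    case (Suc i)
    have "a * x ^\<^sub>m Suc i = a * x ^\<^sub>m i * x" using sq_assoc[OF ac pow_carrier_mat[OF x] x, of i] by simp
    then show ?case using filt_mult_x[OF Suc] by simp
  qed
  then have "a * x ^\<^sub>m i * mprod n v \<in> filt n M x (c + length v)"
    using gen(1)
  proof (induction v rule: rev_induct)
    case Nil then show ?case using right_mult_one_mat[OF filt_carrier[OF Nil(1)]] by simp
  next
    case (snoc m v)
    have m: "m \<in> carrier_mat n n" "mprod n v \<in> carrier_mat n n" "set v \<subseteq> carrier_mat n n"
      using snoc.prems M mprod_carrier[of v n] by auto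
    have "a * x ^\<^sub>m i * mprod n (v @ [m]) = a * x ^\<^sub>m i * mprod n v * m"
      using mprod_append[of v n "[m]"] m mc(2) ac by (simp add: sq_assoc[of _ n] sq_mult_closed right_mult_one_mat[OF m(1)])
    then show ?case using filt_mult_M[OF snoc.IH] snoc.prems by simp
  qed
  then have "a * x ^\<^sub>m i * mprod n v \<in> filt n M x (c + d)" by (rule filt_weaken) (use gen in simp)
  then show ?case using sq_assoc[OF ac mc(2,1)] by simp
next
  case zero
  then show ?case by (simp add: right_mult_zero_mat[OF filt_carrier[OF a]] filt.zero)
next
  case (add b b')
  from mult_add_distrib_mat[OF filt_carrier[OF a] filt_carrier[OF add(1)] filt_carrier[OF add(2)]]
  show ?case using add filt.add by simp
next
  case (smult b s)
  from mult_smult_distrib[OF filt_carrier[OF a] filt_carrier[OF smult(1)], of s]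
  show ?case using smult filt.smult by simp
qed

lemma filt_nil:
  assumes k: "nil_of_index n k M" shows "a \<in> filt n M x k \<Longrightarrow> a = 0\<^sub>m n n"
proof (induction rule: filt.induct)
  case (gen v i)
  then show ?case using nil_of_indexD[OF k M gen] by (simp add: right_mult_zero_mat[OF pow_carrier_mat[OF x]])
qed auto

text \<open>In a word of \<open>p\<close> letters the part free of letters from \<open>M\<close> is
  a multiple of the \<open>p\<close>-th power of \<open>x\<close>, which is 0, so the word has
  filtration degree 1. A product of \<open>k\<close> such words has degree \<open>k\<close> and
  vanishes; hence the index \<open>k * p\<close>.\<close>

lemma nil_extension:
  assumes k: "nil_of_index n k M" and p: "x ^\<^sub>m p = 0\<^sub>m n n"
  shows "nil_of_index n (k * p) {m + a \<cdot>\<^sub>m x | m a. m \<in> M}"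
proof -
  let ?M = "{m + a \<cdot>\<^sub>m x | m a. m \<in> M}"
  have Mc: "?M \<subseteq> carrier_mat n n" using M x by auto
  have letter: "l \<in> filt n M x 0" if l': "l \<in> ?M" for l
  proof -
    obtain m a where l: "l = m + a \<cdot>\<^sub>m x" "m \<in> M" using l' by blast
    have "m \<in> filt n M x 0" using filt_weaken[OF filt_mprod[of "[m]"], of 0] l M right_mult_one_mat[of m n n] by auto
    moreover have "x \<in> filt n M x 0" using filt_mprod_x[of "[]"] x by simp
    ultimately show ?thesis unfolding l by (intro filt.add filt.smult)
  qed
  have mprod_snoc: "mprod n (w @ [l]) = mprod n w * l" if "set w \<subseteq> ?M" "l \<in> ?M" for w l
    using mprod_append[of w n "[l]"] that Mc right_mult_one_mat[of l n n] by auto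
  have short: "\<exists>a b. b \<in> filt n M x 1 \<and> mprod n w = a \<cdot>\<^sub>m x ^\<^sub>m length w + b" if "set w \<subseteq> ?M" for w
    using that
  proof (induction w rule: rev_induct)
    case Nil
    have "mprod n [] = 1 \<cdot>\<^sub>m x ^\<^sub>m length [] + 0\<^sub>m n n" using x by (simp add: one_smult)
    then show ?case using filt.zero by blast
  next
    case (snoc l w)
    then obtain a b where ab: "b \<in> filt n M x 1" "mprod n w = a \<cdot>\<^sub>m x ^\<^sub>m length w + b" by auto
    obtain m s where l: "l = m + s \<cdot>\<^sub>m x" "m \<in> M" using snoc.prems by auto
    let ?y = "x ^\<^sub>m length w"
    have c: "?y \<in> carrier_mat n n" "b \<in> carrier_mat n n" "m \<in> carrier_mat n n" "l \<in> carrier_mat n n"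
      using pow_carrier_mat[OF x] filt_carrier[OF ab(1)] l M x by auto
    have "mprod n (w @ [l]) = (a \<cdot>\<^sub>m ?y + b) * l" using mprod_snoc[of w l] snoc.prems ab by simp
    also have "\<dots> = a \<cdot>\<^sub>m (?y * l) + b * l"
      using c by (simp add: add_mult_distrib_mat[OF smult_carrier_mat[OF c(1)] c(2) c(4)] mult_smult_assoc_mat[OF c(1) c(4)])
    also have "?y * l = ?y * m + s \<cdot>\<^sub>m (?y * x)"
      unfolding l using c x by (simp add: mult_add_distrib_mat[OF c(1) c(3) smult_carrier_mat[OF x]] mult_smult_distrib[OF c(1) x])
    also have "a \<cdot>\<^sub>m (?y * m + s \<cdot>\<^sub>m (?y * x)) + b * l = (a * s) \<cdot>\<^sub>m (x ^\<^sub>m length (w @ [l])) + (a \<cdot>\<^sub>m (?y * m) + b * l)"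
      using c x by (intro eq_matI) (auto simp: algebra_simps simp del: index_mult_mat(1))
    finally have "mprod n (w @ [l]) = (a * s) \<cdot>\<^sub>m (x ^\<^sub>m length (w @ [l])) + (a \<cdot>\<^sub>m (?y * m) + b * l)" .
    moreover have "?y * m \<in> filt n M x 1"
      using filt_xpow_left[OF filt_mprod[of "[m]"]] l c right_mult_one_mat[OF c(3)] by simp
    moreover have "b * l \<in> filt n M x 1" using filt_mult[OF ab(1) letter, of l] snoc.prems by simp
    ultimately show ?case using filt.add filt.smult by blast
  qed
  have one: "mprod n w \<in> filt n M x 1" if w: "set w \<subseteq> ?M" "length w = p" for w
  proof -
    obtain a b where ab: "b \<in> filt n M x 1" "mprod n w = a \<cdot>\<^sub>m x ^\<^sub>m length w + b" using short[OF w(1)] by blast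
    have "mprod n w = b" unfolding ab(2) using w p filt_carrier[OF ab(1)] by simp
    then show ?thesis using ab by simp
  qed
  have "mprod n w \<in> filt n M x j" if "set w \<subseteq> ?M" "length w = j * p" for w j
    using that
  proof (induction j arbitrary: w)
    case 0 then show ?case using filt_mprod[of "[]"] by simp
  next
    case (Suc j)
    have s: "set (take p w) \<subseteq> ?M" "set (drop p w) \<subseteq> ?M" using Suc.prems set_take_subset set_drop_subset by fast+
    have "mprod n w = mprod n (take p w) * mprod n (drop p w)"
      using mprod_append[of "take p w" n "drop p w"] s Mc by auto
    moreover have "mprod n (take p w) \<in> filt n M x 1" by (rule one) (use s Suc.prems in auto)
    moreover have "mprod n (drop p w) \<in> filt n M x j" by (rule Suc.IH) (use s Suc.prems in auto)
    ultimately show ?case using filt_mult[of _ 1 _ j] by simp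
  qed
  then show ?thesis unfolding nil_of_index_def using filt_nil[OF k] by blast
qed

end

text \<open>Take a maximal one among the subalgebras with some nilpotency index. Were it proper, an
  element normalizing it could be adjoined by \<open>nil_extension\<close>, giving a larger
  one.\<close>

theorem engel:
  assumes L: "lie_subalgebra n L" and nil: "\<And>X. X \<in> L \<Longrightarrow> X ^\<^sub>m n = 0\<^sub>m n n"
  shows "\<exists>k. nil_of_index n k L"
proof -
  have Ls: "subspace_mat n L" and Lb: "\<And>X Y. X \<in> L \<Longrightarrow> Y \<in> L \<Longrightarrow> bracket X Y \<in> L"
    using L by (auto simp: lie_subalgebra_def)
  define P where "P M \<longleftrightarrow> M \<subseteq> L \<and> lie_subalgebra n M \<and> (\<exists>k. nil_of_index n k M)" for M
  have "P {0\<^sub>m n n}"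
    unfolding P_def
  proof (intro conjI exI[of _ 1])
    show "{0\<^sub>m n n} \<subseteq> L" using subspaceD(2)[OF Ls] by simp
    show "lie_subalgebra n {0\<^sub>m n n}"
      unfolding lie_subalgebra_def subspace_mat_def bracket_def by auto
    show "nil_of_index n 1 {0\<^sub>m n n}"
      unfolding nil_of_index_def by (auto simp: length_Suc_conv)
  qed
  moreover have "subspace_mat n M" if "P M" for M using that by (simp add: P_def lie_subalgebra_def)
  ultimately obtain M where M: "P M" and max: "\<And>x. x \<in> carrier_mat n n \<Longrightarrow> x \<notin> M \<Longrightarrow> \<not> P {m + a \<cdot>\<^sub>m x | m a. m \<in> M}"
    using maximal_extension[of P n] by blast
  obtain k where k: "nil_of_index n k M" and sub: "M \<subseteq> L" and Ms: "subspace_mat n M"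
    and Mb: "\<And>X Y. X \<in> M \<Longrightarrow> Y \<in> M \<Longrightarrow> bracket X Y \<in> M"
    using M by (auto simp: P_def lie_subalgebra_def)
  have "L \<subseteq> M"
  proof (rule ccontr)
    assume "\<not> L \<subseteq> M"
    then obtain x0 where x0: "x0 \<in> L" "x0 \<notin> M" by blast
    obtain x where x: "x \<in> L" "x \<notin> M" "\<And>m. m \<in> M \<Longrightarrow> bracket m x \<in> M"
      using normalizing_element[OF Ms k x0 subspaceD(1)[OF Ls]] Lb sub by blast
    have xc: "x \<in> carrier_mat n n" using x subspaceD(1)[OF Ls] by blast
    note Mc = subspaceD(1)[OF Ms]
    let ?M = "{m + a \<cdot>\<^sub>m x | m a. m \<in> M}"
    have mem: "m + a \<cdot>\<^sub>m x \<in> ?M" if "m \<in> M" for m a using that by blast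
    have "P ?M"
      unfolding P_def
    proof (intro conjI)
      show "?M \<subseteq> L" using sub x(1) subspaceD(3,4)[OF Ls] by blast
      show "\<exists>k. nil_of_index n k ?M" using nil_extension[OF Mc xc _ k nil[OF x(1)]] x(3) by blast
      show "lie_subalgebra n ?M"
        unfolding lie_subalgebra_def subspace_mat_def
      proof (intro conjI ballI allI)
        show "?M \<subseteq> carrier_mat n n" using Mc xc by auto
        have "0\<^sub>m n n = 0\<^sub>m n n + 0 \<cdot>\<^sub>m x" using xc by (simp add: zero_smult_mat[OF xc])
        then show "0\<^sub>m n n \<in> ?M" using mem[OF subspaceD(2)[OF Ms], of 0] by simp
      next
        fix X Y assume "X \<in> ?M" "Y \<in> ?M"
        then obtain p a q b where XY: "X = p + a \<cdot>\<^sub>m x" "p \<in> M" "Y = q + b \<cdot>\<^sub>m x" "q \<in> M" by blast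
        have c: "p \<in> carrier_mat n n" "q \<in> carrier_mat n n" using XY Mc by auto
        have "X + Y = (p + q) + (a + b) \<cdot>\<^sub>m x"
          unfolding XY using c xc by (intro eq_matI) (auto simp: algebra_simps)
        then show "X + Y \<in> ?M" using mem[OF subspaceD(3)[OF Ms XY(2,4)]] by simp
        have ax: "a \<cdot>\<^sub>m x \<in> carrier_mat n n" "b \<cdot>\<^sub>m x \<in> carrier_mat n n" using xc by auto
        have "bracket X Y = bracket p q + bracket p (b \<cdot>\<^sub>m x) + (bracket (a \<cdot>\<^sub>m x) q + bracket (a \<cdot>\<^sub>m x) (b \<cdot>\<^sub>m x))"
          unfolding XY bracket_add_left[OF c(1) ax(1) add_carrier_mat[OF ax(2)]]
            bracket_add_right[OF c(2) ax(2) c(1)] bracket_add_right[OF c(2) ax(2) ax(1)] ..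
        also have "bracket p (b \<cdot>\<^sub>m x) = b \<cdot>\<^sub>m bracket p x" by (rule bracket_smult_right[OF c(1) xc])
        also have "bracket (a \<cdot>\<^sub>m x) q = (- a) \<cdot>\<^sub>m bracket q x" by (rule bracket_smult_swap[OF xc c(2)])
        also have "bracket (a \<cdot>\<^sub>m x) (b \<cdot>\<^sub>m x) = 0\<^sub>m n n" by (rule bracket_multiples[OF xc])
        finally have "bracket X Y \<in> M"
          using subspaceD(2,3,4)[OF Ms] Mb[OF XY(2,4)] x(3)[OF XY(2)] x(3)[OF XY(4)] by simp
        moreover have "bracket X Y = bracket X Y + 0 \<cdot>\<^sub>m x"
          using calculation Mc by (auto simp: zero_smult_mat[OF xc])
        ultimately show "bracket X Y \<in> ?M" using mem[of "bracket X Y" 0] by simp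
      next
        fix s X assume "X \<in> ?M"
        then obtain p a where X: "X = p + a \<cdot>\<^sub>m x" "p \<in> M" by blast
        have c: "p \<in> carrier_mat n n" using X Mc by auto
        have "s \<cdot>\<^sub>m X = s \<cdot>\<^sub>m p + (s * a) \<cdot>\<^sub>m x"
          unfolding X using c xc by (intro eq_matI) (auto simp: algebra_simps)
        then show "s \<cdot>\<^sub>m X \<in> ?M" using mem[OF subspaceD(4)[OF Ms X(2)]] by simp
      qed
    qed
    then show False using max[OF xc x(2)] by blast
  qed
  then show ?thesis using k sub by auto
qed

section \<open>Unipotent and central subgroups\<close>

text \<open>Products of exponentials, built one factor at a time. Inverses are included because the
  parameter may change its sign.\<close>

inductive_set gen_group :: "nat \<Rightarrow> complex mat set \<Rightarrow> complex mat set" for n S where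
  one: "1\<^sub>m n \<in> gen_group n S"
| step: "X \<in> S \<Longrightarrow> one_param n X c \<Longrightarrow> g \<in> gen_group n S \<Longrightarrow> c t * g \<in> gen_group n S"

definition gen_closure :: "nat \<Rightarrow> complex mat set \<Rightarrow> complex mat set" where
  "gen_closure n S = zariski n closure_of gen_group n S"

text \<open>Produces test groups for the definitions of \<open>reductive\<close> and
  \<open>semisimple\<close>: the Zariski closure of the group generated by the exponentials of
  \<open>S\<close> is algebraic, connected and normal in \<open>G\<close>. Properties of
  \<open>S\<close> then decide whether it is unipotent or solvable.\<close>

locale Ad_stable =
  fixes n :: nat and G S :: "complex mat set"
  assumes G: "algebraic_group n G" and S: "S \<subseteq> lie_algebra n G"
    and Ad: "\<And>g X. g \<in> G \<Longrightarrow> X \<in> S \<Longrightarrow> g * X * minv g \<in> S"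
begin

lemmas G' = algebraic_groupD[OF G]

abbreviation "U0 \<equiv> gen_group n S"
abbreviation "U \<equiv> gen_closure n S"

lemma S_carrier: "X \<in> S \<Longrightarrow> X \<in> carrier_mat n n"
  using S lie_carrier by blast

lemma U0_G: "g \<in> U0 \<Longrightarrow> g \<in> G"
proof (induction rule: gen_group.induct)
  case (step X c g t)
  then show ?case using G'(3) one_param_in_group[OF G] S by blast
qed (rule G'(2))

lemma U0_GL: "g \<in> U0 \<Longrightarrow> g \<in> carrier (GL n)"
  using U0_G G'(1) by blast

lemma U0_carrier: "g \<in> U0 \<Longrightarrow> g \<in> carrier_mat n n"
  using U0_GL GL_carrier by blast

lemma U0_mult: "g \<in> U0 \<Longrightarrow> h \<in> U0 \<Longrightarrow> g * h \<in> U0"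
proof (induction rule: gen_group.induct)
  case (step X c g t)
  have "c t * g * h = c t * (g * h)"
    by (rule sq_assoc[OF one_paramD(1)[OF step(2)] U0_carrier[OF step(3)] U0_carrier[OF step(5)]])
  then show ?case using gen_group.step[OF step(1,2), of "g * h" t] step(4,5) by simp
qed (simp add: left_mult_one_mat[OF U0_carrier])

lemma U0_one_param: "X \<in> S \<Longrightarrow> one_param n X c \<Longrightarrow> c t \<in> U0"
  using gen_group.step[OF _ _ gen_group.one, of X S n c t] one_paramD(1)[of n X c t] by simp

lemma U0_minv: "g \<in> U0 \<Longrightarrow> minv g \<in> U0"
proof (induction rule: gen_group.induct)
  case one
  have "minv (1\<^sub>m n) = 1\<^sub>m n" using minv_eq[OF one_in_GL, of "1\<^sub>m n"] by simp
  then show ?case using gen_group.one by simp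
next
  case (step X c g t)
  have "minv (c t * g) = minv g * c (- t)"
    using minv_mult[OF one_param_inverse(1)[OF S_carrier[OF step(1)] step(2)] U0_GL[OF step(3)], of t]
      one_param_inverse(2)[OF S_carrier[OF step(1)] step(2)] by simp
  then show ?case using U0_mult[OF step(4) U0_one_param[OF step(1,2)]] by simp
qed

lemma U0_conj: "h \<in> U0 \<Longrightarrow> g \<in> G \<Longrightarrow> g * h * minv g \<in> U0"
proof (induction rule: gen_group.induct)
  case one
  then have "g \<in> carrier (GL n)" using G' by blast
  then have "g * 1\<^sub>m n * minv g = 1\<^sub>m n" using minv(2) GL_carrier[of g n] by simp
  then show ?case using gen_group.one by simp
next
  case (step X c h t)
  have g: "g \<in> carrier (GL n)" using G' step by blast
  note gc = GL_carrier[OF g] GL_carrier[OF minv(1)[OF g]]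
  note c = one_paramD(1)[OF step(2)] and h = U0_carrier[OF step(3)]
  have "g * (c t * h) * minv g = g * c t * (minv g * g) * h * minv g"
    unfolding minv(3)[OF g] right_mult_one_mat[OF sq_mult_closed[OF gc(1) c]]
    using gc c[of t] h by (simp only: sq_assoc[of _ n] sq_mult_closed)
  also have "\<dots> = (g * c t * minv g) * (g * h * minv g)"
    using gc c[of t] h by (simp only: sq_assoc[of _ n] sq_mult_closed)
  also have "\<dots> \<in> U0"
    using gen_group.step[OF Ad[OF step(5) step(1)] one_param_conj[OF S_carrier[OF step(1)] step(2) g] step(4)[OF step(5)]] .
  finally show ?case .
qed

text \<open>Each element is joined to the identity by a chain of orbits \<open>c s * g\<close>, each
  connected and meeting the next one.\<close>

lemma U0_connected: "connectedin (zariski n) U0"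
proof -
  have "\<exists>C. connectedin (zariski n) C \<and> C \<subseteq> U0 \<and> g \<in> C \<and> 1\<^sub>m n \<in> C" if "g \<in> U0" for g
    using that
  proof (induction rule: gen_group.induct)
    case one
    show ?case by (rule exI[of _ "{1\<^sub>m n}"]) (simp add: gen_group.one topspace_zariski one_in_GL)
  next
    case (step X c g t)
    then obtain C where C: "connectedin (zariski n) C" "C \<subseteq> U0" "g \<in> C" "1\<^sub>m n \<in> C" by blast
    let ?D = "range (\<lambda>s. c s * g)"
    have D: "connectedin (zariski n) ?D" by (rule one_param_connected[OF S_carrier[OF step(1)] step(2) U0_GL[OF step(3)]])
    have "c 0 * g = g" using one_paramD(2)[OF step(2)] left_mult_one_mat[OF U0_carrier[OF step(3)]] by simp
    then have "g \<in> ?D" by (metis rangeI)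
    then have "connectedin (zariski n) (?D \<union> C)" using connectedin_Un[OF D C(1)] C(3) by blast
    moreover have "?D \<subseteq> U0" using gen_group.step[OF step(1,2,3)] by blast
    ultimately show ?case using C by (intro exI[of _ "?D \<union> C"]) blast
  qed
  then obtain C where C: "\<And>g. g \<in> U0 \<Longrightarrow> connectedin (zariski n) (C g) \<and> C g \<subseteq> U0 \<and> g \<in> C g \<and> 1\<^sub>m n \<in> C g"
    by metis
  have "connectedin (zariski n) (\<Union>(C ` U0))"
    by (rule connectedin_Union) (use C gen_group.one in blast)+
  moreover have "\<Union>(C ` U0) = U0" using C by blast
  ultimately show ?thesis by simp
qed

lemma U0_sub_U: "U0 \<subseteq> U"
  unfolding gen_closure_def by (rule closure_of_subset) (use U0_GL in \<open>auto simp: topspace_zariski\<close>)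

lemma U_minimal: "closedin (zariski n) T \<Longrightarrow> U0 \<subseteq> T \<Longrightarrow> U \<subseteq> T"
  unfolding gen_closure_def by (rule closure_of_minimal)

lemma U_closed: "closedin (zariski n) U"
  unfolding gen_closure_def by (rule closedin_closure_of)

lemma U_G: "U \<subseteq> G"
  using U_minimal[OF G'(5)] U0_G by blast

lemma U_GL: "U \<subseteq> carrier (GL n)"
  using U_G G'(1) by blast

text \<open>The preimage of \<open>U\<close> under \<open>T\<close> is closed and contains
  \<open>U0\<close>, hence contains \<open>U\<close>. For products this is applied twice, once in
  each factor.\<close>

lemma U_image:
  assumes "continuous_map (zariski n) (zariski n) T" "\<And>g. g \<in> U0 \<Longrightarrow> T g \<in> U" "u \<in> U"
  shows "T u \<in> U"
proof -
  have "closedin (zariski n) {x \<in> topspace (zariski n). T x \<in> U}"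
    using assms(1) U_closed unfolding continuous_map_closedin by blast
  then have "U \<subseteq> {x \<in> topspace (zariski n). T x \<in> U}"
    by (rule U_minimal) (use assms(2) U0_GL in \<open>auto simp: topspace_zariski\<close>)
  then show ?thesis using assms(3) by blast
qed

lemma continuous_left: "h \<in> carrier (GL n) \<Longrightarrow> continuous_map (zariski n) (zariski n) (\<lambda>g. h * g)"
  by (rule continuous_map_zariski, rule mult_in_GL, assumption+, rule reg_mult_left, assumption+)

lemma continuous_right: "h \<in> carrier (GL n) \<Longrightarrow> continuous_map (zariski n) (zariski n) (\<lambda>g. g * h)"
  by (rule continuous_map_zariski, rule mult_in_GL, assumption+, rule reg_mult_right, assumption+)

lemma continuous_minv: "continuous_map (zariski n) (zariski n) minv"
  by (rule continuous_map_zariski, rule minv(1), assumption, rule reg_comp_minv, assumption)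

lemma U_mult: assumes "u \<in> U" "v \<in> U" shows "u * v \<in> U"
proof -
  have "h * v \<in> U" if "h \<in> U0" for h
    by (rule U_image[OF continuous_left _ assms(2)]) (use that U0_GL U0_mult U0_sub_U in blast)+
  then show ?thesis
    by (rule U_image[OF continuous_right _ assms(1), rotated]) (use assms U_GL in blast)+
qed

lemma U_minv: "u \<in> U \<Longrightarrow> minv u \<in> U"
  by (rule U_image[OF continuous_minv]) (use U0_minv U0_sub_U in blast)+

lemma U_algebraic: "algebraic_group n U"
  unfolding algebraic_group_def
proof (intro conjI U_closed subgroup.intro)
  show "U \<subseteq> carrier (GL n)" by (rule U_GL)
  show "\<one>\<^bsub>GL n\<^esub> \<in> U" using U0_sub_U gen_group.one by (auto simp: one_GL)
  show "x \<otimes>\<^bsub>GL n\<^esub> y \<in> U" if "x \<in> U" "y \<in> U" for x y using U_mult[OF that] by (simp add: mult_GL)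
  show "inv\<^bsub>GL n\<^esub> x \<in> U" if "x \<in> U" for x using U_minv[OF that] inv_GL[of x n] that U_GL by auto
qed

lemma U_connected: "connectedin (zariski n) U"
  unfolding gen_closure_def by (rule connectedin_closure_of[OF U0_connected])

lemma U_normal: "U \<lhd> GL_sub n G"
proof -
  have sG: "subgroup G (GL n)" using G by (simp add: algebraic_group_def)
  interpret H: group "GL_sub n G" by (rule subgroup.subgroup_is_group[OF sG group_GL])
  have sU: "subgroup U (GL n)" using U_algebraic by (simp add: algebraic_group_def)
  have sub: "subgroup U (GL_sub n G)"
    by (rule group.subgroup_incl[OF group_GL sU sG U_G])
  have "g * u * minv g \<in> U" if g: "g \<in> G" and u: "u \<in> U" for g u
  proof -
    have gG: "g \<in> carrier (GL n)" "minv g \<in> carrier (GL n)" using g G' by blast+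
    have "continuous_map (zariski n) (zariski n) ((\<lambda>x. x * minv g) \<circ> (\<lambda>x. g * x))"
      by (rule continuous_map_compose[OF continuous_left[OF gG(1)] continuous_right[OF gG(2)]])
    then have "((\<lambda>x. x * minv g) \<circ> (\<lambda>x. g * x)) u \<in> U"
      by (rule U_image) (use U0_conj[OF _ g] U0_sub_U u in auto)
    then show ?thesis by simp
  qed
  moreover have "inv\<^bsub>GL_sub n G\<^esub> g = minv g" if "g \<in> G" for g
    using group.m_inv_consistent[OF group_GL sG that] inv_GL[of g n] that G' by auto
  ultimately show ?thesis
    unfolding H.normal_inv_iff using sub by (simp add: mult_GL)
qed

lemma S_trivial:
  assumes "U = {1\<^sub>m n}" and X: "X \<in> S" shows "X = 0\<^sub>m n n"
proof -
  note Xc = S_carrier[OF X]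
  obtain c where c: "one_param n X c" using one_param_exists[OF Xc] by blast
  have "c t = 1\<^sub>m n" for t using U0_one_param[OF X c, of t] U0_sub_U assms(1) by blast
  then have "c = (\<lambda>_. 1\<^sub>m n)" by blast
  then have "mderiv n (\<lambda>_. 1\<^sub>m n) X 0" using one_paramD(3)[OF c, of 0] Xc by simp
  from mderiv_unique[OF this mderiv_const Xc zero_carrier_mat] show ?thesis .
qed

end

section \<open>Groups generated by exponentials of nilpotent matrices\<close>

lemma one_param_nilexp:
  assumes X: "X \<in> carrier_mat n n" and nil: "X ^\<^sub>m n = 0\<^sub>m n n"
  shows "one_param n X (nilexp n X)"
  unfolding one_param_def using nilexp_at_0[OF X] mderiv_nilexp[OF X nil] by simp

lemma bracket_zero_right: "m \<in> carrier_mat n n \<Longrightarrow> bracket m (0\<^sub>m n n) = 0\<^sub>m n n"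
  unfolding bracket_def by (simp add: right_mult_zero_mat left_mult_zero_mat)

text \<open>With 0 in place of \<open>x\<close> only the power \<open>i = 0\<close> contributes, and
  \<open>filt\<close> is the span of the products of at least \<open>c\<close> letters from
  \<open>L\<close>.\<close>

lemma filt_zero_pow:
  assumes L: "L \<subseteq> carrier_mat n n" and L0: "0\<^sub>m n n \<in> L" and b: "b \<in> filt n L (0\<^sub>m n n) 1"
  shows "b ^\<^sub>m k \<in> filt n L (0\<^sub>m n n) k"
proof -
  have norm: "\<forall>m\<in>L. bracket m (0\<^sub>m n n) \<in> L"
    using L L0 bracket_zero_right[of _ n] by auto
  show ?thesis
  proof (induction k)
    case 0
    show ?case
      using filt_mprod[OF L zero_carrier_mat norm, of "[]"] filt_carrier[OF L zero_carrier_mat norm b] by simp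
  next
    case (Suc k)
    show ?case using filt_mult[OF L zero_carrier_mat norm Suc b] by simp
  qed
qed

lemma nilexp_filt:
  assumes L: "L \<subseteq> carrier_mat n n" and L0: "0\<^sub>m n n \<in> L" and X: "X \<in> L"
  shows "\<exists>b\<in>filt n L (0\<^sub>m n n) 1. nilexp n X t = 1\<^sub>m n + b"
proof -
  have norm: "\<forall>m\<in>L. bracket m (0\<^sub>m n n) \<in> L"
    using L L0 bracket_zero_right[of _ n] by auto
  note fc = filt_carrier[OF L zero_carrier_mat norm]
  have Xc: "X \<in> carrier_mat n n" using X L by blast
  have X1: "X \<in> filt n L (0\<^sub>m n n) 1"
    using filt_mprod[OF L zero_carrier_mat norm, of "[X]"] X Xc by simp
  define ps where "ps k = mat n n (\<lambda>(i, j). \<Sum>m<Suc k. t ^ m / fact m * (X ^\<^sub>m m) $$ (i, j))" for k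
  have ps: "\<exists>b\<in>filt n L (0\<^sub>m n n) 1. ps k = 1\<^sub>m n + b" for k
  proof (induction k)
    case 0
    have "ps 0 = 1\<^sub>m n + 0\<^sub>m n n" by (rule eq_matI) (use Xc in \<open>auto simp: ps_def\<close>)
    then show ?case using filt.zero by blast
  next
    case (Suc k)
    then obtain b where b: "b \<in> filt n L (0\<^sub>m n n) 1" "ps k = 1\<^sub>m n + b" by blast
    let ?b = "b + (t ^ Suc k / fact (Suc k)) \<cdot>\<^sub>m X ^\<^sub>m Suc k"
    have Xk: "X ^\<^sub>m Suc k \<in> filt n L (0\<^sub>m n n) 1"
      by (rule filt_weaken[OF L zero_carrier_mat norm filt_zero_pow[OF L L0 X1]]) simp
    have "ps (Suc k) = ps k + (t ^ Suc k / fact (Suc k)) \<cdot>\<^sub>m X ^\<^sub>m Suc k"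
    proof (rule sq_eqI[of _ n])
      fix i j assume ij: "i < n" "j < n"
      define Y where "Y = X ^\<^sub>m Suc k"
      have Y: "Y \<in> carrier_mat n n" unfolding Y_def by (rule fc[OF Xk])
      show "ps (Suc k) $$ (i, j) = (ps k + (t ^ Suc k / fact (Suc k)) \<cdot>\<^sub>m X ^\<^sub>m Suc k) $$ (i, j)"
        unfolding Y_def[symmetric] ps_def sum.lessThan_Suc[of _ "Suc k"] using ij Y by (simp del: sum.lessThan_Suc)
    qed (use fc[OF Xk] in \<open>simp_all add: ps_def\<close>)
    also have "\<dots> = 1\<^sub>m n + ?b"
      unfolding b(2) using fc[OF b(1)] fc[OF Xk] by (intro assoc_add_mat) auto
    finally show ?case using filt.add[OF b(1) filt.smult[OF Xk]] by blast
  qed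
  show ?thesis
  proof (cases n)
    case 0
    then have "nilexp n X t = 1\<^sub>m n + 0\<^sub>m n n" by (intro sq_eqI[of _ n]) (auto simp: nilexp_def)
    then show ?thesis using filt.zero by blast
  next
    case (Suc k)
    then have "nilexp n X t = ps k" unfolding nilexp_def ps_def by simp
    then show ?thesis using ps by simp
  qed
qed

text \<open>The matrices \<open>1 + b\<close> with \<open>b\<close> of filtration degree 1 are
  closed under products, and the \<open>k\<close>-th power of such a \<open>b\<close> has degree
  \<open>k\<close>, hence is 0. That \<open>k\<close> is the same for all elements lets the
  condition pass to the Zariski closure.\<close>

lemma gen_group_unipotent:
  assumes L: "lie_subalgebra n L" and nil: "\<And>X. X \<in> L \<Longrightarrow> X ^\<^sub>m n = 0\<^sub>m n n"
  shows "\<exists>k. \<forall>g\<in>gen_group n L. (g - 1\<^sub>m n) ^\<^sub>m k = 0\<^sub>m n n"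
proof -
  obtain k where k: "nil_of_index n k L" using engel[OF L nil] by blast
  have Ls: "subspace_mat n L" using L by (simp add: lie_subalgebra_def)
  note Lc = subspaceD(1)[OF Ls] and L0 = subspaceD(2)[OF Ls]
  have norm: "\<forall>m\<in>L. bracket m (0\<^sub>m n n) \<in> L"
    using Lc L0 bracket_zero_right[of _ n] by auto
  note fc = filt_carrier[OF Lc zero_carrier_mat norm]
  have "\<exists>b\<in>filt n L (0\<^sub>m n n) 1. g = 1\<^sub>m n + b" if "g \<in> gen_group n L" for g
    using that
  proof (induction rule: gen_group.induct)
    case one
    have "1\<^sub>m n = 1\<^sub>m n + (0\<^sub>m n n :: complex mat)" by simp
    then show ?case using filt.zero by blast
  next
    case (step X c g t)
    then obtain b where b: "b \<in> filt n L (0\<^sub>m n n) 1" "g = 1\<^sub>m n + b" by blast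
    have Xc: "X \<in> carrier_mat n n" using step Lc by blast
    obtain a where a: "a \<in> filt n L (0\<^sub>m n n) 1" "nilexp n X t = 1\<^sub>m n + a"
      using nilexp_filt[OF Lc L0 step(1)] by blast
    have ct: "c t = 1\<^sub>m n + a"
      using one_param_unique[OF Xc step(2) one_param_nilexp[OF Xc nil[OF step(1)]]] a by simp
    have ab: "a * b \<in> filt n L (0\<^sub>m n n) 1"
      by (rule filt_weaken[OF Lc zero_carrier_mat norm filt_mult[OF Lc zero_carrier_mat norm a(1) b(1)]]) simp
    have c: "a \<in> carrier_mat n n" "b \<in> carrier_mat n n" "1\<^sub>m n + b \<in> carrier_mat n n" using fc a b by auto
    have "c t * g = (1\<^sub>m n + b) + (a + a * b)"
      unfolding ct b(2) add_mult_distrib_mat[OF one_carrier_mat c(1) c(3)] left_mult_one_mat[OF c(3)]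
        mult_add_distrib_mat[OF c(1) one_carrier_mat c(2)] right_mult_one_mat[OF c(1)] ..
    also have "\<dots> = 1\<^sub>m n + (b + (a + a * b))" using c fc[OF ab] by (intro assoc_add_mat) auto
    finally show ?case using filt.add[OF b(1) filt.add[OF a(1) ab]] by blast
  qed note * = this
  have "(g - 1\<^sub>m n) ^\<^sub>m k = 0\<^sub>m n n" if g: "g \<in> gen_group n L" for g
  proof -
    obtain b where b: "b \<in> filt n L (0\<^sub>m n n) 1" "g = 1\<^sub>m n + b" using *[OF g] by blast
    have "g - 1\<^sub>m n = b" unfolding b(2) using fc[OF b(1)] by (intro eq_matI) auto
    then show ?thesis using filt_nil[OF Lc zero_carrier_mat norm k filt_zero_pow[OF Lc L0 b(1)]] by simp
  qed
  then show ?thesis by blast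
qed

lemma closedin_unipotent: "closedin (zariski n) {g \<in> carrier (GL n). (g - 1\<^sub>m n) ^\<^sub>m k = 0\<^sub>m n n}"
proof -
  have c: "g - 1\<^sub>m n \<in> carrier_mat n n" "(g - 1\<^sub>m n) ^\<^sub>m k \<in> carrier_mat n n" if "g \<in> carrier (GL n)" for g k
    using GL_carrier[OF that] by (auto intro!: pow_carrier_mat minus_carrier_mat)
  have reg: "reg n (\<lambda>g. ((g - 1\<^sub>m n) ^\<^sub>m k) $$ (i, j))" if "i < n" "j < n" for i j k
    using that
  proof (induction k arbitrary: i j)
    case 0
    show ?case
      by (rule reg_cong[THEN iffD1, rotated, OF reg_const[of n "if i = j then 1 else 0"]]) (use 0 in simp)
  next
    case (Suc k)
    have "reg n (\<lambda>g. \<Sum>l<n. ((g - 1\<^sub>m n) ^\<^sub>m k) $$ (i, l) * (g $$ (l, j) - (if l = j then 1 else 0)))"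
    proof (rule reg_sum)
      fix l assume l: "l \<in> {..<n}"
      have 1: "reg n (\<lambda>g. ((g - 1\<^sub>m n) ^\<^sub>m k) $$ (i, l))" using Suc l by blast
      have 2: "reg n (\<lambda>g. g $$ (l, j) - (if l = j then 1 else 0))"
        by (rule reg_diff[OF reg_entry reg_const]) (use l Suc in auto)
      show "reg n (\<lambda>g. ((g - 1\<^sub>m n) ^\<^sub>m k) $$ (i, l) * (g $$ (l, j) - (if l = j then 1 else 0)))"
        by (rule reg_mult[OF 1 2])
    qed
    then show ?case
    proof (rule reg_cong[THEN iffD1, rotated])
      fix g assume g: "g \<in> carrier (GL n)"
      have "((g - 1\<^sub>m n) ^\<^sub>m Suc k) $$ (i, j) = (\<Sum>l<n. ((g - 1\<^sub>m n) ^\<^sub>m k) $$ (i, l) * (g - 1\<^sub>m n) $$ (l, j))"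
        using mat_mult_entry[OF c(2)[OF g] c(1)[OF g] Suc.prems, of k] by simp
      also have "\<dots> = (\<Sum>l<n. ((g - 1\<^sub>m n) ^\<^sub>m k) $$ (i, l) * (g $$ (l, j) - (if l = j then 1 else 0)))"
        using GL_carrier[OF g] Suc.prems by (intro sum.cong) auto
      finally show "(\<Sum>l<n. ((g - 1\<^sub>m n) ^\<^sub>m k) $$ (i, l) * (g $$ (l, j) - (if l = j then 1 else 0))) = ((g - 1\<^sub>m n) ^\<^sub>m Suc k) $$ (i, j)" ..
    qed
  qed
  have "{g \<in> carrier (GL n). (g - 1\<^sub>m n) ^\<^sub>m k = 0\<^sub>m n n} = {g \<in> carrier (GL n). \<forall>p\<in>idx n. ((g - 1\<^sub>m n) ^\<^sub>m k) $$ p = 0}"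
  proof (intro Collect_cong conj_cong refl)
    fix g assume g: "g \<in> carrier (GL n)"
    show "(g - 1\<^sub>m n) ^\<^sub>m k = 0\<^sub>m n n \<longleftrightarrow> (\<forall>p\<in>idx n. ((g - 1\<^sub>m n) ^\<^sub>m k) $$ p = 0)"
      using c(2)[OF g, of k] by (auto intro!: sq_eqI[of _ n])
  qed
  moreover have "closedin (zariski n) {g \<in> carrier (GL n). \<forall>p\<in>idx n. ((g - 1\<^sub>m n) ^\<^sub>m k) $$ p = 0}"
    by (rule closedin_zariski_reg) (use reg in auto)
  ultimately show ?thesis by simp
qed

text \<open>The closure of the generated group is a connected normal unipotent subgroup, trivial by
  reductivity. All one-parameter subgroups from \<open>L\<close> are then constant.\<close>

theorem reductive_nil_ideal_zero:
  assumes red: "reductive n G" and L: "lie_subalgebra n L" "L \<subseteq> lie_algebra n G"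
    and Ad: "\<And>g X. g \<in> G \<Longrightarrow> X \<in> L \<Longrightarrow> g * X * minv g \<in> L"
    and nil: "\<And>X. X \<in> L \<Longrightarrow> X ^\<^sub>m n = 0\<^sub>m n n" and X: "X \<in> L"
  shows "X = 0\<^sub>m n n"
proof -
  have G: "algebraic_group n G" using red by (simp add: reductive_def)
  interpret Ad_stable n G L by unfold_locales (fact G L(2) Ad)+
  obtain k where k: "\<forall>g\<in>gen_group n L. (g - 1\<^sub>m n) ^\<^sub>m k = 0\<^sub>m n n" using gen_group_unipotent[OF L(1) nil] by blast
  have "U \<subseteq> {g \<in> carrier (GL n). (g - 1\<^sub>m n) ^\<^sub>m k = 0\<^sub>m n n}"
    by (rule U_minimal[OF closedin_unipotent]) (use k U0_GL in blast)
  then have "\<forall>u\<in>U. unipotent n u" unfolding unipotent_def by blast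
  then have "U = {1\<^sub>m n}" using red U_algebraic U_connected U_normal unfolding reductive_def by blast
  then show ?thesis using S_trivial X by blast
qed

section \<open>Groups generated by exponentials of central elements\<close>

lemma closedin_commute:
  assumes h: "h \<in> carrier_mat n n" shows "closedin (zariski n) {g \<in> carrier (GL n). g * h = h * g}"
proof -
  have r: "reg n (\<lambda>g. (\<Sum>l<n. g $$ (i, l) * h $$ (l, j)) - (\<Sum>l<n. h $$ (i, l) * g $$ (l, j)))" if "i < n" "j < n" for i j
    using that by (intro reg_diff reg_sum reg_mult reg_entry reg_const) auto
  have "{g \<in> carrier (GL n). g * h = h * g} = {g \<in> carrier (GL n). \<forall>p\<in>idx n.
      (\<Sum>l<n. g $$ (fst p, l) * h $$ (l, snd p)) - (\<Sum>l<n. h $$ (fst p, l) * g $$ (l, snd p)) = 0}"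
  proof (intro Collect_cong conj_cong refl)
    fix g assume g: "g \<in> carrier (GL n)"
    note gc = GL_carrier[OF g]
    have "g * h = h * g \<longleftrightarrow> (\<forall>i<n. \<forall>j<n. (g * h) $$ (i, j) = (h * g) $$ (i, j))"
      using sq_eqI[OF sq_mult_closed[OF gc h] sq_mult_closed[OF h gc]] by auto
    then show "g * h = h * g \<longleftrightarrow> (\<forall>p\<in>idx n.
      (\<Sum>l<n. g $$ (fst p, l) * h $$ (l, snd p)) - (\<Sum>l<n. h $$ (fst p, l) * g $$ (l, snd p)) = 0)"
      by (auto simp: mat_mult_entry[OF gc h] mat_mult_entry[OF h gc] simp del: index_mult_mat(1))
  qed
  moreover have "closedin (zariski n) {g \<in> carrier (GL n). \<forall>p\<in>idx n.
      (\<Sum>l<n. g $$ (fst p, l) * h $$ (l, snd p)) - (\<Sum>l<n. h $$ (fst p, l) * g $$ (l, snd p)) = 0}"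
    by (rule closedin_zariski_reg) (use r in auto)
  ultimately show ?thesis by simp
qed

lemma commutative_solvable:
  assumes "group H" and comm: "\<And>x y. x \<in> carrier H \<Longrightarrow> y \<in> carrier H \<Longrightarrow> x \<otimes>\<^bsub>H\<^esub> y = y \<otimes>\<^bsub>H\<^esub> x"
  shows "solvable H"
proof -
  interpret group H by fact
  have "x \<otimes>\<^bsub>H\<^esub> y \<otimes>\<^bsub>H\<^esub> inv\<^bsub>H\<^esub> x \<otimes>\<^bsub>H\<^esub> inv\<^bsub>H\<^esub> y = \<one>\<^bsub>H\<^esub>" if "x \<in> carrier H" "y \<in> carrier H" for x y
    using comm[OF that] that by (simp add: m_assoc r_inv)
  then have "derived_set H (carrier H) \<subseteq> {\<one>\<^bsub>H\<^esub>}" by auto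
  moreover have "\<one>\<^bsub>H\<^esub> \<in> derived_set H (carrier H)" by force
  ultimately have "derived_set H (carrier H) = {\<one>\<^bsub>H\<^esub>}" by blast
  then have "derived H (carrier H) = {\<one>\<^bsub>H\<^esub>}" unfolding derived_def by (simp add: generate_one)
  then have "(derived H ^^ 1) (carrier H) = {\<one>\<^bsub>H\<^esub>}" by simp
  then show ?thesis unfolding solvable_iff_trivial_derived_seq by blast
qed

lemma bracket_zero_iff:
  assumes "A \<in> carrier_mat n n" "B \<in> carrier_mat n n"
  shows "bracket A B = 0\<^sub>m n n \<longleftrightarrow> A * B = B * A"
proof
  assume b: "bracket A B = 0\<^sub>m n n"
  show "A * B = B * A"
  proof (rule sq_eqI[OF sq_mult_closed[OF assms] sq_mult_closed[OF assms(2,1)]])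
    fix i j assume ij: "i < n" "j < n"
    have "bracket A B $$ (i, j) = (A * B) $$ (i, j) - (B * A) $$ (i, j)"
      unfolding bracket_def using ij assms by (intro index_minus_mat) auto
    then show "(A * B) $$ (i, j) = (B * A) $$ (i, j)" using b ij by simp
  qed
qed (use assms in \<open>auto simp: bracket_def minus_r_inv_mat[OF sq_mult_closed]\<close>)

text \<open>The centre of the Lie algebra is stable under \<open>G\<close>, and its exponentials
  commute with each other. Commutativity passes to the closure one factor at a time, because
  commuting with a fixed matrix is a closed condition; the closure is then solvable, hence
  trivial.\<close>

theorem semisimple_center_zero:
  assumes ss: "semisimple n G" and X: "X \<in> lie_algebra n G"
    and central: "\<And>Y. Y \<in> lie_algebra n G \<Longrightarrow> bracket X Y = 0\<^sub>m n n"
  shows "X = 0\<^sub>m n n"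
proof -
  have G: "algebraic_group n G" using ss by (simp add: semisimple_def)
  define Z where "Z = {X \<in> lie_algebra n G. \<forall>Y\<in>lie_algebra n G. X * Y = Y * X}"
  have Z: "Z \<subseteq> lie_algebra n G" by (auto simp: Z_def)
  have Ad: "g * X * minv g \<in> Z" if g: "g \<in> G" and X: "X \<in> Z" for g X
  proof -
    have XL: "X \<in> lie_algebra n G" using X Z by blast
    have gG: "g \<in> carrier (GL n)" "minv g \<in> G" using g algebraic_groupD[OF G] by blast+
    note c = GL_carrier[OF gG(1)] GL_carrier[OF minv(1)[OF gG(1)]] lie_carrier[OF XL]
    have "g * X * minv g * Y = Y * (g * X * minv g)" if Y: "Y \<in> lie_algebra n G" for Y
    proof -
      note Yc = lie_carrier[OF Y]
      \<comment> \<open>To test against \<open>Y\<close> that the conjugate of \<open>X\<close> by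
        \<open>g\<close> is central, move \<open>g\<close> to the other side: \<open>X\<close>
        commutes with the conjugate of \<open>Y\<close> by \<open>minv g\<close>.\<close>
      have "minv g * Y * minv (minv g) \<in> lie_algebra n G" by (rule lie_Ad[OF G Y gG(2)])
      then have "X * (minv g * Y * minv (minv g)) = minv g * Y * minv (minv g) * X" using X unfolding Z_def by blast
      then have comm: "X * (minv g * Y * g) = minv g * Y * g * X" by (simp only: minv_minv[OF gG(1)])
      have "g * X * minv g * Y = g * X * minv g * Y * (g * minv g)"
        using c Yc minv(2)[OF gG(1)] by (simp add: right_mult_one_mat[of _ n n] sq_mult_closed)
      also have "\<dots> = g * (X * (minv g * Y * g)) * minv g" using c Yc by (simp only: sq_assoc[of _ n] sq_mult_closed)
      also have "\<dots> = (g * minv g) * Y * (g * X * minv g)" unfolding comm using c Yc by (simp only: sq_assoc[of _ n] sq_mult_closed)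
      finally show ?thesis using c Yc by (simp add: minv(2)[OF gG(1)])
    qed
    then show ?thesis using lie_Ad[OF G XL g] unfolding Z_def by blast
  qed
  interpret Ad_stable n G Z by unfold_locales (fact G Z Ad)+
  have cc: "c t * d s = d s * c t" if "X \<in> Z" "one_param n X c" "Y \<in> Z" "one_param n Y d" for X Y c d s t
  proof -
    have XY: "X * Y = Y * X" using that(1,3) unfolding Z_def by blast
    have Xc: "X \<in> carrier_mat n n" and Yc: "Y \<in> carrier_mat n n" using S_carrier that by auto
    have "c t * Y = Y * c t" by (rule one_param_commute[OF Xc that(2) Yc XY])
    from one_param_commute[OF Yc that(4) one_paramD(1)[OF that(2)] this[symmetric]] show ?thesis by simp
  qed
  have comm0: "g * h = h * g" if g: "g \<in> U0" and h: "h \<in> U0" for g h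
  proof -
    have *: "c t * h = h * c t" if X: "X \<in> Z" "one_param n X c" for X c t
      using h
    proof (induction rule: gen_group.induct)
      case one then show ?case using one_paramD(1)[OF X(2), of t] by simp
    next
      case (step Y d h s)
      note cs = one_paramD(1)[OF X(2)] one_paramD(1)[OF step(2)] U0_carrier[OF step(3)]
      have "c t * (d s * h) = d s * (c t * h)"
        using cc[OF X step(1,2), of t s] by (simp add: sq_assoc[OF cs(1,2,3), symmetric] sq_assoc[OF cs(2,1,3)])
      also have "\<dots> = d s * h * c t" using step(4) by (simp add: sq_assoc[OF cs(2,3,1)])
      finally show ?case .
    qed
    show ?thesis
      using g
    proof (induction rule: gen_group.induct)
      case one then show ?case using U0_carrier[OF h] by simp
    next
      case (step X c g t)
      note cs = one_paramD(1)[OF step(2)] U0_carrier[OF step(3)] U0_carrier[OF h]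
      have "c t * g * h = c t * h * g" using step(4) by (simp add: sq_assoc[OF cs(1,2,3)] sq_assoc[OF cs(1,3,2)])
      also have "\<dots> = h * (c t * g)" using *[OF step(1,2)] by (simp add: sq_assoc[OF cs(3,1,2)])
      finally show ?case .
    qed
  qed
  have comm1: "u * h = h * u" if u: "u \<in> U" and h: "h \<in> U0" for u h
  proof -
    have "U \<subseteq> {g \<in> carrier (GL n). g * h = h * g}"
      by (rule U_minimal[OF closedin_commute[OF U0_carrier[OF h]]]) (use comm0[OF _ h] U0_GL in blast)
    then show ?thesis using u by blast
  qed
  have comm: "u * v = v * u" if u: "u \<in> U" and v: "v \<in> U" for u v
  proof -
    have "v \<in> carrier_mat n n" using v U_GL GL_carrier by blast
    then have "U \<subseteq> {g \<in> carrier (GL n). g * v = v * g}"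
      by (rule U_minimal[OF closedin_commute]) (use comm1[OF v] U0_GL in \<open>auto\<close>)
    then show ?thesis using u by blast
  qed
  have "subgroup U (GL n)" using U_algebraic by (simp add: algebraic_group_def)
  then have "group (GL_sub n U)" by (rule subgroup.subgroup_is_group[OF _ group_GL])
  then have "solvable (GL_sub n U)" by (rule commutative_solvable) (simp add: mult_GL, rule comm)
  then have "U = {1\<^sub>m n}" using ss U_algebraic U_connected U_normal unfolding semisimple_def by blast
  moreover have "X \<in> Z"
    using X central bracket_zero_iff[OF lie_carrier[OF X] lie_carrier] unfolding Z_def by blast
  ultimately show ?thesis using S_trivial by blast
qed

section \<open>The trace form and the Cayley mapping\<close>

lemma trace_mat_add:
  assumes "A \<in> carrier_mat m m" "B \<in> carrier_mat m m"
  shows "trace_mat (A + B) = trace_mat A + trace_mat B"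
  unfolding trace_mat_def using assms by (auto simp: sum.distrib)

lemma trace_mat_smult:
  assumes "A \<in> carrier_mat m m" shows "trace_mat (a \<cdot>\<^sub>m A) = a * trace_mat A"
  unfolding trace_mat_def using assms by (auto simp: sum_distrib_left)

lemma trace_mat_diff:
  assumes "A \<in> carrier_mat m m" "B \<in> carrier_mat m m"
  shows "trace_mat (A - B) = trace_mat A - trace_mat B"
  unfolding trace_mat_def using assms by (auto simp: sum_subtractf)

lemma trace_mat_rotate:
  assumes "A \<in> carrier_mat m m" "B \<in> carrier_mat m m" "C \<in> carrier_mat m m"
  shows "trace_mat (A * B * C) = trace_mat (C * A * B)"
  using trace_mat_mult_comm[OF sq_mult_closed[OF assms(1,2)] assms(3)] sq_assoc[OF assms(3,1,2)] by simp

lemma trace_bracket_invariant: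
  assumes A: "A \<in> carrier_mat m m" and B: "B \<in> carrier_mat m m" and C: "C \<in> carrier_mat m m"
  shows "trace_mat (bracket A B * C) = trace_mat (A * bracket B C)"
proof -
  have "trace_mat (bracket A B * C) = trace_mat (A * B * C) - trace_mat (B * A * C)"
    unfolding bracket_def minus_mult_distrib_mat[OF sq_mult_closed[OF A B] sq_mult_closed[OF B A] C]
    by (rule trace_mat_diff[of _ m]) (intro sq_mult_closed A B C)+
  moreover have "trace_mat (A * bracket B C) = trace_mat (A * B * C) - trace_mat (A * C * B)"
    unfolding bracket_def mult_minus_distrib_mat[OF A sq_mult_closed[OF B C] sq_mult_closed[OF C B]]
      sq_assoc[OF A B C] sq_assoc[OF A C B]
    by (rule trace_mat_diff[of _ m]) (intro sq_mult_closed A B C)+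
  ultimately show ?thesis using trace_mat_rotate[OF A C B] by simp
qed

context rational_representation
begin

abbreviation "tform X Y \<equiv> trace_mat (d\<pi> X * d\<pi> Y)"

definition "nondegenerate \<longleftrightarrow> (\<forall>X\<in>\<gg>. (\<forall>Y\<in>\<gg>. tform X Y = 0) \<longrightarrow> X = 0\<^sub>m n n)"

lemma tform_sym: "tform X Y = tform Y X"
  by (rule trace_mat_mult_comm[OF dpi_carrier dpi_carrier])

lemma tform_add: "X \<in> \<gg> \<Longrightarrow> Y \<in> \<gg> \<Longrightarrow> tform (X + Y) Z = tform X Z + tform Y Z"
  unfolding dpi_add add_mult_distrib_mat[OF dpi_carrier dpi_carrier dpi_carrier]
  by (rule trace_mat_add[of _ m]) (intro sq_mult_closed dpi_carrier)+

lemma tform_smult: "X \<in> \<gg> \<Longrightarrow> tform (a \<cdot>\<^sub>m X) Z = a * tform X Z"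
  unfolding dpi_smult mult_smult_assoc_mat[OF dpi_carrier dpi_carrier]
  by (rule trace_mat_smult[of _ m]) (intro sq_mult_closed dpi_carrier)

lemma tform_bracket: "X \<in> \<gg> \<Longrightarrow> Y \<in> \<gg> \<Longrightarrow> Z \<in> \<gg> \<Longrightarrow> tform (bracket X Y) Z = tform X (bracket Y Z)"
  unfolding dpi_bracket by (rule trace_bracket_invariant) (rule dpi_carrier)+

lemma tform_Ad:
  assumes X: "X \<in> \<gg>" and Y: "Y \<in> \<gg>" and g: "g \<in> G"
  shows "tform (g * X * minv g) Y = tform X (minv g * Y * g)"
proof -
  have gG: "g \<in> carrier (GL n)" using g G' by blast
  have c: "\<pi> g \<in> carrier_mat m m" "minv (\<pi> g) \<in> carrier_mat m m"
    using pi_carrier[OF g] GL_carrier[OF minv(1)[OF pi_GL[OF g]]] by auto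
  have "minv g * Y * minv (minv g) \<in> \<gg>" "d\<pi> (minv g * Y * minv (minv g)) = \<pi> (minv g) * d\<pi> Y * minv (\<pi> (minv g))"
    using lie_Ad[OF G Y G'(4)[OF g]] dpi_Ad[OF Y G'(4)[OF g]] by auto
  then have dY: "d\<pi> (minv g * Y * g) = minv (\<pi> g) * d\<pi> Y * \<pi> g"
    by (simp add: minv_minv[OF gG] pi_minv[OF g] minv_minv[OF pi_GL[OF g]])
  have "tform (g * X * minv g) Y = trace_mat (\<pi> g * (d\<pi> X * minv (\<pi> g) * d\<pi> Y))"
    unfolding dpi_Ad[OF X g] using c by (simp only: sq_assoc[of _ m] sq_mult_closed dpi_carrier)
  also have "\<dots> = trace_mat (d\<pi> X * minv (\<pi> g) * d\<pi> Y * \<pi> g)"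
    by (rule trace_mat_mult_comm[of _ m]) (intro c sq_mult_closed dpi_carrier)+
  also have "\<dots> = tform X (minv g * Y * g)"
    unfolding dY using c by (simp only: sq_assoc[of _ m] sq_mult_closed dpi_carrier)
  finally show ?thesis .
qed

lemma trace_radical_subalgebra: "lie_subalgebra n trace_radical"
  unfolding lie_subalgebra_def subspace_mat_def
proof (intro conjI ballI allI)
  show "trace_radical \<subseteq> carrier_mat n n" using lie_carrier by (auto simp: trace_radical_def)
  show "0\<^sub>m n n \<in> trace_radical"
    using lie_closed(1) tform_smult[OF lie_closed(1), of 0] by (simp add: trace_radical_def)
  show "X + Y \<in> trace_radical" if "X \<in> trace_radical" "Y \<in> trace_radical" for X Y
    using that lie_closed(2) by (simp add: trace_radical_def tform_add)
  show "a \<cdot>\<^sub>m X \<in> trace_radical" if "X \<in> trace_radical" for a X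
    using that lie_closed(3) by (simp add: trace_radical_def tform_smult)
  show "bracket X Y \<in> trace_radical" if "X \<in> trace_radical" "Y \<in> trace_radical" for X Y
    using that lie_bracket[OF G] by (simp add: trace_radical_def tform_bracket)
qed

theorem reductive_nondegenerate:
  assumes red: "reductive n G" and faithful: "locally_faithful n G m \<pi>"
  shows nondegenerate
  unfolding nondegenerate_def
proof (intro ballI impI)
  fix X assume X: "X \<in> \<gg>" "\<forall>Y\<in>\<gg>. tform X Y = 0"
  show "X = 0\<^sub>m n n"
  proof (rule reductive_nil_ideal_zero[OF red trace_radical_subalgebra])
    show "trace_radical \<subseteq> \<gg>" by (auto simp: trace_radical_def)
    show "g * X * minv g \<in> trace_radical" if g: "g \<in> G" and X: "X \<in> trace_radical" for g X
    proof -
      have gG: "g \<in> carrier (GL n)" using g G' by blast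
      have Xg: "X \<in> \<gg>" using X by (simp add: trace_radical_def)
      have "tform (g * X * minv g) Y = 0" if Y: "Y \<in> \<gg>" for Y
      proof -
        have "minv g * Y * g \<in> \<gg>" using lie_Ad[OF G Y G'(4)[OF g]] by (simp add: minv_minv[OF gG])
        then show ?thesis using tform_Ad[OF Xg Y g] X by (simp add: trace_radical_def)
      qed
      then show ?thesis using lie_Ad[OF G Xg g] by (simp add: trace_radical_def)
    qed
    show "X ^\<^sub>m n = 0\<^sub>m n n" if "X \<in> trace_radical" for X by (rule trace_radical_nilpotent[OF faithful that])
    show "X \<in> trace_radical" using X by (simp add: trace_radical_def)
  qed
qed

text \<open>The matrix \<open>A\<close> is kept general: \<open>\<pi> g\<close> gives the Cayley
  mapping on the whole Lie algebra, and \<open>d\<pi> Y\<close> gives the orthogonal projection of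
  \<open>Y\<close> to a subspace \<open>S\<close>.\<close>

lemma form_representation:
  assumes nd: "\<And>X. X \<in> S \<Longrightarrow> (\<And>Y. Y \<in> S \<Longrightarrow> tform X Y = 0) \<Longrightarrow> X = 0\<^sub>m n n"
    and S: "subspace_mat n S" "S \<subseteq> \<gg>" and A: "A \<in> carrier_mat m m"
  shows "\<exists>Y\<in>S. \<forall>X\<in>S. tform Y X = trace_mat (A * d\<pi> X)"
proof (rule riesz[OF S(1)])
  have g: "X \<in> \<gg>" if "X \<in> S" for X using that S(2) by blast
  show "tform (X + Y) Z = tform X Z + tform Y Z" if "X \<in> S" "Y \<in> S" for X Y Z
    using that g by (simp add: tform_add)
  show "tform Z (X + Y) = tform Z X + tform Z Y" if "X \<in> S" "Y \<in> S" for X Y Z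
    using that g tform_sym[of Z] by (simp add: tform_add)
  show "tform (a \<cdot>\<^sub>m X) Y = a * tform X Y" if "X \<in> S" for a X Y
    using that g by (simp add: tform_smult)
  show "tform Y (a \<cdot>\<^sub>m X) = a * tform Y X" if "X \<in> S" for a X Y
    using that g tform_sym[of Y] by (simp add: tform_smult)
  show "X = 0\<^sub>m n n" if "X \<in> S" "\<And>Y. Y \<in> S \<Longrightarrow> tform Y X = 0" for X
    using nd[OF that(1)] that(2) tform_sym by metis
  show "trace_mat (A * d\<pi> (X + Y)) = trace_mat (A * d\<pi> X) + trace_mat (A * d\<pi> Y)" if "X \<in> S" "Y \<in> S" for X Y
    unfolding dpi_add[OF g[OF that(1)] g[OF that(2)]] mult_add_distrib_mat[OF A dpi_carrier dpi_carrier]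
    by (rule trace_mat_add[of _ m]) (intro sq_mult_closed A dpi_carrier)+
  show "trace_mat (A * d\<pi> (a \<cdot>\<^sub>m X)) = a * trace_mat (A * d\<pi> X)" if "X \<in> S" for a X
    unfolding dpi_smult[OF g[OF that]] mult_smult_distrib[OF A dpi_carrier]
    by (rule trace_mat_smult[of _ m]) (intro sq_mult_closed A dpi_carrier)
qed

lemma tform_diff:
  assumes "X \<in> \<gg>" "Y \<in> \<gg>" shows "tform (X - Y) Z = tform X Z - tform Y Z" "X - Y \<in> \<gg>"
proof -
  have eq: "X - Y = X + (- 1) \<cdot>\<^sub>m Y"
    using minus_add_uminus_mat[OF lie_carrier[OF assms(1)] lie_carrier[OF assms(2)]] by (simp add: neg_one_smult_mat)
  show "X - Y \<in> \<gg>" unfolding eq by (intro lie_closed assms)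
  show "tform (X - Y) Z = tform X Z - tform Y Z"
    unfolding eq using tform_add[OF assms(1) lie_closed(3)[OF assms(2)], of "-1" Z] tform_smult[OF assms(2), of "-1" Z] by simp
qed

lemma nondegenerate_eqI:
  assumes nondegenerate "X \<in> \<gg>" "Y \<in> \<gg>" "\<And>Z. Z \<in> \<gg> \<Longrightarrow> tform X Z = tform Y Z" shows "X = Y"
proof -
  have "X - Y = 0\<^sub>m n n"
    using assms(1) tform_diff[OF assms(2,3)] assms(4) unfolding nondegenerate_def by simp
  have "X = (X - Y) + Y" using lie_carrier[OF assms(2)] lie_carrier[OF assms(3)] by (intro eq_matI) auto
  then show ?thesis using \<open>X - Y = 0\<^sub>m n n\<close> lie_carrier[OF assms(3)] by simp
qed

section \<open>The Cayley mapping and its restrictions\<close>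

lemma cayley_eqI:
  assumes nd: nondegenerate and Y: "Y \<in> \<gg>" "\<And>X. X \<in> \<gg> \<Longrightarrow> tform Y X = trace_mat (\<pi> g * d\<pi> X)"
  shows "cayley n G m \<pi> g = Y"
  unfolding cayley_def
proof (rule the_equality)
  show "Y \<in> \<gg> \<and> (\<forall>X\<in>\<gg>. tform Y X = trace_mat (\<pi> g * d\<pi> X))" using Y by blast
  fix Z assume "Z \<in> \<gg> \<and> (\<forall>X\<in>\<gg>. tform Z X = trace_mat (\<pi> g * d\<pi> X))"
  then show "Z = Y" using nondegenerate_eqI[OF nd _ Y(1)] Y(2) by simp
qed

lemma cayley:
  assumes nd: nondegenerate and g: "g \<in> G"
  shows "cayley n G m \<pi> g \<in> \<gg>" "X \<in> \<gg> \<Longrightarrow> tform (cayley n G m \<pi> g) X = trace_mat (\<pi> g * d\<pi> X)"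
proof -
  obtain Y where Y: "Y \<in> \<gg>" "\<And>X. X \<in> \<gg> \<Longrightarrow> tform Y X = trace_mat (\<pi> g * d\<pi> X)"
    using form_representation[OF _ lie_subspace[OF G'(1)] order_refl pi_carrier[OF g]] nd unfolding nondegenerate_def by blast
  then have "cayley n G m \<pi> g = Y" using cayley_eqI[OF nd] by blast
  then show "cayley n G m \<pi> g \<in> \<gg>" "X \<in> \<gg> \<Longrightarrow> tform (cayley n G m \<pi> g) X = trace_mat (\<pi> g * d\<pi> X)" using Y by auto
qed

text \<open>As \<open>\<pi> a\<close> commutes with \<open>\<pi> g\<close>, the linear form that
  defines the Cayley image is invariant under conjugation by \<open>a\<close>, and so is the element
  that represents it.\<close>

lemma cayley_commute:
  assumes nd: nondegenerate and g: "g \<in> G" and a: "a \<in> G" and ag: "a * g = g * a"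
  shows "cayley n G m \<pi> g * a = a * cayley n G m \<pi> g"
proof -
  let ?Y = "cayley n G m \<pi> g"
  note Y = cayley[OF nd g]
  have aG: "a \<in> carrier (GL n)" using a G' by blast
  note ac = GL_carrier[OF aG] GL_carrier[OF minv(1)[OF aG]]
  have pc: "\<pi> g \<in> carrier_mat m m" "\<pi> a \<in> carrier_mat m m" "minv (\<pi> a) \<in> carrier_mat m m"
    using pi_carrier g a GL_carrier[OF minv(1)[OF pi_GL[OF a]]] by auto
  have "?Y = a * ?Y * minv a"
  proof (rule nondegenerate_eqI[OF nd Y(1) lie_Ad[OF G Y(1) a]])
    fix Z assume Z: "Z \<in> \<gg>"
    have Z': "minv a * Z * a \<in> \<gg>" "d\<pi> (minv a * Z * a) = minv (\<pi> a) * d\<pi> Z * \<pi> a"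
      using lie_Ad[OF G Z G'(4)[OF a]] dpi_Ad[OF Z G'(4)[OF a]]
      by (simp_all add: minv_minv[OF aG] pi_minv[OF a] minv_minv[OF pi_GL[OF a]])
    have "tform (a * ?Y * minv a) Z = trace_mat (\<pi> g * (minv (\<pi> a) * d\<pi> Z * \<pi> a))"
      using tform_Ad[OF Y(1) Z a] Y(2)[OF Z'(1)] Z'(2) by simp
    also have "\<dots> = trace_mat ((\<pi> g * minv (\<pi> a) * d\<pi> Z) * \<pi> a)"
      using pc by (simp only: sq_assoc[of _ m] sq_mult_closed dpi_carrier)
    also have "\<dots> = trace_mat (\<pi> a * (\<pi> g * minv (\<pi> a) * d\<pi> Z))"
      by (rule trace_mat_mult_comm[of _ m]) (intro pc sq_mult_closed dpi_carrier)+
    also have "\<pi> a * (\<pi> g * minv (\<pi> a) * d\<pi> Z) = (\<pi> a * \<pi> g) * minv (\<pi> a) * d\<pi> Z"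
      using pc by (simp only: sq_assoc[of _ m] sq_mult_closed dpi_carrier)
    also have "\<pi> a * \<pi> g = \<pi> g * \<pi> a" using pi_mult[OF a g] pi_mult[OF g a] ag by simp
    also have "\<pi> g * \<pi> a * minv (\<pi> a) * d\<pi> Z = \<pi> g * (\<pi> a * minv (\<pi> a)) * d\<pi> Z"
      using pc by (simp only: sq_assoc[of _ m] sq_mult_closed dpi_carrier)
    also have "\<dots> = \<pi> g * d\<pi> Z" unfolding minv(2)[OF pi_GL[OF a]] right_mult_one_mat[OF pc(1)] ..
    finally show "tform ?Y Z = tform (a * ?Y * minv a) Z" using Y(2)[OF Z] by simp
  qed
  then have "?Y * a = a * ?Y * minv a * a" by simp
  also have "\<dots> = a * ?Y * (minv a * a)"
    using ac lie_carrier[OF Y(1)] by (simp only: sq_assoc[of _ n] sq_mult_closed)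
  also have "\<dots> = a * ?Y" unfolding minv(3)[OF aG] by (rule right_mult_one_mat[OF sq_mult_closed[OF ac(1) lie_carrier[OF Y(1)]]])
  finally show ?thesis .
qed

text \<open>Regular extensions of the coefficients of \<open>\<pi>\<close> on \<open>G\<close> also
  extend those on \<open>K\<close>, so both differentials can be computed from the same
  functions.\<close>

lemma restrict:
  assumes K: "algebraic_group n K" "K \<subseteq> G"
  shows "rational_representation n m K \<pi>"
    and "\<And>X. X \<in> lie_algebra n K \<Longrightarrow> rep_differential n K m \<pi> X = d\<pi> X"
    and "locally_faithful n G m \<pi> \<Longrightarrow> locally_faithful n K m \<pi>"
proof -
  have "rational_rep n K m \<pi>"
  proof -
    have "\<exists>F\<in>regular_funs n. \<forall>g\<in>K. F g = \<pi> g $$ (i, j)" if "i < m" "j < m" for i j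
      using coef(1)[OF that] coef(3)[OF that] K(2) by (intro bexI[of _ "coef i j"]) auto
    moreover have "\<pi> \<in> hom (GL_sub n K) (GL m)"
      using rat K(2) unfolding rational_rep_def hom_def by (auto simp: Pi_iff subset_iff)
    ultimately show ?thesis unfolding rational_rep_def by blast
  qed
  then show r: "rational_representation n m K \<pi>" using K(1) by (simp add: rational_representation_def)
  interpret K: rational_representation n m K \<pi> by (rule r)
  show eq: "rep_differential n K m \<pi> X = d\<pi> X" if X: "X \<in> lie_algebra n K" for X
  proof (rule sq_eqI[OF K.dpi_carrier dpi_carrier])
    fix i j assume ij: "i < m" "j < m"
    have XG: "X \<in> \<gg>" using X lie_algebra_mono[OF K(2)] by blast
    have "differential n K (\<lambda>g. \<pi> g $$ (i, j)) X = dlin n (coef i j) X"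
      by (rule K.differential_eq[OF coef(1)[OF ij] _ X]) (use coef(3)[OF ij] K in blast)
    then show "rep_differential n K m \<pi> X $$ (i, j) = d\<pi> X $$ (i, j)"
      using ij unfolding dpi_entry[OF XG ij] by (simp add: rep_differential_def)
  qed
  show "locally_faithful n K m \<pi>" if "locally_faithful n G m \<pi>"
    using that lie_algebra_mono[OF K(2)] eq unfolding locally_faithful_def inj_on_def by (metis subsetD)
qed

text \<open>Reduces both cases to showing that the Cayley image for \<open>G\<close> lies in the Lie
  algebra of \<open>K\<close>: once there, it satisfies the equations that determine the Cayley
  image for \<open>K\<close>.\<close>

theorem cayley_restrict:
  assumes nd: nondegenerate and K: "algebraic_group n K" "K \<subseteq> G"
    and ndK: "rational_representation.nondegenerate n m K \<pi>"
    and k: "k \<in> K" and Y: "cayley n G m \<pi> k \<in> lie_algebra n K"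
  shows "cayley n K m \<pi> k \<in> lie_algebra n K \<and> cayley n G m \<pi> k = cayley n K m \<pi> k"
proof -
  interpret K: rational_representation n m K \<pi> by (rule restrict(1)[OF K])
  note eq = restrict(2)[OF K]
  have "cayley n K m \<pi> k = cayley n G m \<pi> k"
  proof (rule K.cayley_eqI[OF ndK Y])
    fix X assume X: "X \<in> lie_algebra n K"
    then have "X \<in> \<gg>" using lie_algebra_mono[OF K(2)] by blast
    then show "K.tform (cayley n G m \<pi> k) X = trace_mat (\<pi> k * rep_differential n K m \<pi> X)"
      using cayley(2)[OF nd, of k X] k K(2) by (auto simp: eq[OF X] eq[OF Y])
  qed
  then show ?thesis using Y by simp
qed

theorem cayley_centralizer:
  assumes red: "reductive n G" and faithful: "locally_faithful n G m \<pi>"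
    and A: "A \<subseteq> G" and K: "K = identity_component n (G \<inter> (\<Inter>x\<in>A. centralizer G x))"
    and redK: "reductive n K" and k: "k \<in> K"
  shows "cayley n K m \<pi> k \<in> lie_algebra n K \<and> cayley n G m \<pi> k = cayley n K m \<pi> k"
proof -
  let ?H = "G \<inter> (\<Inter>x\<in>A. centralizer G x)"
  have aK: "algebraic_group n K" using redK by (simp add: reductive_def)
  have KH: "K \<subseteq> ?H"
    using connected_component_of_subset_topspace[of "subtopology (zariski n) ?H" "1\<^sub>m n"]
    unfolding K identity_component_def by auto
  then have KG: "K \<subseteq> G" by blast
  interpret K: rational_representation n m K \<pi> by (rule restrict(1)[OF aK KG])
  note nd = reductive_nondegenerate[OF red faithful]
  note ndK = K.reductive_nondegenerate[OF redK restrict(3)[OF aK KG faithful]]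
  have kG: "k \<in> G" using k KG by blast
  let ?Y = "cayley n G m \<pi> k"
  note Y = cayley(1)[OF nd kG]
  note Yc = lie_carrier[OF Y]
  obtain c where c: "one_param n ?Y c" using one_param_exists[OF Yc] by blast
  have cH: "c t \<in> ?H" for t
  proof -
    have "c t * a = a * c t" if a: "a \<in> A" for a
    proof (rule one_param_commute[OF Yc c])
      have aG: "a \<in> G" using A a by blast
      then show "a \<in> carrier_mat n n" using G' GL_carrier by blast
      have "k * a = a * k" using k KH a unfolding centralizer_def by blast
      then show "?Y * a = a * ?Y" using cayley_commute[OF nd kG aG] by simp
    qed
    then show ?thesis using one_param_in_group[OF G Y c] unfolding centralizer_def by blast
  qed
  have "connectedin (zariski n) (range (\<lambda>t. c t * 1\<^sub>m n))" by (rule one_param_connected[OF Yc c one_in_GL])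
  then have "connectedin (zariski n) (range c)" by (simp add: right_mult_one_mat[OF one_paramD(1)[OF c]])
  then have "connectedin (subtopology (zariski n) ?H) (range c)" using cH by (auto simp: connectedin_subtopology)
  moreover have "1\<^sub>m n \<in> range c" using one_paramD(2)[OF c] by (metis rangeI)
  ultimately have "range c \<subseteq> K" unfolding K identity_component_def by (rule connected_component_of_maximal)
  then have "?Y \<in> lie_algebra n K"
    using lieI_one_param[OF K.G'(1) Yc c] by blast
  then show ?thesis by (rule cayley_restrict[OF nd aK KG ndK k])
qed

end

section \<open>Functions that vanish near the identity\<close>

lemma subring_regular: "is_subring (regular_funs n)"
  unfolding is_subring_def
proof (intro conjI ballI)
  show "0 \<in> regular_funs n" "1 \<in> regular_funs n"
    using regular_funs.const[of 0 n] regular_funs.const[of 1 n] by (simp_all add: zero_fun_def one_fun_def)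
  fix x y assume x: "x \<in> regular_funs n" and y: "y \<in> regular_funs n"
  show "x * y \<in> regular_funs n" unfolding times_fun_def by (rule regular_funs.mult[OF x y])
  have "x - y = (\<lambda>g. x g + (-1) * y g)" by (simp add: fun_eq_iff)
  then show "x - y \<in> regular_funs n"
    using regular_funs.add[OF x regular_funs.mult[OF regular_funs.const[of "-1"] y]] by simp
qed

text \<open>Minimality is carried along so that the ring obtained can be recognized as
  \<open>regular_funs n\<close>, which is given by closure rules.\<close>

lemma noetherian_finitely_generated:
  assumes "is_subring R" "noetherian R"
  shows "\<exists>S. is_subring S \<and> noetherian S \<and> R \<union> set xs \<subseteq> S \<and> (\<forall>T. is_subring T \<and> R \<union> set xs \<subseteq> T \<longrightarrow> S \<subseteq> T)"
proof (induction xs)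
  case Nil
  show ?case by (rule exI[of _ R]) (use assms in auto)
next
  case (Cons x xs)
  then obtain S where S: "is_subring S" "noetherian S" "R \<union> set xs \<subseteq> S"
    and least: "\<forall>T. is_subring T \<and> R \<union> set xs \<subseteq> T \<longrightarrow> S \<subseteq> T" by blast
  show ?case
  proof (intro exI[of _ "adjoin S x"] conjI allI impI)
    show "R \<union> set (x # xs) \<subseteq> adjoin S x" using adjoin_superset[OF S(1), of x] S(3) by auto
    fix T assume T: "is_subring T \<and> R \<union> set (x # xs) \<subseteq> T"
    then have "S \<subseteq> T" using least by simp
    then show "adjoin S x \<subseteq> T" using adjoin_least[of T S x] T by simp
  qed (rule subring_adjoin[OF S(1)], rule noetherian_adjoin[OF S(1,2)])
qed

text \<open>The constants form a field, and finitely many generators are adjoined to it: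
  \<open>1 / det\<close> and the \<open>n * n\<close> matrix entries.\<close>

theorem noetherian_regular: "noetherian (regular_funs n)"
proof -
  let ?C = "range (\<lambda>c (g::complex mat). c :: complex)"
  have C: "is_subring ?C" unfolding is_subring_def
  proof (intro conjI ballI)
    show "0 \<in> ?C" "1 \<in> ?C" by (auto simp: zero_fun_def one_fun_def)
    fix x y assume "x \<in> ?C" "y \<in> ?C"
    then obtain a b where "x = (\<lambda>_. a)" "y = (\<lambda>_. b)" by auto
    then have "x - y = (\<lambda>_. a - b)" "x * y = (\<lambda>_. a * b)" by (simp_all add: fun_eq_iff)
    then show "x - y \<in> ?C" "x * y \<in> ?C" by auto
  qed
  have N: "noetherian ?C"
  proof (rule noetherian_field_like)
    fix x assume "x \<in> ?C" "x \<noteq> 0"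
    then obtain a where a: "x = (\<lambda>_. a)" "a \<noteq> 0" by (auto simp: zero_fun_def)
    then have "(\<lambda>_. 1 / a) * x = 1" by (simp add: fun_eq_iff)
    then show "\<exists>y\<in>?C. y * x = 1" by (intro bexI[of _ "\<lambda>_. 1 / a"]) auto
  qed
  define xs where "xs = (\<lambda>g::complex mat. 1 / det g) # map (\<lambda>p g. g $$ p) (List.product [0..<n] [0..<n])"
  obtain S where S: "is_subring S" "noetherian S" "?C \<union> set xs \<subseteq> S"
    and least: "\<forall>T. is_subring T \<and> ?C \<union> set xs \<subseteq> T \<longrightarrow> S \<subseteq> T"
    using noetherian_finitely_generated[OF C N, of xs] by blast
  have "?C \<union> set xs \<subseteq> regular_funs n"
    by (auto simp: xs_def intro: regular_funs.const regular_funs.inv_det regular_funs.entry)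
  then have 1: "S \<subseteq> regular_funs n" using least subring_regular by blast
  have "F \<in> S" if "F \<in> regular_funs n" for F
    using that
  proof induction
    case (const c) then show ?case using S(3) by auto
  next
    case (entry i j)
    then have "(\<lambda>g. g $$ (i, j)) \<in> set xs" by (auto simp: xs_def)
    then show ?case using S(3) by blast
  next
    case inv_det
    then show ?case using S(3) by (auto simp: xs_def)
  next
    case (add f h)
    then show ?case using subring_add[OF S(1), of f h] by (simp add: plus_fun_def)
  next
    case (mult f h)
    then have "f * h \<in> S" using S(1) by (simp add: is_subring_def)
    then show ?case by (simp add: times_fun_def)
  qed
  then have "S = regular_funs n" using 1 by blast
  then show ?thesis using S(2) by simp
qed

section \<open>Left-invariant derivations of the ring\<close>

lemma lder_line:
  assumes F: "reg n F" and X: "X \<in> carrier_mat n n" and g: "g \<in> carrier (GL n)"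
  shows "((\<lambda>s. F (g + s \<cdot>\<^sub>m (g * X))) has_field_derivative lder n X F g) (at 0)"
proof -
  note gc = GL_carrier[OF g]
  have gX: "g * X \<in> carrier_mat n n" by (rule sq_mult_closed[OF gc X])
  have g0: "g + 0 \<cdot>\<^sub>m (g * X) = g" using gX gc by (simp add: zero_smult_mat[OF gX])
  show ?thesis
    using lder_curve[OF F, of "\<lambda>s. g + s \<cdot>\<^sub>m (g * X)" 0 X] mderiv_line[OF gX gc, of 0] g gc gX
    unfolding g0 by simp
qed

lemma lder_eqI:
  assumes "reg n F" "X \<in> carrier_mat n n" "g \<in> carrier (GL n)"
    and "((\<lambda>s. F (g + s \<cdot>\<^sub>m (g * X))) has_field_derivative d) (at 0)"
  shows "lder n X F g = d"
  using DERIV_unique[OF lder_line[OF assms(1-3)] assms(4)] .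

lemma line_zero: "g \<in> carrier (GL n) \<Longrightarrow> X \<in> carrier_mat n n \<Longrightarrow> g + 0 \<cdot>\<^sub>m (g * X) = g"
  using zero_smult_mat[OF sq_mult_closed[OF GL_carrier[of g n], of X]] GL_carrier[of g n] by simp

lemma lder_rules:
  assumes F: "reg n F" and H: "reg n H" and X: "X \<in> carrier_mat n n" and g: "g \<in> carrier (GL n)"
  shows "lder n X (\<lambda>g. F g + H g) g = lder n X F g + lder n X H g"
    and "lder n X (\<lambda>g. F g * H g) g = F g * lder n X H g + H g * lder n X F g"
proof -
  show "lder n X (\<lambda>g. F g + H g) g = lder n X F g + lder n X H g"
    by (rule lder_eqI[OF reg_add[OF F H] X g]) (rule DERIV_add[OF lder_line[OF F X g] lder_line[OF H X g]])
  show "lder n X (\<lambda>g. F g * H g) g = F g * lder n X H g + H g * lder n X F g"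
    by (rule lder_eqI[OF reg_mult[OF F H] X g])
      (use DERIV_mult[OF lder_line[OF F X g] lder_line[OF H X g]] line_zero[OF g X] in \<open>simp add: mult.commute add.commute\<close>)
qed

lemma reg_ycoord: "p \<in> idx n \<Longrightarrow> reg n (ycoord p)"
  by (rule reg_diff) (auto intro: reg_entry reg_const)

lemma regular_ycoord: "p \<in> idx n \<Longrightarrow> ycoord p \<in> regular_funs n"
proof -
  assume p: "p \<in> idx n"
  have "(\<lambda>g. g $$ p + (if fst p = snd p then - 1 else 0)) \<in> regular_funs n"
    using p by (intro regular_funs.add regular_funs.const) (auto intro: regular_funs.entry)
  moreover have "(\<lambda>g. g $$ p + (if fst p = snd p then - 1 else 0)) = ycoord p" by auto
  ultimately show ?thesis by simp
qed

text \<open>Splits \<open>g * X\<close> into \<open>X\<close> and the product of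
  \<open>g - 1\<close> with \<open>X\<close>, thus separating the value at the identity from terms
  in the maximal ideal.\<close>

lemma lder_ycoord:
  assumes p: "p \<in> idx n" and X: "X \<in> carrier_mat n n" and g: "g \<in> carrier (GL n)"
  shows "lder n X (ycoord p) g = X $$ p + (\<Sum>k<n. ycoord (fst p, k) g * X $$ (k, snd p))"
proof -
  note gc = GL_carrier[OF g]
  obtain i j where ij: "p = (i, j)" "i < n" "j < n" using p by auto
  have "lder n X (ycoord p) g = (g * X) $$ (i, j)"
  proof (rule lder_eqI[OF reg_ycoord[OF p] X g])
    have "((\<lambda>s. g $$ p + s * (g * X) $$ (i, j) - (if fst p = snd p then 1 else 0)) has_field_derivative (g * X) $$ (i, j)) (at 0)"
      by (auto intro!: derivative_eq_intros)
    moreover have "g $$ p + s * (g * X) $$ (i, j) = (g + s \<cdot>\<^sub>m (g * X)) $$ p" for s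
      using ij gc X by simp
    ultimately show "((\<lambda>s. ycoord p (g + s \<cdot>\<^sub>m (g * X))) has_field_derivative (g * X) $$ (i, j)) (at 0)" by simp
  qed
  also have "\<dots> = (\<Sum>k<n. g $$ (i, k) * X $$ (k, j))" using mat_mult_entry[OF gc X ij(2,3)] .
  also have "\<dots> = (\<Sum>k<n. (if i = k then X $$ (k, j) else 0) + ycoord (i, k) g * X $$ (k, j))"
    by (rule sum.cong) (auto simp: algebra_simps)
  also have "\<dots> = X $$ p + (\<Sum>k<n. ycoord (fst p, k) g * X $$ (k, snd p))"
    using ij by (simp add: sum.distrib)
  finally show ?thesis .
qed

section \<open>Orders of vanishing along a closed subgroup\<close>

locale zariski_closed_subgroup =
  fixes n :: nat and K :: "complex mat set"
  assumes K: "algebraic_group n K"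
begin

abbreviation "kk \<equiv> lie_algebra n K"
text \<open>The ring modulo \<open>I\<close> is the coordinate ring of \<open>K\<close>, and
  \<open>Q k\<close> stands for the \<open>k\<close>-th power of the maximal ideal of the identity
  in it.\<close>

definition "I = {F \<in> regular_funs n. \<forall>g\<in>K. F g = 0}"

sublocale adic "regular_funs n" I ycoord "idx n"
proof
  show "is_ideal (regular_funs n) I"
    unfolding is_ideal_def
  proof (intro conjI ballI)
    show "0 \<in> I" using subring_zero[OF subring_regular] by (simp add: I_def)
    show "x + y \<in> I" if "x \<in> I" "y \<in> I" for x y
      using that subring_add[OF subring_regular, of x n y] by (simp add: I_def)
    show "r * x \<in> I" if "r \<in> regular_funs n" "x \<in> I" for r x
      using that subring_regular[of n] by (simp add: I_def is_subring_def)
  qed (auto simp: I_def)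
  show "ycoord l \<in> regular_funs n" if "l \<in> idx n" for l using that by (rule regular_ycoord)
qed (simp_all add: subring_regular)

lemma KGL: "g \<in> K \<Longrightarrow> g \<in> carrier (GL n)"
  using algebraic_groupD(1)[OF K] by blast

text \<open>Vanishing to order \<open>k\<close> at the identity along \<open>K\<close>. In contrast
  to \<open>Q\<close> it looks at \<open>F\<close> on \<open>K\<close> only, so it applies to
  expressions that agree with a regular function merely on \<open>K\<close>.\<close>

definition "wreg k F \<longleftrightarrow> (\<exists>p\<in>W k. \<forall>g\<in>K. F g = p g)"

lemma Q_iff_wreg: "F \<in> Q k \<longleftrightarrow> F \<in> regular_funs n \<and> wreg k F"
proof
  assume "F \<in> Q k"
  then obtain p where p: "F \<in> regular_funs n" "p \<in> W k" "F - p \<in> I" unfolding Q_def by blast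
  have "wreg k F" unfolding wreg_def by (rule bexI[OF _ p(2)]) (use p(3) in \<open>simp add: I_def\<close>)
  then show "F \<in> regular_funs n \<and> wreg k F" using p(1) by simp
next
  assume F: "F \<in> regular_funs n \<and> wreg k F"
  then obtain p where p: "p \<in> W k" "\<forall>g\<in>K. F g = p g" unfolding wreg_def by blast
  have "F - p \<in> regular_funs n" using subring_regular F W_sub[OF p(1)] by (simp add: is_subring_def)
  then have "F - p \<in> I" using p(2) by (simp add: I_def)
  then show "F \<in> Q k" using F p(1) unfolding Q_def by blast
qed

lemma wreg_cong: "wreg k F \<Longrightarrow> (\<And>g. g \<in> K \<Longrightarrow> H g = F g) \<Longrightarrow> wreg k H"
  unfolding wreg_def by auto

lemma wreg_add: "wreg k F \<Longrightarrow> wreg k H \<Longrightarrow> wreg k (\<lambda>g. F g + H g)"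
  unfolding wreg_def
proof (elim bexE)
  fix p q assume "p \<in> W k" "q \<in> W k" "\<forall>g\<in>K. F g = p g" "\<forall>g\<in>K. H g = q g"
  then show "\<exists>p\<in>W k. \<forall>g\<in>K. F g + H g = p g" using ideal_add[OF W_ideal] by (intro bexI[of _ "p + q"]) auto
qed

lemma wreg_zero: "wreg k (\<lambda>_. 0)"
  unfolding wreg_def using ideal_zero[OF W_ideal] by (intro bexI[of _ 0]) auto

lemma wreg_sum: "(\<And>i. i \<in> A \<Longrightarrow> wreg k (F i)) \<Longrightarrow> wreg k (\<lambda>g. \<Sum>i\<in>A. F i g)"
proof (induction A rule: infinite_finite_induct)
  case (insert x A)
  then show ?case using wreg_add[of k "F x" "\<lambda>g. \<Sum>i\<in>A. F i g"] by simp
qed (simp_all add: wreg_zero)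

lemma wreg_mult: "wreg j F \<Longrightarrow> wreg k H \<Longrightarrow> wreg (j + k) (\<lambda>g. F g * H g)"
  unfolding wreg_def
proof (elim bexE)
  fix p q assume "p \<in> W j" "q \<in> W k" "\<forall>g\<in>K. F g = p g" "\<forall>g\<in>K. H g = q g"
  then show "\<exists>p\<in>W (j + k). \<forall>g\<in>K. F g * H g = p g" using W_mult by (intro bexI[of _ "p * q"]) auto
qed

lemma wreg_reg:
  assumes "reg n F" shows "wreg 0 F"
proof -
  obtain F' where F': "F' \<in> regular_funs n" "\<forall>g\<in>carrier (GL n). F g = F' g" using assms unfolding reg_def by blast
  show ?thesis unfolding wreg_def by (rule bexI[OF _ W_0[OF F'(1)]]) (use F'(2) KGL in simp)
qed

lemma wreg_ycoord: "p \<in> idx n \<Longrightarrow> wreg 1 (ycoord p)"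
  unfolding wreg_def by (rule bexI[OF _ W_1]) simp_all

lemma wreg_ycoord_mult: "p \<in> idx n \<Longrightarrow> wreg k F \<Longrightarrow> wreg (Suc k) (\<lambda>g. ycoord p g * F g)"
  using wreg_mult[of 1 "ycoord p" k F] wreg_ycoord[of p] by simp

lemma wreg_mult_reg: "reg n F \<Longrightarrow> wreg k H \<Longrightarrow> wreg k (\<lambda>g. F g * H g)"
  using wreg_mult[of 0 F k H] wreg_reg[of F] by simp

text \<open>The coefficients \<open>f p\<close> at the identity are the partial derivatives, since
  each \<open>ycoord p\<close> vanishes there.\<close>

lemma first_order_dlin:
  assumes f: "first_order n F f" and X: "X \<in> carrier_mat n n"
  shows "dlin n F X = (\<Sum>p\<in>idx n. X $$ p * f p (1\<^sub>m n))"
proof -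
  note fD = first_orderD[OF f]
  have y0: "ycoord p (1\<^sub>m n) = 0" if "p \<in> idx n" for p using that by auto
  have H: "reg n (\<lambda>g. ycoord p g * f p g)" if "p \<in> idx n" for p
    using reg_mult[OF reg_ycoord[OF that] fD(2)[OF that]] .
  have "((\<lambda>s. F (1\<^sub>m n) + (\<Sum>p\<in>idx n. ycoord p (1\<^sub>m n + s \<cdot>\<^sub>m (1\<^sub>m n * X)) * f p (1\<^sub>m n + s \<cdot>\<^sub>m (1\<^sub>m n * X))))
    has_field_derivative 0 + (\<Sum>p\<in>idx n. lder n X (\<lambda>g. ycoord p g * f p g) (1\<^sub>m n))) (at 0)"
    by (intro DERIV_add DERIV_const DERIV_sum lder_line[OF H X one_in_GL])
  then have "lder n X (\<lambda>g. F (1\<^sub>m n) + (\<Sum>p\<in>idx n. ycoord p g * f p g)) (1\<^sub>m n)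
      = (\<Sum>p\<in>idx n. lder n X (\<lambda>g. ycoord p g * f p g) (1\<^sub>m n))"
    using lder_eqI[OF reg_add[OF reg_const reg_sum[OF H]] X one_in_GL] by simp
  also have "\<dots> = (\<Sum>p\<in>idx n. X $$ p * f p (1\<^sub>m n))"
  proof (rule sum.cong[OF refl])
    fix p assume p: "p \<in> idx n"
    have "ycoord (fst p, k) (1\<^sub>m n) = 0" if "k < n" for k using p that by auto
    then have "lder n X (ycoord p) (1\<^sub>m n) = X $$ p" using lder_ycoord[OF p X one_in_GL] by simp
    then show "lder n X (\<lambda>g. ycoord p g * f p g) (1\<^sub>m n) = X $$ p * f p (1\<^sub>m n)"
      using lder_rules(2)[OF reg_ycoord[OF p] fD(2)[OF p] X one_in_GL] y0[OF p] by (simp add: mult.commute)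
  qed
  finally show ?thesis
    unfolding lder_one[OF X] using dlin_cong[OF fD(1) fD(3) X] by simp
qed

text \<open>A covector that annihilates the Lie algebra of \<open>K\<close> is the differential of an equation of \<open>K\<close>.\<close>

lemma wreg_conormal:
  assumes D: "D \<in> carrier_mat n n" "\<And>X. X \<in> kk \<Longrightarrow> pairing n D X = 0"
  shows "wreg 2 (\<lambda>g. \<Sum>q\<in>idx n. ycoord q g * D $$ q)"
proof -
  \<comment> \<open>The differentials at the identity of the equations of \<open>K\<close>, as a set
    of covectors.\<close>
  define N where "N = {mat n n (\<lambda>(i, j). Gradient n F i j (1\<^sub>m n)) | F. reg n F \<and> (\<forall>g\<in>K. F g = 0)}"
  define gm where "gm F = mat n n (\<lambda>(i, j). Gradient n F i j (1\<^sub>m n))" for F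
  have pair: "pairing n A X = pairing n X A" for A X by (simp add: pairing_def mult.commute)
  have gm_dlin: "pairing n (gm F) X = dlin n F X" for F X
    unfolding pairing_def gm_def dlin_def sum.cartesian_product by (rule sum.cong) auto
  have gm_eqI: "gm F = A" if "A \<in> carrier_mat n n" "\<And>X. X \<in> carrier_mat n n \<Longrightarrow> dlin n F X = pairing n A X" for F A
  proof (rule sq_eqI[of _ n])
    fix i j assume ij: "i < n" "j < n"
    define E where "E = mat n n (\<lambda>p. if p = (i, j) then 1 else 0 :: complex)"
    have *: "pairing n C E = C $$ (i, j)" for C
    proof -
      have "pairing n C E = (\<Sum>p\<in>idx n. if p = (i, j) then C $$ p else 0)"
        unfolding pairing_def E_def by (rule sum.cong) (auto split: if_splits)
      then show ?thesis using ij by (subst (asm) sum.delta) auto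
    qed
    show "gm F $$ (i, j) = A $$ (i, j)"
      using that(2)[of E] gm_dlin[of F E] unfolding * by (simp add: E_def)
  qed (use that in \<open>auto simp: gm_def\<close>)
  have eq_on: "dlin n F X = d" if "reg n F" "X \<in> carrier_mat n n"
    "((\<lambda>t. F (1\<^sub>m n + t \<cdot>\<^sub>m X)) has_field_derivative d) (at 0)" for F X d
    using DERIV_unique[OF dlin_line[OF that(1,2)] that(3)] .
  have N: "N = gm ` {F. reg n F \<and> (\<forall>g\<in>K. F g = 0)}" unfolding N_def gm_def by blast
  have sub: "subspace_mat n N"
    unfolding subspace_mat_def
  proof (intro conjI ballI allI)
    show "N \<subseteq> carrier_mat n n" by (auto simp: N gm_def)
    have "gm (\<lambda>_. 0) = 0\<^sub>m n n"
    proof (rule gm_eqI)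
      fix X :: "complex mat" assume X: "X \<in> carrier_mat n n"
      show "dlin n (\<lambda>_. 0) X = pairing n (0\<^sub>m n n) X"
        unfolding pairing_def using eq_on[OF reg_const X, of 0 0] by (simp add: sum.neutral)
    qed simp
    then show "0\<^sub>m n n \<in> N" unfolding N by (intro image_eqI[of _ _ "\<lambda>_. 0"]) (simp_all add: reg_const)
    fix A B assume "A \<in> N" "B \<in> N"
    then obtain F H where F: "reg n F" "\<forall>g\<in>K. F g = 0" "A = gm F" and H: "reg n H" "\<forall>g\<in>K. H g = 0" "B = gm H"
      unfolding N by blast
    have c: "gm F \<in> carrier_mat n n" "gm H \<in> carrier_mat n n" by (auto simp: gm_def)
    have "gm (\<lambda>g. F g + H g) = A + B"
    proof (rule gm_eqI)
      fix X :: "complex mat" assume X: "X \<in> carrier_mat n n"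
      have "pairing n (A + B) X = dlin n F X + dlin n H X"
        unfolding gm_dlin[symmetric] F(3) H(3) pairing_def sum.distrib[symmetric]
        by (rule sum.cong) (use c in \<open>auto simp: distrib_right\<close>)
      then show "dlin n (\<lambda>g. F g + H g) X = pairing n (A + B) X"
        using eq_on[OF reg_add[OF F(1) H(1)] X DERIV_add[OF dlin_line[OF F(1) X] dlin_line[OF H(1) X]]] by simp
    qed (use c F(3) H(3) in simp)
    then show "A + B \<in> N" unfolding N using F H reg_add[OF F(1) H(1)] by (intro image_eqI[of _ _ "\<lambda>g. F g + H g"]) auto
  next
    fix c A assume "A \<in> N"
    then obtain F where F: "reg n F" "\<forall>g\<in>K. F g = 0" "A = gm F" unfolding N by blast
    have cc: "gm F \<in> carrier_mat n n" by (auto simp: gm_def)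
    have "gm (\<lambda>g. c * F g) = c \<cdot>\<^sub>m A"
    proof (rule gm_eqI)
      fix X :: "complex mat" assume X: "X \<in> carrier_mat n n"
      have "pairing n (c \<cdot>\<^sub>m A) X = c * dlin n F X"
        unfolding gm_dlin[symmetric] F(3) pairing_def sum_distrib_left
        by (rule sum.cong) (use cc in auto)
      then show "dlin n (\<lambda>g. c * F g) X = pairing n (c \<cdot>\<^sub>m A) X"
        using eq_on[OF reg_mult[OF reg_const F(1)] X DERIV_cmult[OF dlin_line[OF F(1) X]]] by simp
    qed (use cc F(3) in simp)
    then show "c \<cdot>\<^sub>m A \<in> N" unfolding N using F reg_mult[OF reg_const[of n c] F(1)]
      by (intro image_eqI[of _ _ "\<lambda>g. c * F g"]) auto
  qed
  \<comment> \<open>Whatever pairs to zero with all of \<open>N\<close> satisfies the equations that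
    define \<open>kk\<close>, and therefore pairs to zero with \<open>D\<close>.\<close>
  have "D \<in> N"
  proof (rule ccontr)
    assume "D \<notin> N"
    then obtain A where A: "A \<in> carrier_mat n n" "\<forall>X\<in>N. pairing n A X = 0" "pairing n A D \<noteq> 0"
      using double_annihilator[OF sub D(1)] by blast
    have "A \<in> kk"
      unfolding lie_algebra_iff[OF algebraic_groupD(1)[OF K]]
    proof (intro conjI allI impI A(1))
      fix F assume "reg n F \<and> (\<forall>g\<in>K. F g = 0)"
      then have "gm F \<in> N" unfolding N by blast
      then have "pairing n A (gm F) = 0" using A(2) by blast
      then show "dlin n F A = 0" using gm_dlin[of F A] pair[of A] by simp
    qed
    then show False using D(2) A(3) pair by metis
  qed
  then obtain F where F: "reg n F" "\<forall>g\<in>K. F g = 0" "D = gm F" unfolding N by blast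
  obtain F' where F': "F' \<in> regular_funs n" "\<And>g. g \<in> carrier (GL n) \<Longrightarrow> F g = F' g"
    using F(1) unfolding reg_def by blast
  obtain f where f: "first_order n F' f" using regular_first_order[OF F'(1)] by blast
  note fD = first_orderD[OF f]
  have "gm F = mat n n (\<lambda>p. f p (1\<^sub>m n))"
  proof (rule gm_eqI)
    fix X :: "complex mat" assume X: "X \<in> carrier_mat n n"
    have "dlin n F X = (\<Sum>p\<in>idx n. X $$ p * f p (1\<^sub>m n))"
      using dlin_cong[OF F(1) F'(2) X] first_order_dlin[OF f X] by simp
    also have "\<dots> = pairing n (mat n n (\<lambda>p. f p (1\<^sub>m n))) X"
      unfolding pairing_def by (rule sum.cong) (auto simp: mult.commute)
    finally show "dlin n F X = \<dots>" .
  qed simp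
  then have Dq: "D $$ q = f q (1\<^sub>m n)" if "q \<in> idx n" for q using that F(3) by auto
  \<comment> \<open>The equation says that the sum of the \<open>ycoord q g * f q g\<close> is 0 on
    \<open>K\<close>. Replacing \<open>f q\<close> by its value \<open>D $$ q\<close> at the
    identity changes it by terms of order 2.\<close>
  have "wreg (Suc 1) (\<lambda>g. ycoord q g * (f q g - D $$ q))" if q: "q \<in> idx n" for q
  proof (rule wreg_ycoord_mult[OF q])
    obtain H where H: "H \<in> regular_funs n" "\<And>g. g \<in> carrier (GL n) \<Longrightarrow> f q g = H g"
      using fD(2)[OF q] unfolding reg_def by blast
    obtain e where e: "first_order n H e" using regular_first_order[OF H(1)] by blast
    note eD = first_orderD[OF e]
    have "wreg (Suc 0) (\<lambda>g. \<Sum>p\<in>idx n. ycoord p g * e p g)"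
      by (rule wreg_sum) (rule wreg_ycoord_mult, assumption, rule wreg_reg[OF eD(2)])
    then show "wreg 1 (\<lambda>g. f q g - D $$ q)"
      unfolding One_nat_def
      by (rule wreg_cong) (use eD(3) H(2) KGL H(2)[OF one_in_GL] Dq[OF q] in simp)
  qed
  then have "wreg 2 (\<lambda>g. \<Sum>q\<in>idx n. ycoord q g * (f q g - D $$ q))"
    unfolding numeral_2_eq_2 One_nat_def[symmetric] by (rule wreg_sum)
  from wreg_mult_reg[OF reg_const[of n "- 1"] this]
  have "wreg 2 (\<lambda>g. - 1 * (\<Sum>q\<in>idx n. ycoord q g * (f q g - D $$ q)))" .
  then show ?thesis
  proof (rule wreg_cong)
    fix g assume g: "g \<in> K"
    have 1: "F' (1\<^sub>m n) = 0" using F(2) F'(2)[OF one_in_GL] algebraic_groupD(2)[OF K] by simp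
    have "(\<Sum>q\<in>idx n. ycoord q g * f q g) = 0"
      using fD(3)[OF KGL[OF g]] F(2) F'(2)[OF KGL[OF g]] g 1 by simp
    then show "(\<Sum>q\<in>idx n. ycoord q g * D $$ q) = - 1 * (\<Sum>q\<in>idx n. ycoord q g * (f q g - D $$ q))"
      by (simp add: right_diff_distrib sum_subtractf)
  qed
qed

text \<open>The derivation \<open>E\<close> below acts on functions on \<open>K\<close> as an Euler vector field at the identity: it multiplies
  the degree-\<open>k\<close> part of the Taylor expansion by \<open>k\<close>. A family that \<open>E\<close> maps to higher order
  is therefore flat, and Krull's intersection theorem makes it vanish near the identity.\<close>

theorem vanishing_near_one:
  assumes L: "finite L" and h: "\<And>l. l \<in> L \<Longrightarrow> h l \<in> regular_funs n" "\<And>l. l \<in> L \<Longrightarrow> h l (1\<^sub>m n) = 0"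
    and der: "\<And>l Z. l \<in> L \<Longrightarrow> Z \<in> kk \<Longrightarrow>
      \<exists>c. (\<forall>l'\<in>L. reg n (c l')) \<and> (\<forall>g\<in>K. lder n Z (h l) g = (\<Sum>l'\<in>L. c l' g * h l' g))"
  shows "\<exists>u. reg n u \<and> u (1\<^sub>m n) \<noteq> 0 \<and> (\<forall>g\<in>K. u g \<noteq> 0 \<longrightarrow> (\<forall>l\<in>L. h l g = 0))"
proof -
  let ?R = "regular_funs n"
  obtain p where p: "Vector_Spaces.linear fscale fscale p" "\<And>f. unemb n (p f) \<in> kk"
    "\<And>X. X \<in> kk \<Longrightarrow> unemb n (p (emb n X)) = X"
    using subspace_projection[OF lie_subspace[OF algebraic_groupD(1)[OF K]]] by blast
  \<comment> \<open>The unit matrix at \<open>q\<close>, projected onto \<open>kk\<close>. The field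
    \<open>E0\<close> below has at \<open>g\<close> the direction \<open>g\<close> times the
    projection of \<open>g - 1\<close>, which along \<open>K\<close> is radial to first
    order.\<close>
  define B where "B q = unemb n (p (delta q))" for q
  have B: "B q \<in> kk" "B q \<in> carrier_mat n n" for q using p(2) by (simp_all add: B_def)
  define E0 where "E0 F g = (\<Sum>q\<in>idx n. ycoord q g * lder n (B q) F g)" for F g
  \<comment> \<open>\<open>E0 F\<close> is known to agree with a ring element only on
    \<open>GL n\<close>; \<open>E F\<close> picks such an element.\<close>
  define E where "E F = (SOME H. H \<in> ?R \<and> (\<forall>g\<in>carrier (GL n). E0 F g = H g))" for F
  have E: "E F \<in> ?R" "\<And>g. g \<in> K \<Longrightarrow> E F g = E0 F g" if "F \<in> ?R" for F
  proof -
    have "reg n (E0 F)"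
      unfolding E0_def by (rule reg_sum) (rule reg_mult[OF reg_ycoord reg_lder[OF reg_regular[OF that] B(2)]])
    then have "\<exists>H. H \<in> ?R \<and> (\<forall>g\<in>carrier (GL n). E0 F g = H g)" unfolding reg_def by blast
    from someI_ex[OF this] show "E F \<in> ?R" "\<And>g. g \<in> K \<Longrightarrow> E F g = E0 F g"
      unfolding E_def[symmetric] using KGL by auto
  qed
  have inI: "x \<in> I" if "x \<in> ?R" "\<And>g. g \<in> K \<Longrightarrow> x g = 0" for x using that by (simp add: I_def)
  have Rd: "x - y \<in> ?R" "x * y \<in> ?R" "x + y \<in> ?R" if "x \<in> ?R" "y \<in> ?R" for x y
    using subring_regular[of n] subring_add[OF subring_regular that] that by (simp_all add: is_subring_def)
  have flat: "h l \<in> Q k" if l: "l \<in> L" for l k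
  proof (rule euler_infinitely_flat[of E "h ` L"])
    fix a b assume ab: "a \<in> ?R" "b \<in> ?R"
    note r = reg_regular[OF ab(1)] reg_regular[OF ab(2)]
    show "E (a + b) - (E a + E b) \<in> I"
    proof (rule inI)
      show "E (a + b) - (E a + E b) \<in> ?R" by (intro Rd E ab)
      fix g assume g: "g \<in> K"
      have "lder n (B q) (a + b) g = lder n (B q) a g + lder n (B q) b g" for q
        unfolding plus_fun_def by (rule lder_rules(1)[OF r B(2) KGL[OF g]])
      then have "E0 (a + b) g = E0 a g + E0 b g" by (simp add: E0_def distrib_left sum.distrib)
      then show "(E (a + b) - (E a + E b)) g = 0"
        using E(2)[OF _ g] ab Rd(3)[OF ab] by simp
    qed
    show "E (a * b) - (a * E b + b * E a) \<in> I"
    proof (rule inI)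
      show "E (a * b) - (a * E b + b * E a) \<in> ?R" by (intro Rd E ab)
      fix g assume g: "g \<in> K"
      have "lder n (B q) (a * b) g = a g * lder n (B q) b g + b g * lder n (B q) a g" for q
        unfolding times_fun_def by (rule lder_rules(2)[OF r B(2) KGL[OF g]])
      then have "E0 (a * b) g = (\<Sum>q\<in>idx n. a g * (ycoord q g * lder n (B q) b g) + b g * (ycoord q g * lder n (B q) a g))"
        unfolding E0_def by (intro sum.cong) (simp_all add: algebra_simps)
      then have "E0 (a * b) g = a g * E0 b g + b g * E0 a g"
        unfolding E0_def by (simp add: sum.distrib sum_distrib_left)
      then show "(E (a * b) - (a * E b + b * E a)) g = 0"
        using E(2)[OF _ g] ab Rd(2)[OF ab] by simp
    qed
  next
    fix a assume a: "a \<in> I"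
    then have aR: "a \<in> ?R" by (simp add: I_def)
    show "E a \<in> I"
    proof (rule inI[OF E(1)[OF aR]])
      fix g assume g: "g \<in> K"
      have "lder n (B q) a g = 0" for q
        by (rule lder_vanishes[OF K B(1) reg_regular[OF aR] _ g]) (use a in \<open>simp add: I_def\<close>)
      then show "E a g = 0" using E(2)[OF aR g] by (simp add: E0_def)
    qed
  next
    fix a assume a: "a \<in> ?R"
    have "wreg (Suc 0) (E0 a)"
      unfolding E0_def
      by (rule wreg_sum) (rule wreg_ycoord_mult[OF _ wreg_reg[OF reg_lder[OF reg_regular[OF a] B(2)]]])
    then have "wreg 1 (E a)" unfolding One_nat_def by (rule wreg_cong) (rule E(2)[OF a])
    then show "E a \<in> Q 1" using E(1)[OF a] by (simp add: Q_iff_wreg)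
  next
    fix l assume l: "l \<in> idx n"
    \<comment> \<open>The deviation of the projection from the identity in the coordinate
      \<open>l\<close>. It annihilates \<open>kk\<close>, where the projection is the identity, so
      its contribution has order 2.\<close>
    define D where "D = mat n n (\<lambda>q. B q $$ l - delta q l)"
    have D: "D $$ q = B q $$ l - delta q l" if "q \<in> idx n" for q using that by (auto simp: D_def)
    have "pairing n D X = 0" if X: "X \<in> kk" for X
    proof -
      have Xc: "X \<in> carrier_mat n n" using X by (rule lie_carrier)
      have pl: "p (emb n X) = (\<Sum>q\<in>idx n. fscale (X $$ q) (p (delta q)))"
        unfolding emb_expand[of n X] ff.linear_sum[OF p(1)] ff.linear_scale[OF p(1)] ..
      have "X $$ l = p (emb n X) l" using p(3)[OF X] unemb_entry[OF l] by metis
      also have "\<dots> = (\<Sum>q\<in>idx n. X $$ q * B q $$ l)"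
        unfolding pl sum_fun_apply by (simp add: fscale_def B_def unemb_entry[OF l])
      finally have 1: "(\<Sum>q\<in>idx n. X $$ q * B q $$ l) = X $$ l" ..
      have "(\<Sum>q\<in>idx n. X $$ q * delta q l) = (\<Sum>q\<in>idx n. if q = l then X $$ q else 0)"
        by (rule sum.cong) (auto simp: delta_def)
      also have "\<dots> = X $$ l" using l by (subst sum.delta) auto
      finally have 2: "(\<Sum>q\<in>idx n. X $$ q * delta q l) = X $$ l" .
      have "pairing n D X = (\<Sum>q\<in>idx n. X $$ q * B q $$ l) - (\<Sum>q\<in>idx n. X $$ q * delta q l)"
        unfolding pairing_def sum_subtractf[symmetric] by (rule sum.cong) (simp_all add: D algebra_simps)
      then show ?thesis using 1 2 by simp
    qed
    then have "wreg 2 (\<lambda>g. \<Sum>q\<in>idx n. ycoord q g * D $$ q)" by (intro wreg_conormal) (simp_all add: D_def)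
    moreover have "wreg 2 (\<lambda>g. \<Sum>q\<in>idx n. ycoord q g * (\<Sum>k<n. ycoord (fst l, k) g * B q $$ (k, snd l)))"
      unfolding numeral_2_eq_2
    proof (rule wreg_sum, rule wreg_ycoord_mult)
      fix q
      have "wreg (Suc 0) (\<lambda>g. ycoord (fst l, k) g * B q $$ (k, snd l))" if "k \<in> {..<n}" for k
        by (rule wreg_ycoord_mult[OF _ wreg_reg[OF reg_const]]) (use l that in auto)
      then show "wreg (Suc 0) (\<lambda>g. \<Sum>k<n. ycoord (fst l, k) g * B q $$ (k, snd l))" by (rule wreg_sum)
    qed
    ultimately have *: "wreg 2 (\<lambda>g. (\<Sum>q\<in>idx n. ycoord q g * D $$ q)
        + (\<Sum>q\<in>idx n. ycoord q g * (\<Sum>k<n. ycoord (fst l, k) g * B q $$ (k, snd l))))" by (rule wreg_add)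
    note yR = regular_ycoord[OF l]
    have "wreg 2 (E (ycoord l) - ycoord l)"
    proof (rule wreg_cong[OF *])
      fix g assume g: "g \<in> K"
      have "(\<Sum>q\<in>idx n. ycoord q g * delta q l) = (\<Sum>q\<in>idx n. if q = l then ycoord q g else 0)"
        by (rule sum.cong) (auto simp: delta_def)
      also have "\<dots> = ycoord l g" using l by (subst sum.delta) auto
      finally have 1: "(\<Sum>q\<in>idx n. ycoord q g * delta q l) = ycoord l g" .
      have "E0 (ycoord l) g = (\<Sum>q\<in>idx n. ycoord q g * D $$ q + ycoord q g * delta q l +
          ycoord q g * (\<Sum>k<n. ycoord (fst l, k) g * B q $$ (k, snd l)))"
        unfolding E0_def
      proof (rule sum.cong[OF refl])
        fix q assume q: "q \<in> idx n"
        show "ycoord q g * lder n (B q) (ycoord l) g = ycoord q g * D $$ q + ycoord q g * delta q l +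
          ycoord q g * (\<Sum>k<n. ycoord (fst l, k) g * B q $$ (k, snd l))"
          unfolding lder_ycoord[OF l B(2) KGL[OF g]] D[OF q] distrib_left right_diff_distrib by simp
      qed
      then show "(E (ycoord l) - ycoord l) g = (\<Sum>q\<in>idx n. ycoord q g * D $$ q)
        + (\<Sum>q\<in>idx n. ycoord q g * (\<Sum>k<n. ycoord (fst l, k) g * B q $$ (k, snd l)))"
        using E(2)[OF yR g] 1 by (simp add: sum.distrib)
    qed
    then show "E (ycoord l) - ycoord l \<in> Q 2" using Rd(1)[OF E(1)[OF yR] yR] by (simp add: Q_iff_wreg)
  next
    fix k :: nat assume k: "k > 0"
    have "of_nat k = (\<lambda>g::complex mat. of_nat k :: complex)" by (induction k) (auto simp: fun_eq_iff)
    then show "\<exists>c\<in>?R. c * of_nat k = 1"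
      using k by (intro bexI[of _ "\<lambda>_. 1 / of_nat k"]) (auto simp: fun_eq_iff intro: regular_funs.const)
  next
    fix x assume "x \<in> h ` L"
    then obtain l where l: "l \<in> L" "x = h l" by blast
    obtain f where f: "first_order n (h l) f" using regular_first_order[OF h(1)[OF l(1)]] by blast
    note fD = first_orderD[OF f]
    have "wreg (Suc 0) (\<lambda>g. \<Sum>p\<in>idx n. ycoord p g * f p g)"
      by (rule wreg_sum) (rule wreg_ycoord_mult, assumption, rule wreg_reg[OF fD(2)])
    then have "wreg 1 (h l)" unfolding One_nat_def
      by (rule wreg_cong) (use fD(3) KGL h(2)[OF l(1)] in simp)
    then show "x \<in> Q 1" using h(1)[OF l(1)] l(2) by (simp add: Q_iff_wreg)
  next
    fix k x assume IH: "\<And>x. x \<in> h ` L \<Longrightarrow> x \<in> Q k" and "x \<in> h ` L"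
    then obtain l where l: "l \<in> L" "x = h l" by blast
    have "wreg (Suc k) (\<lambda>g. ycoord q g * lder n (B q) (h l) g)" if q: "q \<in> idx n" for q
    proof (rule wreg_ycoord_mult[OF q])
      obtain c where c: "\<And>l'. l' \<in> L \<Longrightarrow> reg n (c l')"
        "\<And>g. g \<in> K \<Longrightarrow> lder n (B q) (h l) g = (\<Sum>l'\<in>L. c l' g * h l' g)"
        using der[OF l(1) B(1)] by blast
      have "wreg k (\<lambda>g. \<Sum>l'\<in>L. c l' g * h l' g)"
      proof (rule wreg_sum)
        fix l' assume l': "l' \<in> L"
        have "wreg k (h l')" using IH[of "h l'"] l' by (simp add: Q_iff_wreg)
        then show "wreg k (\<lambda>g. c l' g * h l' g)" by (rule wreg_mult_reg[OF c(1)[OF l']])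
      qed
      then show "wreg k (\<lambda>g. lder n (B q) (h l) g)" by (rule wreg_cong) (rule c(2))
    qed
    then have "wreg (Suc k) (E0 (h l))" unfolding E0_def by (rule wreg_sum)
    then have "wreg (Suc k) (E (h l))" by (rule wreg_cong) (rule E(2)[OF h(1)[OF l(1)]])
    then show "E x \<in> Q (Suc k)" using E(1)[OF h(1)[OF l(1)]] l(2) by (simp add: Q_iff_wreg)
  qed (use l in simp)
  have "\<forall>l\<in>L. \<exists>a. a \<in> W 1 \<and> h l - a * h l \<in> I"
    using krull_intersection[OF noetherian_regular flat] by blast
  from bchoice[OF this] obtain a where "\<forall>l\<in>L. a l \<in> W 1 \<and> h l - a l * h l \<in> I" ..
  then have a: "\<And>l. l \<in> L \<Longrightarrow> a l \<in> W 1" "\<And>l. l \<in> L \<Longrightarrow> h l - a l * h l \<in> I" by simp_all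
  have W1: "x (1\<^sub>m n) = 0" if "x \<in> W 1" for x
    using that
  proof induction
    case (word w r)
    then obtain q where w: "w = [q]" by (auto simp: length_Suc_conv)
    obtain i j where "q = (i, j)" "i < n" "j < n" using word(1) w by auto
    then show ?case using w by simp
  qed simp_all
  \<comment> \<open>Krull's theorem makes \<open>(1 - a l) * h l\<close> vanish on \<open>K\<close>,
    with \<open>a l\<close> zero at the identity; the product over \<open>L\<close> serves all
    \<open>l\<close> at once.\<close>
  show ?thesis
  proof (intro exI[of _ "\<lambda>g. \<Prod>l\<in>L. 1 - a l g"] conjI ballI impI)
    show "reg n (\<lambda>g. \<Prod>l\<in>L. 1 - a l g)"
      by (rule reg_prod) (rule reg_diff[OF reg_const reg_regular[OF W_sub[OF a(1)]]])
    show "(\<Prod>l\<in>L. 1 - a l (1\<^sub>m n)) \<noteq> 0" using a(1) W1 by simp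
    fix g l assume g: "g \<in> K" "(\<Prod>l\<in>L. 1 - a l g) \<noteq> 0" and l: "l \<in> L"
    then have "1 - a l g \<noteq> 0" using L by auto
    moreover have "(1 - a l g) * h l g = 0" using a(2)[OF l] g(1) by (simp add: I_def algebra_simps)
    ultimately show "h l g = 0" by simp
  qed
qed

end

section \<open>Simple ideals\<close>

lemma bracket_swap:
  assumes "X \<in> carrier_mat n n" "Y \<in> carrier_mat n n"
  shows "bracket X Y = (- 1) \<cdot>\<^sub>m bracket Y X"
  using bracket_smult_swap[OF assms, of 1] assms(1) by (simp add: one_smult)

text \<open>The centre is an ideal, and a proper one since some bracket is nonzero.\<close>

lemma simple_center_zero:
  assumes simple: "simple_ideal n S L" and X: "X \<in> S" "\<And>Y. Y \<in> S \<Longrightarrow> bracket Y X = 0\<^sub>m n n"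
  shows "X = 0\<^sub>m n n"
proof -
  define Z where "Z = {X \<in> S. \<forall>Y\<in>S. bracket Y X = 0\<^sub>m n n}"
  have S: "subspace_mat n S" "\<And>I. lie_ideal n I S \<Longrightarrow> I = {0\<^sub>m n n} \<or> I = S"
    using simple by (auto simp: simple_ideal_def lie_ideal_def)
  note Sc = subsetD[OF subspaceD(1)[OF S(1)]]
  have "lie_ideal n Z S"
    unfolding lie_ideal_def subspace_mat_def
  proof (intro conjI ballI allI)
    show "Z \<subseteq> S" "Z \<subseteq> carrier_mat n n" using Sc by (auto simp: Z_def)
    show "0\<^sub>m n n \<in> Z" using subspaceD(2)[OF S(1)] bracket_zero_right Sc by (simp add: Z_def)
    show "A + B \<in> Z" if "A \<in> Z" "B \<in> Z" for A B
      using that subspaceD(3)[OF S(1)] by (simp add: Z_def bracket_add_right[OF Sc Sc Sc])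
    show "a \<cdot>\<^sub>m A \<in> Z" if "A \<in> Z" for a A
      using that subspaceD(4)[OF S(1)] by (simp add: Z_def bracket_smult_right[OF Sc Sc])
    show "bracket A B \<in> Z" if "A \<in> S" "B \<in> Z" for A B
      using that subspaceD(2)[OF S(1)] bracket_zero_right Sc by (simp add: Z_def)
  qed
  moreover have "Z \<noteq> S" using simple by (auto simp: Z_def simple_ideal_def)
  ultimately show ?thesis using S(2) X by (auto simp: Z_def)
qed

context rational_representation
begin

text \<open>For the subgroup in (b) simplicity takes the place of reductivity. The radical of the
  form is an ideal, so it is zero or everything. In the latter case all elements are nilpotent and
  long iterated brackets vanish by Engel's theorem; as the centre is zero, the brackets can be
  shortened step by step until the algebra itself is zero.\<close>

lemma simple_nondegenerate:
  assumes faithful: "locally_faithful n G m \<pi>" and simple: "simple_ideal n \<gg> L"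
  shows nondegenerate
proof -
  note sub = trace_radical_subalgebra[unfolded lie_subalgebra_def]
  have "lie_ideal n trace_radical \<gg>"
    unfolding lie_ideal_def
  proof (intro conjI ballI)
    show "trace_radical \<subseteq> \<gg>" by (auto simp: trace_radical_def)
    show "subspace_mat n trace_radical" using sub by blast
    fix X Y assume X: "X \<in> \<gg>" and Y: "Y \<in> trace_radical"
    have Yg: "Y \<in> \<gg>" using Y by (simp add: trace_radical_def)
    have YX: "bracket Y X \<in> trace_radical"
      using Y X lie_bracket[OF G] by (simp add: trace_radical_def tform_bracket)
    then show "bracket X Y \<in> trace_radical"
      unfolding bracket_swap[OF lie_carrier[OF X] lie_carrier[OF Yg]] using subspaceD(4) sub by blast
  qed
  then consider "trace_radical = {0\<^sub>m n n}" | "trace_radical = \<gg>" using simple unfolding simple_ideal_def by blast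
  then show ?thesis
  proof cases
    case 1
    then show ?thesis unfolding nondegenerate_def by (auto simp: trace_radical_def)
  next
    case 2
    have "\<exists>k. nil_of_index n k \<gg>"
      by (rule engel) (use trace_radical_subalgebra trace_radical_nilpotent[OF faithful] 2 in simp_all)
    then obtain k where k: "nil_of_index n k \<gg>" ..
    have gc: "\<gg> \<subseteq> carrier_mat n n" using lie_carrier by blast
    define P where "P j \<longleftrightarrow> (\<forall>w x. set w \<subseteq> \<gg> \<and> length w = j \<and> x \<in> \<gg> \<longrightarrow> foldr bracket w x = 0\<^sub>m n n)" for j
    have "P (2 * k)" unfolding P_def using iterated_bracket_zero[OF gc lie_carrier k] by blast
    moreover have step: "P j" if P: "P (Suc j)" for j
      unfolding P_def
    proof (intro allI impI)
      fix w x assume w: "set w \<subseteq> \<gg> \<and> length w = j \<and> x \<in> \<gg>"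
      have "foldr bracket v x \<in> \<gg>" if "set v \<subseteq> \<gg>" for v
        using that by (induction v) (use w lie_bracket[OF G] in auto)
      then show "foldr bracket w x = 0\<^sub>m n n"
      proof (rule simple_center_zero[OF simple])
        fix Y assume "Y \<in> \<gg>"
        then have "foldr bracket (Y # w) x = 0\<^sub>m n n" using P w unfolding P_def by (auto simp del: foldr.simps)
        then show "bracket Y (foldr bracket w x) = 0\<^sub>m n n" by simp
      qed (use w in simp)
    qed
    ultimately have "P 0" using inc_induct[of 0 "2 * k" P] by simp
    then have "\<forall>x\<in>\<gg>. x = 0\<^sub>m n n" unfolding P_def by simp
    then show ?thesis unfolding nondegenerate_def by blast
  qed
qed

text \<open>The entries \<open>h\<close> of \<open>D g\<close> are regular and vanish at the
  identity, and the derivative of \<open>D\<close> along \<open>Z\<close> is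
  \<open>D g * d\<pi> Z\<close>, a combination of the same entries. So they vanish on the part of
  \<open>G\<close> where a certain \<open>u\<close> is nonzero, and \<open>u\<close> is nonzero at
  the identity. The solutions form a subgroup \<open>S\<close> that contains this neighbourhood,
  hence is both closed and relatively open.\<close>

theorem commute_connected:
  assumes conn: "connectedin (zariski n) G" and B: "B \<in> carrier_mat m m"
    and comm: "\<And>Z. Z \<in> \<gg> \<Longrightarrow> d\<pi> Z * B = B * d\<pi> Z" and g: "g \<in> G"
  shows "\<pi> g * B = B * \<pi> g"
proof -
  interpret Z: zariski_closed_subgroup n G by unfold_locales (rule G)
  \<comment> \<open>\<open>coef\<close> stands in for the entries of \<open>\<pi>\<close>, because a
    regular function has to be given outside \<open>G\<close> as well.\<close>
  define h where "h = (\<lambda>(i, j) g. (\<Sum>k<m. coef i k g * B $$ (k, j)) + (\<Sum>k<m. - B $$ (i, k) * coef k j g))"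
  define D where "D g = \<pi> g * B - B * \<pi> g" for g
  have Dc: "D g \<in> carrier_mat m m" if "g \<in> G" for g
    unfolding D_def by (rule minus_carrier_mat) (rule sq_mult_closed[OF B pi_carrier[OF that]])
  have h_eq: "h (i, j) g = D g $$ (i, j)" if "g \<in> G" "i < m" "j < m" for g i j
    unfolding h_def D_def using that B pi_carrier[OF that(1)]
    by (simp add: coef(3) mat_mult_entry[OF pi_carrier[OF that(1)] B] mat_mult_entry[OF B pi_carrier[OF that(1)]] sum_negf
        del: index_mult_mat(1))
  have h_reg: "h l \<in> regular_funs n" if lm: "l \<in> idx m" for l
  proof -
    obtain i j where l: "l = (i, j)" "i < m" "j < m" using lm by blast
    have "(\<lambda>g. \<Sum>k<m. coef i k g * B $$ (k, j)) \<in> regular_funs n"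
      by (rule regular_sum) (rule regular_funs.mult[OF coef(1) regular_funs.const], use l in auto)
    moreover have "(\<lambda>g. \<Sum>k<m. - B $$ (i, k) * coef k j g) \<in> regular_funs n"
      by (rule regular_sum) (rule regular_funs.mult[OF regular_funs.const coef(1)], use l in auto)
    ultimately have "(\<lambda>g. (\<Sum>k<m. coef i k g * B $$ (k, j)) + (\<Sum>k<m. - B $$ (i, k) * coef k j g)) \<in> regular_funs n"
      by (rule regular_funs.add)
    then show ?thesis unfolding h_def l(1) by simp
  qed
  have D1: "D (1\<^sub>m n) = 0\<^sub>m m m"
    unfolding D_def pi_one right_mult_one_mat[OF B] left_mult_one_mat[OF B] using B by (simp add: minus_r_inv_mat)
  have h_der: "lder n Z (h (i, j)) g = (D g * d\<pi> Z) $$ (i, j)"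
    if Z: "Z \<in> \<gg>" and g: "g \<in> G" and ij: "i < m" "j < m" for Z g i j
  proof -
    note Zc = lie_carrier[OF Z] and pg = pi_carrier[OF g]
    have gG: "g \<in> carrier (GL n)" using g G' by blast
    obtain c where c: "one_param n Z c" using one_param_exists[OF Zc] by blast
    note cG = one_param_in_group[OF G Z c] and cD = one_paramD[OF c]
    have m0: "mderiv n c Z 0" using cD(3)[of 0] cD(2) Zc by simp
    have "mderiv n (\<lambda>s. g * c s) (g * Z) 0" by (rule mderiv_mult_left[OF cD(1) GL_carrier[OF gG] Zc m0])
    then have "((\<lambda>s. h (i, j) (g * c s)) has_field_derivative lder n Z (h (i, j)) (g * c 0)) (at 0)"
      using cD(1,2) GL_carrier[OF gG] ij G'(3)[OF g cG] G'(1) gG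
      by (intro lder_curve[OF reg_regular[OF h_reg]]) (auto intro: sq_mult_closed)
    then have 1: "((\<lambda>s. h (i, j) (g * c s)) has_field_derivative lder n Z (h (i, j)) g) (at 0)"
      using cD(2) GL_carrier[OF gG] by simp
    have p: "mderiv m (\<lambda>s. \<pi> (c s)) (d\<pi> Z) 0" by (rule mderiv_pi[OF cG cD(2) m0 Z])
    have pc: "\<pi> (c s) \<in> carrier_mat m m" for s by (rule pi_carrier[OF cG])
    have p': "mderiv m (\<lambda>s. \<pi> g * \<pi> (c s)) (\<pi> g * d\<pi> Z) 0" by (rule mderiv_mult_left[OF pc pg dpi_carrier p])
    note cc = sq_mult_closed[OF pg pc] and dc = sq_mult_closed[OF pg dpi_carrier, of Z]
    have "mderiv m (\<lambda>s. \<pi> g * \<pi> (c s) * B - B * (\<pi> g * \<pi> (c s))) (\<pi> g * d\<pi> Z * B - B * (\<pi> g * d\<pi> Z)) 0"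
      by (rule mderiv_diff[OF sq_mult_closed[OF cc B] sq_mult_closed[OF B cc] sq_mult_closed[OF dc B] sq_mult_closed[OF B dc]
            mderiv_mult_right[OF cc B dc p'] mderiv_mult_left[OF cc B dc p']])
    moreover have "\<pi> g * \<pi> (c s) * B - B * (\<pi> g * \<pi> (c s)) = D (g * c s)" for s
      using pi_mult[OF g cG] by (simp add: D_def)
    ultimately have "mderiv m (\<lambda>s. D (g * c s)) (\<pi> g * d\<pi> Z * B - B * (\<pi> g * d\<pi> Z)) 0" by simp
    from mderivD[OF this ij]
    have 2: "((\<lambda>s. h (i, j) (g * c s)) has_field_derivative (\<pi> g * d\<pi> Z * B - B * (\<pi> g * d\<pi> Z)) $$ (i, j)) (at 0)"
      using h_eq[OF G'(3)[OF g cG] ij] by simp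
    \<comment> \<open>The hypothesis on \<open>B\<close> moves \<open>d\<pi> Z\<close> to the right
      end of both terms, so that \<open>D\<close> satisfies a linear differential equation along
      \<open>Z\<close>.\<close>
    have "\<pi> g * d\<pi> Z * B - B * (\<pi> g * d\<pi> Z) = \<pi> g * B * d\<pi> Z - B * \<pi> g * d\<pi> Z"
      unfolding sq_assoc[OF pg dpi_carrier B] sq_assoc[OF pg B dpi_carrier] sq_assoc[OF B pg dpi_carrier] comm[OF Z] ..
    also have "\<dots> = D g * d\<pi> Z"
      unfolding D_def by (rule minus_mult_distrib_mat[OF sq_mult_closed[OF pg B] sq_mult_closed[OF B pg] dpi_carrier, symmetric])
    finally show ?thesis using DERIV_unique[OF 1 2] by simp
  qed
  have der: "\<exists>c. (\<forall>l'\<in>idx m. reg n (c l')) \<and> (\<forall>g\<in>G. lder n Z (h l) g = (\<Sum>l'\<in>idx m. c l' g * h l' g))"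
    if l: "l \<in> idx m" and Z: "Z \<in> \<gg>" for l Z
  proof -
    obtain i j where ij: "l = (i, j)" "i < m" "j < m" using l by blast
    define c where "c l' = (\<lambda>g::complex mat. if fst l' = i then d\<pi> Z $$ (snd l', j) else 0)" for l'
    show ?thesis
    proof (intro exI[of _ c] conjI ballI)
      show "reg n (c l')" for l' unfolding c_def by (rule reg_const)
      fix g assume g: "g \<in> G"
      have "(\<Sum>l'\<in>idx m. c l' g * h l' g) = (\<Sum>a<m. \<Sum>b<m. c (a, b) g * h (a, b) g)"
        unfolding sum.cartesian_product by (rule sum.cong) auto
      also have "\<dots> = (\<Sum>a<m. if a = i then \<Sum>b<m. d\<pi> Z $$ (b, j) * h (a, b) g else 0)"
        by (rule sum.cong) (auto simp: c_def)
      also have "\<dots> = (\<Sum>b<m. d\<pi> Z $$ (b, j) * h (i, b) g)" using ij by simp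
      also have "\<dots> = (\<Sum>b<m. D g $$ (i, b) * d\<pi> Z $$ (b, j))"
        by (rule sum.cong) (use h_eq[OF g ij(2)] in auto)
      also have "\<dots> = lder n Z (h l) g"
        using mat_mult_entry[OF Dc[OF g] dpi_carrier ij(2,3)] h_der[OF Z g ij(2,3)] ij(1) by simp
      finally show "lder n Z (h l) g = (\<Sum>l'\<in>idx m. c l' g * h l' g)" ..
    qed
  qed
  have h1: "h l (1\<^sub>m n) = 0" if "l \<in> idx m" for l using that h_eq[OF G'(2)] D1 by auto
  have "\<exists>u. reg n u \<and> u (1\<^sub>m n) \<noteq> 0 \<and> (\<forall>g\<in>G. u g \<noteq> 0 \<longrightarrow> (\<forall>l\<in>idx m. h l g = 0))"
    by (rule Z.vanishing_near_one[OF _ h_reg h1 der]) simp_all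
  then obtain u where u: "reg n u" "u (1\<^sub>m n) \<noteq> 0" "\<And>g l. g \<in> G \<Longrightarrow> u g \<noteq> 0 \<Longrightarrow> l \<in> idx m \<Longrightarrow> h l g = 0" by blast
  define S where "S = {g \<in> G. \<pi> g * B = B * \<pi> g}"
  have S_iff: "g \<in> S \<longleftrightarrow> g \<in> G \<and> (\<forall>l\<in>idx m. h l g = 0)" for g
  proof (cases "g \<in> G")
    case True
    have c: "\<pi> g * B \<in> carrier_mat m m" "B * \<pi> g \<in> carrier_mat m m"
      using sq_mult_closed B pi_carrier[OF True] by blast+
    have "D g $$ (i, j) = (\<pi> g * B) $$ (i, j) - (B * \<pi> g) $$ (i, j)" if "i < m" "j < m" for i j
      unfolding D_def using that B pi_carrier[OF True] by (simp del: index_mult_mat(1))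
    then have "(\<forall>l\<in>idx m. h l g = 0) \<longleftrightarrow> (\<forall>i<m. \<forall>j<m. (\<pi> g * B) $$ (i, j) = (B * \<pi> g) $$ (i, j))"
      using h_eq[OF True] by auto
    also have "\<dots> \<longleftrightarrow> \<pi> g * B = B * \<pi> g" using sq_eqI[OF c] by auto
    finally show ?thesis using True by (simp add: S_def)
  qed (simp add: S_def)
  \<comment> \<open>The common zeros of the translates of \<open>u\<close> by elements of
    \<open>S\<close>. Within \<open>G\<close> this turns out to be the complement of
    \<open>S\<close>, so the complement is closed too.\<close>
  define V where "V = {g \<in> carrier (GL n). \<forall>s\<in>S. u (minv s * g) = 0}"
  have SG: "s \<in> G" "s \<in> carrier (GL n)" "minv s \<in> carrier (GL n)" if "s \<in> S" for s
    using that G' minv(1) by (auto simp: S_def)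
  have 1: "1\<^sub>m n \<in> S" using G'(2) B by (simp add: S_def pi_one)
  have "closedin (zariski n) {g \<in> carrier (GL n). \<forall>l\<in>idx m. h l g = 0}"
    by (rule closedin_zariski_reg) (rule reg_regular[OF h_reg])
  moreover have "S = G \<inter> {g \<in> carrier (GL n). \<forall>l\<in>idx m. h l g = 0}" using S_iff G'(1) by blast
  ultimately have clS: "closedin (zariski n) S" using closedin_Int[OF G'(5)] by simp
  have clV: "closedin (zariski n) V"
    unfolding V_def by (rule closedin_zariski_reg) (rule reg_mult_left[OF SG(3) u(1)])
  have cover: "g \<in> S \<or> g \<in> V" if g: "g \<in> G" for g
  proof (rule disjCI)
    assume "g \<notin> V"
    then obtain s where s: "s \<in> S" "u (minv s * g) \<noteq> 0" using g G'(1) by (auto simp: V_def)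
    define k where "k = minv s * g"
    have k: "k \<in> G" using G'(3,4) SG(1)[OF s(1)] g by (simp add: k_def)
    have "k \<in> S" using u(3)[OF k] s(2) k S_iff by (simp add: k_def)
    note gc = GL_carrier[OF SG(2)[OF s(1)]] GL_carrier[OF SG(3)[OF s(1)]]
    have "g \<in> carrier_mat n n" using g G'(1) GL_carrier by blast
    then have "g = s * k" unfolding k_def sq_assoc[OF gc \<open>g \<in> carrier_mat n n\<close>, symmetric] minv(2)[OF SG(2)[OF s(1)]] by simp
    then have pg: "\<pi> g = \<pi> s * \<pi> k" using pi_mult[OF SG(1)[OF s(1)] k] by simp
    note pc = pi_carrier[OF SG(1)[OF s(1)]] pi_carrier[OF k]
    have sB: "\<pi> s * B = B * \<pi> s" and kB: "\<pi> k * B = B * \<pi> k" using s(1) \<open>k \<in> S\<close> by (auto simp: S_def)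
    have "\<pi> g * B = \<pi> s * (B * \<pi> k)" unfolding pg sq_assoc[OF pc B] kB ..
    also have "\<dots> = B * \<pi> g" unfolding pg sq_assoc[OF pc(1) B pc(2), symmetric] sB sq_assoc[OF B pc] ..
    finally show "g \<in> S" using g by (simp add: S_def)
  qed
  have "S \<inter> V = {}"
  proof -
    have "s \<notin> V" if s: "s \<in> S" for s
    proof
      assume "s \<in> V"
      then have "u (minv s * s) = 0" using s by (simp add: V_def)
      then show False using minv(3)[OF SG(2)[OF s]] u(2) by simp
    qed
    then show ?thesis by blast
  qed
  moreover have "S \<inter> G \<noteq> {}" using 1 G'(2) by blast
  ultimately have "V \<inter> G = {}"
    using conn cover clS clV unfolding connectedin_closedin by blast
  then have "g \<in> S" using cover g by blast
  then show ?thesis by (simp add: S_def)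
qed

theorem cayley_simple_factor:
  assumes red: "reductive n G" and faithful: "locally_faithful n G m \<pi>" and ss: "semisimple n G"
    and K: "algebraic_group n K" "K \<subseteq> G" "connectedin (zariski n) K"
    and simple: "simple_ideal n (lie_algebra n K) \<gg>" and k: "k \<in> K"
  shows "cayley n K m \<pi> k \<in> lie_algebra n K \<and> cayley n G m \<pi> k = cayley n K m \<pi> k"
proof -
  interpret K: rational_representation n m K \<pi> by (rule restrict(1)[OF K(1,2)])
  note dK = restrict(2)[OF K(1,2)]
  let ?k = "lie_algebra n K"
  have nd: nondegenerate by (rule reductive_nondegenerate[OF red faithful])
  have ndK: K.nondegenerate by (rule K.simple_nondegenerate[OF restrict(3)[OF K(1,2) faithful] simple])
  have kg: "X \<in> \<gg>" if "X \<in> ?k" for X using that lie_algebra_mono[OF K(2)] by blast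
  have kG: "k \<in> G" using k K(2) by blast
  have ksub: "subspace_mat n ?k" using lie_subspace[OF K.G'(1)] .
  have kideal: "bracket X Y \<in> ?k" if "X \<in> \<gg>" "Y \<in> ?k" for X Y
    using simple that unfolding simple_ideal_def lie_ideal_def by blast
  have knd: "X = 0\<^sub>m n n" if "X \<in> ?k" "\<And>Y. Y \<in> ?k \<Longrightarrow> tform X Y = 0" for X
    using ndK that unfolding K.nondegenerate_def by (simp add: dK)
  define perp where "perp = {Z \<in> \<gg>. \<forall>X\<in>?k. tform Z X = 0}"
  \<comment> \<open>The orthogonal projection exists because the form is nondegenerate on the Lie
    algebra of \<open>K\<close>.\<close>
  have decompose: "\<exists>Y'\<in>?k. Y - Y' \<in> perp \<and> Y = Y' + (Y - Y')" if Y: "Y \<in> \<gg>" for Y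
  proof -
    obtain Y' where Y': "Y' \<in> ?k" "\<forall>X\<in>?k. tform Y' X = tform Y X"
      using form_representation[OF knd ksub _ dpi_carrier, of Y] kg by blast
    have "Y - Y' \<in> perp" using tform_diff[OF Y kg[OF Y'(1)]] Y'(2) by (simp add: perp_def)
    moreover have "Y = Y' + (Y - Y')"
      using lie_carrier[OF Y] lie_carrier[OF Y'(1)] by (intro eq_matI) auto
    ultimately show ?thesis using Y'(1) by blast
  qed
  have perp_g: "Z \<in> \<gg>" if "Z \<in> perp" for Z using that by (simp add: perp_def)
  \<comment> \<open>The bracket lies in the ideal and, by invariance of the form, is orthogonal to
    it.\<close>
  have perp_k: "bracket Z X = 0\<^sub>m n n" if Z: "Z \<in> perp" and X: "X \<in> ?k" for Z X
  proof (rule knd)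
    show "bracket Z X \<in> ?k" by (rule kideal[OF perp_g[OF Z] X])
    fix Y assume Y: "Y \<in> ?k"
    have "bracket X Y \<in> ?k" by (rule kideal[OF kg[OF X] Y])
    then show "tform (bracket Z X) Y = 0"
      using Z tform_bracket[OF perp_g[OF Z] kg[OF X] kg[OF Y]] by (simp add: perp_def)
  qed
  have perp_bracket: "bracket Z X \<in> perp" if Z: "Z \<in> perp" and X: "X \<in> perp" for Z X
  proof -
    have "tform (bracket Z X) Y = 0" if Y: "Y \<in> ?k" for Y
      using tform_bracket[OF perp_g[OF Z] perp_g[OF X] kg[OF Y]] perp_k[OF X Y] tform_sym[of Z]
        tform_smult[OF lie_closed(1), of 0 Z] by simp
    then show ?thesis using lie_bracket[OF G perp_g[OF Z] perp_g[OF X]] by (simp add: perp_def)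
  qed
  have pi_perp: "\<pi> k * d\<pi> Z = d\<pi> Z * \<pi> k" if Z: "Z \<in> perp" for Z
  proof (rule K.commute_connected[OF K(3) dpi_carrier _ k])
    fix X assume X: "X \<in> ?k"
    have "bracket (d\<pi> X) (d\<pi> Z) = d\<pi> (bracket X Z)"
      by (rule dpi_bracket[OF kg[OF X] perp_g[OF Z], symmetric])
    also have "bracket X Z = (- 1) \<cdot>\<^sub>m bracket Z X"
      by (rule bracket_swap[OF lie_carrier[OF X] lie_carrier[OF perp_g[OF Z]]])
    also have "\<dots> = 0\<^sub>m n n" unfolding perp_k[OF Z X] by simp
    finally have "bracket (d\<pi> X) (d\<pi> Z) = 0\<^sub>m m m" by (simp add: dpi_zero)
    then show "rep_differential n K m \<pi> X * d\<pi> Z = d\<pi> Z * rep_differential n K m \<pi> X"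
      unfolding dK[OF X] bracket_zero_iff[OF dpi_carrier dpi_carrier] .
  qed
  let ?Y = "cayley n G m \<pi> k"
  note Y = cayley[OF nd kG]
  obtain Y' where Y': "Y' \<in> ?k" "?Y - Y' \<in> perp" "?Y = Y' + (?Y - Y')" using decompose[OF Y(1)] by blast
  define Z where "Z = ?Y - Y'"
  have Z: "Z \<in> perp" "?Y = Y' + Z" using Y' by (simp_all add: Z_def)
  \<comment> \<open>\<open>Z\<close> may be replaced by the whole Cayley image, because its other
    component is orthogonal to \<open>perp\<close>; invariance of the trace then brings in
    \<open>bracket (\<pi> k) (d\<pi> A)\<close>, which is zero.\<close>
  have trace0: "tform Z (bracket A X) = 0" if A: "A \<in> perp" and X: "X \<in> perp" for A X
  proof -
    note AX = perp_g[OF A] perp_g[OF X]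
    note B = perp_bracket[OF A X]
    have pc: "\<pi> k \<in> carrier_mat m m" by (rule pi_carrier[OF kG])
    have "tform Y' (bracket A X) = 0" using B Y'(1) tform_sym[of Y'] by (simp add: perp_def)
    then have "tform Z (bracket A X) = tform ?Y (bracket A X)"
      using tform_add[OF kg[OF Y'(1)] perp_g[OF Z(1)]] Z(2) by simp
    also have "\<dots> = trace_mat (\<pi> k * bracket (d\<pi> A) (d\<pi> X))"
      using Y(2)[OF perp_g[OF B]] dpi_bracket[OF AX] by simp
    also have "\<dots> = trace_mat (bracket (\<pi> k) (d\<pi> A) * d\<pi> X)"
      by (rule trace_bracket_invariant[symmetric]) (rule pc dpi_carrier)+
    also have "bracket (\<pi> k) (d\<pi> A) = 0\<^sub>m m m"
      using pi_perp[OF A] bracket_zero_iff[OF pc dpi_carrier] by simp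
    also have "trace_mat (0\<^sub>m m m * d\<pi> X) = 0"
      unfolding left_mult_zero_mat[OF dpi_carrier] by (simp add: trace_mat_def)
    finally show ?thesis .
  qed
  have perp_all: "bracket W A = 0\<^sub>m n n" if W: "W \<in> perp" and A: "A \<in> \<gg>"
    and zero: "\<And>B. B \<in> perp \<Longrightarrow> bracket W B = 0\<^sub>m n n" for W A
  proof -
    obtain A' where A': "A' \<in> ?k" "A - A' \<in> perp" "A = A' + (A - A')" using decompose[OF A] by blast
    have "bracket W A = bracket W A' + bracket W (A - A')"
      by (subst A'(3), rule bracket_add_right) (use A' lie_carrier perp_g W in auto)
    then show ?thesis using perp_k[OF W A'(1)] zero[OF A'(2)] by simp
  qed
  \<comment> \<open>Only the component of \<open>X\<close> in \<open>perp\<close> contributes to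
    \<open>bracket A X\<close>, so \<open>bracket Z A\<close> is orthogonal to the whole Lie algebra
    of \<open>G\<close>.\<close>
  have "bracket Z A = 0\<^sub>m n n" if A: "A \<in> perp" for A
  proof -
    have ZA: "bracket Z A \<in> \<gg>" by (rule perp_g[OF perp_bracket[OF Z(1) A]])
    have "tform (bracket Z A) X = 0" if X: "X \<in> \<gg>" for X
    proof -
      obtain X' where X': "X' \<in> ?k" "X - X' \<in> perp" "X = X' + (X - X')" using decompose[OF X] by blast
      have "bracket A X = bracket A X' + bracket A (X - X')"
        by (subst X'(3), rule bracket_add_right) (use X' lie_carrier perp_g A in auto)
      also have "\<dots> = bracket A (X - X')"
        using perp_k[OF A X'(1)] lie_carrier[OF perp_g[OF perp_bracket[OF A X'(2)]]] by simp
      finally show ?thesis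
        using tform_bracket[OF perp_g[OF Z(1)] perp_g[OF A] X] trace0[OF A X'(2)] by simp
    qed
    then show ?thesis using nd ZA unfolding nondegenerate_def by blast
  qed
  then have "Z = 0\<^sub>m n n"
    using semisimple_center_zero[OF ss perp_g[OF Z(1)]] perp_all[OF Z(1)] by blast
  then have "?Y = Y'" using Z(2) lie_carrier[OF Y'(1)] by simp
  then show ?thesis using cayley_restrict[OF nd K(1,2) ndK k] Y'(1) by simp
qed

end

theorem theorem2p6:
  fixes n m :: nat and G :: "complex mat set" and \<pi> :: "complex mat \<Rightarrow> complex mat"
  assumes "reductive n G"
    and "connectedin (zariski n) G"
    and "rational_rep n G m \<pi>"
    and "locally_faithful n G m \<pi>"
  shows "(\<forall>A K. A \<subseteq> G \<and> K = identity_component n (G \<inter> (\<Inter>x\<in>A. centralizer G x)) \<and> reductive n K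
            \<longrightarrow> (\<forall>k\<in>K. cayley n K m \<pi> k \<in> lie_algebra n K \<and> cayley n G m \<pi> k = cayley n K m \<pi> k))
       \<and> (semisimple n G \<longrightarrow>
            (\<forall>K. algebraic_group n K \<and> connectedin (zariski n) K \<and> K \<subseteq> G
                 \<and> simple_ideal n (lie_algebra n K) (lie_algebra n G)
            \<longrightarrow> (\<forall>k\<in>K. cayley n K m \<pi> k \<in> lie_algebra n K \<and> cayley n G m \<pi> k = cayley n K m \<pi> k)))"
proof -
  interpret rational_representation n m G \<pi>
    using assms(1,3) by (simp add: rational_representation_def reductive_def)
  show ?thesis
    using cayley_centralizer[OF assms(1,4)] cayley_simple_factor[OF assms(1,4)] by blast
qed

end
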